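(* For $N=1$, $m\geq 3$, $m$ odd and $\mathrm{char}\,\mathbb{K}\neq 2$, $$\mathrm{HH}^*(\Lambda_1)/\mathcal{N}\cong \mathbb{K}[\chi_{4,0},\chi_{2m,2},\chi_{2m,-2}]/(\chi_{4,0}^m - \chi_{2m,2}\chi_{2m,-2})$$ and hence $\mathrm{HH}^*(\Lambda_1)/\mathcal{N}$ is a commutative finitely generated algebra of Krull dimension $2$.
   Context: Let $\mathbb{K}$ be a field. Let $\mathcal{Q}$ be the quiver with vertices $0,1,\ldots,m-1$ and, for each $i$ (indices modulo $m$), arrows $a_i:i\to i+1$ and $\bar a_i:i+1\to i$. Paths are written from left to right; $e_i$ is the trivial path at $i$. $\Lambda_N=\mathbb{K}\mathcal{Q}/I_N$ where $I_N$ is generated by $a_ia_{i+1}$, $\bar a_{i-1}\bar a_{i-2}$, $(a_i\bar a_i)^N-(\bar a_{i-1}a_{i-1})^N$ for all $i$. $\mathrm{HH}^*(\Lambda_N)=\mathrm{Ext}^*_{\Lambda_N^e}(\Lambda_N,\Lambda_N)$ with the Yoneda product; $\mathcal{N}$ is the ideal generated by all homogeneous nilpotent elements. Write $\otimes=\otimes_{\mathbb{K}}$. A minimal projective bimodule resolution of $\Lambda_N$ is $(P^*,\partial^* )$ with $P^n=\bigoplus_{i=0}^{m-1}\bigoplus_{r=0}^n\Lambda_Ne_i\otimes e_{i+n-2r}\Lambda_N$. Write $e_i\otimes_r e_{i+n-2r}$ for the generator of the $(i,r)$-summand of $P^n$ (first index modulo $m$; generators in $P^{n-1}$ with tensor subscript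 $-1$ or $n$ are $0$). Unsubscripted $a,\bar a$ denote the arrows of that type making the expression composable. $\partial^0$ is multiplication, and for $n\geq1$, $\partial^n(e_i\otimes_r e_{i+n-2r})$ is: if $n-2r>0$: $e_i\otimes_r e_{i+n-1-2r}a+(-1)^{n+r}a e_{i+1}\otimes_r e_{i+n-2r}+(-1)^{n+r}\bar a(a\bar a)^{N-1}e_{i-1}\otimes_{r-1}e_{i+n-2r}+(-1)^n e_i\otimes_{r-1}e_{i+n+1-2r}\bar a(a\bar a)^{N-1}$; if $n-2r<0$: $e_i\otimes_r e_{i+n-1-2r}a(\bar aa)^{N-1}+(-1)^{n+r}a(\bar aa)^{N-1} e_{i+1}\otimes_r e_{i+n-2r}+(-1)^{n+r}\bar a e_{i-1}\otimes_{r-1}e_{i+n-2r}+(-1)^n e_i\otimes_{r-1}e_{i+n+1-2r}\bar a$; if $n=2r$: $\sum_{k=0}^{N-1}\big((\bar aa)^k[e_i\otimes_{r}e_{i-1}a+(-1)^{r}\bar a e_{i-1}\otimes_{r-1}e_i](\bar aa)^{N-k-1}+(a\bar a)^k[(-1)^{r}ae_{i+1}\otimes_{r}e_i+e_i\otimes_{r-1}e_{i+1}\bar a](a\bar a)^{N-k-1}\big)$. Classes in $\mathrm{HH}^n(\Lambda_N)$ are represented by cocycles in $\mathrm{Hom}_{\Lambda_N^e}(P^n,\Lambda_N)$; for a cocycle only the non-zero images of generators are listed. For $0\leq i\leq m-1$ and $k\in\mathbb{Z}$, $e_i\otimes e_{i+k}\in P^n$ means $e_i\otimes_r e_{i+n-2r}$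 with $r=(n-k)/2$ ($k$ is not reduced modulo $m$). Here, for all $i=0,\ldots,m-1$: $\chi_{4,0}\in\mathrm{HH}^4$: $e_i\otimes e_i\mapsto e_i$; $\chi_{2m,2}\in\mathrm{HH}^{2m}$: $e_i\otimes e_{i+2m}\mapsto e_i$; $\chi_{2m,-2}\in\mathrm{HH}^{2m}$: $e_i\otimes e_{i-2m}\mapsto e_i$. In the quotient, these symbols denote the images of the classes. *)

theory Defs
  imports
    "Graph_Theory.Arc_Walk"
    "HOL-Library.Poly_Mapping"
    "HOL-Library.Extended_Nat"
    "HOL-Algebra.QuotRing"
    "HOL-Algebra.Module"
    "HOL-Algebra.Subrings"
begin

section \<open>Vector spaces and algebras over a field\<close>

text \<open>
  The ground field is a type of class \<open>field\<close>. Vector spaces and (not necessarily commutative)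
  algebras over it are records of type \<open>('k, 'a) module\<close>; for vector spaces and modules
  the fields \<open>mult\<close> and \<open>one\<close> carry no meaning, as in \<open>HOL-Algebra.Module\<close>.
\<close>

definition field_ring :: "'k::field ring" where
  "field_ring = \<lparr>carrier = UNIV, mult = (*), one = 1, zero = 0, add = (+)\<rparr>"

text \<open>Quotient by a subspace (or, for algebras, by a two-sided ideal); it extends
  \<open>FactRing\<close> by scalar multiplication.\<close>

definition quot :: "('k, 'a, 'c) module_scheme \<Rightarrow> 'a set \<Rightarrow> ('k, 'a set) module"
    (infixl \<open>'/'/\<^sub>k\<close> 65) where
  "V //\<^sub>k U =
    \<lparr>carrier = carrier (V Quot U), mult = mult (V Quot U), one = one (V Quot U),
     zero = zero (V Quot U), add = add (V Quot U),
     smult = (\<lambda>c X. \<Union>x\<in>X. U +>\<^bsub>V\<^esub> (c \<odot>\<^bsub>V\<^esub> x))\<rparr>"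

definition lin_span :: "('k::field, 'a, 'c) module_scheme \<Rightarrow> 'a set \<Rightarrow> 'a set" where
  "lin_span V S = \<Inter>{U. submodule U (field_ring :: 'k ring) V \<and> S \<subseteq> U}"

definition free_space :: "'s set \<Rightarrow> ('k::field, 's \<Rightarrow>\<^sub>0 'k) module" where
  "free_space S =
    \<lparr>carrier = {f. Poly_Mapping.keys f \<subseteq> S}, mult = undefined, one = undefined,
     zero = 0, add = (+), smult = (\<lambda>c. Poly_Mapping.map ((*) c))\<rparr>"

definition alg_iso ::
    "('k, 'a, 'c) module_scheme \<Rightarrow> ('k, 'b, 'd) module_scheme \<Rightarrow> ('a \<Rightarrow> 'b) set" where
  "alg_iso A B =
    {h \<in> ring_iso A B. \<forall>c. \<forall>x\<in>carrier A. h (c \<odot>\<^bsub>A\<^esub> x) = c \<odot>\<^bsub>B\<^esub> h x}"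

definition fin_gen_algebra :: "('k::field, 'a, 'c) module_scheme \<Rightarrow> bool" where
  "fin_gen_algebra A \<longleftrightarrow>
    (\<exists>S. finite S \<and> S \<subseteq> carrier A \<and>
      (\<forall>B. subring B A \<and> submodule B (field_ring :: 'k ring) A \<and> S \<subseteq> B \<longrightarrow> B = carrier A))"

text \<open>Supremum of the lengths \<open>n\<close> of chains of prime ideals \<open>p\<^sub>0 \<subset> \<dots> \<subset> p\<^sub>n\<close>.\<close>

definition krull_dim :: "('a, 'c) ring_scheme \<Rightarrow> enat" where
  "krull_dim R = Sup {enat n | n.
    \<exists>p. (\<forall>i\<le>n. primeideal (p i) R) \<and> (\<forall>i<n. p i \<subset> p (Suc i))}"

text \<open>The polynomial algebra with variables indexed by the type \<open>'v\<close>.\<close>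

definition poly_alg :: "('k::field, ('v \<Rightarrow>\<^sub>0 nat) \<Rightarrow>\<^sub>0 'k) module" where
  "poly_alg =
    \<lparr>carrier = UNIV, mult = (*), one = 1, zero = 0, add = (+),
     smult = (\<lambda>c. Poly_Mapping.map ((*) c))\<rparr>"

definition pvar :: "'v \<Rightarrow> ('v \<Rightarrow>\<^sub>0 nat) \<Rightarrow>\<^sub>0 'k::field" where
  "pvar v = Poly_Mapping.single (Poly_Mapping.single v 1) 1"


section \<open>Path algebras\<close>

text \<open>A path is a pair of its source and its list of arrows, read from left to right;
  \<open>(v, [])\<close> is the trivial path at \<open>v\<close>.\<close>

type_synonym ('v, 'e) path = "'v \<times> 'e list"

definition paths :: "('v, 'e) pre_digraph \<Rightarrow> ('v, 'e) path set" where
  "paths G = {(u, p) | u p. \<exists>v. pre_digraph.awalk G u p v}"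

definition path_algebra ::
    "('v, 'e) pre_digraph \<Rightarrow> ('k::field, ('v, 'e) path \<Rightarrow>\<^sub>0 'k) module" where
  "path_algebra G = (free_space (paths G))
    \<lparr>mult := (\<lambda>f g. \<Sum>p\<in>Poly_Mapping.keys f. \<Sum>q\<in>Poly_Mapping.keys g.
        if pre_digraph.awlast G (fst p) (snd p) = fst q
        then Poly_Mapping.single (fst p, snd p @ snd q)
               (Poly_Mapping.lookup f p * Poly_Mapping.lookup g q)
        else 0),
     one := (\<Sum>v\<in>verts G. Poly_Mapping.single (v, []) 1)\<rparr>"


section \<open>Bimodules\<close>

record ('k, 'a, 'x) bimod = "('k, 'x) module" +
  lact :: "'a \<Rightarrow> 'x \<Rightarrow> 'x"
  ract :: "'x \<Rightarrow> 'a \<Rightarrow> 'x"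

text \<open>Bimodules on which the field acts centrally, i.e. modules over the enveloping algebra
  \<open>A \<otimes> A\<^sup>o\<^sup>p\<close>.\<close>

locale bimodule =
  fixes A :: "('k::field, 'a) module" and M :: "('k, 'a, 'x) bimod"
  assumes "module (field_ring :: 'k ring) M"
    and "\<And>a x. a \<in> carrier A \<Longrightarrow> x \<in> carrier M \<Longrightarrow> lact M a x \<in> carrier M"
    and "\<And>a x. a \<in> carrier A \<Longrightarrow> x \<in> carrier M \<Longrightarrow> ract M x a \<in> carrier M"
    and "\<And>a x y. a \<in> carrier A \<Longrightarrow> x \<in> carrier M \<Longrightarrow> y \<in> carrier M \<Longrightarrow>
           lact M a (x \<oplus>\<^bsub>M\<^esub> y) = lact M a x \<oplus>\<^bsub>M\<^esub> lact M a y"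
    and "\<And>a x y. a \<in> carrier A \<Longrightarrow> x \<in> carrier M \<Longrightarrow> y \<in> carrier M \<Longrightarrow>
           ract M (x \<oplus>\<^bsub>M\<^esub> y) a = ract M x a \<oplus>\<^bsub>M\<^esub> ract M y a"
    and "\<And>a b x. a \<in> carrier A \<Longrightarrow> b \<in> carrier A \<Longrightarrow> x \<in> carrier M \<Longrightarrow>
           lact M (a \<oplus>\<^bsub>A\<^esub> b) x = lact M a x \<oplus>\<^bsub>M\<^esub> lact M b x"
    and "\<And>a b x. a \<in> carrier A \<Longrightarrow> b \<in> carrier A \<Longrightarrow> x \<in> carrier M \<Longrightarrow>
           ract M x (a \<oplus>\<^bsub>A\<^esub> b) = ract M x a \<oplus>\<^bsub>M\<^esub> ract M x b"
    and "\<And>a b x. a \<in> carrier A \<Longrightarrow> b \<in> carrier A \<Longrightarrow> x \<in> carrier M \<Longrightarrow>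
           lact M (a \<otimes>\<^bsub>A\<^esub> b) x = lact M a (lact M b x)"
    and "\<And>a b x. a \<in> carrier A \<Longrightarrow> b \<in> carrier A \<Longrightarrow> x \<in> carrier M \<Longrightarrow>
           ract M x (a \<otimes>\<^bsub>A\<^esub> b) = ract M (ract M x a) b"
    and "\<And>a b x. a \<in> carrier A \<Longrightarrow> b \<in> carrier A \<Longrightarrow> x \<in> carrier M \<Longrightarrow>
           ract M (lact M a x) b = lact M a (ract M x b)"
    and "\<And>c x. x \<in> carrier M \<Longrightarrow> lact M (c \<odot>\<^bsub>A\<^esub> \<one>\<^bsub>A\<^esub>) x = c \<odot>\<^bsub>M\<^esub> x"
    and "\<And>c x. x \<in> carrier M \<Longrightarrow> ract M x (c \<odot>\<^bsub>A\<^esub> \<one>\<^bsub>A\<^esub>) = c \<odot>\<^bsub>M\<^esub> x"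

text \<open>Homomorphisms are \<open>undefined\<close> outside the carrier, so that equal maps are equal functions.\<close>

definition bimod_hom ::
    "('k, 'a) module \<Rightarrow> ('k, 'a, 'x) bimod \<Rightarrow> ('k, 'a, 'y) bimod \<Rightarrow> ('x \<Rightarrow> 'y) set" where
  "bimod_hom A M N = {f \<in> carrier M \<rightarrow>\<^sub>E carrier N.
     (\<forall>x\<in>carrier M. \<forall>y\<in>carrier M. f (x \<oplus>\<^bsub>M\<^esub> y) = f x \<oplus>\<^bsub>N\<^esub> f y) \<and>
     (\<forall>c. \<forall>x\<in>carrier M. f (c \<odot>\<^bsub>M\<^esub> x) = c \<odot>\<^bsub>N\<^esub> f x) \<and>
     (\<forall>a\<in>carrier A. \<forall>x\<in>carrier M.
        f (lact M a x) = lact N a (f x) \<and> f (ract M x a) = ract N (f x) a)}"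

definition hom_space ::
    "('k, 'a) module \<Rightarrow> ('k, 'a, 'x) bimod \<Rightarrow> ('k, 'a, 'y) bimod \<Rightarrow> ('k, 'x \<Rightarrow> 'y) module" where
  "hom_space A M N =
    \<lparr>carrier = bimod_hom A M N, mult = undefined, one = undefined,
     zero = (\<lambda>x\<in>carrier M. \<zero>\<^bsub>N\<^esub>), add = (\<lambda>f g. \<lambda>x\<in>carrier M. f x \<oplus>\<^bsub>N\<^esub> g x),
     smult = (\<lambda>c f. \<lambda>x\<in>carrier M. c \<odot>\<^bsub>N\<^esub> f x)\<rparr>"

definition regular_bimod :: "('k, 'a) module \<Rightarrow> ('k, 'a, 'a) bimod" where
  "regular_bimod A =
    \<lparr>carrier = carrier A, mult = mult A, one = one A, zero = zero A, add = add A,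
     smult = smult A, lact = mult A, ract = mult A\<rparr>"

definition direct_sum :: "'i set \<Rightarrow> ('i \<Rightarrow> ('k, 'a, 'x) bimod) \<Rightarrow> ('k, 'a, 'i \<Rightarrow> 'x) bimod" where
  "direct_sum I M =
    \<lparr>carrier = {x \<in> (\<Pi>\<^sub>E i\<in>I. carrier (M i)). finite {i \<in> I. x i \<noteq> \<zero>\<^bsub>M i\<^esub>}},
     mult = undefined, one = undefined,
     zero = (\<lambda>i\<in>I. \<zero>\<^bsub>M i\<^esub>), add = (\<lambda>x y. \<lambda>i\<in>I. x i \<oplus>\<^bsub>M i\<^esub> y i),
     smult = (\<lambda>c x. \<lambda>i\<in>I. c \<odot>\<^bsub>M i\<^esub> x i),
     lact = (\<lambda>a x. \<lambda>i\<in>I. lact (M i) a (x i)), ract = (\<lambda>x a. \<lambda>i\<in>I. ract (M i) (x i) a)\<rparr>"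

text \<open>The tensor product over the field: the space freely spanned by pairs, modulo bilinearity.\<close>

definition tensor_rels ::
    "('k::field, 'v) module \<Rightarrow> ('k, 'w) module \<Rightarrow> ('v \<times> 'w \<Rightarrow>\<^sub>0 'k) set" where
  "tensor_rels V W =
    (\<Union>x\<in>carrier V. \<Union>x'\<in>carrier V. \<Union>y\<in>carrier W.
      {Poly_Mapping.single (x \<oplus>\<^bsub>V\<^esub> x', y) 1
        - Poly_Mapping.single (x, y) 1 - Poly_Mapping.single (x', y) 1}) \<union>
    (\<Union>x\<in>carrier V. \<Union>y\<in>carrier W. \<Union>y'\<in>carrier W.
      {Poly_Mapping.single (x, y \<oplus>\<^bsub>W\<^esub> y') 1
        - Poly_Mapping.single (x, y) 1 - Poly_Mapping.single (x, y') 1}) \<union>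
    (\<Union>c. \<Union>x\<in>carrier V. \<Union>y\<in>carrier W.
      {Poly_Mapping.single (c \<odot>\<^bsub>V\<^esub> x, y) 1 - Poly_Mapping.single (x, y) c,
       Poly_Mapping.single (x, c \<odot>\<^bsub>W\<^esub> y) 1 - Poly_Mapping.single (x, y) c})"

definition tensor_ker ::
    "('k::field, 'v) module \<Rightarrow> ('k, 'w) module \<Rightarrow> ('v \<times> 'w \<Rightarrow>\<^sub>0 'k) set" where
  "tensor_ker V W = lin_span (free_space (carrier V \<times> carrier W)) (tensor_rels V W)"

definition tensor_class ::
    "('k::field, 'v) module \<Rightarrow> ('k, 'w) module \<Rightarrow> ('v \<times> 'w \<Rightarrow>\<^sub>0 'k) \<Rightarrow> ('v \<times> 'w \<Rightarrow>\<^sub>0 'k) set" where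
  "tensor_class V W f = tensor_ker V W +>\<^bsub>free_space (carrier V \<times> carrier W)\<^esub> f"

definition tensor ::
    "('k::field, 'v) module \<Rightarrow> ('k, 'w) module \<Rightarrow> ('k, ('v \<times> 'w \<Rightarrow>\<^sub>0 'k) set) module" where
  "tensor V W = free_space (carrier V \<times> carrier W) //\<^sub>k tensor_ker V W"

definition left_ideal_of :: "('k, 'a) module \<Rightarrow> 'a \<Rightarrow> ('k, 'a) module" where
  "left_ideal_of A e = A\<lparr>carrier := {x \<otimes>\<^bsub>A\<^esub> e | x. x \<in> carrier A}\<rparr>"

definition right_ideal_of :: "('k, 'a) module \<Rightarrow> 'a \<Rightarrow> ('k, 'a) module" where
  "right_ideal_of A e = A\<lparr>carrier := {e \<otimes>\<^bsub>A\<^esub> x | x. x \<in> carrier A}\<rparr>"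

text \<open>The bimodule \<open>Ae \<otimes> e'A\<close>, with \<open>a (x \<otimes> y) = ax \<otimes> y\<close> and \<open>(x \<otimes> y) a = x \<otimes> ya\<close>.\<close>

definition proj_bimod ::
    "('k::field, 'a) module \<Rightarrow> 'a \<Rightarrow> 'a \<Rightarrow> ('k, 'a, ('a \<times> 'a \<Rightarrow>\<^sub>0 'k) set) bimod" where
  "proj_bimod A e e' =
    (let V = left_ideal_of A e; W = right_ideal_of A e'; T = tensor V W in
    \<lparr>carrier = carrier T, mult = mult T, one = one T, zero = zero T, add = add T,
     smult = smult T,
     lact = (\<lambda>a X. \<Union>f\<in>X. tensor_class V W
       (\<Sum>(x, y)\<in>Poly_Mapping.keys f.
          Poly_Mapping.single (a \<otimes>\<^bsub>A\<^esub> x, y) (Poly_Mapping.lookup f (x, y)))),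
     ract = (\<lambda>X a. \<Union>f\<in>X. tensor_class V W
       (\<Sum>(x, y)\<in>Poly_Mapping.keys f.
          Poly_Mapping.single (x, y \<otimes>\<^bsub>A\<^esub> a) (Poly_Mapping.lookup f (x, y))))\<rparr>)"

definition proj_gen :: "('k::field, 'a) module \<Rightarrow> 'a \<Rightarrow> 'a \<Rightarrow> ('a \<times> 'a \<Rightarrow>\<^sub>0 'k) set" where
  "proj_gen A e e' =
    tensor_class (left_ideal_of A e) (right_ideal_of A e') (Poly_Mapping.single (e, e') 1)"

definition free_bimod ::
    "('k::field, 'a) module \<Rightarrow> 'i set \<Rightarrow> ('k, 'a, 'i \<Rightarrow> ('a \<times> 'a \<Rightarrow>\<^sub>0 'k) set) bimod" where
  "free_bimod A I = direct_sum I (\<lambda>_. proj_bimod A \<one>\<^bsub>A\<^esub> \<one>\<^bsub>A\<^esub>)"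

text \<open>Projective means direct summand of a free bimodule. Index sets inside the type of \<open>M\<close>
  suffice, since \<open>M\<close> is a quotient of the free bimodule on its own carrier.\<close>

definition projective_bimod :: "('k::field, 'a) module \<Rightarrow> ('k, 'a, 'x) bimod \<Rightarrow> bool" where
  "projective_bimod A M \<longleftrightarrow> bimodule A M \<and>
    (\<exists>I :: 'x set. \<exists>s\<in>bimod_hom A M (free_bimod A I). \<exists>r\<in>bimod_hom A (free_bimod A I) M.
      \<forall>x\<in>carrier M. r (s x) = x)"


section \<open>Hochschild cohomology\<close>

text \<open>An augmented complex \<open>\<dots> \<rightarrow> P\<^sup>1 \<rightarrow> P\<^sup>0 \<rightarrow> A\<close>; for \<open>n \<ge> 1\<close>, \<open>bdry Q n\<close> is the
  map \<open>P\<^sup>n \<rightarrow> P\<^sup>n\<^sup>-\<^sup>1\<close>.\<close>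

record ('k, 'a, 'x) aug_complex =
  obj :: "nat \<Rightarrow> ('k, 'a, 'x) bimod"
  bdry :: "nat \<Rightarrow> 'x \<Rightarrow> 'x"
  aug :: "'x \<Rightarrow> 'a"

definition projective_resolution ::
    "('k::field, 'a) module \<Rightarrow> ('k, 'a, 'x) aug_complex \<Rightarrow> bool" where
  "projective_resolution A Q \<longleftrightarrow>
    (\<forall>n. projective_bimod A (obj Q n)) \<and>
    (\<forall>n. bdry Q (Suc n) \<in> bimod_hom A (obj Q (Suc n)) (obj Q n)) \<and>
    aug Q \<in> bimod_hom A (obj Q 0) (regular_bimod A) \<and>
    aug Q ` carrier (obj Q 0) = carrier A \<and>
    {x \<in> carrier (obj Q 0). aug Q x = \<zero>\<^bsub>A\<^esub>} = bdry Q 1 ` carrier (obj Q 1) \<and>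
    (\<forall>n. {x \<in> carrier (obj Q (Suc n)). bdry Q (Suc n) x = \<zero>\<^bsub>obj Q n\<^esub>} =
         bdry Q (Suc (Suc n)) ` carrier (obj Q (Suc (Suc n))))"

definition cocycles ::
    "('k, 'a) module \<Rightarrow> ('k, 'a, 'x) aug_complex \<Rightarrow> nat \<Rightarrow> ('k, 'x \<Rightarrow> 'a) module" where
  "cocycles A Q n = (hom_space A (obj Q n) (regular_bimod A))
    \<lparr>carrier := {f \<in> bimod_hom A (obj Q n) (regular_bimod A).
       \<forall>x\<in>carrier (obj Q (Suc n)). f (bdry Q (Suc n) x) = \<zero>\<^bsub>A\<^esub>}\<rparr>"

definition coboundaries ::
    "('k, 'a) module \<Rightarrow> ('k, 'a, 'x) aug_complex \<Rightarrow> nat \<Rightarrow> ('x \<Rightarrow> 'a) set" where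
  "coboundaries A Q n = (case n of
     0 \<Rightarrow> {\<zero>\<^bsub>cocycles A Q 0\<^esub>}
   | Suc k \<Rightarrow> (\<lambda>g. compose (carrier (obj Q n)) g (bdry Q n)) `
       bimod_hom A (obj Q k) (regular_bimod A))"

text \<open>\<open>Ext\<^sup>n\<close> of \<open>A\<close> by \<open>A\<close> over the enveloping algebra, computed from a projective resolution
  \<open>Q\<close> of \<open>A\<close>.\<close>

definition Ext_grp ::
    "('k, 'a) module \<Rightarrow> ('k, 'a, 'x) aug_complex \<Rightarrow> nat \<Rightarrow> ('k, ('x \<Rightarrow> 'a) set) module" where
  "Ext_grp A Q n = cocycles A Q n //\<^sub>k coboundaries A Q n"

definition Ext_class ::
    "('k, 'a) module \<Rightarrow> ('k, 'a, 'x) aug_complex \<Rightarrow> nat \<Rightarrow> ('x \<Rightarrow> 'a) \<Rightarrow> ('x \<Rightarrow> 'a) set" where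
  "Ext_class A Q n f = coboundaries A Q n +>\<^bsub>cocycles A Q n\<^esub> f"

text \<open>Chain maps \<open>L\<^sub>k : P\<^sup>p\<^sup>+\<^sup>k \<rightarrow> P\<^sup>k\<close> lifting \<open>g : P\<^sup>p \<rightarrow> A\<close>.\<close>

definition chain_lifts ::
    "('k, 'a) module \<Rightarrow> ('k, 'a, 'x) aug_complex \<Rightarrow> nat \<Rightarrow> ('x \<Rightarrow> 'a) \<Rightarrow> (nat \<Rightarrow> 'x \<Rightarrow> 'x) set" where
  "chain_lifts A Q p g = {L.
     (\<forall>k. L k \<in> bimod_hom A (obj Q (p + k)) (obj Q k)) \<and>
     (\<forall>x\<in>carrier (obj Q p). aug Q (L 0 x) = g x) \<and>
     (\<forall>k. \<forall>x\<in>carrier (obj Q (Suc (p + k))).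
        bdry Q (Suc k) (L (Suc k) x) = L k (bdry Q (Suc (p + k)) x))}"

text \<open>The Yoneda product \<open>[f] [g] = [f \<circ> L\<^sub>n]\<close> of classes of degrees \<open>n\<close> and \<open>p\<close>, where \<open>L\<close> lifts \<open>g\<close>.
  Like \<open>rcoset_mult\<close> it is written as a union over all representatives and all lifts, each
  of which contributes the same class.\<close>

definition yoneda ::
    "('k, 'a) module \<Rightarrow> ('k, 'a, 'x) aug_complex \<Rightarrow> nat \<Rightarrow> nat \<Rightarrow>
     ('x \<Rightarrow> 'a) set \<Rightarrow> ('x \<Rightarrow> 'a) set \<Rightarrow> ('x \<Rightarrow> 'a) set" where
  "yoneda A Q n p X Y = (\<Union>f\<in>X. \<Union>g\<in>Y. \<Union>L\<in>chain_lifts A Q p g.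
     Ext_class A Q (p + n) (compose (carrier (obj Q (p + n))) f (L n)))"

definition in_degree ::
    "('k, 'a) module \<Rightarrow> ('k, 'a, 'x) aug_complex \<Rightarrow> nat \<Rightarrow> ('x \<Rightarrow> 'a) set \<Rightarrow> nat \<Rightarrow> ('x \<Rightarrow> 'a) set" where
  "in_degree A Q n X = (\<lambda>k. if k = n then X else \<zero>\<^bsub>Ext_grp A Q k\<^esub>)"

text \<open>\<open>HH\<^sup>*(A) = \<Oplus>\<^sub>n Ext\<^sup>n\<close>, as families of classes with finite support.\<close>

definition HH ::
    "('k, 'a) module \<Rightarrow> ('k, 'a, 'x) aug_complex \<Rightarrow> ('k, nat \<Rightarrow> ('x \<Rightarrow> 'a) set) module" where
  "HH A Q =
    \<lparr>carrier = {h. (\<forall>n. h n \<in> carrier (Ext_grp A Q n)) \<and> finite {n. h n \<noteq> \<zero>\<^bsub>Ext_grp A Q n\<^esub>}},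
     mult = (\<lambda>h h'. \<lambda>n. \<Oplus>\<^bsub>Ext_grp A Q n\<^esub>k\<in>{..n}. yoneda A Q k (n - k) (h k) (h' (n - k))),
     one = in_degree A Q 0 (Ext_class A Q 0 (aug Q)),
     zero = (\<lambda>n. \<zero>\<^bsub>Ext_grp A Q n\<^esub>),
     add = (\<lambda>h h'. \<lambda>n. h n \<oplus>\<^bsub>Ext_grp A Q n\<^esub> h' n),
     smult = (\<lambda>c h. \<lambda>n. c \<odot>\<^bsub>Ext_grp A Q n\<^esub> h n)\<rparr>"

definition nil_ideal ::
    "('k, 'a) module \<Rightarrow> ('k, 'a, 'x) aug_complex \<Rightarrow> (nat \<Rightarrow> ('x \<Rightarrow> 'a) set) set" where
  "nil_ideal A Q = Idl\<^bsub>HH A Q\<^esub>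
    {h \<in> carrier (HH A Q). (\<exists>n. \<forall>k. k \<noteq> n \<longrightarrow> h k = \<zero>\<^bsub>Ext_grp A Q k\<^esub>) \<and>
       (\<exists>k::nat. h [^]\<^bsub>HH A Q\<^esub> k = \<zero>\<^bsub>HH A Q\<^esub>)}"

definition HH_red ::
    "('k, 'a) module \<Rightarrow> ('k, 'a, 'x) aug_complex \<Rightarrow> ('k, (nat \<Rightarrow> ('x \<Rightarrow> 'a) set) set) module" where
  "HH_red A Q = HH A Q //\<^sub>k nil_ideal A Q"

text \<open>The image in the quotient of the class of a cocycle \<open>f\<close> of degree \<open>n\<close>.\<close>

definition HH_red_class ::
    "('k, 'a) module \<Rightarrow> ('k, 'a, 'x) aug_complex \<Rightarrow> nat \<Rightarrow> ('x \<Rightarrow> 'a) \<Rightarrow>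
     (nat \<Rightarrow> ('x \<Rightarrow> 'a) set) set" where
  "HH_red_class A Q n f = nil_ideal A Q +>\<^bsub>HH A Q\<^esub> in_degree A Q n (Ext_class A Q n f)"


section \<open>The algebras \<open>\<Lambda>\<^sub>N\<close>\<close>

text \<open>Vertices are \<open>0, \<dots>, m - 1\<close>; \<open>Arr i\<close> is \<open>a\<^sub>i : i \<rightarrow> i + 1\<close> and \<open>Bar i\<close> is
  the reverse arrow \<open>i + 1 \<rightarrow> i\<close>.\<close>

datatype arrow = Arr int | Bar int

definition quiver :: "nat \<Rightarrow> (int, arrow) pre_digraph" where
  "quiver m =
    \<lparr>verts = {0..<int m}, arcs = Arr ` {0..<int m} \<union> Bar ` {0..<int m},
     tail = (\<lambda>x. case x of Arr i \<Rightarrow> i | Bar i \<Rightarrow> (i + 1) mod int m),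
     head = (\<lambda>x. case x of Arr i \<Rightarrow> (i + 1) mod int m | Bar i \<Rightarrow> i)\<rparr>"

type_synonym 'k KQ = "(int, arrow) path \<Rightarrow>\<^sub>0 'k"

abbreviation KQ :: "nat \<Rightarrow> ('k::field, 'k KQ) module" where
  "KQ m \<equiv> path_algebra (quiver m)"

definition vertex :: "nat \<Rightarrow> int \<Rightarrow> 'k::field KQ" where
  "vertex m i = Poly_Mapping.single (i mod int m, []) 1"

definition arr :: "nat \<Rightarrow> int \<Rightarrow> 'k::field KQ" where
  "arr m i = Poly_Mapping.single (i mod int m, [Arr (i mod int m)]) 1"

definition bar :: "nat \<Rightarrow> int \<Rightarrow> 'k::field KQ" where
  "bar m i = Poly_Mapping.single ((i + 1) mod int m, [Bar (i mod int m)]) 1"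

definition I_Lam :: "nat \<Rightarrow> nat \<Rightarrow> 'k::field KQ set" where
  "I_Lam m N = Idl\<^bsub>KQ m\<^esub> (\<Union>i.
     {arr m i \<otimes>\<^bsub>KQ m\<^esub> arr m (i + 1),
      bar m (i - 1) \<otimes>\<^bsub>KQ m\<^esub> bar m (i - 2),
      (arr m i \<otimes>\<^bsub>KQ m\<^esub> bar m i) [^]\<^bsub>KQ m\<^esub> N
        \<ominus>\<^bsub>KQ m\<^esub> (bar m (i - 1) \<otimes>\<^bsub>KQ m\<^esub> arr m (i - 1)) [^]\<^bsub>KQ m\<^esub> N})"

definition Lam :: "nat \<Rightarrow> nat \<Rightarrow> ('k::field, 'k KQ set) module" where
  "Lam m N = KQ m //\<^sub>k I_Lam m N"

definition idem :: "nat \<Rightarrow> nat \<Rightarrow> int \<Rightarrow> 'k::field KQ set" where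
  "idem m N i = I_Lam m N +>\<^bsub>KQ m\<^esub> vertex m i"

text \<open>The sums \<open>a\<close> and \<open>b\<close> of all arrows of each of the two types. Multiplication by idempotents
  picks out the composable arrow: e.g. \<open>e\<^sub>i a = a\<^sub>i\<close> and \<open>a e\<^sub>i\<^sub>+\<^sub>1 = a\<^sub>i\<close>.\<close>

definition a_sum :: "nat \<Rightarrow> nat \<Rightarrow> 'k::field KQ set" where
  "a_sum m N = I_Lam m N +>\<^bsub>KQ m\<^esub> (\<Sum>i\<in>{0..<int m}. arr m i)"

definition b_sum :: "nat \<Rightarrow> nat \<Rightarrow> 'k::field KQ set" where
  "b_sum m N = I_Lam m N +>\<^bsub>KQ m\<^esub> (\<Sum>i\<in>{0..<int m}. bar m i)"


section \<open>The minimal projective bimodule resolution of \<open>\<Lambda>\<^sub>N\<close>\<close>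

type_synonym 'k Lam_res = "int \<times> int \<Rightarrow> ('k KQ set \<times> 'k KQ set \<Rightarrow>\<^sub>0 'k) set"

definition res_idx :: "nat \<Rightarrow> nat \<Rightarrow> (int \<times> int) set" where
  "res_idx m n = {0..<int m} \<times> {0..int n}"

definition res_obj :: "nat \<Rightarrow> nat \<Rightarrow> nat \<Rightarrow> ('k::field, 'k KQ set, 'k Lam_res) bimod" where
  "res_obj m N n = direct_sum (res_idx m n)
     (\<lambda>(i, r). proj_bimod (Lam m N) (idem m N i) (idem m N (i + int n - 2 * r)))"

text \<open>\<open>res_gen m N n i r\<close> is the generator of the \<open>(i, r)\<close>-summand of \<open>P\<^sup>n\<close>; it is \<open>0\<close>
  for \<open>r = -1\<close> and \<open>r = n + 1\<close>.\<close>

definition res_gen :: "nat \<Rightarrow> nat \<Rightarrow> nat \<Rightarrow> int \<Rightarrow> int \<Rightarrow> 'k::field Lam_res" where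
  "res_gen m N n i r =
    (\<lambda>s\<in>res_idx m n. if s = (i mod int m, r)
       then proj_gen (Lam m N) (idem m N i) (idem m N (i + int n - 2 * r))
       else \<zero>\<^bsub>res_obj m N n\<^esub> s)"

text \<open>The image of \<open>res_gen m N n i r\<close> under the \<open>n\<close>-th differential, \<open>n \<ge> 1\<close>.\<close>

definition res_bdry_gen :: "nat \<Rightarrow> nat \<Rightarrow> nat \<Rightarrow> int \<Rightarrow> int \<Rightarrow> 'k::field Lam_res" where
  "res_bdry_gen m N n i r =
    (let A = Lam m N; P = res_obj m N (n - 1); g = res_gen m N (n - 1);
         a = a_sum m N; b = b_sum m N; ab = a \<otimes>\<^bsub>A\<^esub> b; ba = b \<otimes>\<^bsub>A\<^esub> a;
         bab = b \<otimes>\<^bsub>A\<^esub> ab [^]\<^bsub>A\<^esub> (N - 1); aba = a \<otimes>\<^bsub>A\<^esub> ba [^]\<^bsub>A\<^esub> (N - 1);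
         sg = (\<lambda>k x. (- 1) ^ k \<odot>\<^bsub>P\<^esub> x); q = nat r
     in if int n - 2 * r > 0 then
          ract P (g i r) a
          \<oplus>\<^bsub>P\<^esub> sg (n + q) (lact P a (g (i + 1) r))
          \<oplus>\<^bsub>P\<^esub> sg (n + q) (lact P bab (g (i - 1) (r - 1)))
          \<oplus>\<^bsub>P\<^esub> sg n (ract P (g i (r - 1)) bab)
        else if int n - 2 * r < 0 then
          ract P (g i r) aba
          \<oplus>\<^bsub>P\<^esub> sg (n + q) (lact P aba (g (i + 1) r))
          \<oplus>\<^bsub>P\<^esub> sg (n + q) (lact P b (g (i - 1) (r - 1)))
          \<oplus>\<^bsub>P\<^esub> sg n (ract P (g i (r - 1)) b)
        else
          (\<Oplus>\<^bsub>P\<^esub>k\<in>{..<N}.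
             lact P (ba [^]\<^bsub>A\<^esub> k)
               (ract P (ract P (g i r) a \<oplus>\<^bsub>P\<^esub> sg q (lact P b (g (i - 1) (r - 1))))
                  (ba [^]\<^bsub>A\<^esub> (N - k - 1)))
             \<oplus>\<^bsub>P\<^esub> lact P (ab [^]\<^bsub>A\<^esub> k)
               (ract P (sg q (lact P a (g (i + 1) r)) \<oplus>\<^bsub>P\<^esub> ract P (g i (r - 1)) b)
                  (ab [^]\<^bsub>A\<^esub> (N - k - 1)))))"

text \<open>A bimodule homomorphism out of \<open>P\<^sup>n\<close> is determined by the images of the generators.\<close>

definition hom_by_gens ::
    "nat \<Rightarrow> nat \<Rightarrow> nat \<Rightarrow> ('k::field, 'k KQ set, 'y) bimod \<Rightarrow> (int \<Rightarrow> int \<Rightarrow> 'y) \<Rightarrow>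
     'k Lam_res \<Rightarrow> 'y" where
  "hom_by_gens m N n M v = (THE f. f \<in> bimod_hom (Lam m N) (res_obj m N n) M \<and>
     (\<forall>(i, r)\<in>res_idx m n. f (res_gen m N n i r) = v i r))"

definition Lam_resolution :: "nat \<Rightarrow> nat \<Rightarrow> ('k::field, 'k KQ set, 'k Lam_res) aug_complex" where
  "Lam_resolution m N =
    \<lparr>obj = res_obj m N,
     bdry = (\<lambda>n. hom_by_gens m N n (res_obj m N (n - 1)) (res_bdry_gen m N n)),
     aug = hom_by_gens m N 0 (regular_bimod (Lam m N)) (\<lambda>i r. idem m N i)\<rparr>"

text \<open>The cochain of degree \<open>n\<close> with \<open>e\<^sub>i \<otimes> e\<^sub>i\<^sub>+\<^sub>k \<mapsto> e\<^sub>i\<close> for all \<open>i\<close>, and zero on all other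
  generators; \<open>r = (n - k) / 2\<close> is rewritten as \<open>k = n - 2 r\<close>.\<close>

definition chi :: "nat \<Rightarrow> nat \<Rightarrow> nat \<Rightarrow> int \<Rightarrow> 'k::field Lam_res \<Rightarrow> 'k KQ set" where
  "chi m N n k = hom_by_gens m N n (regular_bimod (Lam m N))
     (\<lambda>i r. if int n - 2 * r = k then idem m N i else \<zero>\<^bsub>Lam m N\<^esub>)"

definition HH_Lam_red ::
    "nat \<Rightarrow> nat \<Rightarrow> ('k::field, (nat \<Rightarrow> ('k Lam_res \<Rightarrow> 'k KQ set) set) set) module" where
  "HH_Lam_red m N = HH_red (Lam m N) (Lam_resolution m N)"

definition chi_red ::
    "nat \<Rightarrow> nat \<Rightarrow> nat \<Rightarrow> int \<Rightarrow> (nat \<Rightarrow> ('k::field Lam_res \<Rightarrow> 'k KQ set) set) set" where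
  "chi_red m N n k = HH_red_class (Lam m N) (Lam_resolution m N) n (chi m N n k)"


section \<open>The presented algebra\<close>

datatype chi_var = X40 | X2 | Xm2  \<comment> \<open>for the classes of degrees \<open>4\<close>, \<open>2m\<close>, \<open>2m\<close>\<close>

definition chi_rel :: "nat \<Rightarrow> ((chi_var \<Rightarrow>\<^sub>0 nat) \<Rightarrow>\<^sub>0 'k::field) set" where
  "chi_rel m = Idl\<^bsub>poly_alg\<^esub> {pvar X40 ^ m - pvar X2 * pvar Xm2}"

definition chi_alg :: "nat \<Rightarrow> ('k::field, ((chi_var \<Rightarrow>\<^sub>0 nat) \<Rightarrow>\<^sub>0 'k) set) module" where
  "chi_alg m = poly_alg //\<^sub>k chi_rel m"

definition chi_var_class :: "nat \<Rightarrow> chi_var \<Rightarrow> ((chi_var \<Rightarrow>\<^sub>0 nat) \<Rightarrow>\<^sub>0 'k::field) set" where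
  "chi_var_class m v = chi_rel m +>\<^bsub>poly_alg\<^esub> pvar v"

end

(*
A minimal resolution with generators g(i,r), 0 <= r <= n, in degree n is exact because it carries an
explicit right linear contracting homotopy, so that HH is a ring under lifting of cocycles to
chain maps. For a cocycle f of degree n let c(n,r) be the coefficient of e_i in f(g(i,r)). The cocycle
equations together with m odd and char K different from 2 force c(n,r) to be independent of i, and to
vanish unless n and r are even and m divides n - 2 r. The e-coefficients of a lift of g are again those
of g, shifted by r, so f -> sum of c(n,r) x^(n-r) y^r is a ring homomorphism from HH to K[x,y].
Its kernel consists of the classes of cocycles with values in the radical. These lift to chain maps that
raise the length filtration, and rad^3 = 0, so that every element of the kernel has cube zero; since
K[x,y] is a domain, the kernel is the ideal of nilpotents. The image is spanned by the monomials
x^p y^q with p, q even and p = q mod m, and so is the image of X40 -> x^2 y^2, X2 -> x^(2m),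
Xm2 -> y^(2m), whose kernel is generated by X40^m - X2 Xm2. Three elements of K[x,y] are algebraically
dependent, which bounds the Krull dimension of the image from above.
*)
theory Submission
  imports Defs "HOL-Computational_Algebra.Polynomial"
begin

text \<open>No general theory of derived functors is invoked. Lifts exist because a homomorphism out
  of P^n may take any values on the generators that fit their two idempotents, and the homotopy,
  although only right linear, supplies a preimage for each generator. The choice of these preimages
  matters: the homotopy shortens a term by at most one arrow, while each term of the differential
  contains an arrow, so a lift built from it keeps a cocycle with values in rad^d at length d or
  more. The constraints on c(n,r) come from two recursions along the cycle, with factors (-1)^(n+r)
  and (-1)^r, one from the arrows a and one from the opposite arrows; after m steps one is back at
  the start. Graded commutativity of HH is never shown: the quotient is commutative because it
  embeds into K[x,y]. Cosets of finitely supported functions are unfit for computing, so the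
  explicit identities are verified in coordinates, with vertices ranging over all integers and
  periodicity as a side condition: moving along an arrow is then a plain shift.\<close>

hide_const (open) Multiset.mult Polynomial.smult

section \<open>Vector spaces\<close>

abbreviation (input) "plookup \<equiv> Poly_Mapping.lookup"
abbreviation (input) "psingle \<equiv> Poly_Mapping.single"
abbreviation (input) "pkeys \<equiv> Poly_Mapping.keys"

lemma field_ring_simps [simp]:
  "carrier (field_ring :: 'k::field ring) = UNIV"
  "x \<oplus>\<^bsub>field_ring\<^esub> y = (x + y :: 'k)"
  "x \<otimes>\<^bsub>field_ring\<^esub> y = (x * y :: 'k)"
  "\<one>\<^bsub>field_ring\<^esub> = (1 :: 'k)"
  "\<zero>\<^bsub>field_ring\<^esub> = (0 :: 'k)"
  by (simp_all add: field_ring_def)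

lemma cring_field_ring: "cring (field_ring :: 'k::field ring)"
proof (rule cringI)
  show "abelian_group (field_ring :: 'k ring)"
    by (rule abelian_groupI) (auto simp: add.assoc add.commute intro: exI[of _ "- _"] left_minus)
  show "comm_monoid (field_ring :: 'k ring)"
    by (rule comm_monoidI) (auto simp: mult.assoc mult.commute)
qed (auto simp: distrib_right)

text \<open>The module axioms over \<open>field_ring\<close> with scalars taken directly from the
  field type; \<open>module_iff_vec\<close> is the bridge. The record scheme is left open so that
  algebras, bimodules and quotients are covered at once.\<close>

locale vec = abelian_group V
  for V :: "('k::field, 'a, 'c) module_scheme" (structure) +
  assumes smult_closed [simp, intro]: "x \<in> carrier V ==> c \<odot> x \<in> carrier V"
    and smult_l_distr: "x \<in> carrier V ==> (c + d) \<odot> x = c \<odot> x \<oplus> d \<odot> x"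
    and smult_r_distr: "x \<in> carrier V ==> y \<in> carrier V ==> c \<odot> (x \<oplus> y) = c \<odot> x \<oplus> c \<odot> y"
    and smult_assoc: "x \<in> carrier V ==> (c * d) \<odot> x = c \<odot> (d \<odot> x)"
    and smult_one [simp]: "x \<in> carrier V ==> 1 \<odot> x = x"

lemma module_iff_vec: "module (field_ring :: 'k::field ring) V \<longleftrightarrow> vec V"
proof
  assume "module (field_ring :: 'k ring) V"
  then interpret module "field_ring :: 'k ring" V .
  show "vec V"
    using smult_closed smult_l_distr smult_r_distr smult_assoc1 smult_one
    by unfold_locales auto
next
  assume "vec V"
  then interpret vec V .
  show "module (field_ring :: 'k ring) V"
    by (intro moduleI cring_field_ring)
      (auto simp: abelian_group_axioms smult_l_distr smult_r_distr smult_assoc)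
qed

context vec begin

lemma vec: "vec V" by (rule vec_axioms)

lemma smult_zero_left [simp]: "x \<in> carrier V ==> 0 \<odot> x = \<zero>"
  using module.smult_l_null[of "field_ring :: 'k ring" V x] module_iff_vec vec by auto

lemma smult_zero_right [simp]: "c \<odot> \<zero> = \<zero>"
  using module.smult_r_null[of "field_ring :: 'k ring" V c] module_iff_vec vec by auto

lemma smult_minus_left: "x \<in> carrier V ==> (- c) \<odot> x = \<ominus> (c \<odot> x)"
proof -
  assume x: "x \<in> carrier V"
  have "(- c) \<odot> x \<oplus> c \<odot> x = \<zero>"
    using smult_l_distr[OF x, of "- c" c] x by simp
  then show ?thesis using x by (metis minus_equality smult_closed)
qed

lemma smult_minus_one: "x \<in> carrier V ==> (- 1) \<odot> x = \<ominus> x"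
  using smult_minus_left[of x 1] by simp

lemma smult_neg: "x \<in> carrier V ==> c \<odot> (\<ominus> x) = \<ominus> (c \<odot> x)"
  by (metis a_inv_closed mult.commute smult_assoc smult_minus_one smult_closed)

lemma smult_minus_right:
  "x \<in> carrier V ==> y \<in> carrier V ==> c \<odot> (x \<ominus> y) = c \<odot> x \<ominus> c \<odot> y"
  by (simp add: minus_eq smult_r_distr smult_neg)

lemma smult_finsum:
  assumes "f \<in> I \<rightarrow> carrier V"
  shows "c \<odot> (\<Oplus>i\<in>I. f i) = (\<Oplus>i\<in>I. c \<odot> f i)"
  using assms
proof (induct I rule: infinite_finite_induct)
  case (insert x F)
  then show ?case by (simp add: Pi_iff smult_r_distr finsum_closed)
qed auto

end

abbreviation subspace :: "'a set => ('k::field, 'a, 'c) module_scheme => bool" where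
  "subspace U V \<equiv> submodule U (field_ring :: 'k ring) V"

context vec begin

lemma subspaceI:
  assumes "U \<subseteq> carrier V" "\<zero> \<in> U" "\<And>x y. x \<in> U ==> y \<in> U ==> x \<oplus> y \<in> U"
    "\<And>c x. x \<in> U ==> c \<odot> x \<in> U"
  shows "subspace U V"
proof -
  interpret M: module "field_ring :: 'k ring" V using module_iff_vec vec by auto
  show ?thesis
  proof (rule M.submoduleI)
    fix a assume "a \<in> U"
    then show "\<ominus> a \<in> U" using assms(1) assms(4)[of a "-1"] smult_minus_one by auto
  qed (use assms in auto)
qed

lemma subspaceD:
  assumes "subspace U V"
  shows "U \<subseteq> carrier V" "\<zero> \<in> U" "\<And>x y. x \<in> U ==> y \<in> U ==> x \<oplus> y \<in> U"
    "\<And>c x. x \<in> U ==> c \<odot> x \<in> U" "\<And>x. x \<in> U ==> \<ominus> x \<in> U"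
    "\<And>x y. x \<in> U ==> y \<in> U ==> x \<ominus> y \<in> U"
proof -
  interpret M: module "field_ring :: 'k ring" V using module_iff_vec vec by auto
  note E = M.submoduleE[OF assms]
  show 1: "U \<subseteq> carrier V" and 2: "\<And>x y. x \<in> U ==> y \<in> U ==> x \<oplus> y \<in> U"
    and 3: "\<And>c x. x \<in> U ==> c \<odot> x \<in> U" and 4: "\<And>x. x \<in> U ==> \<ominus> x \<in> U"
    using E by auto
  then show "\<And>x y. x \<in> U ==> y \<in> U ==> x \<ominus> y \<in> U" by (auto simp: minus_eq)
  obtain x where "x \<in> U" using E(2) by auto
  then show "\<zero> \<in> U" using 1 3[of x 0] by auto
qed

lemma subspace_vec: "subspace U V ==> vec (V\<lparr>carrier := U\<rparr>)"
  using submodule.submodule_is_module[of U "field_ring :: 'k ring" V] module_iff_vec vec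
  by blast

lemma subspace_additive_subgroup:
  assumes "subspace U V" shows "abelian_subgroup U V"
  using assms by (intro abelian_subgroupI3 additive_subgroup.intro abelian_group_axioms)
    (auto simp: submodule_def)

end

text \<open>Axioms pass along a surjection that respects the operations. Applied to the coset map
  for quotients, and to the identity when two records share these operations but differ in other
  fields.\<close>

lemma vec_image:
  fixes V :: "('k::field, 'a, 'c) module_scheme" (structure) and Q :: "('k, 'b, 'd) module_scheme"
  assumes "vec V" and p: "p ` carrier V = carrier Q"
    and add: "\<And>x y. x \<in> carrier V ==> y \<in> carrier V ==> p (x \<oplus>\<^bsub>V\<^esub> y) = p x \<oplus>\<^bsub>Q\<^esub> p y"
    and smult: "\<And>c x. x \<in> carrier V ==> p (c \<odot>\<^bsub>V\<^esub> x) = c \<odot>\<^bsub>Q\<^esub> p x"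
    and zero: "p \<zero>\<^bsub>V\<^esub> = \<zero>\<^bsub>Q\<^esub>"
  shows "vec Q"
proof -
  interpret vec V by fact
  have cl: "x \<in> carrier V ==> p x \<in> carrier Q" for x using p by auto
  have cs: thesis if "X \<in> carrier Q" "\<And>x. x \<in> carrier V ==> X = p x ==> thesis" for X thesis
    using that(1) that(2) unfolding p[symmetric] by (elim imageE) simp
  interpret Q: abelian_group Q
  proof (rule abelian_groupI)
    fix X Y assume XY: "X \<in> carrier Q" "Y \<in> carrier Q"
    obtain x where x: "x \<in> carrier V" "X = p x" using cs[OF XY(1)] .
    obtain y where y: "y \<in> carrier V" "Y = p y" using cs[OF XY(2)] .
    show "X \<oplus>\<^bsub>Q\<^esub> Y \<in> carrier Q" "X \<oplus>\<^bsub>Q\<^esub> Y = Y \<oplus>\<^bsub>Q\<^esub> X"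
      using cl[OF a_closed[OF x(1) y(1)]] add[OF x(1) y(1)] add[OF y(1) x(1)] a_comm[OF x(1) y(1)]
      unfolding x y by metis+
    show "\<zero>\<^bsub>Q\<^esub> \<oplus>\<^bsub>Q\<^esub> X = X" using add[of \<zero> x, symmetric] x by (simp add: zero)
    show "\<exists>y\<in>carrier Q. y \<oplus>\<^bsub>Q\<^esub> X = \<zero>\<^bsub>Q\<^esub>"
      using add[of "\<ominus> x" x, symmetric] x by (intro bexI[of _ "p (\<ominus> x)"] cl) (simp_all add: l_neg zero)
    fix Z assume "Z \<in> carrier Q"
    then obtain z where z: "z \<in> carrier V" "Z = p z" by (rule cs)
    show "X \<oplus>\<^bsub>Q\<^esub> Y \<oplus>\<^bsub>Q\<^esub> Z = X \<oplus>\<^bsub>Q\<^esub> (Y \<oplus>\<^bsub>Q\<^esub> Z)"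
      using add[of "x \<oplus> y" z, symmetric] add[of x "y \<oplus> z", symmetric] add[of x y, symmetric] add[of y z, symmetric] x y z
      by (simp add: a_assoc)
  qed (use cl[of \<zero>] zero in auto)
  show ?thesis
  proof
    fix X Y :: 'b and c d :: 'k assume X: "X \<in> carrier Q"
    obtain x where x: "x \<in> carrier V" "X = p x" using cs[OF X] .
    show "c \<odot>\<^bsub>Q\<^esub> X \<in> carrier Q" using smult[of x c, symmetric] x cl[of "c \<odot> x"] by simp
    show "(c + d) \<odot>\<^bsub>Q\<^esub> X = c \<odot>\<^bsub>Q\<^esub> X \<oplus>\<^bsub>Q\<^esub> d \<odot>\<^bsub>Q\<^esub> X"
      using smult[of x "c + d", symmetric] smult[of x c, symmetric] smult[of x d, symmetric] add[of "c \<odot> x" "d \<odot> x", symmetric] x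
      by (simp add: smult_l_distr)
    show "(c * d) \<odot>\<^bsub>Q\<^esub> X = c \<odot>\<^bsub>Q\<^esub> (d \<odot>\<^bsub>Q\<^esub> X)"
      using smult[of x "c * d", symmetric] smult[of "d \<odot> x" c, symmetric] smult[of x d, symmetric] x by (simp add: smult_assoc)
    show "1 \<odot>\<^bsub>Q\<^esub> X = X" using smult[of x 1, symmetric] x by simp
    assume "Y \<in> carrier Q"
    then obtain y where y: "y \<in> carrier V" "Y = p y" by (rule cs)
    show "c \<odot>\<^bsub>Q\<^esub> (X \<oplus>\<^bsub>Q\<^esub> Y) = c \<odot>\<^bsub>Q\<^esub> X \<oplus>\<^bsub>Q\<^esub> c \<odot>\<^bsub>Q\<^esub> Y"
      using smult[of "x \<oplus> y" c, symmetric] smult[of x c, symmetric] smult[of y c, symmetric] add[of x y, symmetric] add[of "c \<odot> x" "c \<odot> y", symmetric] x y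
      by (simp add: smult_r_distr)
  qed
qed

section \<open>Quotients by subspaces\<close>

lemma quot_simps:
  "carrier (V //\<^sub>k U) = a_rcosets\<^bsub>V\<^esub> U"
  "mult (V //\<^sub>k U) = rcoset_mult V U"
  "one (V //\<^sub>k U) = U +>\<^bsub>V\<^esub> \<one>\<^bsub>V\<^esub>"
  "zero (V //\<^sub>k U) = U"
  "add (V //\<^sub>k U) = set_add V"
  "smult (V //\<^sub>k U) c X = (\<Union>x\<in>X. U +>\<^bsub>V\<^esub> (c \<odot>\<^bsub>V\<^esub> x))"
  by (simp_all add: quot_def FactRing_def)

lemma carrier_quot: "carrier (V //\<^sub>k U) = (\<lambda>x. U +>\<^bsub>V\<^esub> x) ` carrier V"
  by (auto simp: quot_simps A_RCOSETS_def' a_r_coset_def')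

locale vec_sub = vec V for V :: "('k::field, 'a, 'c) module_scheme" (structure) and U +
  assumes sub: "subspace U V"
begin

sublocale U: abelian_subgroup U V by (rule subspace_additive_subgroup[OF sub])

lemma coset_eq_iff:
  "x \<in> carrier V ==> y \<in> carrier V ==> U +> x = U +> y \<longleftrightarrow> x \<ominus> y \<in> U"
  using U.a_rcos_module[of y x] U.a_repr_independence'[of x y] U.a_rcos_self[of x]
  by (auto simp: minus_eq)

lemma coset_eq_zero_iff: "x \<in> carrier V ==> U +> x = U \<longleftrightarrow> x \<in> U"
  using U.a_rcos_const[of x] U.a_rcos_self[of x] by auto

lemma mem_coset_iff: "x \<in> carrier V ==> y \<in> U +> x \<longleftrightarrow> y \<in> carrier V \<and> U +> y = U +> x"
  using U.a_elemrcos_carrier[of x y] U.a_rcos_self[of y] U.a_repr_independence'[of y x]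
  by auto

lemma quot_add:
  "x \<in> carrier V ==> y \<in> carrier V ==> (U +> x) \<oplus>\<^bsub>V //\<^sub>k U\<^esub> (U +> y) = U +> (x \<oplus> y)"
  by (simp add: quot_simps U.a_rcos_sum)

lemma quot_smult:
  assumes "x \<in> carrier V" shows "c \<odot>\<^bsub>V //\<^sub>k U\<^esub> (U +> x) = U +> (c \<odot> x)"
proof -
  \<comment> \<open>Scalar multiplication on the quotient is a union over all representatives; it is
    a coset because each of them contributes the same set.\<close>
  have "U +> (c \<odot> y) = U +> (c \<odot> x)" if "y \<in> U +> x" for y
  proof -
    from that assms have y: "y \<in> carrier V" "y \<ominus> x \<in> U" by (auto simp: mem_coset_iff coset_eq_iff)
    have "c \<odot> y \<ominus> c \<odot> x = c \<odot> (y \<ominus> x)" using y assms by (simp add: smult_minus_right)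
    then show ?thesis using y assms subspaceD[OF sub] by (simp add: coset_eq_iff)
  qed
  moreover have "x \<in> U +> x" using assms by (rule U.a_rcos_self)
  ultimately show ?thesis unfolding quot_simps by blast
qed

lemma quot_zero: "U +> \<zero> = \<zero>\<^bsub>V //\<^sub>k U\<^esub>"
  by (simp add: quot_simps coset_eq_zero_iff)

lemma quot_vec: "vec (V //\<^sub>k U)"
  by (rule vec_image[OF vec, where p = "\<lambda>x. U +> x"])
    (auto simp: carrier_quot quot_add quot_smult quot_zero)

lemma quot_closed: "x \<in> carrier V ==> U +> x \<in> carrier (V //\<^sub>k U)"
  by (auto simp: carrier_quot)

end

text \<open>Nothing is required outside the carrier, unlike in \<open>bimod_hom\<close>, so
  composites need no restriction.\<close>

definition vlin :: "('k::field, 'a, 'c) module_scheme => ('k, 'b, 'd) module_scheme => ('a => 'b) => bool" where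
  "vlin V W f \<longleftrightarrow> f \<in> carrier V \<rightarrow> carrier W \<and>
    (\<forall>x\<in>carrier V. \<forall>y\<in>carrier V. f (x \<oplus>\<^bsub>V\<^esub> y) = f x \<oplus>\<^bsub>W\<^esub> f y) \<and>
    (\<forall>c. \<forall>x\<in>carrier V. f (c \<odot>\<^bsub>V\<^esub> x) = c \<odot>\<^bsub>W\<^esub> f x)"

lemma vlinI:
  assumes "\<And>x. x \<in> carrier V ==> f x \<in> carrier W"
    "\<And>x y. x \<in> carrier V ==> y \<in> carrier V ==> f (x \<oplus>\<^bsub>V\<^esub> y) = f x \<oplus>\<^bsub>W\<^esub> f y"
    "\<And>c x. x \<in> carrier V ==> f (c \<odot>\<^bsub>V\<^esub> x) = c \<odot>\<^bsub>W\<^esub> f x"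
  shows "vlin V W f"
  using assms by (auto simp: vlin_def)

lemma vlinD:
  assumes "vlin V W f"
  shows "x \<in> carrier V ==> f x \<in> carrier W"
    "x \<in> carrier V ==> y \<in> carrier V ==> f (x \<oplus>\<^bsub>V\<^esub> y) = f x \<oplus>\<^bsub>W\<^esub> f y"
    "x \<in> carrier V ==> f (c \<odot>\<^bsub>V\<^esub> x) = c \<odot>\<^bsub>W\<^esub> f x"
  using assms by (auto simp: vlin_def)

lemma vlin_zero:
  assumes "vec V" "vec W" "vlin V W f" shows "f \<zero>\<^bsub>V\<^esub> = \<zero>\<^bsub>W\<^esub>"
proof -
  interpret V: vec V by fact
  interpret W: vec W by fact
  have "f (0 \<odot>\<^bsub>V\<^esub> \<zero>\<^bsub>V\<^esub>) = 0 \<odot>\<^bsub>W\<^esub> f \<zero>\<^bsub>V\<^esub>" by (rule vlinD[OF assms(3)]) auto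
  then show ?thesis using vlinD(1)[OF assms(3), of "\<zero>\<^bsub>V\<^esub>"] by simp
qed

lemma vlin_minus:
  assumes "vec V" "vec W" "vlin V W f" "x \<in> carrier V" shows "f (\<ominus>\<^bsub>V\<^esub> x) = \<ominus>\<^bsub>W\<^esub> f x"
proof -
  interpret V: vec V by fact
  interpret W: vec W by fact
  show ?thesis
    using vlinD(3)[OF assms(3,4), of "-1"] vlinD(1)[OF assms(3,4)] assms(4)
    by (simp add: V.smult_minus_one W.smult_minus_one)
qed

lemma vlin_diff:
  assumes "vec V" "vec W" "vlin V W f" "x \<in> carrier V" "y \<in> carrier V"
  shows "f (x \<ominus>\<^bsub>V\<^esub> y) = f x \<ominus>\<^bsub>W\<^esub> f y"
proof -
  interpret V: vec V by fact
  interpret W: vec W by fact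
  show ?thesis
    using assms(4,5) by (simp add: V.minus_eq W.minus_eq vlinD[OF assms(3)] vlin_minus[OF assms(1-3)])
qed

lemma vlin_finsum:
  assumes "vec V" "vec W" "vlin V W f" "g \<in> I \<rightarrow> carrier V"
  shows "f (finsum V g I) = finsum W (\<lambda>i. f (g i)) I"
proof -
  interpret V: vec V by fact
  interpret W: vec W by fact
  show ?thesis using assms(4)
  proof (induct I rule: infinite_finite_induct)
    case (insert x F)
    then show ?case
      by (simp add: Pi_iff vlinD[OF assms(3)])
  qed (simp_all add: vlin_zero[OF assms(1-3)])
qed

lemma vlin_comp:
  "vlin U V f ==> vlin V W g ==> vlin U W (\<lambda>x. g (f x))"
  by (auto simp: vlin_def Pi_iff)

lemma (in vec_sub) vlin_coset: "vlin V (V //\<^sub>k U) (\<lambda>x. U +> x)"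
  by (rule vlinI) (auto simp: quot_closed quot_add quot_smult)

lemma (in vec) lin_span_subspace:
  assumes "S \<subseteq> carrier V" shows "subspace (lin_span V S) V"
proof -
  have c: "subspace (carrier V) V" by (rule subspaceI) auto
  show ?thesis
  proof (rule subspaceI)
    show "lin_span V S \<subseteq> carrier V" using c assms by (auto simp: lin_span_def)
    show "\<zero> \<in> lin_span V S" by (auto simp: lin_span_def dest: subspaceD(2))
  qed (simp_all add: lin_span_def subspaceD(3,4))
qed

lemma (in vec) lin_span_minimal: "subspace U V ==> S \<subseteq> U ==> lin_span V S \<subseteq> U"
  by (auto simp: lin_span_def)

lemma lin_span_superset: "S \<subseteq> lin_span V S"
  by (auto simp: lin_span_def)

text \<open>The kernel is a subspace, so once the relations lie in it their whole span does. This is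
  how bilinear maps descend to tensor products.\<close>

lemma vlin_lin_span_zero:
  assumes "vec V" "vec W" "vlin V W f" "S \<subseteq> carrier V" "\<And>x. x \<in> S ==> f x = \<zero>\<^bsub>W\<^esub>"
    and "x \<in> lin_span V S"
  shows "f x = \<zero>\<^bsub>W\<^esub>"
proof -
  interpret V: vec V by fact
  interpret W: vec W by fact
  have "subspace {x \<in> carrier V. f x = \<zero>\<^bsub>W\<^esub>} V"
    by (rule V.subspaceI) (auto simp: vlinD[OF assms(3)] vlin_zero[OF assms(1-3)])
  from V.lin_span_minimal[OF this, of S] assms(4-6) show ?thesis by auto
qed

section \<open>Tensor products\<close>

lemma lookup_scale [simp]:
  "plookup (Poly_Mapping.map ((*) c) f) k = (c :: 'k::field) * plookup f k"
  by (simp add: Poly_Mapping.map.rep_eq when_def)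

lemma keys_scale_subset: "pkeys (Poly_Mapping.map ((*) (c :: 'k::field)) f) \<subseteq> pkeys f"
  by (auto simp: in_keys_iff)

lemma free_space_simps [simp]:
  "carrier (free_space S) = {f. pkeys f \<subseteq> S}"
  "zero (free_space S) = 0" "add (free_space S) = (+)"
  "smult (free_space S) = (\<lambda>c. Poly_Mapping.map ((*) c))"
  by (simp_all add: free_space_def)

lemma vec_free_space: "vec (free_space S :: ('k::field, 's \<Rightarrow>\<^sub>0 'k) module)"
proof -
  interpret abelian_group "free_space S :: ('k::field, 's \<Rightarrow>\<^sub>0 'k) module"
  proof (rule abelian_groupI; simp only: free_space_simps)
    fix x y :: "'s \<Rightarrow>\<^sub>0 'k"
    assume x: "x \<in> {f. pkeys f \<subseteq> S}"
    show "\<exists>y\<in>{f. pkeys f \<subseteq> S}. y + x = 0"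
      using x by (intro bexI[of _ "- x"]) (auto simp: in_keys_iff)
    assume y: "y \<in> {f. pkeys f \<subseteq> S}"
    show "x + y \<in> {f. pkeys f \<subseteq> S}"
      using x y Poly_Mapping.keys_add[of x y] by auto
  qed (auto simp: add_ac)
  show ?thesis
  proof (unfold_locales; simp only: free_space_simps)
    fix x :: "'s \<Rightarrow>\<^sub>0 'k" and c
    assume "x \<in> {f. pkeys f \<subseteq> S}"
    then show "Poly_Mapping.map ((*) c) x \<in> {f. pkeys f \<subseteq> S}"
      using keys_scale_subset[of c x] by auto
  qed (auto intro!: poly_mapping_eqI simp: lookup_add algebra_simps)
qed

lemma finsum_free_space:
  assumes "finite I" "\<And>i. i \<in> I ==> pkeys (g i) \<subseteq> S"
  shows "finsum (free_space S :: ('k::field, 's \<Rightarrow>\<^sub>0 'k) module) g I = sum g I"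
  using assms
proof (induct I rule: finite_induct)
  case empty
  interpret vec "free_space S :: ('k::field, 's \<Rightarrow>\<^sub>0 'k) module" by (rule vec_free_space)
  show ?case by simp
next
  case (insert x F)
  interpret vec "free_space S :: ('k::field, 's \<Rightarrow>\<^sub>0 'k) module" by (rule vec_free_space)
  show ?case using insert by (subst finsum_insert) (auto simp: Pi_iff)
qed

lemma minus_free_space:
  assumes "pkeys (x :: 's \<Rightarrow>\<^sub>0 'k::field) \<subseteq> S" "pkeys y \<subseteq> S"
  shows "x \<ominus>\<^bsub>free_space S\<^esub> y = x - y"
proof -
  interpret vec "free_space S :: ('k::field, 's \<Rightarrow>\<^sub>0 'k) module" by (rule vec_free_space)
  have "\<ominus>\<^bsub>free_space S\<^esub> y = - y"
    by (rule minus_equality) (use assms in \<open>auto simp: in_keys_iff\<close>)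
  then show ?thesis by (simp add: minus_eq)
qed

lemma poly_mapping_sum_single:
  "f = (\<Sum>p\<in>pkeys f. psingle p (plookup f p))"
  by (rule poly_mapping_eqI) (auto simp: lookup_sum lookup_single when_def in_keys_iff)

definition lin_ext :: "('k::field, 'b, 'd) module_scheme => ('s => 'b) => ('s \<Rightarrow>\<^sub>0 'k) => 'b" where
  "lin_ext M B f = (\<Oplus>\<^bsub>M\<^esub>p\<in>pkeys f. plookup f p \<odot>\<^bsub>M\<^esub> B p)"

context vec begin

lemma minus_zero_iff: "x \<in> carrier V ==> y \<in> carrier V ==> x \<ominus> y = \<zero> \<longleftrightarrow> x = y"
  using minus_equality[of x "\<ominus> y"] by (auto simp: minus_eq r_neg)

lemma lin_ext_superset:
  assumes "finite T" "pkeys f \<subseteq> T" "\<And>p. p \<in> T ==> B p \<in> carrier V"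
  shows "lin_ext V B f = (\<Oplus>p\<in>T. plookup f p \<odot> B p)"
  unfolding lin_ext_def
  by (rule add.finprod_mono_neutral_cong_left) (use assms in \<open>auto simp: in_keys_iff\<close>)

lemma vlin_lin_ext:
  fixes B :: "'s => 'a"
  assumes B: "\<And>p. p \<in> S ==> B p \<in> carrier V"
  shows "vlin (free_space S) V (lin_ext V B)"
proof (rule vlinI)
  fix x y :: "'s \<Rightarrow>\<^sub>0 'k" and c
  assume x: "x \<in> carrier (free_space S)"
  let ?k = pkeys and ?l = plookup
  have xS: "?k x \<subseteq> S" using x by simp
  have c: "f ` I \<subseteq> carrier V ==> finsum V f I \<in> carrier V" for f :: "'s => 'a" and I
    by (rule finsum_closed) auto
  show "lin_ext V B x \<in> carrier V" unfolding lin_ext_def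
    by (rule finsum_closed) (use xS B in auto)
  have "lin_ext V B (Poly_Mapping.map ((*) c) x) = (\<Oplus>p\<in>?k x. (c * ?l x p) \<odot> B p)"
    by (subst lin_ext_superset[of "?k x"]) (use keys_scale_subset[of c x] xS B in auto)
  also have "\<dots> = (\<Oplus>p\<in>?k x. c \<odot> (?l x p \<odot> B p))"
    by (rule add.finprod_cong') (use xS B in \<open>auto simp: smult_assoc\<close>)
  also have "\<dots> = c \<odot> lin_ext V B x"
    unfolding lin_ext_def by (rule smult_finsum[symmetric]) (use xS B in auto)
  finally show "lin_ext V B (c \<odot>\<^bsub>free_space S\<^esub> x) = c \<odot> lin_ext V B x" by simp
  assume y: "y \<in> carrier (free_space S)"
  have yS: "?k y \<subseteq> S" using y by simp
  let ?T = "?k x \<union> ?k y"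
  have T: "finite ?T" "\<And>p. p \<in> ?T ==> B p \<in> carrier V" using xS yS B by auto
  have "lin_ext V B (x + y) = (\<Oplus>p\<in>?T. ?l (x + y) p \<odot> B p)"
    by (rule lin_ext_superset) (use T Poly_Mapping.keys_add[of x y] in auto)
  also have "\<dots> = (\<Oplus>p\<in>?T. (?l x p \<odot> B p) \<oplus> (?l y p \<odot> B p))"
    by (rule add.finprod_cong') (use T in \<open>auto simp: lookup_add smult_l_distr\<close>)
  also have "\<dots> = (\<Oplus>p\<in>?T. ?l x p \<odot> B p) \<oplus> (\<Oplus>p\<in>?T. ?l y p \<odot> B p)"
    by (rule finsum_addf) (use T in auto)
  also have "\<dots> = lin_ext V B x \<oplus> lin_ext V B y"
    using lin_ext_superset[of ?T x B] lin_ext_superset[of ?T y B] T by simp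
  finally show "lin_ext V B (x \<oplus>\<^bsub>free_space S\<^esub> y) = lin_ext V B x \<oplus> lin_ext V B y" by simp
qed

lemma lin_ext_single:
  assumes "B p \<in> carrier V" shows "lin_ext V B (psingle p c) = c \<odot> B p"
  by (subst lin_ext_superset[of "{p}"]) (use assms in auto)

lemma vlin_free_unique:
  assumes "vlin (free_space S) V \<phi>" "pkeys f \<subseteq> S"
  shows "\<phi> f = lin_ext V (\<lambda>p. \<phi> (psingle p 1)) f"
proof -
  let ?F = "free_space S :: ('k, _) module"
  interpret F: vec ?F by (rule vec_free_space)
  let ?s = "\<lambda>p. psingle p (plookup f p)"
  have "f = finsum ?F ?s (pkeys f)"
    by (subst finsum_free_space) (use assms(2) poly_mapping_sum_single in auto)
  then have "\<phi> f = \<phi> (finsum ?F ?s (pkeys f))" by simp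
  also have "\<dots> = (\<Oplus>p\<in>pkeys f. \<phi> (?s p))"
    by (rule vlin_finsum[OF vec_free_space vec assms(1)])
      (use assms(2) in \<open>auto split: if_splits\<close>)
  also have "\<dots> = lin_ext V (\<lambda>p. \<phi> (psingle p 1)) f"
    unfolding lin_ext_def
  proof (rule add.finprod_cong')
    show "(\<lambda>p. plookup f p \<odot> \<phi> (psingle p 1)) \<in> pkeys f \<rightarrow> carrier V"
      using assms(2) by (auto intro!: smult_closed vlinD(1)[OF assms(1)] split: if_splits)
    fix p assume "p \<in> pkeys f"
    then have "psingle p 1 \<in> carrier ?F" using assms(2) by auto
    from vlinD(3)[OF assms(1) this, of "plookup f p"]
    show "\<phi> (?s p) = plookup f p \<odot> \<phi> (psingle p 1)" by simp
  qed simp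
  finally show ?thesis .
qed

end

definition bilinear_map ::
    "('k::field, 'v, 'c) module_scheme => ('k, 'w, 'd) module_scheme => ('k, 'b, 'e) module_scheme =>
     ('v => 'w => 'b) => bool" where
  "bilinear_map V W M B \<longleftrightarrow> (\<forall>x\<in>carrier V. vlin W M (B x)) \<and> (\<forall>y\<in>carrier W. vlin V M (\<lambda>x. B x y))"

lemma bilinear_mapI:
  assumes "\<And>x. x \<in> carrier V ==> vlin W M (B x)" "\<And>y. y \<in> carrier W ==> vlin V M (\<lambda>x. B x y)"
  shows "bilinear_map V W M B"
  using assms by (auto simp: bilinear_map_def)

definition pure :: "('k::field, 'v) module => ('k, 'w) module => 'v => 'w => ('v \<times> 'w \<Rightarrow>\<^sub>0 'k) set" where
  "pure V W x y = tensor_class V W (psingle (x, y) 1)"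

text \<open>Evaluated on an arbitrary representative; for bilinear \<open>B\<close> the choice does
  not matter (\<open>tensor_lift_class\<close>).\<close>

definition tensor_lift :: "('k::field, 'b, 'd) module_scheme => ('v => 'w => 'b) => ('v \<times> 'w \<Rightarrow>\<^sub>0 'k) set => 'b" where
  "tensor_lift M B X = lin_ext M (\<lambda>(x, y). B x y) (SOME f. f \<in> X)"

locale tens = V: vec V + W: vec W
  for V :: "('k::field, 'v) module" and W :: "('k, 'w) module"
begin

abbreviation "F \<equiv> free_space (carrier V \<times> carrier W) :: ('k, 'v \<times> 'w \<Rightarrow>\<^sub>0 'k) module"
abbreviation "T \<equiv> tensor V W"

sublocale F: vec F by (rule vec_free_space)

lemma tensor_relsI:
  assumes "x \<in> carrier V" "y \<in> carrier W"
  shows "x' \<in> carrier V ==> psingle (x \<oplus>\<^bsub>V\<^esub> x', y) 1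
        - psingle (x, y) 1 - psingle (x', y) 1 \<in> tensor_rels V W"
    and "y' \<in> carrier W ==> psingle (x, y \<oplus>\<^bsub>W\<^esub> y') 1
        - psingle (x, y) 1 - psingle (x, y') 1 \<in> tensor_rels V W"
    and "psingle (c \<odot>\<^bsub>V\<^esub> x, y) 1 - psingle (x, y) c \<in> tensor_rels V W"
    and "psingle (x, c \<odot>\<^bsub>W\<^esub> y) 1 - psingle (x, y) c \<in> tensor_rels V W"
  unfolding tensor_rels_def
  subgoal by (rule UnI1, rule UnI1, rule UN_I[OF assms(1)], rule UN_I, assumption, rule UN_I[OF assms(2)], rule singletonI)
  subgoal by (rule UnI1, rule UnI2, rule UN_I[OF assms(1)], rule UN_I[OF assms(2)], rule UN_I, assumption, rule singletonI)
  subgoal by (rule UnI2, rule UN_I[OF UNIV_I], rule UN_I[OF assms(1)], rule UN_I[OF assms(2)], rule insertI1)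
  subgoal by (rule UnI2, rule UN_I[OF UNIV_I], rule UN_I[OF assms(1)], rule UN_I[OF assms(2)], rule insertI2, rule singletonI)
  done

lemma tensor_rels_subset: "tensor_rels V W \<subseteq> carrier F"
proof -
  have s: "psingle p c \<in> carrier F" if "p \<in> carrier V \<times> carrier W" for p c
    using that by auto
  have d: "x - y \<in> carrier F" if "x \<in> carrier F" "y \<in> carrier F" for x y
    using F.minus_closed[OF that] minus_free_space[of x _ y] that by auto
  show ?thesis unfolding tensor_rels_def
    by (auto simp del: free_space_simps intro!: d s)
qed

sublocale Q: vec_sub F "tensor_ker V W"
  using F.lin_span_subspace[OF tensor_rels_subset]
  by (intro vec_sub.intro vec_sub_axioms.intro) (simp_all add: tensor_ker_def vec_free_space)

lemma T_def: "T = F //\<^sub>k tensor_ker V W" by (simp add: tensor_def)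

sublocale T: vec T unfolding T_def by (rule Q.quot_vec)

lemma vlin_tensor_class: "vlin F T (tensor_class V W)"
  using Q.vlin_coset unfolding T_def tensor_class_def .

lemma carrier_T: "carrier T = tensor_class V W ` carrier F"
  unfolding T_def carrier_quot tensor_class_def ..

lemma tensor_class_eq: "f \<in> carrier F ==> g \<in> carrier F ==> f - g \<in> tensor_ker V W ==>
    tensor_class V W f = tensor_class V W g"
  by (simp add: tensor_class_def Q.coset_eq_iff minus_free_space)

lemma tensor_rel_ker: "r \<in> tensor_rels V W ==> r \<in> tensor_ker V W"
  using lin_span_superset[of "tensor_rels V W" F] by (auto simp: tensor_ker_def)

lemma pure_closed [simp, intro]: "x \<in> carrier V ==> y \<in> carrier W ==> pure V W x y \<in> carrier T"
  by (auto simp: pure_def carrier_T)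

lemma smult_pure:
  assumes "x \<in> carrier V" "y \<in> carrier W"
  shows "c \<odot>\<^bsub>T\<^esub> pure V W x y = tensor_class V W (psingle (x, y) c)"
  using vlinD(3)[OF vlin_tensor_class, of "psingle (x, y) 1" c] assms
  by (simp add: pure_def)

lemma pure_add:
  assumes "x \<in> carrier V" "x' \<in> carrier V" "y \<in> carrier W" "y' \<in> carrier W"
  shows "pure V W (x \<oplus>\<^bsub>V\<^esub> x') y = pure V W x y \<oplus>\<^bsub>T\<^esub> pure V W x' y"
    "pure V W x (y \<oplus>\<^bsub>W\<^esub> y') = pure V W x y \<oplus>\<^bsub>T\<^esub> pure V W x y'"
proof -
  let ?s = "\<lambda>x y. psingle (x, y) (1 :: 'k)"
  have c: "?s x y \<in> carrier F" if "x \<in> carrier V" "y \<in> carrier W" for x y using that by auto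
  have a: "f + g \<in> carrier F" if "f \<in> carrier F" "g \<in> carrier F" for f g
    using F.a_closed[OF that] by simp
  have p: "pure V W x y \<oplus>\<^bsub>T\<^esub> pure V W x' y' = tensor_class V W (?s x y + ?s x' y')"
    if "x \<in> carrier V" "y \<in> carrier W" "x' \<in> carrier V" "y' \<in> carrier W" for x x' y y'
    using vlinD(2)[OF vlin_tensor_class c c, of x y x' y'] that by (simp add: pure_def)
  have "?s (x \<oplus>\<^bsub>V\<^esub> x') y - ?s x y - ?s x' y \<in> tensor_rels V W"
    by (rule tensor_relsI(1)[OF assms(1,3,2)])
  then have rel: "?s (x \<oplus>\<^bsub>V\<^esub> x') y - (?s x y + ?s x' y) \<in> tensor_ker V W"
    unfolding diff_diff_eq by (rule tensor_rel_ker)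
  show "pure V W (x \<oplus>\<^bsub>V\<^esub> x') y = pure V W x y \<oplus>\<^bsub>T\<^esub> pure V W x' y"
    unfolding p[OF assms(1,3,2,3)] unfolding pure_def
    by (rule tensor_class_eq[OF c a[OF c c] rel]) (rule V.a_closed assms)+
  have "?s x (y \<oplus>\<^bsub>W\<^esub> y') - ?s x y - ?s x y' \<in> tensor_rels V W"
    by (rule tensor_relsI(2)[OF assms(1,3,4)])
  then have rel: "?s x (y \<oplus>\<^bsub>W\<^esub> y') - (?s x y + ?s x y') \<in> tensor_ker V W"
    unfolding diff_diff_eq by (rule tensor_rel_ker)
  show "pure V W x (y \<oplus>\<^bsub>W\<^esub> y') = pure V W x y \<oplus>\<^bsub>T\<^esub> pure V W x y'"
    unfolding p[OF assms(1,3,1,4)] unfolding pure_def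
    by (rule tensor_class_eq[OF c a[OF c c] rel]) (rule W.a_closed assms)+
qed

lemma pure_smult:
  assumes "x \<in> carrier V" "y \<in> carrier W"
  shows "pure V W (c \<odot>\<^bsub>V\<^esub> x) y = c \<odot>\<^bsub>T\<^esub> pure V W x y"
    "pure V W x (c \<odot>\<^bsub>W\<^esub> y) = c \<odot>\<^bsub>T\<^esub> pure V W x y"
proof -
  have "psingle (c \<odot>\<^bsub>V\<^esub> x, y) 1 - psingle (x, y) c \<in> tensor_rels V W"
    "psingle (x, c \<odot>\<^bsub>W\<^esub> y) 1 - psingle (x, y) c \<in> tensor_rels V W"
    by (rule tensor_relsI[OF assms])+
  note rel = this
  show "pure V W (c \<odot>\<^bsub>V\<^esub> x) y = c \<odot>\<^bsub>T\<^esub> pure V W x y"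
    "pure V W x (c \<odot>\<^bsub>W\<^esub> y) = c \<odot>\<^bsub>T\<^esub> pure V W x y"
    unfolding smult_pure[OF assms] unfolding pure_def
    by (rule tensor_class_eq; use assms rel in \<open>simp add: tensor_rel_ker\<close>)+
qed

lemma tensor_class_expand:
  assumes "f \<in> carrier F" shows "tensor_class V W f = lin_ext T (\<lambda>(x, y). pure V W x y) f"
proof -
  have "tensor_class V W f = lin_ext T (\<lambda>p. tensor_class V W (psingle p 1)) f"
    by (rule T.vlin_free_unique[OF vlin_tensor_class]) (use assms in auto)
  also have "(\<lambda>p. tensor_class V W (psingle p 1)) = (\<lambda>(x, y). pure V W x y)"
    by (auto simp: pure_def)
  finally show ?thesis .
qed

text \<open>Zero and all scalar multiples of a pure tensor are again pure, so sums are the only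
  other case.\<close>

lemma tensor_induct [consumes 1, case_names pure add]:
  assumes "X \<in> carrier T"
    and pure: "\<And>x y. x \<in> carrier V ==> y \<in> carrier W ==> P (pure V W x y)"
    and add: "\<And>X Y. X \<in> carrier T ==> Y \<in> carrier T ==> P X ==> P Y ==> P (X \<oplus>\<^bsub>T\<^esub> Y)"
  shows "P X"
proof -
  obtain f where f: "f \<in> carrier F" "X = tensor_class V W f" using assms(1) by (auto simp: carrier_T)
  have z: "P \<zero>\<^bsub>T\<^esub>"
    using pure[OF V.zero_closed W.zero_closed] pure_smult(1)[OF V.zero_closed W.zero_closed, of 0] by simp
  have *: "P (\<Oplus>\<^bsub>T\<^esub>p\<in>K. g p \<odot>\<^bsub>T\<^esub> (case p of (x, y) => pure V W x y))"
    if "finite K" "K \<subseteq> carrier V \<times> carrier W" for K g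
    using that
  proof (induct K)
    case (insert p K)
    obtain x y where p: "p = (x, y)" by (cases p)
    have xy: "x \<in> carrier V" "y \<in> carrier W" using insert p by auto
    have "P (g p \<odot>\<^bsub>T\<^esub> pure V W x y)"
      using pure[of "g p \<odot>\<^bsub>V\<^esub> x" y] xy by (simp add: pure_smult)
    moreover have "(\<lambda>p. g p \<odot>\<^bsub>T\<^esub> (case p of (x, y) => pure V W x y)) \<in> K \<rightarrow> carrier T"
      using insert.prems by auto
    ultimately show ?case using insert xy p by (subst T.finsum_insert) (auto intro!: add T.finsum_closed)
  qed (simp add: z)
  show ?thesis using *[of "pkeys f" "plookup f"] f
    by (simp add: tensor_class_expand lin_ext_def)
qed

text \<open>\<open>lin_ext\<close> sends each bilinearity relation to zero, hence all of
  \<open>tensor_ker\<close>, and two representatives of a class differ by an element of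
  \<open>tensor_ker\<close>.\<close>

lemma tensor_lift_class:
  assumes "vec M" "bilinear_map V W M B" "f \<in> carrier F"
  shows "tensor_lift M B (tensor_class V W f) = lin_ext M (\<lambda>(x, y). B x y) f"
proof -
  interpret M: vec M by fact
  let ?B = "\<lambda>(x, y). B x y"
  have v: "vlin F M (lin_ext M ?B)"
    by (rule M.vlin_lin_ext) (use assms(2) in \<open>auto simp: bilinear_map_def vlinD(1)\<close>)
  have s: "lin_ext M ?B (psingle (x, y) c) = c \<odot>\<^bsub>M\<^esub> B x y"
    if "x \<in> carrier V" "y \<in> carrier W" for x y c
    by (subst M.lin_ext_single) (use assms(2) that in \<open>auto simp: bilinear_map_def vlinD(1)\<close>)
  have cl: "B x y \<in> carrier M" if "x \<in> carrier V" "y \<in> carrier W" for x y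
    using assms(2) that by (auto simp: bilinear_map_def vlinD(1))
  have diff: "lin_ext M ?B (x - y) = lin_ext M ?B x \<ominus>\<^bsub>M\<^esub> lin_ext M ?B y"
    if "x \<in> carrier F" "y \<in> carrier F" for x y
    using vlin_diff[OF F.vec assms(1) v that] minus_free_space[of x _ y] that by simp
  have sc: "psingle p c \<in> carrier F" if "p \<in> carrier V \<times> carrier W" for p c
    using that by auto
  have dc: "x - y \<in> carrier F" if "x \<in> carrier F" "y \<in> carrier F" for x y
    using F.minus_closed[OF that] minus_free_space[of x _ y] that by auto
  have bl: "\<And>x x' y. x \<in> carrier V ==> x' \<in> carrier V ==> y \<in> carrier W ==> B (x \<oplus>\<^bsub>V\<^esub> x') y = B x y \<oplus>\<^bsub>M\<^esub> B x' y"
    "\<And>x y y'. x \<in> carrier V ==> y \<in> carrier W ==> y' \<in> carrier W ==> B x (y \<oplus>\<^bsub>W\<^esub> y') = B x y \<oplus>\<^bsub>M\<^esub> B x y'"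
    "\<And>c x y. x \<in> carrier V ==> y \<in> carrier W ==> B (c \<odot>\<^bsub>V\<^esub> x) y = c \<odot>\<^bsub>M\<^esub> B x y"
    "\<And>c x y. x \<in> carrier V ==> y \<in> carrier W ==> B x (c \<odot>\<^bsub>W\<^esub> y) = c \<odot>\<^bsub>M\<^esub> B x y"
    using assms(2) by (auto simp: bilinear_map_def vlin_def)
  have three: "(u \<oplus>\<^bsub>M\<^esub> w) \<ominus>\<^bsub>M\<^esub> u \<ominus>\<^bsub>M\<^esub> w = \<zero>\<^bsub>M\<^esub>" if "u \<in> carrier M" "w \<in> carrier M" for u w
  proof -
    have "(u \<oplus>\<^bsub>M\<^esub> w) \<ominus>\<^bsub>M\<^esub> u = w \<oplus>\<^bsub>M\<^esub> (u \<oplus>\<^bsub>M\<^esub> \<ominus>\<^bsub>M\<^esub> u)" using that by (simp add: M.minus_eq M.a_ac)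
    also have "\<dots> = w" using that by (simp add: M.r_neg)
    finally have "(u \<oplus>\<^bsub>M\<^esub> w) \<ominus>\<^bsub>M\<^esub> u = w" .
    then show ?thesis using that by (simp add: M.minus_eq M.r_neg)
  qed
  have two: "u \<ominus>\<^bsub>M\<^esub> u = \<zero>\<^bsub>M\<^esub>" if "u \<in> carrier M" for u
    using that by (simp add: M.minus_eq M.r_neg)
  have r: "lin_ext M ?B r = \<zero>\<^bsub>M\<^esub>" if "r \<in> tensor_rels V W" for r
  proof -
    note d3 = diff[OF dc[OF sc sc] sc] diff[OF sc sc]
    show ?thesis
      using that unfolding tensor_rels_def
      apply (elim UnE UN_E insertE emptyE)
      subgoal by (simp only: d3 s SigmaI V.a_closed bl cl M.smult_one M.a_closed three)
      subgoal by (simp only: d3 s SigmaI W.a_closed bl cl M.smult_one M.a_closed three)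
      subgoal by (simp only: d3 s SigmaI V.smult_closed bl cl M.smult_one M.smult_closed two)
      subgoal by (simp only: d3 s SigmaI W.smult_closed bl cl M.smult_one M.smult_closed two)
      done
  qed
  have "(SOME g. g \<in> tensor_class V W f) \<in> tensor_class V W f" (is "?g \<in> _")
    by (rule someI[of _ f]) (use assms(3) Q.U.a_rcos_self in \<open>auto simp: tensor_class_def\<close>)
  then have g: "?g \<in> carrier F" "?g - f \<in> tensor_ker V W"
    using Q.mem_coset_iff[of f ?g] assms(3) by (auto simp: tensor_class_def Q.coset_eq_iff minus_free_space)
  have "lin_ext M ?B (?g - f) = \<zero>\<^bsub>M\<^esub>"
    using vlin_lin_span_zero[OF F.vec assms(1) v tensor_rels_subset r] g(2) by (auto simp: tensor_ker_def)
  then have "lin_ext M ?B ?g = lin_ext M ?B f"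
    using diff[OF g(1) assms(3)] vlinD(1)[OF v] g(1) assms(3) by (simp add: M.minus_zero_iff)
  then show ?thesis by (simp add: tensor_lift_def)
qed

lemma tensor_lift_pure:
  assumes "vec M" "bilinear_map V W M B" "x \<in> carrier V" "y \<in> carrier W"
  shows "tensor_lift M B (pure V W x y) = B x y"
proof -
  interpret M: vec M by fact
  have "B x y \<in> carrier M" using assms(2-4) by (auto simp: bilinear_map_def vlinD(1))
  then show ?thesis using assms unfolding pure_def
    by (subst tensor_lift_class[OF assms(1,2)]) (auto simp: M.lin_ext_single)
qed

lemma vlin_tensor_lift:
  assumes "vec M" "bilinear_map V W M B"
  shows "vlin T M (tensor_lift M B)"
proof -
  interpret M: vec M by fact
  let ?B = "\<lambda>(x, y). B x y"
  have v: "vlin F M (lin_ext M ?B)"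
    by (rule M.vlin_lin_ext) (use assms(2) in \<open>auto simp: bilinear_map_def vlinD(1)\<close>)
  show ?thesis
  proof (rule vlinI)
    fix X Y c assume "X \<in> carrier T"
    then obtain x where x: "x \<in> carrier F" "X = tensor_class V W x" by (auto simp: carrier_T)
    show "tensor_lift M B X \<in> carrier M"
      using x vlinD(1)[OF v] tensor_lift_class[OF assms] by simp
    note L = tensor_lift_class[OF assms]
    have e: "c \<odot>\<^bsub>T\<^esub> tensor_class V W x = tensor_class V W (c \<odot>\<^bsub>F\<^esub> x)"
      using vlinD(3)[OF vlin_tensor_class x(1), of c] by simp
    show "tensor_lift M B (c \<odot>\<^bsub>T\<^esub> X) = c \<odot>\<^bsub>M\<^esub> tensor_lift M B X"
      unfolding x(2) e L[OF F.smult_closed[OF x(1)]] L[OF x(1)] by (rule vlinD(3)[OF v x(1)])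
    assume "Y \<in> carrier T"
    then obtain y where y: "y \<in> carrier F" "Y = tensor_class V W y" by (auto simp: carrier_T)
    have e: "tensor_class V W x \<oplus>\<^bsub>T\<^esub> tensor_class V W y = tensor_class V W (x \<oplus>\<^bsub>F\<^esub> y)"
      using vlinD(2)[OF vlin_tensor_class x(1) y(1)] by simp
    show "tensor_lift M B (X \<oplus>\<^bsub>T\<^esub> Y) = tensor_lift M B X \<oplus>\<^bsub>M\<^esub> tensor_lift M B Y"
      unfolding x(2) y(2) e L[OF F.a_closed[OF x(1) y(1)]] L[OF x(1)] L[OF y(1)]
      by (rule vlinD(2)[OF v x(1) y(1)])
  qed
qed

end

section \<open>Algebras and bimodules\<close>

locale kalg = ring A + vec A for A :: "('k::field, 'a, 'c) module_scheme" (structure) +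
  assumes smult_mult_left: "x \<in> carrier A ==> y \<in> carrier A ==> (c \<odot> x) \<otimes> y = c \<odot> (x \<otimes> y)"
    and smult_mult_right: "x \<in> carrier A ==> y \<in> carrier A ==> x \<otimes> (c \<odot> y) = c \<odot> (x \<otimes> y)"
begin

lemma kalg: "kalg A" by (rule kalg_axioms)

text \<open>Since \<open>c x = (c 1) x\<close>, closure under left multiplication already gives
  closure under scalars.\<close>

lemma ideal_vec_sub:
  assumes "ideal I A" shows "vec_sub A I"
proof -
  interpret I: ideal I A by fact
  have "c \<odot> x \<in> I" if "x \<in> I" for c x
    using I.I_l_closed[OF that, of "c \<odot> \<one>"] I.Icarr[OF that] by (simp add: smult_mult_left)
  then show ?thesis
    by (intro vec_sub.intro vec_sub_axioms.intro subspaceI vec I.a_subset) auto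
qed

end

text \<open>For \<open>A //\<^sub>k I\<close> and the factor ring, which are different records with
  the same ring operations.\<close>

lemma ring_same_ops:
  assumes "ring R" "carrier S = carrier R" "mult S = mult R" "one S = one R" "zero S = zero R" "add S = add R"
  shows "ring S"
proof -
  interpret R: ring R by fact
  show ?thesis
  proof (rule ringI)
    show "abelian_group S"
      by (rule abelian_groupI) (use R.add.l_inv_ex in \<open>auto simp: assms R.a_ac\<close>)
    show "Group.monoid S" by (rule monoidI) (auto simp: assms R.m_assoc)
  qed (auto simp: assms R.l_distr R.r_distr)
qed

lemma kalg_quot:
  assumes "kalg A" "ideal I A" shows "kalg (A //\<^sub>k I)"
proof -
  interpret kalg A by fact
  interpret I: ideal I A by fact
  interpret Q: vec_sub A I by (rule ideal_vec_sub) fact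
  interpret QR: ring "A //\<^sub>k I"
    by (rule ring_same_ops[OF I.quotient_is_ring]) (simp_all add: quot_def)
  interpret QV: vec "A //\<^sub>k I" by (rule Q.quot_vec)
  have m: "(I +>\<^bsub>A\<^esub> x) \<otimes>\<^bsub>A //\<^sub>k I\<^esub> (I +>\<^bsub>A\<^esub> y) = I +>\<^bsub>A\<^esub> (x \<otimes>\<^bsub>A\<^esub> y)"
    if "x \<in> carrier A" "y \<in> carrier A" for x y
    using I.rcoset_mult_add[OF that] by (simp add: quot_simps)
  show ?thesis
  proof
    fix X Y c assume XY: "X \<in> carrier (A //\<^sub>k I)" "Y \<in> carrier (A //\<^sub>k I)"
    obtain x where x: "x \<in> carrier A" "X = I +>\<^bsub>A\<^esub> x" using XY(1) unfolding carrier_quot by (elim imageE)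
    obtain y where y: "y \<in> carrier A" "Y = I +>\<^bsub>A\<^esub> y" using XY(2) unfolding carrier_quot by (elim imageE)
    show "c \<odot>\<^bsub>A //\<^sub>k I\<^esub> X \<otimes>\<^bsub>A //\<^sub>k I\<^esub> Y = c \<odot>\<^bsub>A //\<^sub>k I\<^esub> (X \<otimes>\<^bsub>A //\<^sub>k I\<^esub> Y)"
      "X \<otimes>\<^bsub>A //\<^sub>k I\<^esub> (c \<odot>\<^bsub>A //\<^sub>k I\<^esub> Y) = c \<odot>\<^bsub>A //\<^sub>k I\<^esub> (X \<otimes>\<^bsub>A //\<^sub>k I\<^esub> Y)"
      using x y by (simp_all add: m Q.quot_smult smult_mult_left smult_mult_right)
  qed
qed

locale bim = A: kalg A + M: vec M
  for A :: "('k::field, 'a) module" and M :: "('k, 'a, 'x) bimod" +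
  assumes lact_closed [simp, intro]: "a \<in> carrier A ==> x \<in> carrier M ==> lact M a x \<in> carrier M"
    and ract_closed [simp, intro]: "a \<in> carrier A ==> x \<in> carrier M ==> ract M x a \<in> carrier M"
    and lact_add: "a \<in> carrier A ==> x \<in> carrier M ==> y \<in> carrier M ==>
           lact M a (x \<oplus>\<^bsub>M\<^esub> y) = lact M a x \<oplus>\<^bsub>M\<^esub> lact M a y"
    and ract_add: "a \<in> carrier A ==> x \<in> carrier M ==> y \<in> carrier M ==>
           ract M (x \<oplus>\<^bsub>M\<^esub> y) a = ract M x a \<oplus>\<^bsub>M\<^esub> ract M y a"
    and lact_add_scalar: "a \<in> carrier A ==> b \<in> carrier A ==> x \<in> carrier M ==>
           lact M (a \<oplus>\<^bsub>A\<^esub> b) x = lact M a x \<oplus>\<^bsub>M\<^esub> lact M b x"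
    and ract_add_scalar: "a \<in> carrier A ==> b \<in> carrier A ==> x \<in> carrier M ==>
           ract M x (a \<oplus>\<^bsub>A\<^esub> b) = ract M x a \<oplus>\<^bsub>M\<^esub> ract M x b"
    and lact_mult: "a \<in> carrier A ==> b \<in> carrier A ==> x \<in> carrier M ==>
           lact M (a \<otimes>\<^bsub>A\<^esub> b) x = lact M a (lact M b x)"
    and ract_mult: "a \<in> carrier A ==> b \<in> carrier A ==> x \<in> carrier M ==>
           ract M x (a \<otimes>\<^bsub>A\<^esub> b) = ract M (ract M x a) b"
    and ract_lact: "a \<in> carrier A ==> b \<in> carrier A ==> x \<in> carrier M ==>
           ract M (lact M a x) b = lact M a (ract M x b)"
    and lact_scalar: "\<And>c x. x \<in> carrier M ==> lact M (c \<odot>\<^bsub>A\<^esub> \<one>\<^bsub>A\<^esub>) x = c \<odot>\<^bsub>M\<^esub> x"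
    and ract_scalar: "\<And>c x. x \<in> carrier M ==> ract M x (c \<odot>\<^bsub>A\<^esub> \<one>\<^bsub>A\<^esub>) = c \<odot>\<^bsub>M\<^esub> x"

lemma bimodule_iff_bim:
  assumes "kalg A" shows "bimodule A M \<longleftrightarrow> bim A M"
  unfolding bimodule_def bim_def bim_axioms_def module_iff_vec
  by (simp only: assms conj_assoc simp_thms)

context bim begin

lemma bim: "bim A M" by (rule bim_axioms)

lemma lact_one [simp]: "x \<in> carrier M ==> lact M \<one>\<^bsub>A\<^esub> x = x"
  using lact_scalar[of x 1] by simp

lemma ract_one [simp]: "x \<in> carrier M ==> ract M x \<one>\<^bsub>A\<^esub> = x"
  using ract_scalar[of x 1] by simp

text \<open>Compatibility of the actions with scalars is not among the axioms; it follows because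
  \<open>c\<close> acts on both sides as the algebra element \<open>c 1\<close>.\<close>

lemma lact_smult_scalar:
  "a \<in> carrier A ==> x \<in> carrier M ==> lact M (c \<odot>\<^bsub>A\<^esub> a) x = c \<odot>\<^bsub>M\<^esub> lact M a x"
  using lact_mult[of "c \<odot>\<^bsub>A\<^esub> \<one>\<^bsub>A\<^esub>" a x] lact_scalar[of "lact M a x" c]
  by (simp add: A.smult_mult_left)

lemma lact_smult:
  "a \<in> carrier A ==> x \<in> carrier M ==> lact M a (c \<odot>\<^bsub>M\<^esub> x) = c \<odot>\<^bsub>M\<^esub> lact M a x"
  using lact_mult[of a "c \<odot>\<^bsub>A\<^esub> \<one>\<^bsub>A\<^esub>" x] lact_scalar[of x c]
  by (simp add: A.smult_mult_right lact_smult_scalar)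

lemma ract_smult_scalar:
  "a \<in> carrier A ==> x \<in> carrier M ==> ract M x (c \<odot>\<^bsub>A\<^esub> a) = c \<odot>\<^bsub>M\<^esub> ract M x a"
  using ract_mult[of a "c \<odot>\<^bsub>A\<^esub> \<one>\<^bsub>A\<^esub>" x] ract_scalar[of "ract M x a" c]
  by (simp add: A.smult_mult_right)

lemma ract_smult:
  "a \<in> carrier A ==> x \<in> carrier M ==> ract M (c \<odot>\<^bsub>M\<^esub> x) a = c \<odot>\<^bsub>M\<^esub> ract M x a"
  using ract_mult[of "c \<odot>\<^bsub>A\<^esub> \<one>\<^bsub>A\<^esub>" a x] ract_scalar[of x c]
  by (simp add: A.smult_mult_left ract_smult_scalar)

lemma vlin_lact: "a \<in> carrier A ==> vlin M M (lact M a)"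
  by (rule vlinI) (auto simp: lact_add lact_smult)

lemma vlin_ract: "a \<in> carrier A ==> vlin M M (\<lambda>x. ract M x a)"
  by (rule vlinI) (auto simp: ract_add ract_smult)

lemma vlin_lact_scalar: "x \<in> carrier M ==> vlin A M (\<lambda>a. lact M a x)"
  by (rule vlinI) (auto simp: lact_add_scalar lact_smult_scalar)

lemma vlin_ract_scalar: "x \<in> carrier M ==> vlin A M (\<lambda>a. ract M x a)"
  by (rule vlinI) (auto simp: ract_add_scalar ract_smult_scalar)

lemma lact_zero [simp]: "a \<in> carrier A ==> lact M a \<zero>\<^bsub>M\<^esub> = \<zero>\<^bsub>M\<^esub>"
  by (rule vlin_zero[OF M.vec M.vec vlin_lact])

lemma ract_zero [simp]: "a \<in> carrier A ==> ract M \<zero>\<^bsub>M\<^esub> a = \<zero>\<^bsub>M\<^esub>"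
  by (rule vlin_zero[OF M.vec M.vec vlin_ract])

lemma lact_zero_scalar [simp]: "x \<in> carrier M ==> lact M \<zero>\<^bsub>A\<^esub> x = \<zero>\<^bsub>M\<^esub>"
  by (rule vlin_zero[OF A.vec M.vec vlin_lact_scalar])

lemma ract_zero_scalar [simp]: "x \<in> carrier M ==> ract M x \<zero>\<^bsub>A\<^esub> = \<zero>\<^bsub>M\<^esub>"
  by (rule vlin_zero[OF A.vec M.vec vlin_ract_scalar])

end

lemma bim_regular:
  assumes "kalg A" shows "bim A (regular_bimod A)"
proof -
  interpret kalg A by fact
  have v: "vec (regular_bimod A)"
    by (rule vec_image[OF vec, where p = "\<lambda>x. x"]) (auto simp: regular_bimod_def)
  show ?thesis
    by (intro bim.intro bim_axioms.intro kalg v)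
      (auto simp: regular_bimod_def l_distr r_distr m_assoc smult_mult_left smult_mult_right)
qed

lemma regular_bimod_simps [simp]:
  "carrier (regular_bimod A) = carrier A" "zero (regular_bimod A) = zero A"
  "add (regular_bimod A) = add A" "smult (regular_bimod A) = smult A"
  "lact (regular_bimod A) = mult A" "ract (regular_bimod A) = mult A"
  by (simp_all add: regular_bimod_def)

lemma bimod_homI:
  assumes "f \<in> extensional (carrier M)" "vlin M N f"
    "\<And>a x. a \<in> carrier A ==> x \<in> carrier M ==> f (lact M a x) = lact N a (f x)"
    "\<And>a x. a \<in> carrier A ==> x \<in> carrier M ==> f (ract M x a) = ract N (f x) a"
  shows "f \<in> bimod_hom A M N"
  using assms by (auto simp: bimod_hom_def vlin_def PiE_def)

lemma bimod_homD:
  assumes "f \<in> bimod_hom A M N"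
  shows "f \<in> extensional (carrier M)" "vlin M N f"
    "\<And>a x. a \<in> carrier A ==> x \<in> carrier M ==> f (lact M a x) = lact N a (f x)"
    "\<And>a x. a \<in> carrier A ==> x \<in> carrier M ==> f (ract M x a) = ract N (f x) a"
  using assms by (auto simp: bimod_hom_def vlin_def PiE_def)

lemma bimod_hom_closed: "f \<in> bimod_hom A M N ==> x \<in> carrier M ==> f x \<in> carrier N"
  by (auto simp: bimod_hom_def)

lemma bimod_hom_eqI:
  fixes A :: "('k::field, 'a) module"
  assumes "f \<in> bimod_hom A M N" "g \<in> bimod_hom A M N" "\<And>x. x \<in> carrier M ==> f x = g x"
  shows "f = g"
  using extensionalityI[OF bimod_homD(1)[OF assms(1)] bimod_homD(1)[OF assms(2)]] assms(3) by blast

lemma vlin_restrict_iff: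
  "vlin M N (\<lambda>x\<in>carrier M. f x) \<longleftrightarrow> vlin M N f" if "vec M"
proof -
  interpret vec M by fact
  show ?thesis by (auto simp: vlin_def Pi_iff)
qed

lemma bimod_hom_restrictI:
  assumes "bim A M" "vlin M N f"
    "\<And>a x. a \<in> carrier A ==> x \<in> carrier M ==> f (lact M a x) = lact N a (f x)"
    "\<And>a x. a \<in> carrier A ==> x \<in> carrier M ==> f (ract M x a) = ract N (f x) a"
  shows "(\<lambda>x\<in>carrier M. f x) \<in> bimod_hom A M N"
proof -
  interpret bim A M by fact
  show ?thesis
    by (rule bimod_homI) (use assms in \<open>auto simp: vlin_restrict_iff[OF M.vec]\<close>)
qed

lemma bimod_hom_comp:
  assumes "bim A M" "f \<in> bimod_hom A M N" "g \<in> bimod_hom A N P"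
  shows "compose (carrier M) g f \<in> bimod_hom A M P"
  unfolding compose_def
  by (rule bimod_hom_restrictI[OF assms(1) vlin_comp[OF bimod_homD(2)[OF assms(2)] bimod_homD(2)[OF assms(3)]]])
    (simp_all add: bimod_homD(3,4)[OF assms(2)] bimod_homD(3,4)[OF assms(3)] bimod_hom_closed[OF assms(2)])

lemma bimod_hom_id: "bim A M ==> (\<lambda>x\<in>carrier M. x) \<in> bimod_hom A M M"
  by (rule bimod_hom_restrictI) (auto simp: vlin_def)

lemma hom_space_simps [simp]:
  "carrier (hom_space A M N) = bimod_hom A M N"
  "zero (hom_space A M N) = (\<lambda>x\<in>carrier M. \<zero>\<^bsub>N\<^esub>)"
  "add (hom_space A M N) = (\<lambda>f g. \<lambda>x\<in>carrier M. f x \<oplus>\<^bsub>N\<^esub> g x)"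
  "smult (hom_space A M N) = (\<lambda>c f. \<lambda>x\<in>carrier M. c \<odot>\<^bsub>N\<^esub> f x)"
  by (simp_all add: hom_space_def)

lemma bimod_hom_zero:
  assumes "bim A M" "bim A N" shows "(\<lambda>x\<in>carrier M. \<zero>\<^bsub>N\<^esub>) \<in> bimod_hom A M N"
proof -
  interpret N: bim A N by fact
  show ?thesis by (rule bimod_hom_restrictI[OF assms(1)]) (auto intro!: vlinI)
qed

lemma bimod_hom_add:
  assumes "bim A M" "bim A N" "f \<in> bimod_hom A M N" "g \<in> bimod_hom A M N"
  shows "(\<lambda>x\<in>carrier M. f x \<oplus>\<^bsub>N\<^esub> g x) \<in> bimod_hom A M N"
proof -
  interpret N: bim A N by fact
  note c = bimod_hom_closed[OF assms(3)] bimod_hom_closed[OF assms(4)]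
  show ?thesis
    by (rule bimod_hom_restrictI[OF assms(1)])
      (auto intro!: vlinI simp: c vlinD[OF bimod_homD(2)[OF assms(3)]] vlinD[OF bimod_homD(2)[OF assms(4)]]
        bimod_homD(3,4)[OF assms(3)] bimod_homD(3,4)[OF assms(4)] N.M.a_ac N.M.smult_r_distr N.lact_add N.ract_add)
qed

lemma bimod_hom_smult:
  assumes "bim A M" "bim A N" "f \<in> bimod_hom A M N"
  shows "(\<lambda>x\<in>carrier M. c \<odot>\<^bsub>N\<^esub> f x) \<in> bimod_hom A M N"
proof -
  interpret N: bim A N by fact
  note cl = bimod_hom_closed[OF assms(3)]
  have sw: "c \<odot>\<^bsub>N\<^esub> (d \<odot>\<^bsub>N\<^esub> y) = d \<odot>\<^bsub>N\<^esub> (c \<odot>\<^bsub>N\<^esub> y)" if "y \<in> carrier N" for d y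
    using N.M.smult_assoc[OF that, of c d] N.M.smult_assoc[OF that, of d c] by (simp add: mult.commute)
  show ?thesis
    by (rule bimod_hom_restrictI[OF assms(1)])
      (auto intro!: vlinI sw simp: cl vlinD[OF bimod_homD(2)[OF assms(3)]] N.M.smult_r_distr
        bimod_homD(3,4)[OF assms(3)] N.lact_smult N.ract_smult)
qed

lemma vec_hom_space:
  assumes "bim A M" "bim A N" shows "vec (hom_space A M N)"
proof -
  interpret M: bim A M by fact
  interpret N: bim A N by fact
  have c: "f \<in> bimod_hom A M N ==> x \<in> carrier M ==> f x \<in> carrier N" for f x
    by (rule bimod_hom_closed)
  have e: "f \<in> bimod_hom A M N ==> f \<in> extensional (carrier M)" for f
    by (rule bimod_homD)
  have n: "(\<lambda>x\<in>carrier M. (- 1) \<odot>\<^bsub>N\<^esub> f x) \<in> bimod_hom A M N" if "f \<in> bimod_hom A M N" for f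
    by (rule bimod_hom_smult[OF assms that])
  interpret abelian_group "hom_space A M N"
  proof (rule abelian_groupI; simp only: hom_space_simps)
    fix f g h assume f: "f \<in> bimod_hom A M N"
    show "(\<lambda>x\<in>carrier M. (\<lambda>x\<in>carrier M. \<zero>\<^bsub>N\<^esub>) x \<oplus>\<^bsub>N\<^esub> f x) = f"
      by (rule extensionalityI[of _ "carrier M"]) (auto simp: c f e)
    show "\<exists>g\<in>bimod_hom A M N. (\<lambda>x\<in>carrier M. g x \<oplus>\<^bsub>N\<^esub> f x) = (\<lambda>x\<in>carrier M. \<zero>\<^bsub>N\<^esub>)"
      by (rule bexI[OF _ n[OF f]], rule extensionalityI[of _ "carrier M"])
        (auto simp: c f N.M.smult_minus_one N.M.l_neg)
    assume g: "g \<in> bimod_hom A M N"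
    show "(\<lambda>x\<in>carrier M. f x \<oplus>\<^bsub>N\<^esub> g x) = (\<lambda>x\<in>carrier M. g x \<oplus>\<^bsub>N\<^esub> f x)"
      by (rule extensionalityI[of _ "carrier M"]) (auto simp: c f g N.M.a_comm)
    assume h: "h \<in> bimod_hom A M N"
    show "(\<lambda>x\<in>carrier M. (\<lambda>x\<in>carrier M. f x \<oplus>\<^bsub>N\<^esub> g x) x \<oplus>\<^bsub>N\<^esub> h x) =
        (\<lambda>x\<in>carrier M. f x \<oplus>\<^bsub>N\<^esub> (\<lambda>x\<in>carrier M. g x \<oplus>\<^bsub>N\<^esub> h x) x)"
      by (rule extensionalityI[of _ "carrier M"]) (auto simp: c f g h N.M.a_assoc)
  qed (simp_all add: bimod_hom_zero bimod_hom_add assms)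
  show ?thesis
  proof (unfold_locales; simp only: hom_space_simps)
    fix f g :: "_ => _" and a b assume f: "f \<in> bimod_hom A M N"
    show "(\<lambda>x\<in>carrier M. a \<odot>\<^bsub>N\<^esub> f x) \<in> bimod_hom A M N" by (rule bimod_hom_smult[OF assms f])
    show "(\<lambda>x\<in>carrier M. (a + b) \<odot>\<^bsub>N\<^esub> f x) =
        (\<lambda>x\<in>carrier M. (\<lambda>x\<in>carrier M. a \<odot>\<^bsub>N\<^esub> f x) x \<oplus>\<^bsub>N\<^esub> (\<lambda>x\<in>carrier M. b \<odot>\<^bsub>N\<^esub> f x) x)"
      by (rule extensionalityI[of _ "carrier M"]) (auto simp: c f N.M.smult_l_distr)
    show "(\<lambda>x\<in>carrier M. (a * b) \<odot>\<^bsub>N\<^esub> f x) = (\<lambda>x\<in>carrier M. a \<odot>\<^bsub>N\<^esub> (\<lambda>x\<in>carrier M. b \<odot>\<^bsub>N\<^esub> f x) x)"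
      by (rule extensionalityI[of _ "carrier M"]) (auto simp: c f N.M.smult_assoc)
    show "(\<lambda>x\<in>carrier M. 1 \<odot>\<^bsub>N\<^esub> f x) = f"
      by (rule extensionalityI[of _ "carrier M"]) (auto simp: c f e)
    assume g: "g \<in> bimod_hom A M N"
    show "(\<lambda>x\<in>carrier M. a \<odot>\<^bsub>N\<^esub> (\<lambda>x\<in>carrier M. f x \<oplus>\<^bsub>N\<^esub> g x) x) =
        (\<lambda>x\<in>carrier M. (\<lambda>x\<in>carrier M. a \<odot>\<^bsub>N\<^esub> f x) x \<oplus>\<^bsub>N\<^esub> (\<lambda>x\<in>carrier M. a \<odot>\<^bsub>N\<^esub> g x) x)"
      by (rule extensionalityI[of _ "carrier M"]) (auto simp: c f g N.M.smult_r_distr)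
  qed
qed

section \<open>Projective bimodules\<close>

locale idem_pair = kalg A for A :: "('k::field, 'a) module" (structure) +
  fixes e e' :: 'a
  assumes e_closed [simp]: "e \<in> carrier A" "e' \<in> carrier A"
    and e_idem [simp]: "e \<otimes> e = e" "e' \<otimes> e' = e'"
begin

abbreviation "V \<equiv> left_ideal_of A e"
abbreviation "W \<equiv> right_ideal_of A e'"

text \<open>Idempotency turns the image of multiplication by \<open>e\<close> into the set of its
  fixed points, a condition that can be tested on an element.\<close>

lemma carrier_V: "carrier V = {x \<in> carrier A. x \<otimes> e = x}"
  unfolding left_ideal_of_def using m_assoc[of _ e e] by (auto intro: sym)

lemma carrier_W: "carrier W = {x \<in> carrier A. e' \<otimes> x = x}"
  unfolding right_ideal_of_def using m_assoc[of e' e', symmetric] by (auto intro: sym)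

lemma V_simps [simp]: "zero V = \<zero>" "add V = add A" "smult V = smult A"
  by (simp_all add: left_ideal_of_def)

lemma W_simps [simp]: "zero W = \<zero>" "add W = add A" "smult W = smult A"
  by (simp_all add: right_ideal_of_def)

lemma vec_V: "vec V"
proof -
  have "subspace (carrier V) A"
    by (rule subspaceI) (auto simp: carrier_V l_distr smult_mult_left)
  from subspace_vec[OF this] show ?thesis by (simp add: left_ideal_of_def)
qed

lemma vec_W: "vec W"
proof -
  have "subspace (carrier W) A"
    by (rule subspaceI) (auto simp: carrier_W r_distr smult_mult_right)
  from subspace_vec[OF this] show ?thesis by (simp add: right_ideal_of_def)
qed

sublocale TT: tens V W by (intro tens.intro vec_V vec_W)

abbreviation "P \<equiv> proj_bimod A e e'"

lemma P_simps [simp]: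
  "carrier P = carrier TT.T" "zero P = zero TT.T" "add P = add TT.T" "smult P = smult TT.T"
  by (simp_all add: proj_bimod_def Let_def)

lemma mult_V: "a \<in> carrier A ==> x \<in> carrier V ==> a \<otimes> x \<in> carrier V"
  by (auto simp: carrier_V m_assoc)

lemma mult_W: "a \<in> carrier A ==> y \<in> carrier W ==> y \<otimes> a \<in> carrier W"
  by (auto simp: carrier_W simp flip: m_assoc)

lemma V_carr: "x \<in> carrier V ==> x \<in> carrier A" by (simp add: carrier_V)
lemma W_carr: "x \<in> carrier W ==> x \<in> carrier A" by (simp add: carrier_W)

lemma bil_l: "a \<in> carrier A ==> bilinear_map V W TT.T (\<lambda>x y. pure V W (a \<otimes> x) y)"
  using TT.pure_add(1)[OF mult_V mult_V] TT.pure_smult(1)[OF mult_V]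
    TT.pure_add(2)[OF mult_V mult_V] TT.pure_smult(2)[OF mult_V]
  by (auto intro!: bilinear_mapI vlinI simp: mult_V V_carr r_distr smult_mult_right)

lemma bil_r: "a \<in> carrier A ==> bilinear_map V W TT.T (\<lambda>x y. pure V W x (y \<otimes> a))"
  using TT.pure_add(2)[OF _ _ mult_W mult_W] TT.pure_smult(2)[OF _ mult_W]
    TT.pure_add(1)[OF _ _ mult_W mult_W] TT.pure_smult(1)[OF _ mult_W]
  by (auto intro!: bilinear_mapI vlinI simp: mult_W W_carr l_distr smult_mult_left)

text \<open>Terms may collide when they are pushed forward, \<open>p\<close> and \<open>q\<close>
  not being injective in general; the class of the sum is still the linear extension of the images
  of pure tensors.\<close>

lemma push_class:
  assumes "f \<in> carrier TT.F" "\<And>x y. x \<in> carrier V ==> y \<in> carrier W ==> p x \<in> carrier V \<and> q y \<in> carrier W"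
  shows "tensor_class V W (\<Sum>(x, y)\<in>pkeys f.
      psingle (p x, q y) (plookup f (x, y))) =
    lin_ext TT.T (\<lambda>(x, y). pure V W (p x) (q y)) f"
proof -
  let ?s = "\<lambda>(x, y). psingle (p x, q y) (plookup f (x, y))"
  let ?K = "pkeys f"
  have K: "x \<in> carrier V \<and> y \<in> carrier W" if "(x, y) \<in> ?K" for x y
    using assms(1) that by auto
  have s: "?s z \<in> carrier TT.F" if "z \<in> ?K" for z
    using K assms(2) that by (cases z) auto
  have "tensor_class V W (sum ?s ?K) = tensor_class V W (finsum TT.F ?s ?K)"
    by (subst finsum_free_space) (use s in \<open>auto simp only: free_space_simps finite_keys mem_Collect_eq\<close>)
  also have "\<dots> = finsum TT.T (\<lambda>z. tensor_class V W (?s z)) ?K"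
    by (rule vlin_finsum[OF TT.F.vec TT.T.vec TT.vlin_tensor_class]) (use s in blast)
  also have "\<dots> = lin_ext TT.T (\<lambda>(x, y). pure V W (p x) (q y)) f"
    unfolding lin_ext_def
  proof (rule TT.T.add.finprod_cong'[OF refl])
    show "(\<lambda>z. plookup f z \<odot>\<^bsub>TT.T\<^esub> (case z of (x, y) => pure V W (p x) (q y))) \<in> ?K \<rightarrow> carrier TT.T"
      using K assms(2) by (intro funcsetI TT.T.smult_closed) (auto intro!: TT.pure_closed)
    fix z assume "z \<in> ?K"
    then show "tensor_class V W (?s z) = plookup f z \<odot>\<^bsub>TT.T\<^esub> (case z of (x, y) => pure V W (p x) (q y))"
      using K[of "fst z" "snd z"] assms(2)[of "fst z" "snd z"] TT.smult_pure[of "p (fst z)" "q (snd z)"]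
      by (cases z) simp
  qed
  finally show ?thesis .
qed

lemma rep: 
  assumes "X \<in> carrier TT.T"
  obtains f where "f \<in> carrier TT.F" "X = tensor_class V W f" "f \<in> X"
    "\<And>g. g \<in> X ==> g \<in> carrier TT.F \<and> tensor_class V W g = X"
proof -
  obtain f where f: "f \<in> carrier TT.F" "X = tensor_class V W f"
    using assms unfolding TT.carrier_T by (elim imageE)
  show ?thesis
    by (rule that[OF f]) (use f TT.Q.mem_coset_iff[of f] TT.Q.U.a_rcos_self[of f] in \<open>auto simp: tensor_class_def\<close>)
qed

text \<open>Evaluates the definitions of the two actions, which are unions over representatives that
  all contribute the same class.\<close>

lemma UN_const_on: "f \<in> X ==> (\<And>g. g \<in> X ==> F g = c) ==> (\<Union>g\<in>X. F g) = c"
  by auto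

lemma lact_P:
  assumes "a \<in> carrier A" "X \<in> carrier TT.T"
  shows "lact P a X = tensor_lift TT.T (\<lambda>x y. pure V W (a \<otimes> x) y) X"
proof -
  have "lact P a X = (\<Union>g\<in>X. tensor_class V W (\<Sum>(x, y)\<in>pkeys g.
      psingle (a \<otimes> x, y) (plookup g (x, y))))"
    by (simp add: proj_bimod_def Let_def)
  also have "\<dots> = tensor_lift TT.T (\<lambda>x y. pure V W (a \<otimes> x) y) X"
  proof -
  obtain f where f: "f \<in> X" and X: "\<And>g. g \<in> X ==> g \<in> carrier TT.F \<and> tensor_class V W g = X"
    using rep[OF assms(2)] by metis
  have "tensor_class V W (\<Sum>(x, y)\<in>pkeys g.
      psingle (a \<otimes> x, y) (plookup g (x, y))) =
      tensor_lift TT.T (\<lambda>x y. pure V W (a \<otimes> x) y) X" if "g \<in> X" for g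
    using push_class[of g "\<lambda>x. a \<otimes> x" "\<lambda>y. y"] X[OF that] mult_V[OF assms(1)]
      TT.tensor_lift_class[OF TT.T.vec bil_l[OF assms(1)], of g] by simp
  then show ?thesis by (rule UN_const_on[OF f])
  qed
  finally show ?thesis .
qed

lemma ract_P:
  assumes "a \<in> carrier A" "X \<in> carrier TT.T"
  shows "ract P X a = tensor_lift TT.T (\<lambda>x y. pure V W x (y \<otimes> a)) X"
proof -
  have "ract P X a = (\<Union>g\<in>X. tensor_class V W (\<Sum>(x, y)\<in>pkeys g.
      psingle (x, y \<otimes> a) (plookup g (x, y))))"
    by (simp add: proj_bimod_def Let_def)
  also have "\<dots> = tensor_lift TT.T (\<lambda>x y. pure V W x (y \<otimes> a)) X"
  proof -
  obtain f where f: "f \<in> X" and X: "\<And>g. g \<in> X ==> g \<in> carrier TT.F \<and> tensor_class V W g = X"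
    using rep[OF assms(2)] by metis
  have "tensor_class V W (\<Sum>(x, y)\<in>pkeys g.
      psingle (x, y \<otimes> a) (plookup g (x, y))) =
      tensor_lift TT.T (\<lambda>x y. pure V W x (y \<otimes> a)) X" if "g \<in> X" for g
    using push_class[of g "\<lambda>x. x" "\<lambda>y. y \<otimes> a"] X[OF that] mult_W[OF assms(1)]
      TT.tensor_lift_class[OF TT.T.vec bil_r[OF assms(1)], of g] by simp
  then show ?thesis by (rule UN_const_on[OF f])
  qed
  finally show ?thesis .
qed

lemma lact_pure: "a \<in> carrier A ==> x \<in> carrier V ==> y \<in> carrier W ==>
    lact P a (pure V W x y) = pure V W (a \<otimes> x) y"
  by (simp add: lact_P TT.tensor_lift_pure[OF TT.T.vec bil_l])

lemma ract_pure: "a \<in> carrier A ==> x \<in> carrier V ==> y \<in> carrier W ==>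
    ract P (pure V W x y) a = pure V W x (y \<otimes> a)"
  by (simp add: ract_P TT.tensor_lift_pure[OF TT.T.vec bil_r])

lemma vlin_lact_P: "a \<in> carrier A ==> vlin TT.T TT.T (lact P a)"
  using TT.vlin_tensor_lift[OF TT.T.vec bil_l, of a] by (simp add: vlin_def Pi_iff lact_P)

lemma vlin_ract_P: "a \<in> carrier A ==> vlin TT.T TT.T (\<lambda>X. ract P X a)"
  using TT.vlin_tensor_lift[OF TT.T.vec bil_r, of a] by (simp add: vlin_def Pi_iff ract_P)

lemma vec_P: "vec P"
  by (rule vec_image[OF TT.T.vec, where p = "\<lambda>x. x"]) auto

lemma bim_P: "bim A P"
proof (intro bim.intro bim_axioms.intro kalg vec_P; (unfold P_simps)?)
  note l = vlinD[OF vlin_lact_P] and r = vlinD[OF vlin_ract_P]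
  have sw: "(u \<oplus>\<^bsub>TT.T\<^esub> v) \<oplus>\<^bsub>TT.T\<^esub> (u' \<oplus>\<^bsub>TT.T\<^esub> v') = (u \<oplus>\<^bsub>TT.T\<^esub> u') \<oplus>\<^bsub>TT.T\<^esub> (v \<oplus>\<^bsub>TT.T\<^esub> v')"
    if "u \<in> carrier TT.T" "v \<in> carrier TT.T" "u' \<in> carrier TT.T" "v' \<in> carrier TT.T" for u v u' v'
    using that by (simp add: TT.T.a_ac)
  show "lact P a x \<in> carrier TT.T" "ract P x a \<in> carrier TT.T"
    if "a \<in> carrier A" "x \<in> carrier TT.T" for a x using that l(1) r(1) by auto
  show "lact P a (x \<oplus>\<^bsub>TT.T\<^esub> y) = lact P a x \<oplus>\<^bsub>TT.T\<^esub> lact P a y"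
    "ract P (x \<oplus>\<^bsub>TT.T\<^esub> y) a = ract P x a \<oplus>\<^bsub>TT.T\<^esub> ract P y a"
    if "a \<in> carrier A" "x \<in> carrier TT.T" "y \<in> carrier TT.T" for a x y using that l(2) r(2) by auto
  fix a b x assume ab: "a \<in> carrier A" "b \<in> carrier A" and x: "x \<in> carrier TT.T"
  show "lact P (a \<oplus> b) x = lact P a x \<oplus>\<^bsub>TT.T\<^esub> lact P b x"
    using x
  proof (induct rule: TT.tensor_induct)
    case (pure x y)
    then show ?case using ab TT.pure_add(1)[OF mult_V mult_V, of a x b x y] by (simp add: lact_pure l_distr V_carr)
  next
    case (add X Y) then show ?case using ab by (simp add: l sw)
  qed
  show "ract P x (a \<oplus> b) = ract P x a \<oplus>\<^bsub>TT.T\<^esub> ract P x b"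
    using x
  proof (induct rule: TT.tensor_induct)
    case (pure x y)
    then show ?case using ab TT.pure_add(2)[OF _ _ mult_W mult_W, of x x a y b y] by (simp add: ract_pure r_distr W_carr)
  next
    case (add X Y) then show ?case using ab by (simp add: r sw)
  qed
  show "lact P (a \<otimes> b) x = lact P a (lact P b x)"
    using x
  proof (induct rule: TT.tensor_induct)
    case (pure x y) then show ?case using ab by (simp add: lact_pure mult_V m_assoc V_carr)
  next
    case (add X Y) then show ?case using ab by (simp add: l)
  qed
  show "ract P x (a \<otimes> b) = ract P (ract P x a) b"
    using x
  proof (induct rule: TT.tensor_induct)
    case (pure x y) then show ?case using ab by (simp add: ract_pure mult_W m_assoc W_carr)
  next
    case (add X Y) then show ?case using ab by (simp add: r)
  qed
  show "ract P (lact P a x) b = lact P a (ract P x b)"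
    using x
  proof (induct rule: TT.tensor_induct)
    case (pure x y) then show ?case using ab by (simp add: lact_pure ract_pure mult_V mult_W)
  next
    case (add X Y) then show ?case using ab by (simp add: l r)
  qed
next
  note l = vlinD[OF vlin_lact_P] and r = vlinD[OF vlin_ract_P]
  fix c x assume x: "x \<in> carrier TT.T"
  show "lact P (c \<odot> \<one>) x = c \<odot>\<^bsub>TT.T\<^esub> x"
    using x
  proof (induct rule: TT.tensor_induct)
    case (pure x y)
    then show ?case using TT.pure_smult(1)[of x y c] by (simp add: lact_pure smult_mult_left V_carr)
  next
    case (add X Y) then show ?case by (simp add: l TT.T.smult_r_distr)
  qed
  show "ract P x (c \<odot> \<one>) = c \<odot>\<^bsub>TT.T\<^esub> x"
    using x
  proof (induct rule: TT.tensor_induct)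
    case (pure x y)
    then show ?case using TT.pure_smult(2)[of x y c] by (simp add: ract_pure smult_mult_right W_carr)
  next
    case (add X Y) then show ?case by (simp add: r TT.T.smult_r_distr)
  qed
qed

lemma e_V [simp]: "e \<in> carrier V" and e_W [simp]: "e' \<in> carrier W"
  by (simp_all add: carrier_V carrier_W)

lemma proj_gen_pure: "proj_gen A e e' = pure V W e e'"
  by (simp add: proj_gen_def pure_def)

lemma proj_gen_closed: "proj_gen A e e' \<in> carrier P"
  by (simp add: proj_gen_pure)

lemma pure_gen:
  assumes "x \<in> carrier V" "y \<in> carrier W"
  shows "pure V W x y = ract P (lact P x (proj_gen A e e')) y"
proof -
  have x: "x \<in> carrier A" "x \<otimes> e = x" using assms(1) by (simp_all add: carrier_V)
  have y: "y \<in> carrier A" "e' \<otimes> y = y" using assms(2) by (simp_all add: carrier_W)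
  show ?thesis
    unfolding proj_gen_pure lact_pure[OF x(1) e_V e_W] x(2) ract_pure[OF y(1) assms(1) e_W] y(2) ..
qed

lemma gen_e: "lact P e (proj_gen A e e') = proj_gen A e e'" "ract P (proj_gen A e e') e' = proj_gen A e e'"
  by (simp_all add: proj_gen_pure lact_pure ract_pure)

lemma proj_induct [consumes 1, case_names gen add]:
  assumes "X \<in> carrier P"
    and "\<And>x y. x \<in> carrier A ==> y \<in> carrier A ==> R (ract P (lact P x (proj_gen A e e')) y)"
    and "\<And>X Y. X \<in> carrier P ==> Y \<in> carrier P ==> R X ==> R Y ==> R (X \<oplus>\<^bsub>P\<^esub> Y)"
  shows "R X"
  using assms(1) unfolding P_simps
proof (induct rule: TT.tensor_induct)
  case (pure x y) then show ?case using assms(2)[of x y] by (simp add: pure_gen V_carr W_carr)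
next
  case (add X Y) then show ?case using assms(3)[of X Y] by simp
qed

lemma bilinear_act:
  assumes "bim A N" "w \<in> carrier N"
  shows "bilinear_map V W N (\<lambda>u v. ract N (lact N u w) v)"
proof -
  interpret N: bim A N by fact
  show ?thesis
    by (auto intro!: bilinear_mapI vlinI simp: V_carr W_carr assms(2) N.lact_add_scalar N.ract_add_scalar
        N.ract_add N.lact_smult_scalar N.ract_smult_scalar N.ract_smult)
qed

text \<open>The map \<open>u \<otimes> v \<mapsto> u w v\<close>. It takes the generator to
  \<open>e w e'\<close>, which is \<open>w\<close> itself under the conditions of
  \<open>phom_gen\<close>.\<close>

definition "phom N w = tensor_lift N (\<lambda>u v. ract N (lact N u w) v)"

context
  fixes N :: "('k, 'a, 'x) bimod" and w
  assumes N: "bim A N" and w: "w \<in> carrier N"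
begin

interpretation N: bim A N by (rule N)

lemma vlin_phom: "vlin P N (phom N w)"
  using TT.vlin_tensor_lift[OF N.M.vec bilinear_act[OF N w]] by (simp add: vlin_def phom_def)

lemma phom_pure: "u \<in> carrier V ==> v \<in> carrier W ==> phom N w (pure V W u v) = ract N (lact N u w) v"
  unfolding phom_def by (rule TT.tensor_lift_pure[OF N.M.vec bilinear_act[OF N w]])

lemma phom_lact:
  assumes "a \<in> carrier A" "X \<in> carrier P" shows "phom N w (lact P a X) = lact N a (phom N w X)"
  using assms(2) unfolding P_simps
proof (induct rule: TT.tensor_induct)
  case (pure x y)
  then show ?case using assms(1) w by (simp add: lact_pure phom_pure mult_V V_carr W_carr N.lact_mult N.ract_lact)
next
  case (add X Y)
  then show ?case using assms(1) vlinD[OF vlin_phom] vlinD[OF vlin_lact_P] by (simp add: N.lact_add)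
qed

lemma phom_ract:
  assumes "a \<in> carrier A" "X \<in> carrier P" shows "phom N w (ract P X a) = ract N (phom N w X) a"
  using assms(2) unfolding P_simps
proof (induct rule: TT.tensor_induct)
  case (pure x y)
  then show ?case using assms(1) w by (simp add: ract_pure phom_pure mult_W V_carr W_carr N.ract_mult)
next
  case (add X Y)
  then show ?case using assms(1) vlinD[OF vlin_phom] vlinD[OF vlin_ract_P] by (simp add: N.ract_add)
qed

lemma phom_gen:
  assumes "lact N e w = w" "ract N w e' = w" shows "phom N w (proj_gen A e e') = w"
  using assms by (simp add: proj_gen_pure phom_pure)

end

end

section \<open>Finite direct sums of bimodules and their universal property\<close>

lemma carrier_direct_sum:
  "finite I ==> carrier (direct_sum I M) = (\<Pi>\<^sub>E i\<in>I. carrier (M i))"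
  by (auto simp: direct_sum_def)

lemma direct_sum_simps:
  "zero (direct_sum I M) = (\<lambda>i\<in>I. \<zero>\<^bsub>M i\<^esub>)"
  "add (direct_sum I M) = (\<lambda>x y. \<lambda>i\<in>I. x i \<oplus>\<^bsub>M i\<^esub> y i)"
  "smult (direct_sum I M) = (\<lambda>c x. \<lambda>i\<in>I. c \<odot>\<^bsub>M i\<^esub> x i)"
  "lact (direct_sum I M) = (\<lambda>a x. \<lambda>i\<in>I. lact (M i) a (x i))"
  "ract (direct_sum I M) = (\<lambda>x a. \<lambda>i\<in>I. ract (M i) (x i) a)"
  by (simp_all add: direct_sum_def)

lemma bim_direct_sum:
  fixes A :: "('k::field, 'a) module"
  assumes "kalg A" "finite I" "\<And>i. i \<in> I ==> bim A (M i)"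
  shows "bim A (direct_sum I M)"
proof -
  let ?D = "direct_sum I M"
  interpret A: kalg A by fact
  have v: "vec (M i)" if "i \<in> I" for i using assms(3)[OF that] by (simp add: bim_def)
  have g: "abelian_group (M i)" if "i \<in> I" for i using v[OF that] by (simp add: vec_def)
  note S = carrier_direct_sum[OF assms(2)] direct_sum_simps
  note G = abelian_groupE[OF g] abelian_group.minus_closed[OF g]
  have cl: "x i \<in> carrier (M i)" if "x \<in> (\<Pi>\<^sub>E i\<in>I. carrier (M i))" "i \<in> I" for x i
    using that by auto
  have ag: "abelian_group ?D"
  proof (rule abelian_groupI; unfold S)
    fix x y z
    assume x: "x \<in> (\<Pi>\<^sub>E i\<in>I. carrier (M i))"
    show "(\<lambda>i\<in>I. (\<lambda>i\<in>I. \<zero>\<^bsub>M i\<^esub>) i \<oplus>\<^bsub>M i\<^esub> x i) = x"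
      by (rule extensionalityI[of _ I]) (use x cl[OF x] in \<open>auto simp: G(5) PiE_iff\<close>)
    show "\<exists>y\<in>\<Pi>\<^sub>E i\<in>I. carrier (M i). (\<lambda>i\<in>I. y i \<oplus>\<^bsub>M i\<^esub> x i) = (\<lambda>i\<in>I. \<zero>\<^bsub>M i\<^esub>)"
      by (rule bexI[of _ "\<lambda>i\<in>I. \<ominus>\<^bsub>M i\<^esub> x i"], rule restrict_ext)
        (use cl[OF x] in \<open>auto simp: abelian_group.l_neg[OF g] abelian_group.a_inv_closed[OF g]\<close>)
    assume y: "y \<in> (\<Pi>\<^sub>E i\<in>I. carrier (M i))"
    show "(\<lambda>i\<in>I. x i \<oplus>\<^bsub>M i\<^esub> y i) \<in> (\<Pi>\<^sub>E i\<in>I. carrier (M i))"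
      using cl[OF x] cl[OF y] by (auto intro!: G(1))
    show "(\<lambda>i\<in>I. x i \<oplus>\<^bsub>M i\<^esub> y i) = (\<lambda>i\<in>I. y i \<oplus>\<^bsub>M i\<^esub> x i)"
      by (rule restrict_ext) (rule G(4)[OF _ cl[OF x] cl[OF y]])
    assume z: "z \<in> (\<Pi>\<^sub>E i\<in>I. carrier (M i))"
    show "(\<lambda>i\<in>I. (\<lambda>i\<in>I. x i \<oplus>\<^bsub>M i\<^esub> y i) i \<oplus>\<^bsub>M i\<^esub> z i) = (\<lambda>i\<in>I. x i \<oplus>\<^bsub>M i\<^esub> (\<lambda>i\<in>I. y i \<oplus>\<^bsub>M i\<^esub> z i) i)"
      by (rule restrict_ext) (simp add: G(3)[OF _ cl[OF x] cl[OF y] cl[OF z]])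
  qed (auto intro!: G(2))
  interpret abelian_group ?D by (rule ag)
  note bm = bim.lact_closed bim.ract_closed bim.lact_add bim.ract_add bim.lact_add_scalar bim.ract_add_scalar
    bim.lact_mult bim.ract_mult bim.ract_lact bim.lact_scalar bim.ract_scalar
  have vd: "vec ?D"
  proof (unfold_locales; unfold S)
    fix x y and c d :: 'k assume x: "x \<in> (\<Pi>\<^sub>E i\<in>I. carrier (M i))"
    show "(\<lambda>i\<in>I. c \<odot>\<^bsub>M i\<^esub> x i) \<in> (\<Pi>\<^sub>E i\<in>I. carrier (M i))"
      using cl[OF x] by (auto intro!: vec.smult_closed[OF v])
    show "(\<lambda>i\<in>I. (c + d) \<odot>\<^bsub>M i\<^esub> x i) = (\<lambda>i\<in>I. (\<lambda>i\<in>I. c \<odot>\<^bsub>M i\<^esub> x i) i \<oplus>\<^bsub>M i\<^esub> (\<lambda>i\<in>I. d \<odot>\<^bsub>M i\<^esub> x i) i)"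
      by (rule restrict_ext) (simp add: vec.smult_l_distr[OF v cl[OF x]])
    show "(\<lambda>i\<in>I. (c * d) \<odot>\<^bsub>M i\<^esub> x i) = (\<lambda>i\<in>I. c \<odot>\<^bsub>M i\<^esub> (\<lambda>i\<in>I. d \<odot>\<^bsub>M i\<^esub> x i) i)"
      by (rule restrict_ext) (simp add: vec.smult_assoc[OF v cl[OF x]])
    show "(\<lambda>i\<in>I. 1 \<odot>\<^bsub>M i\<^esub> x i) = x"
      by (rule extensionalityI[of _ I]) (use x cl[OF x] in \<open>auto simp: vec.smult_one[OF v] PiE_iff\<close>)
    assume y: "y \<in> (\<Pi>\<^sub>E i\<in>I. carrier (M i))"
    show "(\<lambda>i\<in>I. c \<odot>\<^bsub>M i\<^esub> (\<lambda>i\<in>I. x i \<oplus>\<^bsub>M i\<^esub> y i) i) =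
      (\<lambda>i\<in>I. (\<lambda>i\<in>I. c \<odot>\<^bsub>M i\<^esub> x i) i \<oplus>\<^bsub>M i\<^esub> (\<lambda>i\<in>I. c \<odot>\<^bsub>M i\<^esub> y i) i)"
      by (rule restrict_ext) (simp add: vec.smult_r_distr[OF v cl[OF x] cl[OF y]])
  qed
  show ?thesis
  proof (intro bim.intro bim_axioms.intro assms(1) vd; unfold S)
    fix a b x assume a: "a \<in> carrier A" and b: "b \<in> carrier A" and x: "x \<in> (\<Pi>\<^sub>E i\<in>I. carrier (M i))"
    show "(\<lambda>i\<in>I. lact (M i) (a \<oplus>\<^bsub>A\<^esub> b) (x i)) = (\<lambda>i\<in>I. (\<lambda>i\<in>I. lact (M i) a (x i)) i \<oplus>\<^bsub>M i\<^esub> (\<lambda>i\<in>I. lact (M i) b (x i)) i)"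
      by (rule restrict_ext) (simp add: bm(5)[OF assms(3) a b cl[OF x]])
    show "(\<lambda>i\<in>I. ract (M i) (x i) (a \<oplus>\<^bsub>A\<^esub> b)) = (\<lambda>i\<in>I. (\<lambda>i\<in>I. ract (M i) (x i) a) i \<oplus>\<^bsub>M i\<^esub> (\<lambda>i\<in>I. ract (M i) (x i) b) i)"
      by (rule restrict_ext) (simp add: bm(6)[OF assms(3) a b cl[OF x]])
    show "(\<lambda>i\<in>I. lact (M i) (a \<otimes>\<^bsub>A\<^esub> b) (x i)) = (\<lambda>i\<in>I. lact (M i) a ((\<lambda>i\<in>I. lact (M i) b (x i)) i))"
      by (rule restrict_ext) (simp add: bm(7)[OF assms(3) a b cl[OF x]])
    show "(\<lambda>i\<in>I. ract (M i) (x i) (a \<otimes>\<^bsub>A\<^esub> b)) = (\<lambda>i\<in>I. ract (M i) ((\<lambda>i\<in>I. ract (M i) (x i) a) i) b)"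
      by (rule restrict_ext) (simp add: bm(8)[OF assms(3) a b cl[OF x]])
    show "(\<lambda>i\<in>I. ract (M i) ((\<lambda>i\<in>I. lact (M i) a (x i)) i) b) = (\<lambda>i\<in>I. lact (M i) a ((\<lambda>i\<in>I. ract (M i) (x i) b) i))"
      by (rule restrict_ext) (simp add: bm(9)[OF assms(3) a b cl[OF x]])
  next
    fix a x assume a: "a \<in> carrier A" and x: "x \<in> (\<Pi>\<^sub>E i\<in>I. carrier (M i))"
    show "(\<lambda>i\<in>I. lact (M i) a (x i)) \<in> (\<Pi>\<^sub>E i\<in>I. carrier (M i))"
      "(\<lambda>i\<in>I. ract (M i) (x i) a) \<in> (\<Pi>\<^sub>E i\<in>I. carrier (M i))"
      using cl[OF x] by (auto intro!: bm(1,2)[OF assms(3)] a)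
    fix y assume y: "y \<in> (\<Pi>\<^sub>E i\<in>I. carrier (M i))"
    show "(\<lambda>i\<in>I. lact (M i) a ((\<lambda>i\<in>I. x i \<oplus>\<^bsub>M i\<^esub> y i) i)) = (\<lambda>i\<in>I. (\<lambda>i\<in>I. lact (M i) a (x i)) i \<oplus>\<^bsub>M i\<^esub> (\<lambda>i\<in>I. lact (M i) a (y i)) i)"
      by (rule restrict_ext) (simp add: bm(3)[OF assms(3) a cl[OF x] cl[OF y]])
    show "(\<lambda>i\<in>I. ract (M i) ((\<lambda>i\<in>I. x i \<oplus>\<^bsub>M i\<^esub> y i) i) a) = (\<lambda>i\<in>I. (\<lambda>i\<in>I. ract (M i) (x i) a) i \<oplus>\<^bsub>M i\<^esub> (\<lambda>i\<in>I. ract (M i) (y i) a) i)"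
      by (rule restrict_ext) (simp add: bm(4)[OF assms(3) a cl[OF x] cl[OF y]])
  next
    fix c x assume x: "x \<in> (\<Pi>\<^sub>E i\<in>I. carrier (M i))"
    show "(\<lambda>i\<in>I. lact (M i) (c \<odot>\<^bsub>A\<^esub> \<one>\<^bsub>A\<^esub>) (x i)) = (\<lambda>i\<in>I. c \<odot>\<^bsub>M i\<^esub> x i)"
      by (rule restrict_ext) (simp add: bm(10)[OF assms(3) cl[OF x]])
    show "(\<lambda>i\<in>I. ract (M i) (x i) (c \<odot>\<^bsub>A\<^esub> \<one>\<^bsub>A\<^esub>)) = (\<lambda>i\<in>I. c \<odot>\<^bsub>M i\<^esub> x i)"
      by (rule restrict_ext) (simp add: bm(11)[OF assms(3) cl[OF x]])
  qed
qed

locale idem_family = kalg A for A :: "('k::field, 'a) module" (structure) +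
  fixes I :: "'i set" and e e' :: "'i => 'a"
  assumes fin: "finite I"
    and idem_pair: "\<And>i. i \<in> I ==> idem_pair A (e i) (e' i)"
begin

abbreviation "M i \<equiv> proj_bimod A (e i) (e' i)"
abbreviation "D \<equiv> direct_sum I M"

lemma bim_M: "i \<in> I ==> bim A (M i)"
  by (rule idem_pair.bim_P[OF idem_pair])

lemma bim_D: "bim A D"
  by (rule bim_direct_sum[OF kalg fin bim_M])

sublocale D: bim A D by (rule bim_D)

lemma carrier_D: "carrier D = (\<Pi>\<^sub>E i\<in>I. carrier (M i))"
  by (rule carrier_direct_sum[OF fin])

definition inj_at :: "'i => ('a \<times> 'a \<Rightarrow>\<^sub>0 'k) set => 'i => ('a \<times> 'a \<Rightarrow>\<^sub>0 'k) set" where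
  "inj_at i X = (\<lambda>j\<in>I. if j = i then X else \<zero>\<^bsub>M j\<^esub>)"

definition gen :: "'i => 'i => ('a \<times> 'a \<Rightarrow>\<^sub>0 'k) set" where
  "gen i = inj_at i (proj_gen A (e i) (e' i))"

lemma M_zero_closed: "i \<in> I ==> \<zero>\<^bsub>M i\<^esub> \<in> carrier (M i)"
  using bim_M[of i] by (simp add: bim_def vec_def abelian_groupE(2))

lemma inj_at_closed: "i \<in> I ==> X \<in> carrier (M i) ==> inj_at i X \<in> carrier D"
  unfolding carrier_D inj_at_def by (auto simp: M_zero_closed)

lemma gen_closed: "i \<in> I ==> gen i \<in> carrier D"
  unfolding gen_def by (intro inj_at_closed idem_pair.proj_gen_closed[OF idem_pair])

lemma inj_at_add:
  assumes "i \<in> I" "X \<in> carrier (M i)" "Y \<in> carrier (M i)"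
  shows "inj_at i (X \<oplus>\<^bsub>M i\<^esub> Y) = inj_at i X \<oplus>\<^bsub>D\<^esub> inj_at i Y"
  unfolding direct_sum_simps inj_at_def
  by (rule restrict_ext) (use bim_M M_zero_closed in \<open>auto simp: abelian_groupE(5) bim_def vec_def\<close>)

lemma inj_at_act:
  assumes "i \<in> I" "X \<in> carrier (M i)" "a \<in> carrier A"
  shows "lact D a (inj_at i X) = inj_at i (lact (M i) a X)" "ract D (inj_at i X) a = inj_at i (ract (M i) X a)"
  unfolding direct_sum_simps inj_at_def
  by (rule restrict_ext; use assms(3) in \<open>auto simp: bim.lact_zero[OF bim_M] bim.ract_zero[OF bim_M]\<close>)+

lemma D_induct [consumes 1, case_names zero gen add]:
  assumes "x \<in> carrier D" and zero: "Q \<zero>\<^bsub>D\<^esub>"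
    and gen: "\<And>i a b. i \<in> I ==> a \<in> carrier A ==> b \<in> carrier A ==> Q (ract D (lact D a (gen i)) b)"
    and add: "\<And>x y. x \<in> carrier D ==> y \<in> carrier D ==> Q x ==> Q y ==> Q (x \<oplus>\<^bsub>D\<^esub> y)"
  shows "Q x"
proof -
  have inj: "Q (inj_at i X)" if i: "i \<in> I" and X: "X \<in> carrier (M i)" for i X
    using X
  proof (induct rule: idem_pair.proj_induct[OF idem_pair[OF i], consumes 1, case_names gen add])
    case (gen a b)
    have g: "proj_gen A (e i) (e' i) \<in> carrier (M i)" by (rule idem_pair.proj_gen_closed[OF idem_pair[OF i]])
    then have "inj_at i (ract (M i) (lact (M i) a (proj_gen A (e i) (e' i))) b) = ract D (lact D a (gen i)) b"
      unfolding gen_def using gen i bim.lact_closed[OF bim_M[OF i] _ g] by (simp add: inj_at_act)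
    then show ?case using assms(3)[OF i gen] by simp
  next
    case (add X Y)
    then show ?case using inj_at_add[OF i add(1,2)] assms(4)[OF inj_at_closed[OF i] inj_at_closed[OF i]] by simp
  qed
  \<comment> \<open>Induction on the set \<open>J\<close> of indices whose components have been
    added so far; the remaining components are zero.\<close>
  have "Q (\<lambda>i\<in>I. if i \<in> J then x i else \<zero>\<^bsub>M i\<^esub>)" if "J \<subseteq> I" for J
    using finite_subset[OF that fin] that
  proof (induct J rule: finite_induct)
    case empty then show ?case using zero by (simp add: direct_sum_simps restrict_def)
  next
    case (insert i J)
    let ?y = "\<lambda>j\<in>I. if j \<in> J then x j else \<zero>\<^bsub>M j\<^esub>"
    have x: "x j \<in> carrier (M j)" if "j \<in> I" for j using assms(1) that unfolding carrier_D by auto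
    have y: "?y \<in> carrier D" unfolding carrier_D using x M_zero_closed by auto
    have "(\<lambda>j\<in>I. if j \<in> insert i J then x j else \<zero>\<^bsub>M j\<^esub>) = inj_at i (x i) \<oplus>\<^bsub>D\<^esub> ?y"
      unfolding direct_sum_simps inj_at_def
    proof (rule restrict_ext)
      fix j assume j: "j \<in> I"
      interpret Mj: bim A "M j" by (rule bim_M[OF j])
      show "(if j \<in> insert i J then x j else \<zero>\<^bsub>M j\<^esub>) =
         (\<lambda>j\<in>I. if j = i then x i else \<zero>\<^bsub>M j\<^esub>) j \<oplus>\<^bsub>M j\<^esub> (\<lambda>j\<in>I. if j \<in> J then x j else \<zero>\<^bsub>M j\<^esub>) j"
      proof (cases "j = i")
        case True
        show ?thesis using x[OF j] insert(2) j unfolding True[symmetric] by simp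
      next
        case False
        then show ?thesis using x[OF j] Mj.M.zero_closed j by simp
      qed
    qed
    note e = this
    have iI: "i \<in> I" and JI: "J \<subseteq> I" using insert(4) by auto
    show ?case
      unfolding e by (rule add[OF inj_at_closed[OF iI x[OF iI]] y inj[OF iI x[OF iI]] insert(3)[OF JI]])
  qed
  from this[of I] have "Q (\<lambda>i\<in>I. x i)" by (simp cong: restrict_cong)
  moreover have "(\<lambda>i\<in>I. x i) = x" using assms(1) unfolding carrier_D by (simp add: PiE_def extensional_restrict)
  ultimately show ?thesis by simp
qed

lemma hom_unique:
  assumes "bim A N" "f \<in> bimod_hom A D N" "g \<in> bimod_hom A D N" "\<And>i. i \<in> I ==> f (gen i) = g (gen i)"
  shows "f = g"
proof (rule bimod_hom_eqI[OF assms(2,3)])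
  interpret N: bim A N by fact
  fix x assume "x \<in> carrier D"
  then show "f x = g x"
  proof (induct rule: D_induct)
    case zero
    show ?case
      using vlin_zero[OF D.M.vec N.M.vec bimod_homD(2)[OF assms(2)]]
        vlin_zero[OF D.M.vec N.M.vec bimod_homD(2)[OF assms(3)]] by simp
  next
    case (gen i a b)
    then show ?case using gen_closed[of i] assms(4)[of i]
      by (simp add: bimod_homD(3,4)[OF assms(2)] bimod_homD(3,4)[OF assms(3)])
  next
    case (add x y)
    then show ?case by (simp add: vlinD(2)[OF bimod_homD(2)[OF assms(2)]] vlinD(2)[OF bimod_homD(2)[OF assms(3)]])
  qed
qed

text \<open>The map is the sum of the component maps \<open>phom\<close>. The two equations on
  \<open>w i\<close> place it where the image of a generator fixed by these idempotents has to
  lie.\<close>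

lemma hom_exists:
  assumes "bim A N" and w: "\<And>i. i \<in> I ==> w i \<in> carrier N"
    and ew: "\<And>i. i \<in> I ==> lact N (e i) (w i) = w i" "\<And>i. i \<in> I ==> ract N (w i) (e' i) = w i"
  shows "\<exists>f\<in>bimod_hom A D N. \<forall>i\<in>I. f (gen i) = w i"
proof -
  interpret N: bim A N by fact
  define t where "t = (\<lambda>i. idem_pair.phom N (w i))"
  have tv: "vlin (M i) N (t i)" if "i \<in> I" for i
    unfolding t_def by (rule idem_pair.vlin_phom[OF idem_pair[OF that] assms(1) w[OF that]])
  have tl: "t i (lact (M i) a X) = lact N a (t i X)" and tr: "t i (ract (M i) X a) = ract N (t i X) a"
    if "i \<in> I" "a \<in> carrier A" "X \<in> carrier (M i)" for i a X
    unfolding t_def using idem_pair.phom_lact[OF idem_pair[OF that(1)] assms(1) w[OF that(1)] that(2,3)]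
      idem_pair.phom_ract[OF idem_pair[OF that(1)] assms(1) w[OF that(1)] that(2,3)] by auto
  have tz: "t i \<zero>\<^bsub>M i\<^esub> = \<zero>\<^bsub>N\<^esub>" if "i \<in> I" for i
    using vlin_zero[OF _ N.M.vec tv[OF that]] bim_M[OF that] by (simp add: bim_def)
  have cl: "x i \<in> carrier (M i)" if "x \<in> carrier D" "i \<in> I" for x i
    using that unfolding carrier_D by auto
  have tc: "(\<lambda>i. t i (x i)) \<in> I \<rightarrow> carrier N" if "x \<in> carrier D" for x
    using vlinD(1)[OF tv cl[OF that]] by auto
  define F where "F = (\<lambda>x. \<Oplus>\<^bsub>N\<^esub>i\<in>I. t i (x i))"
  have Fv: "vlin D N F"
  proof (rule vlinI)
    fix x y c assume x: "x \<in> carrier D"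
    show "F x \<in> carrier N" unfolding F_def by (rule N.M.finsum_closed[OF tc[OF x]])
    have "F (c \<odot>\<^bsub>D\<^esub> x) = (\<Oplus>\<^bsub>N\<^esub>i\<in>I. c \<odot>\<^bsub>N\<^esub> t i (x i))"
      unfolding F_def direct_sum_simps
      by (rule N.M.add.finprod_cong'[OF refl])
        (use tc[OF x] in \<open>auto simp: vlinD(3)[OF tv cl[OF x]] Pi_iff\<close>)
    also have "\<dots> = c \<odot>\<^bsub>N\<^esub> F x" unfolding F_def by (rule N.M.smult_finsum[OF tc[OF x], symmetric])
    finally show "F (c \<odot>\<^bsub>D\<^esub> x) = c \<odot>\<^bsub>N\<^esub> F x" .
    assume y: "y \<in> carrier D"
    have "F (x \<oplus>\<^bsub>D\<^esub> y) = (\<Oplus>\<^bsub>N\<^esub>i\<in>I. t i (x i) \<oplus>\<^bsub>N\<^esub> t i (y i))"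
      unfolding F_def direct_sum_simps
      by (rule N.M.add.finprod_cong'[OF refl])
        (use tc[OF x] tc[OF y] in \<open>auto simp: vlinD(2)[OF tv cl[OF x] cl[OF y]] Pi_iff\<close>)
    also have "\<dots> = F x \<oplus>\<^bsub>N\<^esub> F y" unfolding F_def by (rule N.M.finsum_addf[OF tc[OF x] tc[OF y]])
    finally show "F (x \<oplus>\<^bsub>D\<^esub> y) = F x \<oplus>\<^bsub>N\<^esub> F y" .
  qed
  have Fl: "F (lact D a x) = lact N a (F x)" if "a \<in> carrier A" "x \<in> carrier D" for a x
  proof -
    have "F (lact D a x) = (\<Oplus>\<^bsub>N\<^esub>i\<in>I. lact N a (t i (x i)))"
      unfolding F_def direct_sum_simps
      by (rule N.M.add.finprod_cong'[OF refl])
        (use tc[OF that(2)] that(1) in \<open>auto simp: tl[OF _ _ cl[OF that(2)]] Pi_iff\<close>)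
    also have "\<dots> = lact N a (F x)"
      unfolding F_def by (rule vlin_finsum[OF N.M.vec N.M.vec N.vlin_lact tc, symmetric]) (fact that)+
    finally show ?thesis .
  qed
  have Fr: "F (ract D x a) = ract N (F x) a" if "a \<in> carrier A" "x \<in> carrier D" for a x
  proof -
    have "F (ract D x a) = (\<Oplus>\<^bsub>N\<^esub>i\<in>I. ract N (t i (x i)) a)"
      unfolding F_def direct_sum_simps
      by (rule N.M.add.finprod_cong'[OF refl])
        (use tc[OF that(2)] that(1) in \<open>auto simp: tr[OF _ _ cl[OF that(2)]] Pi_iff\<close>)
    also have "\<dots> = ract N (F x) a"
      unfolding F_def by (rule vlin_finsum[OF N.M.vec N.M.vec N.vlin_ract tc, symmetric]) (fact that)+
    finally show ?thesis .
  qed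
  have Fg: "F (gen i) = w i" if i: "i \<in> I" for i
  proof -
    have "F (gen i) = (\<Oplus>\<^bsub>N\<^esub>j\<in>I. if i = j then w j else \<zero>\<^bsub>N\<^esub>)"
      unfolding F_def gen_def inj_at_def
    proof (rule N.M.add.finprod_cong'[OF refl])
      show "(\<lambda>j. if i = j then w j else \<zero>\<^bsub>N\<^esub>) \<in> I \<rightarrow> carrier N" using w by auto
      fix j assume j: "j \<in> I"
      have "t i (proj_gen A (e i) (e' i)) = w i"
        unfolding t_def by (rule idem_pair.phom_gen[OF idem_pair[OF i] assms(1) w[OF i] ew(1)[OF i] ew(2)[OF i]])
      then show "t j ((\<lambda>j\<in>I. if j = i then proj_gen A (e i) (e' i) else \<zero>\<^bsub>M j\<^esub>) j) =
          (if i = j then w j else \<zero>\<^bsub>N\<^esub>)"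
        using j tz[OF j] by (cases "i = j") auto
    qed
    also have "\<dots> = w i"
      by (rule N.M.add.finprod_singleton[OF i fin]) (use w in auto)
    finally show ?thesis .
  qed
  show ?thesis
  proof (rule bexI)
    show "(\<lambda>x\<in>carrier D. F x) \<in> bimod_hom A D N"
      by (rule bimod_hom_restrictI[OF bim_D Fv]) (erule (1) Fl, erule (1) Fr)
  qed (simp add: Fg gen_closed)
qed

end

section \<open>Lifting of chain maps\<close>

text \<open>Projectivity enters as the two lifting properties \<open>lift_aug\<close> and
  \<open>lift_bdry\<close>, the form in which the comparison of chain maps uses it and in which the
  generators will deliver it.\<close>

locale lifting_complex =
  fixes A :: "('k::field, 'a) module" and Q :: "('k, 'a, 'x) aug_complex"
  assumes bimP: "\<And>n. bim A (obj Q n)"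
    and bdry: "\<And>n. bdry Q (Suc n) \<in> bimod_hom A (obj Q (Suc n)) (obj Q n)"
    and aug: "aug Q \<in> bimod_hom A (obj Q 0) (regular_bimod A)"
    and exact_aug: "\<And>x. x \<in> carrier (obj Q 0) ==>
      aug Q x = \<zero>\<^bsub>A\<^esub> \<longleftrightarrow> x \<in> bdry Q (Suc 0) ` carrier (obj Q (Suc 0))"
    and exact: "\<And>n x. x \<in> carrier (obj Q (Suc n)) ==>
      bdry Q (Suc n) x = \<zero>\<^bsub>obj Q n\<^esub> \<longleftrightarrow> x \<in> bdry Q (Suc (Suc n)) ` carrier (obj Q (Suc (Suc n)))"
    and lift_aug: "\<And>n f. f \<in> bimod_hom A (obj Q n) (regular_bimod A) ==>
      \<exists>h\<in>bimod_hom A (obj Q n) (obj Q 0). \<forall>x\<in>carrier (obj Q n). aug Q (h x) = f x"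
    and lift_bdry: "\<And>n k f. f \<in> bimod_hom A (obj Q n) (obj Q k) ==>
      (\<And>x. x \<in> carrier (obj Q n) ==> f x \<in> bdry Q (Suc k) ` carrier (obj Q (Suc k))) ==>
      \<exists>h\<in>bimod_hom A (obj Q n) (obj Q (Suc k)). \<forall>x\<in>carrier (obj Q n). bdry Q (Suc k) (h x) = f x"
begin

abbreviation "P \<equiv> obj Q"
abbreviation "C n \<equiv> carrier (P n)"
abbreviation "d \<equiv> bdry Q"
abbreviation "H n k \<equiv> bimod_hom A (P n) (P k)"
abbreviation "HA n \<equiv> bimod_hom A (P n) (regular_bimod A)"
abbreviation "Z n \<equiv> carrier (cocycles A Q n)"
abbreviation "B n \<equiv> coboundaries A Q n"

lemma kalg_A: "kalg A" using bimP[of 0] by (simp add: bim_def)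

sublocale A: kalg A by (rule kalg_A)

lemma bimR: "bim A (regular_bimod A)" by (rule bim_regular[OF kalg_A])

lemma vecP: "vec (P n)" using bimP[of n] by (simp add: bim_def)
lemma vecR: "vec (regular_bimod A)" using bimR by (simp add: bim_def)

lemma Z_def: "Z n = {f \<in> HA n. \<forall>x\<in>C (Suc n). f (d (Suc n) x) = \<zero>\<^bsub>A\<^esub>}"
  by (simp add: cocycles_def)

lemma Z_HA: "f \<in> Z n ==> f \<in> HA n" by (simp add: Z_def)
lemma Z_d: "f \<in> Z n ==> x \<in> C (Suc n) ==> f (d (Suc n) x) = \<zero>\<^bsub>A\<^esub>" by (simp add: Z_def)
lemma Z_I: "f \<in> HA n ==> (\<And>x. x \<in> C (Suc n) ==> f (d (Suc n) x) = \<zero>\<^bsub>A\<^esub>) ==> f \<in> Z n" by (simp add: Z_def)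

lemma d_closed: "x \<in> C (Suc n) ==> d (Suc n) x \<in> C n"
  by (rule bimod_hom_closed[OF bdry])

lemma dd: "x \<in> C (Suc (Suc n)) ==> d (Suc n) (d (Suc (Suc n)) x) = \<zero>\<^bsub>P n\<^esub>"
  using exact[OF d_closed] by blast

lemma aug_d: "x \<in> C (Suc 0) ==> aug Q (d (Suc 0) x) = \<zero>\<^bsub>A\<^esub>"
  using exact_aug[OF d_closed] by blast

lemma H_zero: "f \<in> H n k ==> f \<zero>\<^bsub>P n\<^esub> = \<zero>\<^bsub>P k\<^esub>"
  by (rule vlin_zero[OF vecP vecP bimod_homD(2)])

lemma HA_zero: "f \<in> HA n ==> f \<zero>\<^bsub>P n\<^esub> = \<zero>\<^bsub>A\<^esub>"
proof -
  assume "f \<in> HA n"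
  from vlin_zero[OF vecP vecR bimod_homD(2)[OF this]] show ?thesis by simp
qed

lemma HA_add: "f \<in> HA n ==> x \<in> C n ==> y \<in> C n ==> f (x \<oplus>\<^bsub>P n\<^esub> y) = f x \<oplus>\<^bsub>A\<^esub> f y"
proof -
  assume f: "f \<in> HA n" and "x \<in> C n" "y \<in> C n"
  from vlinD(2)[OF bimod_homD(2)[OF f] this(2,3)] show ?thesis by simp
qed

lemma HA_closed: "f \<in> HA n ==> x \<in> C n ==> f x \<in> carrier A"
proof -
  assume f: "f \<in> HA n" and "x \<in> C n"
  from bimod_hom_closed[OF f this(2)] show ?thesis by simp
qed

lemma H_comp: "f \<in> H n k ==> g \<in> H k l ==> compose (C n) g f \<in> H n l"
  by (rule bimod_hom_comp[OF bimP])

lemma HA_comp: "f \<in> H n k ==> g \<in> HA k ==> compose (C n) g f \<in> HA n"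
  by (rule bimod_hom_comp[OF bimP])

lemma H_diff:
  assumes "f \<in> H n k" "g \<in> H n k" shows "(\<lambda>x\<in>C n. f x \<ominus>\<^bsub>P k\<^esub> g x) \<in> H n k"
proof -
  interpret Pk: bim A "P k" by (rule bimP)
  have "(\<lambda>x\<in>C n. f x \<ominus>\<^bsub>P k\<^esub> g x) = (\<lambda>x\<in>C n. f x \<oplus>\<^bsub>P k\<^esub> (\<lambda>x\<in>C n. (- 1) \<odot>\<^bsub>P k\<^esub> g x) x)"
    by (rule restrict_ext) (simp add: Pk.M.minus_eq Pk.M.smult_minus_one bimod_hom_closed[OF assms(2)])
  then show ?thesis using bimod_hom_add[OF bimP bimP assms(1) bimod_hom_smult[OF bimP bimP assms(2)]] by simp
qed

lemma vec_cocycles: "vec (cocycles A Q n)"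
proof -
  interpret V: vec "hom_space A (P n) (regular_bimod A)" by (rule vec_hom_space[OF bimP bimR])
  have "subspace (Z n) (hom_space A (P n) (regular_bimod A))"
  proof (rule V.subspaceI)
    show "\<zero>\<^bsub>hom_space A (P n) (regular_bimod A)\<^esub> \<in> Z n"
      using V.zero_closed by (auto intro!: Z_I simp: d_closed)
    fix f g c assume f: "f \<in> Z n"
    show "c \<odot>\<^bsub>hom_space A (P n) (regular_bimod A)\<^esub> f \<in> Z n"
      using V.smult_closed[of f c] Z_HA[OF f] by (auto intro!: Z_I simp: d_closed Z_d[OF f])
    assume g: "g \<in> Z n"
    show "f \<oplus>\<^bsub>hom_space A (P n) (regular_bimod A)\<^esub> g \<in> Z n"
      using V.a_closed[of f g] Z_HA[OF f] Z_HA[OF g]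
      by (auto intro!: Z_I simp: d_closed Z_d[OF f] Z_d[OF g])
  qed (auto simp: Z_def)
  from V.subspace_vec[OF this] show ?thesis by (simp add: cocycles_def)
qed

lemma cocycles_simps:
  "zero (cocycles A Q n) = (\<lambda>x\<in>C n. \<zero>\<^bsub>A\<^esub>)"
  "add (cocycles A Q n) = (\<lambda>f g. \<lambda>x\<in>C n. f x \<oplus>\<^bsub>A\<^esub> g x)"
  "smult (cocycles A Q n) = (\<lambda>c f. \<lambda>x\<in>C n. c \<odot>\<^bsub>A\<^esub> f x)"
  by (simp_all add: cocycles_def)

lemma Z_minus:
  assumes "f \<in> Z n" "g \<in> Z n" shows "f \<ominus>\<^bsub>cocycles A Q n\<^esub> g = (\<lambda>x\<in>C n. f x \<ominus>\<^bsub>A\<^esub> g x)"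
proof -
  interpret V: vec "cocycles A Q n" by (rule vec_cocycles)
  have "f \<ominus>\<^bsub>cocycles A Q n\<^esub> g = f \<oplus>\<^bsub>cocycles A Q n\<^esub> ((- 1) \<odot>\<^bsub>cocycles A Q n\<^esub> g)"
    using assms by (simp add: V.minus_eq V.smult_minus_one)
  also have "\<dots> = (\<lambda>x\<in>C n. f x \<ominus>\<^bsub>A\<^esub> g x)"
    unfolding cocycles_simps
    by (rule restrict_ext) (simp add: A.minus_eq A.smult_minus_one HA_closed[OF Z_HA[OF assms(2)]])
  finally show ?thesis .
qed

lemma B_zero: "(\<lambda>x\<in>C n. \<zero>\<^bsub>A\<^esub>) \<in> B n"
proof (cases n)
  case 0 then show ?thesis by (simp add: coboundaries_def cocycles_simps)
next
  case (Suc k)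
  have "(\<lambda>x\<in>C k. \<zero>\<^bsub>A\<^esub>) \<in> HA k" using bimod_hom_zero[OF bimP[of k] bimR] by simp
  moreover have "(\<lambda>x\<in>C n. \<zero>\<^bsub>A\<^esub>) = compose (C n) (\<lambda>x\<in>C k. \<zero>\<^bsub>A\<^esub>) (d n)"
    unfolding compose_def Suc by (rule restrict_ext) (simp add: d_closed)
  ultimately show ?thesis unfolding Suc by (auto simp: coboundaries_def)
qed

lemma B_0: "f \<in> B 0 \<longleftrightarrow> f = (\<lambda>x\<in>C 0. \<zero>\<^bsub>A\<^esub>)"
  by (simp add: coboundaries_def cocycles_simps)

lemma B_Suc: "f \<in> B (Suc k) \<longleftrightarrow> (\<exists>g\<in>HA k. f = compose (C (Suc k)) g (d (Suc k)))"
  by (auto simp: coboundaries_def)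

lemma compose_d_Z: "g \<in> HA k ==> compose (C (Suc k)) g (d (Suc k)) \<in> Z (Suc k)"
  by (rule Z_I[OF HA_comp[OF bdry]]) (auto simp: compose_eq d_closed dd HA_zero)

lemma B_sub_Z: "f \<in> B n ==> f \<in> Z n"
proof (cases n)
  case 0
  interpret V: vec "cocycles A Q n" by (rule vec_cocycles)
  assume "f \<in> B n" then show ?thesis using V.zero_closed 0 by (simp add: B_0 cocycles_simps)
next
  case (Suc k) assume "f \<in> B n" then show ?thesis using compose_d_Z by (auto simp: B_Suc Suc)
qed

lemma vec_sub_B: "vec_sub (cocycles A Q n) (B n)"
proof (intro vec_sub.intro vec_sub_axioms.intro vec_cocycles vec.subspaceI)
  show "B n \<subseteq> Z n" using B_sub_Z by blast
  show "\<zero>\<^bsub>cocycles A Q n\<^esub> \<in> B n" by (simp add: cocycles_simps B_zero)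
  fix f g c assume f: "f \<in> B n"
  show "c \<odot>\<^bsub>cocycles A Q n\<^esub> f \<in> B n"
  proof (cases n)
    case 0
    then show ?thesis using f unfolding 0 B_0 cocycles_simps by (auto intro!: restrict_ext)
  next
    case (Suc k)
    obtain f' where f': "f' \<in> HA k" "f = compose (C n) f' (d n)" using f unfolding Suc B_Suc by blast
    have "(\<lambda>x\<in>C k. c \<odot>\<^bsub>A\<^esub> f' x) \<in> HA k" using bimod_hom_smult[OF bimP bimR f'(1), of c] by simp
    moreover have "c \<odot>\<^bsub>cocycles A Q n\<^esub> f = compose (C n) (\<lambda>x\<in>C k. c \<odot>\<^bsub>A\<^esub> f' x) (d n)"
      unfolding cocycles_simps f'(2) compose_def Suc by (rule restrict_ext) (simp add: d_closed)
    ultimately show ?thesis unfolding Suc B_Suc by blast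
  qed
  assume g: "g \<in> B n"
  show "f \<oplus>\<^bsub>cocycles A Q n\<^esub> g \<in> B n"
  proof (cases n)
    case 0
    then show ?thesis using f g unfolding 0 B_0 cocycles_simps by (auto intro!: restrict_ext)
  next
    case (Suc k)
    obtain f' where f': "f' \<in> HA k" "f = compose (C n) f' (d n)" using f unfolding Suc B_Suc by blast
    obtain g' where g': "g' \<in> HA k" "g = compose (C n) g' (d n)" using g unfolding Suc B_Suc by blast
    have "(\<lambda>x\<in>C k. f' x \<oplus>\<^bsub>A\<^esub> g' x) \<in> HA k" using bimod_hom_add[OF bimP bimR f'(1) g'(1)] by simp
    moreover have "f \<oplus>\<^bsub>cocycles A Q n\<^esub> g = compose (C n) (\<lambda>x\<in>C k. f' x \<oplus>\<^bsub>A\<^esub> g' x) (d n)"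
      unfolding cocycles_simps f'(2) g'(2) compose_def Suc by (rule restrict_ext) (simp add: d_closed)
    ultimately show ?thesis unfolding Suc B_Suc by blast
  qed
qed

text \<open>\<open>chain_lifts\<close> without reference to a cocycle, so that differences and
  composites can be handled before it is settled what they lift.\<close>

definition cmap :: "nat => (nat => 'x => 'x) => bool" where
  "cmap q L \<longleftrightarrow> (\<forall>k. L k \<in> H (q + k) k) \<and>
     (\<forall>k. \<forall>x\<in>C (Suc (q + k)). d (Suc k) (L (Suc k) x) = L k (d (Suc (q + k)) x))"

lemma chain_lifts_iff: "L \<in> chain_lifts A Q q g \<longleftrightarrow> cmap q L \<and> (\<forall>x\<in>C q. aug Q (L 0 x) = g x)"
  by (auto simp: chain_lifts_def cmap_def)

lemma cmapD:
  assumes "cmap q L"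
  shows "L k \<in> H (q + k) k" "x \<in> C (Suc (q + k)) ==> d (Suc k) (L (Suc k) x) = L k (d (Suc (q + k)) x)"
    "x \<in> C (q + k) ==> L k x \<in> C k"
  using assms bimod_hom_closed[of "L k" A "P (q + k)" "P k" x] by (auto simp: cmap_def)

lemma lifts_exist:
  assumes g: "g \<in> Z q" shows "\<exists>L. L \<in> chain_lifts A Q q g"
proof -
  \<comment> \<open>The last clause is what the next step needs: on boundaries \<open>h\<close>
    takes values in the image of the differential, so \<open>h\<close> after the differential can be
    lifted.\<close>
  define R where "R = (\<lambda>k h. h \<in> H (q + k) k \<and> (k = 0 \<longrightarrow> (\<forall>x\<in>C q. aug Q (h x) = g x)) \<and>
      (\<forall>x\<in>C (Suc (q + k)). h (d (Suc (q + k)) x) \<in> d (Suc k) ` C (Suc k)))"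
  define S where "S = (\<lambda>k h h'. \<forall>x\<in>C (Suc (q + k)). d (Suc k) (h' x) = h (d (Suc (q + k)) x))"
  have "\<exists>L. \<forall>k. R k (L k) \<and> S k (L k) (L (Suc k))"
  proof (rule dependent_nat_choice)
    obtain h where h: "h \<in> H q 0" "\<forall>x\<in>C q. aug Q (h x) = g x" using lift_aug[OF Z_HA[OF g]] by blast
    have "h (d (Suc q) x) \<in> d (Suc 0) ` C (Suc 0)" if "x \<in> C (Suc q)" for x
    proof -
      have "aug Q (h (d (Suc q) x)) = \<zero>\<^bsub>A\<^esub>" using h(2) d_closed[OF that] Z_d[OF g that] by simp
      then show ?thesis using exact_aug[OF bimod_hom_closed[OF h(1) d_closed[OF that]]] by simp
    qed
    then show "\<exists>h. R 0 h" unfolding R_def using h by (intro exI[of _ h]) simp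
  next
    fix h k assume "R k h"
    then have h: "h \<in> H (q + k) k" "\<And>x. x \<in> C (Suc (q + k)) ==> h (d (Suc (q + k)) x) \<in> d (Suc k) ` C (Suc k)"
      by (auto simp: R_def)
    have hd: "compose (C (Suc (q + k))) h (d (Suc (q + k))) \<in> H (Suc (q + k)) k" by (rule H_comp[OF bdry h(1)])
    obtain h' where h': "h' \<in> H (Suc (q + k)) (Suc k)"
      "\<forall>x\<in>C (Suc (q + k)). d (Suc k) (h' x) = compose (C (Suc (q + k))) h (d (Suc (q + k))) x"
      using lift_bdry[OF hd] h(2) by (auto simp: compose_eq)
    have s: "d (Suc k) (h' x) = h (d (Suc (q + k)) x)" if "x \<in> C (Suc (q + k))" for x
      using h'(2) that by (simp add: compose_eq)
    have "h' (d (Suc (Suc (q + k))) x) \<in> d (Suc (Suc k)) ` C (Suc (Suc k))" if "x \<in> C (Suc (Suc (q + k)))" for x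
    proof -
      have "d (Suc k) (h' (d (Suc (Suc (q + k))) x)) = \<zero>\<^bsub>P k\<^esub>"
        using s[OF d_closed[OF that]] dd[OF that] H_zero[OF h(1)] by simp
      then show ?thesis using exact[OF bimod_hom_closed[OF h'(1) d_closed[OF that]]] by simp
    qed
    then show "\<exists>h'. R (Suc k) h' \<and> S k h h'"
      unfolding R_def S_def using h'(1) s by (intro exI[of _ h']) simp
  qed
  then show ?thesis unfolding chain_lifts_iff cmap_def R_def S_def by (metis add_0_right)
qed

text \<open>Each \<open>s (Suc k)\<close> is a lift of \<open>L (Suc k)\<close> minus
  \<open>s k\<close> after the differential. In degree 0 the condition on the augmentation puts
  \<open>L 0\<close> into the image of the differential.\<close>

lemma homotopy_exists:
  assumes L: "cmap q L" and z: "\<And>x. x \<in> C q ==> aug Q (L 0 x) = \<zero>\<^bsub>A\<^esub>"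
  shows "\<exists>s. (\<forall>k. s k \<in> H (q + k) (Suc k)) \<and> (\<forall>x\<in>C q. L 0 x = d (Suc 0) (s 0 x)) \<and>
    (\<forall>k. \<forall>x\<in>C (Suc (q + k)). L (Suc k) x = s k (d (Suc (q + k)) x) \<oplus>\<^bsub>P (Suc k)\<^esub> d (Suc (Suc k)) (s (Suc k) x))"
proof -
  \<comment> \<open>The last clause says that \<open>L k\<close> and the differential after
    \<open>s\<close> agree on boundaries; it makes the next difference a cycle.\<close>
  define R where "R = (\<lambda>k s. s \<in> H (q + k) (Suc k) \<and> (k = 0 \<longrightarrow> (\<forall>x\<in>C q. L 0 x = d (Suc 0) (s x))) \<and>
      (\<forall>x\<in>C (Suc (q + k)). d (Suc k) (s (d (Suc (q + k)) x)) = L k (d (Suc (q + k)) x)))"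
  define S where "S = (\<lambda>k s s'. \<forall>x\<in>C (Suc (q + k)).
      L (Suc k) x = s (d (Suc (q + k)) x) \<oplus>\<^bsub>P (Suc k)\<^esub> d (Suc (Suc k)) (s' x))"
  have "\<exists>s. \<forall>k. R k (s k) \<and> S k (s k) (s (Suc k))"
  proof (rule dependent_nat_choice)
    have L0: "L 0 \<in> H q 0" using cmapD(1)[OF L, of 0] by simp
    have "L 0 x \<in> d (Suc 0) ` C (Suc 0)" if "x \<in> C q" for x
      using z[OF that] exact_aug[OF bimod_hom_closed[OF L0 that]] by simp
    then obtain h where h: "h \<in> H q (Suc 0)" "\<forall>x\<in>C q. d (Suc 0) (h x) = L 0 x"
      using lift_bdry[OF L0] by blast
    then show "\<exists>h. R 0 h" unfolding R_def by (intro exI[of _ h]) (simp add: d_closed)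
  next
    fix s k assume "R k s"
    then have s: "s \<in> H (q + k) (Suc k)" "\<And>x. x \<in> C (Suc (q + k)) ==> d (Suc k) (s (d (Suc (q + k)) x)) = L k (d (Suc (q + k)) x)"
      by (auto simp: R_def)
    interpret Pk: bim A "P (Suc k)" by (rule bimP)
    interpret Pk0: bim A "P k" by (rule bimP)
    let ?n = "Suc (q + k)"
    have sd: "compose (C ?n) s (d ?n) \<in> H ?n (Suc k)" by (rule H_comp[OF bdry s(1)])
    have Lk: "L (Suc k) \<in> H ?n (Suc k)" using cmapD(1)[OF L, of "Suc k"] by simp
    define f where "f = (\<lambda>x\<in>C ?n. L (Suc k) x \<ominus>\<^bsub>P (Suc k)\<^esub> compose (C ?n) s (d ?n) x)"
    have f: "f \<in> H ?n (Suc k)" unfolding f_def by (rule H_diff[OF Lk sd])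
    have fx: "f x = L (Suc k) x \<ominus>\<^bsub>P (Suc k)\<^esub> s (d ?n x)" if "x \<in> C ?n" for x
      using that by (simp add: f_def compose_eq)
    have cl: "L (Suc k) x \<in> C (Suc k)" "s (d ?n x) \<in> C (Suc k)" if "x \<in> C ?n" for x
      using bimod_hom_closed[OF Lk that] bimod_hom_closed[OF s(1) d_closed[OF that]] by auto
    have "f x \<in> d (Suc (Suc k)) ` C (Suc (Suc k))" if x: "x \<in> C ?n" for x
    proof -
      have "d (Suc k) (f x) = d (Suc k) (L (Suc k) x) \<ominus>\<^bsub>P k\<^esub> d (Suc k) (s (d ?n x))"
        unfolding fx[OF x] by (rule vlin_diff[OF vecP vecP bimod_homD(2)[OF bdry] cl[OF x]])
      also have "\<dots> = \<zero>\<^bsub>P k\<^esub>"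
        using cmapD(2)[OF L x] s(2)[OF x] bimod_hom_closed[OF cmapD(1)[OF L, of k] d_closed[OF x]]
        by (simp add: Pk0.M.minus_zero_iff)
      finally show ?thesis using exact[OF bimod_hom_closed[OF f x]] by simp
    qed
    then obtain h where h: "h \<in> H ?n (Suc (Suc k))" "\<forall>x\<in>C ?n. d (Suc (Suc k)) (h x) = f x"
      using lift_bdry[OF f] by blast
    have S1: "L (Suc k) x = s (d ?n x) \<oplus>\<^bsub>P (Suc k)\<^esub> d (Suc (Suc k)) (h x)" if x: "x \<in> C ?n" for x
    proof -
      have "s (d ?n x) \<oplus>\<^bsub>P (Suc k)\<^esub> d (Suc (Suc k)) (h x) = s (d ?n x) \<oplus>\<^bsub>P (Suc k)\<^esub> (L (Suc k) x \<ominus>\<^bsub>P (Suc k)\<^esub> s (d ?n x))"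
        using h(2) x fx[OF x] by simp
      also have "\<dots> = L (Suc k) x"
        using cl[OF x] by (simp add: Pk.M.minus_eq Pk.M.a_lcomm Pk.M.r_neg)
      finally show ?thesis by simp
    qed
    have "d (Suc (Suc k)) (h (d (Suc ?n) x)) = L (Suc k) (d (Suc ?n) x)" if x: "x \<in> C (Suc ?n)" for x
    proof -
      have "s (d ?n (d (Suc ?n) x)) = \<zero>\<^bsub>P (Suc k)\<^esub>" using dd[OF x] H_zero[OF s(1)] by simp
      then show ?thesis
        using S1[OF d_closed[OF x]] d_closed[OF bimod_hom_closed[OF h(1) d_closed[OF x]]] by simp
    qed
    then show "\<exists>h. R (Suc k) h \<and> S k s h"
      unfolding R_def S_def using h(1) S1 by (intro exI[of _ h]) simp
  qed
  then obtain s where "\<And>k. R k (s k)" "\<And>k. S k (s k) (s (Suc k))" by blast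
  then show ?thesis unfolding R_def S_def by (intro exI[of _ s]) (metis add_0_right)
qed

lemma comp_Z:
  assumes f: "f \<in> Z n" and L: "cmap p L" shows "compose (C (p + n)) f (L n) \<in> Z (p + n)"
proof (rule Z_I[OF HA_comp[OF cmapD(1)[OF L] Z_HA[OF f]]])
  fix x assume x: "x \<in> C (Suc (p + n))"
  have "L (Suc n) x \<in> C (Suc n)" using cmapD(3)[OF L, of x "Suc n"] x by simp
  then show "compose (C (p + n)) f (L n) (d (Suc (p + n)) x) = \<zero>\<^bsub>A\<^esub>"
    using cmapD(2)[OF L x] Z_d[OF f] d_closed[OF x] by (simp add: compose_eq flip: cmapD(2)[OF L x])
qed

text \<open>With a null homotopy \<open>s\<close> the cocycle \<open>f\<close> kills the part
  \<open>d s\<close> and leaves \<open>f s\<close> after the differential. In degree 0 only the part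
  \<open>d s\<close> is present, and the composite vanishes.\<close>

lemma comp_zero_lift:
  assumes f: "f \<in> Z n" and L: "cmap p L" and z: "\<And>x. x \<in> C p ==> aug Q (L 0 x) = \<zero>\<^bsub>A\<^esub>"
  shows "compose (C (p + n)) f (L n) \<in> B (p + n)"
proof -
  obtain s where s: "\<And>k. s k \<in> H (p + k) (Suc k)" "\<And>x. x \<in> C p ==> L 0 x = d (Suc 0) (s 0 x)"
    "\<And>k x. x \<in> C (Suc (p + k)) ==> L (Suc k) x = s k (d (Suc (p + k)) x) \<oplus>\<^bsub>P (Suc k)\<^esub> d (Suc (Suc k)) (s (Suc k) x)"
    using homotopy_exists[OF L z] by blast
  show ?thesis
  proof (cases n)
    case 0
    have "compose (C p) f (L 0) = (\<lambda>x\<in>C p. \<zero>\<^bsub>A\<^esub>)"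
      unfolding compose_def
      by (rule restrict_ext) (use s(2) Z_d[OF f[unfolded 0]] bimod_hom_closed[OF s(1)[of 0]] in auto)
    then show ?thesis using B_zero[of p] 0 by simp
  next
    case (Suc k)
    have g: "compose (C (p + k)) f (s k) \<in> HA (p + k)" by (rule HA_comp[OF s(1) Z_HA[OF f[unfolded Suc]]])
    have "compose (C (Suc (p + k))) f (L (Suc k)) =
        compose (C (Suc (p + k))) (compose (C (p + k)) f (s k)) (d (Suc (p + k)))"
      unfolding compose_def[of "C (Suc (p + k))"]
    proof (rule restrict_ext)
      fix x assume x: "x \<in> C (Suc (p + k))"
      have h: "s (Suc k) x \<in> C (Suc (Suc k))" using bimod_hom_closed[OF s(1)[of "Suc k"]] x by simp
      have h2: "s k (d (Suc (p + k)) x) \<in> C (Suc k)" by (rule bimod_hom_closed[OF s(1) d_closed[OF x]])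
      have "f (L (Suc k) x) = f (s k (d (Suc (p + k)) x)) \<oplus>\<^bsub>A\<^esub> f (d (Suc (Suc k)) (s (Suc k) x))"
        unfolding s(3)[OF x] by (rule HA_add[OF Z_HA[OF f[unfolded Suc]] h2 d_closed[OF h]])
      then show "f (L (Suc k) x) = compose (C (p + k)) f (s k) (d (Suc (p + k)) x)"
        using Z_d[OF f[unfolded Suc] h] d_closed[OF x] HA_closed[OF Z_HA[OF f[unfolded Suc]] h2]
        by (simp add: compose_eq)
    qed
    then show ?thesis using g unfolding Suc add_Suc_right B_Suc by blast
  qed
qed

text \<open>If \<open>f = g d\<close>, moving the chain map past the differential exhibits the
  composite as the coboundary of \<open>g\<close> after the chain map.\<close>

lemma comp_coboundary_left:
  assumes f: "f \<in> B n" and L: "cmap p L" shows "compose (C (p + n)) f (L n) \<in> B (p + n)"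
proof (cases n)
  case 0
  then have "compose (C p) f (L 0) = (\<lambda>x\<in>C p. \<zero>\<^bsub>A\<^esub>)"
    using f cmapD(3)[OF L, of _ 0] unfolding compose_def by (auto intro!: restrict_ext simp: B_0)
  then show ?thesis using B_zero[of p] 0 by simp
next
  case (Suc k)
  obtain g where g: "g \<in> HA k" "f = compose (C n) g (d n)" using f unfolding Suc B_Suc by blast
  have "compose (C (Suc (p + k))) f (L (Suc k)) =
      compose (C (Suc (p + k))) (compose (C (p + k)) g (L k)) (d (Suc (p + k)))"
    unfolding compose_def[of "C (Suc (p + k))"]
  proof (rule restrict_ext)
    fix x assume x: "x \<in> C (Suc (p + k))"
    have "L (Suc k) x \<in> C (Suc k)" using cmapD(3)[OF L, of x "Suc k"] x by simp
    then show "f (L (Suc k) x) = compose (C (p + k)) g (L k) (d (Suc (p + k)) x)"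
      unfolding g(2) Suc using cmapD(2)[OF L x] d_closed[OF x] by (simp add: compose_eq)
  qed
  then show ?thesis using HA_comp[OF cmapD(1)[OF L, of k] g(1)] unfolding Suc add_Suc_right B_Suc by blast
qed

text \<open>Write \<open>g = g' d\<close> and lift \<open>g'\<close> to \<open>s\<close> through the
  augmentation. Subtracting \<open>s d\<close> from \<open>L 0\<close> gives a map that augments to
  zero and still starts a chain map because \<open>d d = 0\<close>. Higher components are untouched;
  for \<open>n = 0\<close> the correction \<open>f s d\<close> is itself a coboundary.\<close>

lemma comp_coboundary_right:
  assumes f: "f \<in> Z n" and L: "L \<in> chain_lifts A Q p g" and g: "g \<in> B p"
  shows "compose (C (p + n)) f (L n) \<in> B (p + n)"
proof (cases p)
  case 0
  then show ?thesis using comp_zero_lift[OF f, of p L] L g by (simp add: chain_lifts_iff B_0)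
next
  case (Suc p')
  have cm: "cmap p L" and aL: "\<And>x. x \<in> C p ==> aug Q (L 0 x) = g x" using L by (auto simp: chain_lifts_iff)
  obtain g' where g': "g' \<in> HA p'" "g = compose (C p) g' (d p)" using g unfolding Suc B_Suc by blast
  obtain s where s: "s \<in> H p' 0" "\<And>x. x \<in> C p' ==> aug Q (s x) = g' x" using lift_aug[OF g'(1)] by blast
  have dp: "d p \<in> H p p'" unfolding Suc by (rule bdry)
  have sd: "compose (C p) s (d p) \<in> H p 0" by (rule H_comp[OF dp s(1)])
  have L0: "L 0 \<in> H p 0" using cmapD(1)[OF cm, of 0] by simp
  interpret P0: bim A "P 0" by (rule bimP)
  define M0 where "M0 = (\<lambda>x\<in>C p. L 0 x \<ominus>\<^bsub>P 0\<^esub> compose (C p) s (d p) x)"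
  have M0: "M0 \<in> H p 0" unfolding M0_def by (rule H_diff[OF L0 sd])
  have cl: "L 0 x \<in> C 0" "s (d p x) \<in> C 0" if "x \<in> C p" for x
    using bimod_hom_closed[OF L0 that] bimod_hom_closed[OF s(1) bimod_hom_closed[OF dp that]] by auto
  have M0x: "M0 x = L 0 x \<ominus>\<^bsub>P 0\<^esub> s (d p x)" if "x \<in> C p" for x
    using that by (simp add: M0_def compose_eq)
  define M where "M = (\<lambda>k. if k = 0 then M0 else L k)"
  have cM: "cmap p M"
    unfolding cmap_def
  proof (intro conjI allI ballI)
    fix k show "M k \<in> H (p + k) k" using M0 cmapD(1)[OF cm, of k] by (simp add: M_def)
    fix x assume x: "x \<in> C (Suc (p + k))"
    show "d (Suc k) (M (Suc k) x) = M k (d (Suc (p + k)) x)"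
    proof (cases k)
      case 0
      have dx: "d (Suc p) x \<in> C p" using d_closed x 0 by simp
      have "s (d p (d (Suc p) x)) = \<zero>\<^bsub>P 0\<^esub>" using dd[of x p'] x 0 H_zero[OF s(1)] by (simp add: Suc)
      then have "M0 (d (Suc p) x) = L 0 (d (Suc p) x)"
        using M0x[OF dx] cl(1)[OF dx] by (simp add: P0.M.minus_eq)
      then show ?thesis using cmapD(2)[OF cm x] 0 by (simp add: M_def)
    next
      case (Suc l) then show ?thesis using cmapD(2)[OF cm x] by (simp add: M_def)
    qed
  qed
  have aM: "aug Q (M 0 x) = \<zero>\<^bsub>A\<^esub>" if x: "x \<in> C p" for x
  proof -
    \<comment> \<open>Subtraction in \<open>regular_bimod A\<close> unfolds to the same term as in
      \<open>A\<close>: the definition of the inverse sees only carrier, addition and zero.\<close>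
    have "aug Q (M0 x) = aug Q (L 0 x) \<ominus>\<^bsub>A\<^esub> aug Q (s (d p x))"
      using vlin_diff[OF vecP vecR bimod_homD(2)[OF aug] cl[OF x]] M0x[OF x] by (simp add: a_minus_def a_inv_def m_inv_def)
    also have "\<dots> = g x \<ominus>\<^bsub>A\<^esub> g x"
      using aL[OF x] s(2)[OF bimod_hom_closed[OF dp x]] x by (simp add: g'(2) compose_eq)
    also have "\<dots> = \<zero>\<^bsub>A\<^esub>"
      using HA_closed[OF Z_HA[OF B_sub_Z[OF g]] x] by (simp add: A.minus_zero_iff)
    finally show ?thesis by (simp add: M_def)
  qed
  note 1 = comp_zero_lift[OF f cM aM]
  show ?thesis
  proof (cases n)
    case 0
    interpret Bp: vec_sub "cocycles A Q p" "B p" by (rule vec_sub_B)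
    have fH: "f \<in> HA 0" using Z_HA[OF f] 0 by simp
    have fsd: "compose (C p) (compose (C p') f s) (d p) \<in> B p"
      using HA_comp[OF s(1) fH] unfolding Suc B_Suc by blast
    have "compose (C p) f (M 0) \<oplus>\<^bsub>cocycles A Q p\<^esub> compose (C p) (compose (C p') f s) (d p) \<in> B p"
      using Bp.subspaceD(3)[OF Bp.sub _ fsd] 1 0 by simp
    moreover have "compose (C p) f (M 0) \<oplus>\<^bsub>cocycles A Q p\<^esub> compose (C p) (compose (C p') f s) (d p) = compose (C p) f (L 0)"
      unfolding cocycles_simps compose_def[of "C p"]
    proof (rule restrict_ext)
      fix x assume x: "x \<in> C p"
      have "f (M 0 x) \<oplus>\<^bsub>A\<^esub> f (s (d p x)) = f ((L 0 x \<ominus>\<^bsub>P 0\<^esub> s (d p x)) \<oplus>\<^bsub>P 0\<^esub> s (d p x))"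
        using HA_add[OF fH P0.M.minus_closed[OF cl[OF x]] cl(2)[OF x]] M0x[OF x] by (simp add: M_def)
      also have "\<dots> = f (L 0 x)" using cl[OF x] by (simp add: P0.M.minus_eq P0.M.a_assoc P0.M.l_neg)
      finally show "(\<lambda>x\<in>C p. f (M 0 x)) x \<oplus>\<^bsub>A\<^esub> (\<lambda>x\<in>C p. compose (C p') f s (d p x)) x = f (L 0 x)"
        using x bimod_hom_closed[OF dp x] by (simp add: compose_eq)
    qed
    ultimately show ?thesis using 0 by simp
  next
    case (Suc k) then show ?thesis using 1 by (simp add: M_def)
  qed
qed

end

section \<open>The ring of Hochschild classes\<close>

text \<open>For the associativity of the convolution product: with \<open>k = i + j\<close>, summing
  a triangle by columns instead of rows regroups the triple products around the other pair of
  factors.\<close>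

lemma (in abelian_monoid) finsum_triangle:
  fixes n :: nat and T :: "nat => nat => 'a"
  assumes T: "\<And>j k. j \<le> k ==> k \<le> n ==> T j k \<in> carrier G"
  shows "(\<Oplus>k\<in>{..n}. \<Oplus>j\<in>{..k}. T j k) = (\<Oplus>j\<in>{..n}. \<Oplus>i\<in>{..n - j}. T j (i + j))"
  using T
proof (induct n)
  case 0 then show ?case by simp
next
  case (Suc n)
  have c1: "(\<lambda>j. T j k) \<in> {..k} \<rightarrow> carrier G" if "k \<le> Suc n" for k using Suc.prems that by auto
  have c2: "(\<lambda>i. T j (i + j)) \<in> {..N - j} \<rightarrow> carrier G" if "j \<le> N" "N \<le> Suc n" for j N
    using Suc.prems that by auto
  have IH: "(\<Oplus>k\<in>{..n}. \<Oplus>j\<in>{..k}. T j k) = (\<Oplus>j\<in>{..n}. \<Oplus>i\<in>{..n - j}. T j (i + j))"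
    using Suc by auto
  have cl: "(\<lambda>j. \<Oplus>i\<in>{..n - j}. T j (i + j)) \<in> {..n} \<rightarrow> carrier G"
    using c2[of _ n] by (auto intro!: finsum_closed)
  have cT: "(\<lambda>j. T j (Suc n)) \<in> {..n} \<rightarrow> carrier G" using Suc.prems by auto
  have "(\<Oplus>k\<in>{..Suc n}. \<Oplus>j\<in>{..k}. T j k) = (\<Oplus>j\<in>{..Suc n}. T j (Suc n)) \<oplus> (\<Oplus>k\<in>{..n}. \<Oplus>j\<in>{..k}. T j k)"
    by (rule finsum_Suc) (use c1 in \<open>auto intro!: finsum_closed\<close>)
  also have "(\<Oplus>j\<in>{..Suc n}. T j (Suc n)) = T (Suc n) (Suc n) \<oplus> (\<Oplus>j\<in>{..n}. T j (Suc n))"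
    by (rule finsum_Suc) (use c1[of "Suc n"] in auto)
  also have "(T (Suc n) (Suc n) \<oplus> (\<Oplus>j\<in>{..n}. T j (Suc n))) \<oplus> (\<Oplus>k\<in>{..n}. \<Oplus>j\<in>{..k}. T j k) =
      T (Suc n) (Suc n) \<oplus> ((\<Oplus>j\<in>{..n}. T j (Suc n)) \<oplus> (\<Oplus>j\<in>{..n}. \<Oplus>i\<in>{..n - j}. T j (i + j)))"
    unfolding IH using Suc.prems[of "Suc n" "Suc n"] finsum_closed[OF cl] finsum_closed[OF cT] by (simp add: a_assoc)
  also have "(\<Oplus>j\<in>{..n}. T j (Suc n)) \<oplus> (\<Oplus>j\<in>{..n}. \<Oplus>i\<in>{..n - j}. T j (i + j)) =
      (\<Oplus>j\<in>{..n}. T j (Suc n) \<oplus> (\<Oplus>i\<in>{..n - j}. T j (i + j)))"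
    by (rule finsum_addf[OF cT cl, symmetric])
  also have "\<dots> = (\<Oplus>j\<in>{..n}. \<Oplus>i\<in>{..Suc n - j}. T j (i + j))"
  proof (rule add.finprod_cong'[OF refl])
    show "(\<lambda>j. \<Oplus>i\<in>{..Suc n - j}. T j (i + j)) \<in> {..n} \<rightarrow> carrier G"
      using c2[of _ "Suc n"] by (auto intro!: finsum_closed)
    fix j assume j: "j \<in> {..n}"
    then have e: "Suc n - j = Suc (n - j)" by auto
    have "(\<Oplus>i\<in>{..Suc (n - j)}. T j (i + j)) = T j (Suc (n - j) + j) \<oplus> (\<Oplus>i\<in>{..n - j}. T j (i + j))"
      by (rule finsum_Suc) (use c2[of j "Suc n"] j e in auto)
    then show "T j (Suc n) \<oplus> (\<Oplus>i\<in>{..n - j}. T j (i + j)) = (\<Oplus>i\<in>{..Suc n - j}. T j (i + j))"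
      unfolding e using j by simp
  qed
  also have "T (Suc n) (Suc n) \<oplus> \<dots> = (\<Oplus>j\<in>{..Suc n}. \<Oplus>i\<in>{..Suc n - j}. T j (i + j))"
  proof -
    have "(\<Oplus>j\<in>{..Suc n}. \<Oplus>i\<in>{..Suc n - j}. T j (i + j)) =
        (\<Oplus>i\<in>{..Suc n - Suc n}. T (Suc n) (i + Suc n)) \<oplus> (\<Oplus>j\<in>{..n}. \<Oplus>i\<in>{..Suc n - j}. T j (i + j))"
      by (rule finsum_Suc) (use c2[of _ "Suc n"] in \<open>auto intro!: finsum_closed\<close>)
    then show ?thesis using Suc.prems[of "Suc n" "Suc n"] by simp
  qed
  finally show ?case .
qed

context lifting_complex begin

abbreviation "Ext n \<equiv> Ext_grp A Q n"
abbreviation "cls n f \<equiv> Ext_class A Q n f"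

sublocale B: vec_sub "cocycles A Q n" "coboundaries A Q n" for n by (rule vec_sub_B)

lemma vec_Ext: "vec (Ext n)" unfolding Ext_grp_def by (rule B.quot_vec)

sublocale E: vec "Ext n" for n by (rule vec_Ext)

lemma carrier_Ext: "carrier (Ext n) = cls n ` Z n"
  by (simp add: Ext_grp_def carrier_quot Ext_class_def image_def)

lemma cls_closed: "f \<in> Z n ==> cls n f \<in> carrier (Ext n)" by (simp add: carrier_Ext)

lemma Ext_cases:
  assumes "X \<in> carrier (Ext n)" obtains f where "f \<in> Z n" "X = cls n f"
  using assms unfolding carrier_Ext by blast

lemma cls_add: "f \<in> Z n ==> g \<in> Z n ==> cls n f \<oplus>\<^bsub>Ext n\<^esub> cls n g = cls n (\<lambda>x\<in>C n. f x \<oplus>\<^bsub>A\<^esub> g x)"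
  using B.quot_add[of f n g] by (simp add: Ext_grp_def Ext_class_def cocycles_simps)

lemma cls_smult: "f \<in> Z n ==> c \<odot>\<^bsub>Ext n\<^esub> cls n f = cls n (\<lambda>x\<in>C n. c \<odot>\<^bsub>A\<^esub> f x)"
  using B.quot_smult[of f n c] by (simp add: Ext_grp_def Ext_class_def cocycles_simps)

lemma cls_eq_iff: "f \<in> Z n ==> g \<in> Z n ==> cls n f = cls n g \<longleftrightarrow> (\<lambda>x\<in>C n. f x \<ominus>\<^bsub>A\<^esub> g x) \<in> B n"
  by (simp add: Ext_class_def B.coset_eq_iff Z_minus)

lemma mem_cls_iff: "f \<in> Z n ==> g \<in> cls n f \<longleftrightarrow> g \<in> Z n \<and> cls n g = cls n f"
  by (simp add: Ext_class_def B.mem_coset_iff)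

lemma Ext_zero: "\<zero>\<^bsub>Ext n\<^esub> = cls n (\<lambda>x\<in>C n. \<zero>\<^bsub>A\<^esub>)"
  using B.quot_zero[of n] by (simp add: Ext_grp_def Ext_class_def cocycles_simps)

lemma Z_zero: "(\<lambda>x\<in>C n. \<zero>\<^bsub>A\<^esub>) \<in> Z n" using B_sub_Z[OF B_zero] .

lemma Z_add: "f \<in> Z n ==> g \<in> Z n ==> (\<lambda>x\<in>C n. f x \<oplus>\<^bsub>A\<^esub> g x) \<in> Z n"
  using B.a_closed[of f n g] by (simp add: cocycles_simps)

lemma Z_smult: "f \<in> Z n ==> (\<lambda>x\<in>C n. c \<odot>\<^bsub>A\<^esub> f x) \<in> Z n"
  using B.smult_closed[of f n c] by (simp add: cocycles_simps)

lemma cmap_diff: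
  assumes L: "cmap q L" and M: "cmap q M"
  shows "cmap q (\<lambda>k. \<lambda>x\<in>C (q + k). L k x \<ominus>\<^bsub>P k\<^esub> M k x)"
  unfolding cmap_def
proof (intro conjI allI ballI)
  fix k
  show "(\<lambda>x\<in>C (q + k). L k x \<ominus>\<^bsub>P k\<^esub> M k x) \<in> H (q + k) k" by (rule H_diff[OF cmapD(1)[OF L] cmapD(1)[OF M]])
  fix x assume x: "x \<in> C (Suc (q + k))"
  have "d (Suc k) (L (Suc k) x \<ominus>\<^bsub>P (Suc k)\<^esub> M (Suc k) x) = d (Suc k) (L (Suc k) x) \<ominus>\<^bsub>P k\<^esub> d (Suc k) (M (Suc k) x)"
    by (rule vlin_diff[OF vecP vecP bimod_homD(2)[OF bdry]]) (use cmapD(3)[OF L, of x "Suc k"] cmapD(3)[OF M, of x "Suc k"] x in auto)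
  then show "d (Suc k) ((\<lambda>x\<in>C (q + Suc k). L (Suc k) x \<ominus>\<^bsub>P (Suc k)\<^esub> M (Suc k) x) x) =
      (\<lambda>x\<in>C (q + k). L k x \<ominus>\<^bsub>P k\<^esub> M k x) (d (Suc (q + k)) x)"
    using x d_closed[OF x] cmapD(2)[OF L x] cmapD(2)[OF M x] by simp
qed

lemma aug_diff:
  assumes "x \<in> C 0" "y \<in> C 0" shows "aug Q (x \<ominus>\<^bsub>P 0\<^esub> y) = aug Q x \<ominus>\<^bsub>A\<^esub> aug Q y"
  using vlin_diff[OF vecP vecR bimod_homD(2)[OF aug] assms] by (simp add: a_minus_def a_inv_def m_inv_def)

text \<open>A change of \<open>f\<close> is harmless by \<open>comp_coboundary_left\<close>. Then
  \<open>L' - L\<close> lifts \<open>g' - g\<close>, so \<open>comp_coboundary_right\<close> covers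
  a change of \<open>g\<close> and of the lift together; hence the union over all choices
  collapses.\<close>

lemma yoneda_cls:
  assumes f: "f \<in> Z n" and g: "g \<in> Z p" and L: "L \<in> chain_lifts A Q p g"
  shows "yoneda A Q n p (cls n f) (cls p g) = cls (p + n) (compose (C (p + n)) f (L n))"
proof -
  have cL: "cmap p L" using L by (simp add: chain_lifts_iff)
  have key: "cls (p + n) (compose (C (p + n)) f' (L' n)) = cls (p + n) (compose (C (p + n)) f (L n))"
    if f': "f' \<in> cls n f" and g': "g' \<in> cls p g" and L': "L' \<in> chain_lifts A Q p g'" for f' g' L'
  proof -
    have fZ: "f' \<in> Z n" and fB: "(\<lambda>x\<in>C n. f' x \<ominus>\<^bsub>A\<^esub> f x) \<in> B n"
      using f' mem_cls_iff[OF f] cls_eq_iff[OF _ f] by auto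
    have gZ: "g' \<in> Z p" and gB: "(\<lambda>x\<in>C p. g' x \<ominus>\<^bsub>A\<^esub> g x) \<in> B p"
      using g' mem_cls_iff[OF g] cls_eq_iff[OF _ g] by auto
    have cL': "cmap p L'" using L' by (simp add: chain_lifts_iff)
    interpret Pn: bim A "P n" by (rule bimP)
    note clL = cmapD(3)[OF cL, of _ n] and clL' = cmapD(3)[OF cL', of _ n]
    have 1: "compose (C (p + n)) (\<lambda>x\<in>C n. f' x \<ominus>\<^bsub>A\<^esub> f x) (L' n) \<in> B (p + n)"
      by (rule comp_coboundary_left[OF fB cL'])
    have "compose (C (p + n)) (\<lambda>x\<in>C n. f' x \<ominus>\<^bsub>A\<^esub> f x) (L' n) =
       (\<lambda>x\<in>C (p + n). compose (C (p + n)) f' (L' n) x \<ominus>\<^bsub>A\<^esub> compose (C (p + n)) f (L' n) x)"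
      unfolding compose_def[of "C (p + n)" "\<lambda>x\<in>C n. f' x \<ominus>\<^bsub>A\<^esub> f x"]
      by (rule restrict_ext) (simp add: clL' compose_eq)
    with 1 have a: "cls (p + n) (compose (C (p + n)) f' (L' n)) = cls (p + n) (compose (C (p + n)) f (L' n))"
      using cls_eq_iff[OF comp_Z[OF fZ cL'] comp_Z[OF f cL']] by simp
    have "(\<lambda>k. \<lambda>x\<in>C (p + k). L' k x \<ominus>\<^bsub>P k\<^esub> L k x) \<in> chain_lifts A Q p (\<lambda>x\<in>C p. g' x \<ominus>\<^bsub>A\<^esub> g x)"
      unfolding chain_lifts_iff
    proof (intro conjI ballI cmap_diff cL cL')
      fix x assume x: "x \<in> C p"
      have "L' 0 x \<in> C 0" "L 0 x \<in> C 0" using cmapD(3)[OF cL, of x 0] cmapD(3)[OF cL', of x 0] x by auto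
      then show "aug Q ((\<lambda>x\<in>C (p + 0). L' 0 x \<ominus>\<^bsub>P 0\<^esub> L 0 x) x) = (\<lambda>x\<in>C p. g' x \<ominus>\<^bsub>A\<^esub> g x) x"
        using aug_diff[of "L' 0 x" "L 0 x"] L L' x by (simp add: chain_lifts_iff)
    qed
    from comp_coboundary_right[OF f this gB]
    have 2: "compose (C (p + n)) f (\<lambda>x\<in>C (p + n). L' n x \<ominus>\<^bsub>P n\<^esub> L n x) \<in> B (p + n)" .
    have "compose (C (p + n)) f (\<lambda>x\<in>C (p + n). L' n x \<ominus>\<^bsub>P n\<^esub> L n x) =
       (\<lambda>x\<in>C (p + n). compose (C (p + n)) f (L' n) x \<ominus>\<^bsub>A\<^esub> compose (C (p + n)) f (L n) x)"
      unfolding compose_def[of "C (p + n)" f "\<lambda>x\<in>C (p + n). L' n x \<ominus>\<^bsub>P n\<^esub> L n x"]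
    proof (rule restrict_ext)
      fix x assume x: "x \<in> C (p + n)"
      have "f (L' n x \<ominus>\<^bsub>P n\<^esub> L n x) = f (L' n x) \<ominus>\<^bsub>regular_bimod A\<^esub> f (L n x)"
        by (rule vlin_diff[OF vecP vecR bimod_homD(2)[OF Z_HA[OF f]] clL'[OF x] clL[OF x]])
      then show "f ((\<lambda>x\<in>C (p + n). L' n x \<ominus>\<^bsub>P n\<^esub> L n x) x) =
          compose (C (p + n)) f (L' n) x \<ominus>\<^bsub>A\<^esub> compose (C (p + n)) f (L n) x"
        using x by (simp add: compose_eq a_minus_def a_inv_def m_inv_def)
    qed
    with 2 have "cls (p + n) (compose (C (p + n)) f (L' n)) = cls (p + n) (compose (C (p + n)) f (L n))"
      using cls_eq_iff[OF comp_Z[OF f cL'] comp_Z[OF f cL]] by simp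
    with a show ?thesis by simp
  qed
  have ne: "f \<in> cls n f" "g \<in> cls p g" using f g by (simp_all add: mem_cls_iff)
  show ?thesis
    unfolding yoneda_def
  proof (rule equalityI; rule subsetI)
    fix z assume "z \<in> (\<Union>f\<in>cls n f. \<Union>g\<in>cls p g. \<Union>L\<in>chain_lifts A Q p g. cls (p + n) (compose (C (p + n)) f (L n)))"
    then show "z \<in> cls (p + n) (compose (C (p + n)) f (L n))" using key by (elim UN_E) simp
  next
    fix z assume "z \<in> cls (p + n) (compose (C (p + n)) f (L n))"
    then show "z \<in> (\<Union>f\<in>cls n f. \<Union>g\<in>cls p g. \<Union>L\<in>chain_lifts A Q p g. cls (p + n) (compose (C (p + n)) f (L n)))"
      by (intro UN_I[OF ne(1)] UN_I[OF ne(2)] UN_I[OF L])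
  qed
qed

abbreviation "Y \<equiv> yoneda A Q"

lemma Y_closed:
  assumes "X \<in> carrier (Ext n)" "U \<in> carrier (Ext p)" shows "Y n p X U \<in> carrier (Ext (p + n))"
proof -
  obtain f where f: "f \<in> Z n" "X = cls n f" using assms(1) by (rule Ext_cases)
  obtain g where g: "g \<in> Z p" "U = cls p g" using assms(2) by (rule Ext_cases)
  obtain L where L: "L \<in> chain_lifts A Q p g" using lifts_exist[OF g(1)] by blast
  have "cmap p L" using L by (simp add: chain_lifts_iff)
  from comp_Z[OF f(1) this] show ?thesis
    unfolding f(2) g(2) yoneda_cls[OF f(1) g(1) L] by (rule cls_closed)
qed

lemma vlin_Y_left:
  assumes "U \<in> carrier (Ext p)" shows "vlin (Ext n) (Ext (p + n)) (\<lambda>X. Y n p X U)"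
proof (rule vlinI)
  obtain g where g: "g \<in> Z p" "U = cls p g" using assms by (rule Ext_cases)
  obtain L where L: "L \<in> chain_lifts A Q p g" using lifts_exist[OF g(1)] by blast
  have cL: "cmap p L" using L by (simp add: chain_lifts_iff)
  note cl = cmapD(3)[OF cL, of _ n]
  fix X c assume X: "X \<in> carrier (Ext n)"
  then show "Y n p X U \<in> carrier (Ext (p + n))" by (rule Y_closed[OF _ assms])
  obtain f where f: "f \<in> Z n" "X = cls n f" using X by (rule Ext_cases)
  note y = yoneda_cls[OF _ g(1) L]
  have "compose (C (p + n)) (\<lambda>x\<in>C n. c \<odot>\<^bsub>A\<^esub> f x) (L n) = (\<lambda>x\<in>C (p + n). c \<odot>\<^bsub>A\<^esub> compose (C (p + n)) f (L n) x)"
    unfolding compose_def[of "C (p + n)" "\<lambda>x\<in>C n. c \<odot>\<^bsub>A\<^esub> f x"] by (rule restrict_ext) (simp add: cl compose_eq)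
  then show "Y n p (c \<odot>\<^bsub>Ext n\<^esub> X) U = c \<odot>\<^bsub>Ext (p + n)\<^esub> Y n p X U"
    unfolding f(2) g(2) cls_smult[OF f(1)] y[OF f(1)] y[OF Z_smult[OF f(1)]] cls_smult[OF comp_Z[OF f(1) cL]] by simp
  fix X' assume X': "X' \<in> carrier (Ext n)"
  obtain f' where f': "f' \<in> Z n" "X' = cls n f'" using X' by (rule Ext_cases)
  have "compose (C (p + n)) (\<lambda>x\<in>C n. f x \<oplus>\<^bsub>A\<^esub> f' x) (L n) =
     (\<lambda>x\<in>C (p + n). compose (C (p + n)) f (L n) x \<oplus>\<^bsub>A\<^esub> compose (C (p + n)) f' (L n) x)"
    unfolding compose_def[of "C (p + n)" "\<lambda>x\<in>C n. f x \<oplus>\<^bsub>A\<^esub> f' x"] by (rule restrict_ext) (simp add: cl compose_eq)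
  then show "Y n p (X \<oplus>\<^bsub>Ext n\<^esub> X') U = Y n p X U \<oplus>\<^bsub>Ext (p + n)\<^esub> Y n p X' U"
    unfolding f(2) f'(2) g(2) cls_add[OF f(1) f'(1)] y[OF f(1)] y[OF f'(1)] y[OF Z_add[OF f(1) f'(1)]]
      cls_add[OF comp_Z[OF f(1) cL] comp_Z[OF f'(1) cL]] by simp
qed

text \<open>Multiples and sums of chosen lifts are lifts of the multiples and sums of
  cocycles.\<close>

lemma vlin_Y_right:
  assumes "X \<in> carrier (Ext n)" shows "vlin (Ext p) (Ext (p + n)) (\<lambda>U. Y n p X U)"
proof (rule vlinI)
  obtain f where f: "f \<in> Z n" "X = cls n f" using assms by (rule Ext_cases)
  interpret Pn: bim A "P n" by (rule bimP)
  note fv = bimod_homD(2)[OF Z_HA[OF f(1)]]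
  fix U c assume U: "U \<in> carrier (Ext p)"
  then show "Y n p X U \<in> carrier (Ext (p + n))" by (rule Y_closed[OF assms])
  obtain g where g: "g \<in> Z p" "U = cls p g" using U by (rule Ext_cases)
  obtain L where L: "L \<in> chain_lifts A Q p g" using lifts_exist[OF g(1)] by blast
  have cL: "cmap p L" using L by (simp add: chain_lifts_iff)
  have lin: "vlin (P i) (P j) h ==> x \<in> C i ==> c \<odot>\<^bsub>P j\<^esub> h x = h (c \<odot>\<^bsub>P i\<^esub> x)" for h i j x
    by (simp add: vlinD(3))
  let ?M = "\<lambda>k. \<lambda>x\<in>C (p + k). c \<odot>\<^bsub>P k\<^esub> L k x"
  have M: "?M \<in> chain_lifts A Q p (\<lambda>x\<in>C p. c \<odot>\<^bsub>A\<^esub> g x)"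
    unfolding chain_lifts_iff cmap_def
  proof (intro conjI allI ballI)
    fix k show "?M k \<in> H (p + k) k" by (rule bimod_hom_smult[OF bimP bimP cmapD(1)[OF cL]])
    fix x assume x: "x \<in> C (Suc (p + k))"
    have "L (Suc k) x \<in> C (Suc k)" using cmapD(3)[OF cL, of x "Suc k"] x by simp
    from vlinD(3)[OF bimod_homD(2)[OF bdry] this]
    show "d (Suc k) (?M (Suc k) x) = ?M k (d (Suc (p + k)) x)"
      using x d_closed[OF x] cmapD(2)[OF cL x] by simp
  next
    fix x assume x: "x \<in> C p"
    have "L 0 x \<in> C 0" using cmapD(3)[OF cL, of x 0] x by simp
    from vlinD(3)[OF bimod_homD(2)[OF aug] this]
    show "aug Q (?M 0 x) = (\<lambda>x\<in>C p. c \<odot>\<^bsub>A\<^esub> g x) x" using x L by (simp add: chain_lifts_iff)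
  qed
  have "compose (C (p + n)) f (?M n) = (\<lambda>x\<in>C (p + n). c \<odot>\<^bsub>A\<^esub> compose (C (p + n)) f (L n) x)"
    unfolding compose_def[of "C (p + n)" f "?M n"]
    by (rule restrict_ext) (use vlinD(3)[OF fv cmapD(3)[OF cL]] in \<open>simp add: compose_eq\<close>)
  then show "Y n p X (c \<odot>\<^bsub>Ext p\<^esub> U) = c \<odot>\<^bsub>Ext (p + n)\<^esub> Y n p X U"
    unfolding f(2) g(2) cls_smult[OF g(1)] yoneda_cls[OF f(1) g(1) L] yoneda_cls[OF f(1) Z_smult[OF g(1)] M]
      cls_smult[OF comp_Z[OF f(1) cL]] by simp
  fix U' assume U': "U' \<in> carrier (Ext p)"
  obtain g' where g': "g' \<in> Z p" "U' = cls p g'" using U' by (rule Ext_cases)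
  obtain L' where L': "L' \<in> chain_lifts A Q p g'" using lifts_exist[OF g'(1)] by blast
  have cL': "cmap p L'" using L' by (simp add: chain_lifts_iff)
  let ?N = "\<lambda>k. \<lambda>x\<in>C (p + k). L k x \<oplus>\<^bsub>P k\<^esub> L' k x"
  have N: "?N \<in> chain_lifts A Q p (\<lambda>x\<in>C p. g x \<oplus>\<^bsub>A\<^esub> g' x)"
    unfolding chain_lifts_iff cmap_def
  proof (intro conjI allI ballI)
    fix k show "?N k \<in> H (p + k) k" by (rule bimod_hom_add[OF bimP bimP cmapD(1)[OF cL] cmapD(1)[OF cL']])
    fix x assume x: "x \<in> C (Suc (p + k))"
    have "L (Suc k) x \<in> C (Suc k)" "L' (Suc k) x \<in> C (Suc k)"
      using cmapD(3)[OF cL, of x "Suc k"] cmapD(3)[OF cL', of x "Suc k"] x by auto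
    from vlinD(2)[OF bimod_homD(2)[OF bdry] this]
    show "d (Suc k) (?N (Suc k) x) = ?N k (d (Suc (p + k)) x)"
      using x d_closed[OF x] cmapD(2)[OF cL x] cmapD(2)[OF cL' x] by simp
  next
    fix x assume x: "x \<in> C p"
    have "L 0 x \<in> C 0" "L' 0 x \<in> C 0" using cmapD(3)[OF cL, of x 0] cmapD(3)[OF cL', of x 0] x by auto
    from vlinD(2)[OF bimod_homD(2)[OF aug] this]
    show "aug Q (?N 0 x) = (\<lambda>x\<in>C p. g x \<oplus>\<^bsub>A\<^esub> g' x) x" using x L L' by (simp add: chain_lifts_iff)
  qed
  have "compose (C (p + n)) f (?N n) =
     (\<lambda>x\<in>C (p + n). compose (C (p + n)) f (L n) x \<oplus>\<^bsub>A\<^esub> compose (C (p + n)) f (L' n) x)"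
    unfolding compose_def[of "C (p + n)" f "?N n"]
    by (rule restrict_ext) (use vlinD(2)[OF fv cmapD(3)[OF cL] cmapD(3)[OF cL']] in \<open>simp add: compose_eq\<close>)
  then show "Y n p X (U \<oplus>\<^bsub>Ext p\<^esub> U') = Y n p X U \<oplus>\<^bsub>Ext (p + n)\<^esub> Y n p X U'"
    unfolding f(2) g(2) g'(2) cls_add[OF g(1) g'(1)] yoneda_cls[OF f(1) g(1) L] yoneda_cls[OF f(1) g'(1) L']
      yoneda_cls[OF f(1) Z_add[OF g(1) g'(1)] N] cls_add[OF comp_Z[OF f(1) cL] comp_Z[OF f(1) cL']] by simp
qed

lemma cmap_comp:
  assumes L: "cmap p L" and M: "cmap q M"
  shows "cmap (q + p) (\<lambda>k. compose (C (q + p + k)) (L k) (M (p + k)))"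
  unfolding cmap_def
proof (intro conjI allI ballI)
  fix k
  have M': "M (p + k) \<in> H (q + p + k) (p + k)" using cmapD(1)[OF M, of "p + k"] by (simp add: add.assoc)
  show "compose (C (q + p + k)) (L k) (M (p + k)) \<in> H (q + p + k) k" by (rule H_comp[OF M' cmapD(1)[OF L]])
  fix x assume x: "x \<in> C (Suc (q + p + k))"
  have M2: "M (Suc (p + k)) x \<in> C (Suc (p + k))" using cmapD(3)[OF M, of x "Suc (p + k)"] x by (simp add: add.assoc)
  have M1: "d (Suc (p + k)) (M (Suc (p + k)) x) = M (p + k) (d (Suc (q + p + k)) x)"
    using cmapD(2)[OF M, of x "p + k"] x by (simp add: add.assoc)
  have "d (Suc k) (L (Suc k) (M (Suc (p + k)) x)) = L k (d (Suc (p + k)) (M (Suc (p + k)) x))"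
    by (rule cmapD(2)[OF L M2])
  then show "d (Suc k) (compose (C (q + p + Suc k)) (L (Suc k)) (M (p + Suc k)) x) =
      compose (C (q + p + k)) (L k) (M (p + k)) (d (Suc (q + p + k)) x)"
    using x d_closed[OF x] M1 by (simp add: compose_eq)
qed

text \<open>A lift of \<open>g\<close> composed with a shifted lift of \<open>h\<close> lifts the
  cocycle that represents their product. With this choice the two sides are the same cochain, not
  merely the same class.\<close>

lemma Y_assoc:
  assumes "X \<in> carrier (Ext n)" "U \<in> carrier (Ext p)" "W \<in> carrier (Ext q)"
  shows "Y n (q + p) X (Y p q U W) = Y (p + n) q (Y n p X U) W"
proof -
  obtain f where f: "f \<in> Z n" "X = cls n f" using assms(1) by (rule Ext_cases)
  obtain g where g: "g \<in> Z p" "U = cls p g" using assms(2) by (rule Ext_cases)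
  obtain h where h: "h \<in> Z q" "W = cls q h" using assms(3) by (rule Ext_cases)
  obtain L where L: "L \<in> chain_lifts A Q p g" using lifts_exist[OF g(1)] by blast
  obtain M where M: "M \<in> chain_lifts A Q q h" using lifts_exist[OF h(1)] by blast
  have cL: "cmap p L" and cM: "cmap q M" using L M by (auto simp: chain_lifts_iff)
  let ?N = "\<lambda>k. compose (C (q + p + k)) (L k) (M (p + k))"
  have N: "?N \<in> chain_lifts A Q (q + p) (compose (C (q + p)) g (M p))"
    unfolding chain_lifts_iff
  proof (intro conjI ballI cmap_comp cL cM)
    fix x assume x: "x \<in> C (q + p)"
    then show "aug Q (?N 0 x) = compose (C (q + p)) g (M p) x"
      using L cmapD(3)[OF cM x] by (simp add: chain_lifts_iff compose_eq)
  qed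
  have "compose (C (q + p + n)) f (?N n) = compose (C (q + (p + n))) (compose (C (p + n)) f (L n)) (M (p + n))"
    unfolding compose_def[of "C (q + p + n)"] compose_def[of "C (q + (p + n))"] add.assoc
  proof (rule restrict_ext)
    fix x assume x: "x \<in> C (q + (p + n))"
    then show "f ((\<lambda>x\<in>C (q + (p + n)). L n (M (p + n) x)) x) = compose (C (p + n)) f (L n) (M (p + n) x)"
      using cmapD(3)[OF cM x] by (simp add: compose_eq)
  qed
  then show ?thesis
    unfolding f(2) g(2) h(2) yoneda_cls[OF g(1) h(1) M] yoneda_cls[OF f(1) g(1) L]
      yoneda_cls[OF f(1) comp_Z[OF g(1) cM] N] yoneda_cls[OF comp_Z[OF f(1) cL] h(1) M]
    by (simp add: add.assoc)
qed

lemma aug_Z: "aug Q \<in> Z 0" by (rule Z_I[OF aug aug_d])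

text \<open>The identity is a lift of the augmentation.\<close>

lemma Y_one_right:
  assumes "X \<in> carrier (Ext n)" shows "Y n 0 X (cls 0 (aug Q)) = X"
proof -
  obtain f where f: "f \<in> Z n" "X = cls n f" using assms by (rule Ext_cases)
  have L: "(\<lambda>k. \<lambda>x\<in>C k. x) \<in> chain_lifts A Q 0 (aug Q)"
    unfolding chain_lifts_iff cmap_def by (auto simp: bimod_hom_id[OF bimP] d_closed)
  have "compose (C n) f (\<lambda>x\<in>C n. x) = f"
    by (rule extensionalityI[of _ "C n"]) (auto simp: compose_eq compose_def bimod_homD(1)[OF Z_HA[OF f(1)]])
  then show ?thesis unfolding f(2) yoneda_cls[OF f(1) aug_Z L] by simp
qed

lemma Y_one_left:
  assumes "U \<in> carrier (Ext p)" shows "Y 0 p (cls 0 (aug Q)) U = U"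
proof -
  obtain g where g: "g \<in> Z p" "U = cls p g" using assms by (rule Ext_cases)
  obtain L where L: "L \<in> chain_lifts A Q p g" using lifts_exist[OF g(1)] by blast
  have "compose (C p) (aug Q) (L 0) = g"
    by (rule extensionalityI[of _ "C p"])
      (use L in \<open>auto simp: chain_lifts_iff compose_eq compose_def bimod_homD(1)[OF Z_HA[OF g(1)]]\<close>)
  then show ?thesis unfolding g(2) yoneda_cls[OF aug_Z g(1) L] by simp
qed

abbreviation "HHr \<equiv> HH A Q"

lemma HH_simps:
  "carrier HHr = {h. (\<forall>n. h n \<in> carrier (Ext n)) \<and> finite {n. h n \<noteq> \<zero>\<^bsub>Ext n\<^esub>}}"
  "zero HHr = (\<lambda>n. \<zero>\<^bsub>Ext n\<^esub>)"
  "add HHr = (\<lambda>h h' n. h n \<oplus>\<^bsub>Ext n\<^esub> h' n)"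
  "smult HHr = (\<lambda>c h n. c \<odot>\<^bsub>Ext n\<^esub> h n)"
  "one HHr = in_degree A Q 0 (cls 0 (aug Q))"
  "mult HHr = (\<lambda>h h' n. \<Oplus>\<^bsub>Ext n\<^esub>k\<in>{..n}. Y k (n - k) (h k) (h' (n - k)))"
  by (simp_all add: HH_def)

lemma HH_closed: "h \<in> carrier HHr ==> h n \<in> carrier (Ext n)" by (simp add: HH_simps)

lemma HH_I: "(\<And>n. h n \<in> carrier (Ext n)) ==> (\<And>n. n > N ==> h n = \<zero>\<^bsub>Ext n\<^esub>) ==> h \<in> carrier HHr"
  by (auto simp: HH_simps intro!: finite_subset[of _ "{..N}"])

lemma HH_bound:
  assumes "h \<in> carrier HHr" obtains N where "\<And>n. n > N ==> h n = \<zero>\<^bsub>Ext n\<^esub>"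
proof -
  have fin: "finite {n. h n \<noteq> \<zero>\<^bsub>Ext n\<^esub>}" using assms by (simp add: HH_simps)
  then obtain N where "\<forall>n\<in>{n. h n \<noteq> \<zero>\<^bsub>Ext n\<^esub>}. n \<le> N" using finite_nat_set_iff_bounded_le by blast
  then show ?thesis using that[of N] by fastforce
qed

lemma Y_closed': "k \<le> n ==> X \<in> carrier (Ext k) ==> U \<in> carrier (Ext (n - k)) ==> Y k (n - k) X U \<in> carrier (Ext n)"
  using Y_closed[of X k U "n - k"] by simp

lemma Y_vlin':
  assumes "k \<le> n"
  shows "U \<in> carrier (Ext (n - k)) ==> vlin (Ext k) (Ext n) (\<lambda>X. Y k (n - k) X U)"
    "X \<in> carrier (Ext k) ==> vlin (Ext (n - k)) (Ext n) (\<lambda>U. Y k (n - k) X U)"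
  using vlin_Y_left[of U "n - k" k] vlin_Y_right[of X k "n - k"] assms by auto

lemma Y_zero:
  assumes "k \<le> n"
  shows "U \<in> carrier (Ext (n - k)) ==> Y k (n - k) \<zero>\<^bsub>Ext k\<^esub> U = \<zero>\<^bsub>Ext n\<^esub>"
    "X \<in> carrier (Ext k) ==> Y k (n - k) X \<zero>\<^bsub>Ext (n - k)\<^esub> = \<zero>\<^bsub>Ext n\<^esub>"
  using vlin_zero[OF vec_Ext vec_Ext Y_vlin'(1)[OF assms, of U]]
    vlin_zero[OF vec_Ext vec_Ext Y_vlin'(2)[OF assms, of X]] by auto

lemma mult_term_closed:
  assumes "h \<in> carrier HHr" "h' \<in> carrier HHr"
  shows "(\<lambda>k. Y k (n - k) (h k) (h' (n - k))) \<in> {..n} \<rightarrow> carrier (Ext n)"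
  using Y_closed'[OF _ HH_closed[OF assms(1)] HH_closed[OF assms(2)]] by auto

lemma HH_mult_closed:
  assumes h: "h \<in> carrier HHr" and h': "h' \<in> carrier HHr"
  shows "h \<otimes>\<^bsub>HHr\<^esub> h' \<in> carrier HHr"
proof -
  obtain N where N: "\<And>n. n > N ==> h n = \<zero>\<^bsub>Ext n\<^esub>" by (rule HH_bound[OF h]) blast
  obtain N' where N': "\<And>n. n > N' ==> h' n = \<zero>\<^bsub>Ext n\<^esub>" by (rule HH_bound[OF h']) blast
  show ?thesis
  proof (rule HH_I[of _ "N + N'"])
    fix n show "(h \<otimes>\<^bsub>HHr\<^esub> h') n \<in> carrier (Ext n)"
      unfolding HH_simps by (rule E.finsum_closed[OF mult_term_closed[OF h h']])
    assume n: "n > N + N'"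
    have "Y k (n - k) (h k) (h' (n - k)) = \<zero>\<^bsub>Ext n\<^esub>" if "k \<in> {..n}" for k
    proof (cases "k > N")
      case True then show ?thesis using that N[of k] Y_zero(1)[of k n] HH_closed[OF h'] by auto
    next
      case False
      then have "n - k > N'" using n by linarith
      then show ?thesis using that N'[of "n - k"] Y_zero(2)[of k n] HH_closed[OF h] by auto
    qed
    then show "(h \<otimes>\<^bsub>HHr\<^esub> h') n = \<zero>\<^bsub>Ext n\<^esub>" unfolding HH_simps by (rule E.add.finprod_one_eqI)
  qed
qed

lemma HH_abelian_group: "abelian_group HHr"
proof (rule abelian_groupI)
  fix h h' h'' assume h: "h \<in> carrier HHr"
  obtain N where N: "\<And>n. n > N ==> h n = \<zero>\<^bsub>Ext n\<^esub>" by (rule HH_bound[OF h]) blast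
  note hc = HH_closed[OF h]
  show "\<zero>\<^bsub>HHr\<^esub> \<oplus>\<^bsub>HHr\<^esub> h = h" unfolding HH_simps by (rule ext) (simp add: hc)
  show "\<exists>y\<in>carrier HHr. y \<oplus>\<^bsub>HHr\<^esub> h = \<zero>\<^bsub>HHr\<^esub>"
  proof (rule bexI)
    show "(\<lambda>n. \<ominus>\<^bsub>Ext n\<^esub> h n) \<oplus>\<^bsub>HHr\<^esub> h = \<zero>\<^bsub>HHr\<^esub>"
      unfolding HH_simps by (rule ext) (simp add: hc E.l_neg)
    show "(\<lambda>n. \<ominus>\<^bsub>Ext n\<^esub> h n) \<in> carrier HHr"
      by (rule HH_I[of _ N]) (simp_all add: hc N)
  qed
  assume h': "h' \<in> carrier HHr"
  obtain N' where N': "\<And>n. n > N' ==> h' n = \<zero>\<^bsub>Ext n\<^esub>" by (rule HH_bound[OF h']) blast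
  note hc' = HH_closed[OF h']
  show "h \<oplus>\<^bsub>HHr\<^esub> h' \<in> carrier HHr"
    by (rule HH_I[of _ "max N N'"]) (simp_all add: HH_simps(3) hc hc' N N')
  show "h \<oplus>\<^bsub>HHr\<^esub> h' = h' \<oplus>\<^bsub>HHr\<^esub> h" unfolding HH_simps by (rule ext) (simp add: hc hc' E.a_comm)
  assume h'': "h'' \<in> carrier HHr"
  show "h \<oplus>\<^bsub>HHr\<^esub> h' \<oplus>\<^bsub>HHr\<^esub> h'' = h \<oplus>\<^bsub>HHr\<^esub> (h' \<oplus>\<^bsub>HHr\<^esub> h'')"
    unfolding HH_simps by (rule ext) (simp add: hc hc' HH_closed[OF h''] E.a_assoc)
qed (rule HH_I[of _ 0]; simp add: HH_simps)

lemma HH_assoc: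
  assumes h: "h \<in> carrier HHr" and h': "h' \<in> carrier HHr" and h'': "h'' \<in> carrier HHr"
  shows "h \<otimes>\<^bsub>HHr\<^esub> h' \<otimes>\<^bsub>HHr\<^esub> h'' = h \<otimes>\<^bsub>HHr\<^esub> (h' \<otimes>\<^bsub>HHr\<^esub> h'')"
proof
  fix n
  note c = HH_closed[OF h] and c' = HH_closed[OF h'] and c'' = HH_closed[OF h'']
  \<comment> \<open>\<open>T j k\<close> is the triple product of the components in degrees
    \<open>j\<close>, \<open>k - j\<close> and \<open>n - k\<close>.\<close>
  define T where "T = (\<lambda>j k. Y k (n - k) (Y j (k - j) (h j) (h' (k - j))) (h'' (n - k)))"
  have Tc: "T j k \<in> carrier (Ext n)" if "j \<le> k" "k \<le> n" for j k
    unfolding T_def by (intro Y_closed' that c c' c'')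
  have "(h \<otimes>\<^bsub>HHr\<^esub> h' \<otimes>\<^bsub>HHr\<^esub> h'') n = (\<Oplus>\<^bsub>Ext n\<^esub>k\<in>{..n}. \<Oplus>\<^bsub>Ext n\<^esub>j\<in>{..k}. T j k)"
    unfolding HH_simps
  proof (rule E.add.finprod_cong'[OF refl])
    show "(\<lambda>k. \<Oplus>\<^bsub>Ext n\<^esub>j\<in>{..k}. T j k) \<in> {..n} \<rightarrow> carrier (Ext n)"
      using Tc by (auto intro!: E.finsum_closed)
    fix k assume k: "k \<in> {..n}"
    show "Y k (n - k) (\<Oplus>\<^bsub>Ext k\<^esub>j\<in>{..k}. Y j (k - j) (h j) (h' (k - j))) (h'' (n - k)) = (\<Oplus>\<^bsub>Ext n\<^esub>j\<in>{..k}. T j k)"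
      unfolding T_def
      by (rule vlin_finsum[OF vec_Ext vec_Ext Y_vlin'(1)[OF _ c''] mult_term_closed[OF h h']]) (use k in auto)
  qed
  also have "\<dots> = (\<Oplus>\<^bsub>Ext n\<^esub>j\<in>{..n}. \<Oplus>\<^bsub>Ext n\<^esub>i\<in>{..n - j}. T j (i + j))"
    by (rule E.finsum_triangle[OF Tc])
  also have "\<dots> = (h \<otimes>\<^bsub>HHr\<^esub> (h' \<otimes>\<^bsub>HHr\<^esub> h'')) n"
    unfolding HH_simps
  proof (rule E.add.finprod_cong'[OF refl])
    show "(\<lambda>j. Y j (n - j) (h j) (\<Oplus>\<^bsub>Ext (n - j)\<^esub>k\<in>{..n - j}. Y k (n - j - k) (h' k) (h'' (n - j - k)))) \<in> {..n} \<rightarrow> carrier (Ext n)"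
      using E.finsum_closed[OF mult_term_closed[OF h' h'']] by (auto intro!: Y_closed' c simp del: diff_diff_left)
    fix j assume j: "j \<in> {..n}"
    have "Y j (n - j) (h j) (\<Oplus>\<^bsub>Ext (n - j)\<^esub>i\<in>{..n - j}. Y i (n - j - i) (h' i) (h'' (n - j - i))) =
        (\<Oplus>\<^bsub>Ext n\<^esub>i\<in>{..n - j}. Y j (n - j) (h j) (Y i (n - j - i) (h' i) (h'' (n - j - i))))"
      by (rule vlin_finsum[OF vec_Ext vec_Ext Y_vlin'(2)[OF _ c] mult_term_closed[OF h' h'']]) (use j in auto)
    also have "\<dots> = (\<Oplus>\<^bsub>Ext n\<^esub>i\<in>{..n - j}. T j (i + j))"
    proof (rule E.add.finprod_cong'[OF refl])
      show "(\<lambda>i. T j (i + j)) \<in> {..n - j} \<rightarrow> carrier (Ext n)" using Tc j by auto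
      fix i assume i: "i \<in> {..n - j}"
      have e: "n - j = n - j - i + i" "n - (i + j) = n - j - i" using i j by auto
      show "Y j (n - j) (h j) (Y i (n - j - i) (h' i) (h'' (n - j - i))) = T j (i + j)"
        using Y_assoc[OF c[of j] c'[of i] c''[of "n - j - i"]] e by (simp add: T_def)
    qed
    finally show "(\<Oplus>\<^bsub>Ext n\<^esub>i\<in>{..n - j}. T j (i + j)) =
      Y j (n - j) (h j) (\<Oplus>\<^bsub>Ext (n - j)\<^esub>k\<in>{..n - j}. Y k (n - j - k) (h' k) (h'' (n - j - k)))" by simp
  qed
  finally show "(h \<otimes>\<^bsub>HHr\<^esub> h' \<otimes>\<^bsub>HHr\<^esub> h'') n = (h \<otimes>\<^bsub>HHr\<^esub> (h' \<otimes>\<^bsub>HHr\<^esub> h'')) n" .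
qed

lemma in_degree_closed: "X \<in> carrier (Ext n) ==> in_degree A Q n X \<in> carrier HHr"
  by (rule HH_I[of _ n]) (auto simp: in_degree_def)

lemma HH_ring: "ring HHr"
proof (rule ringI[OF HH_abelian_group])
  have one: "\<one>\<^bsub>HHr\<^esub> \<in> carrier HHr" unfolding HH_simps(5) by (rule in_degree_closed[OF cls_closed[OF aug_Z]])
  show "Group.monoid HHr"
  proof (rule monoidI)
    fix h assume h: "h \<in> carrier HHr"
    note c = HH_closed[OF h]
    show "\<one>\<^bsub>HHr\<^esub> \<otimes>\<^bsub>HHr\<^esub> h = h"
    proof
      fix n
      have "(\<one>\<^bsub>HHr\<^esub> \<otimes>\<^bsub>HHr\<^esub> h) n = (\<Oplus>\<^bsub>Ext n\<^esub>k\<in>{..n}. if 0 = k then h n else \<zero>\<^bsub>Ext n\<^esub>)"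
        unfolding HH_simps
        by (rule E.add.finprod_cong'[OF refl]) (auto simp: in_degree_def Y_one_left c Y_zero(1) split: if_splits)
      also have "\<dots> = h n" by (rule E.add.finprod_singleton[of 0 _ "\<lambda>_. h n"]) (auto simp: c)
      finally show "(\<one>\<^bsub>HHr\<^esub> \<otimes>\<^bsub>HHr\<^esub> h) n = h n" .
    qed
    show "h \<otimes>\<^bsub>HHr\<^esub> \<one>\<^bsub>HHr\<^esub> = h"
    proof
      fix n
      have "(h \<otimes>\<^bsub>HHr\<^esub> \<one>\<^bsub>HHr\<^esub>) n = (\<Oplus>\<^bsub>Ext n\<^esub>k\<in>{..n}. if n = k then h n else \<zero>\<^bsub>Ext n\<^esub>)"
        unfolding HH_simps
      proof (rule E.add.finprod_cong'[OF refl])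
        fix k assume k: "k \<in> {..n}"
        show "Y k (n - k) (h k) (in_degree A Q 0 (cls 0 (aug Q)) (n - k)) = (if n = k then h n else \<zero>\<^bsub>Ext n\<^esub>)"
          using k Y_one_right[OF c, of n] Y_zero(2)[of k n, OF _ c] by (auto simp: in_degree_def)
      qed (auto simp: c)
      also have "\<dots> = h n" by (rule E.add.finprod_singleton[of n _ "\<lambda>_. h n"]) (auto simp: c)
      finally show "(h \<otimes>\<^bsub>HHr\<^esub> \<one>\<^bsub>HHr\<^esub>) n = h n" .
    qed
  qed (simp_all add: HH_mult_closed one HH_assoc)
  fix h h' h'' assume h: "h \<in> carrier HHr" and h': "h' \<in> carrier HHr" and h'': "h'' \<in> carrier HHr"
  note c = HH_closed[OF h] and c' = HH_closed[OF h'] and c'' = HH_closed[OF h'']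
  show "(h \<oplus>\<^bsub>HHr\<^esub> h') \<otimes>\<^bsub>HHr\<^esub> h'' = h \<otimes>\<^bsub>HHr\<^esub> h'' \<oplus>\<^bsub>HHr\<^esub> h' \<otimes>\<^bsub>HHr\<^esub> h''"
  proof
    fix n
    have "((h \<oplus>\<^bsub>HHr\<^esub> h') \<otimes>\<^bsub>HHr\<^esub> h'') n = (\<Oplus>\<^bsub>Ext n\<^esub>k\<in>{..n}.
        Y k (n - k) (h k) (h'' (n - k)) \<oplus>\<^bsub>Ext n\<^esub> Y k (n - k) (h' k) (h'' (n - k)))"
      unfolding HH_simps
      by (rule E.add.finprod_cong'[OF refl])
        (use vlinD(2)[OF Y_vlin'(1)[OF _ c''] c c'] in \<open>auto intro!: E.a_closed Y_closed' c c' c''\<close>)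
    also have "\<dots> = (h \<otimes>\<^bsub>HHr\<^esub> h'' \<oplus>\<^bsub>HHr\<^esub> h' \<otimes>\<^bsub>HHr\<^esub> h'') n"
      unfolding HH_simps by (rule E.finsum_addf[OF mult_term_closed[OF h h''] mult_term_closed[OF h' h'']])
    finally show "((h \<oplus>\<^bsub>HHr\<^esub> h') \<otimes>\<^bsub>HHr\<^esub> h'') n = (h \<otimes>\<^bsub>HHr\<^esub> h'' \<oplus>\<^bsub>HHr\<^esub> h' \<otimes>\<^bsub>HHr\<^esub> h'') n" .
  qed
  show "h'' \<otimes>\<^bsub>HHr\<^esub> (h \<oplus>\<^bsub>HHr\<^esub> h') = h'' \<otimes>\<^bsub>HHr\<^esub> h \<oplus>\<^bsub>HHr\<^esub> h'' \<otimes>\<^bsub>HHr\<^esub> h'"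
  proof
    fix n
    have "(h'' \<otimes>\<^bsub>HHr\<^esub> (h \<oplus>\<^bsub>HHr\<^esub> h')) n = (\<Oplus>\<^bsub>Ext n\<^esub>k\<in>{..n}.
        Y k (n - k) (h'' k) (h (n - k)) \<oplus>\<^bsub>Ext n\<^esub> Y k (n - k) (h'' k) (h' (n - k)))"
      unfolding HH_simps
      by (rule E.add.finprod_cong'[OF refl])
        (use vlinD(2)[OF Y_vlin'(2)[OF _ c''] c c'] in \<open>auto intro!: E.a_closed Y_closed' c c' c''\<close>)
    also have "\<dots> = (h'' \<otimes>\<^bsub>HHr\<^esub> h \<oplus>\<^bsub>HHr\<^esub> h'' \<otimes>\<^bsub>HHr\<^esub> h') n"
      unfolding HH_simps by (rule E.finsum_addf[OF mult_term_closed[OF h'' h] mult_term_closed[OF h'' h']])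
    finally show "(h'' \<otimes>\<^bsub>HHr\<^esub> (h \<oplus>\<^bsub>HHr\<^esub> h')) n = (h'' \<otimes>\<^bsub>HHr\<^esub> h \<oplus>\<^bsub>HHr\<^esub> h'' \<otimes>\<^bsub>HHr\<^esub> h') n" .
  qed
qed

lemma HH_vec: "vec HHr"
proof -
  interpret abelian_group HHr by (rule HH_abelian_group)
  show ?thesis
  proof
    fix h h' and c e :: 'k assume h: "h \<in> carrier HHr"
    obtain N where N: "\<And>n. n > N ==> h n = \<zero>\<^bsub>Ext n\<^esub>" by (rule HH_bound[OF h]) blast
    note hc = HH_closed[OF h]
    show "c \<odot>\<^bsub>HHr\<^esub> h \<in> carrier HHr" by (rule HH_I[of _ N]) (simp_all add: HH_simps(4) hc N)
    show "(c + e) \<odot>\<^bsub>HHr\<^esub> h = c \<odot>\<^bsub>HHr\<^esub> h \<oplus>\<^bsub>HHr\<^esub> e \<odot>\<^bsub>HHr\<^esub> h"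
      unfolding HH_simps by (rule ext) (simp add: hc E.smult_l_distr)
    show "(c * e) \<odot>\<^bsub>HHr\<^esub> h = c \<odot>\<^bsub>HHr\<^esub> (e \<odot>\<^bsub>HHr\<^esub> h)"
      unfolding HH_simps by (rule ext) (simp add: hc E.smult_assoc)
    show "1 \<odot>\<^bsub>HHr\<^esub> h = h" unfolding HH_simps by (rule ext) (simp add: hc)
    assume h': "h' \<in> carrier HHr"
    show "c \<odot>\<^bsub>HHr\<^esub> (h \<oplus>\<^bsub>HHr\<^esub> h') = c \<odot>\<^bsub>HHr\<^esub> h \<oplus>\<^bsub>HHr\<^esub> c \<odot>\<^bsub>HHr\<^esub> h'"
      unfolding HH_simps by (rule ext) (simp add: hc HH_closed[OF h'] E.smult_r_distr)
  qed
qed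

lemma HH_kalg: "kalg HHr"
proof -
  interpret ring HHr by (rule HH_ring)
  interpret vec HHr by (rule HH_vec)
  show ?thesis
  proof
    fix h h' and c :: 'k assume h: "h \<in> carrier HHr" and h': "h' \<in> carrier HHr"
    note hc = HH_closed[OF h] and hc' = HH_closed[OF h']
    show "c \<odot>\<^bsub>HHr\<^esub> h \<otimes>\<^bsub>HHr\<^esub> h' = c \<odot>\<^bsub>HHr\<^esub> (h \<otimes>\<^bsub>HHr\<^esub> h')"
    proof
      fix n
      have "(c \<odot>\<^bsub>HHr\<^esub> h \<otimes>\<^bsub>HHr\<^esub> h') n = (\<Oplus>\<^bsub>Ext n\<^esub>k\<in>{..n}. c \<odot>\<^bsub>Ext n\<^esub> Y k (n - k) (h k) (h' (n - k)))"
        unfolding HH_simps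
        by (rule E.add.finprod_cong'[OF refl])
          (use vlinD(3)[OF Y_vlin'(1)[OF _ hc'] hc] in \<open>auto intro!: E.smult_closed Y_closed' hc hc'\<close>)
      also have "\<dots> = (c \<odot>\<^bsub>HHr\<^esub> (h \<otimes>\<^bsub>HHr\<^esub> h')) n"
        unfolding HH_simps by (rule E.smult_finsum[OF mult_term_closed[OF h h'], symmetric])
      finally show "(c \<odot>\<^bsub>HHr\<^esub> h \<otimes>\<^bsub>HHr\<^esub> h') n = (c \<odot>\<^bsub>HHr\<^esub> (h \<otimes>\<^bsub>HHr\<^esub> h')) n" .
    qed
    show "h \<otimes>\<^bsub>HHr\<^esub> (c \<odot>\<^bsub>HHr\<^esub> h') = c \<odot>\<^bsub>HHr\<^esub> (h \<otimes>\<^bsub>HHr\<^esub> h')"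
    proof
      fix n
      have "(h \<otimes>\<^bsub>HHr\<^esub> (c \<odot>\<^bsub>HHr\<^esub> h')) n = (\<Oplus>\<^bsub>Ext n\<^esub>k\<in>{..n}. c \<odot>\<^bsub>Ext n\<^esub> Y k (n - k) (h k) (h' (n - k)))"
        unfolding HH_simps
        by (rule E.add.finprod_cong'[OF refl])
          (use vlinD(3)[OF Y_vlin'(2)[OF _ hc] hc'] in \<open>auto intro!: E.smult_closed Y_closed' hc hc'\<close>)
      also have "\<dots> = (c \<odot>\<^bsub>HHr\<^esub> (h \<otimes>\<^bsub>HHr\<^esub> h')) n"
        unfolding HH_simps by (rule E.smult_finsum[OF mult_term_closed[OF h h'], symmetric])
      finally show "(h \<otimes>\<^bsub>HHr\<^esub> (c \<odot>\<^bsub>HHr\<^esub> h')) n = (c \<odot>\<^bsub>HHr\<^esub> (h \<otimes>\<^bsub>HHr\<^esub> h')) n" .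
    qed
  qed
qed

end

section \<open>The algebra in coordinates\<close>

datatype bas = bE | bA | bB | bS

text \<open>\<open>cf x t i\<close> is the coefficient of the basis element of type \<open>t\<close> (\<open>e\<close>, \<open>a\<close>, \<open>b\<close> or \<open>s = ab = ba\<close>)
  with source \<open>i\<close>; indices are not reduced modulo \<open>m\<close>.\<close>

datatype 'k lam = MkLam (cf: "bas => int => 'k")

lemma lam_eqI: "(\<And>t i. cf x t i = cf y t i) ==> x = y"
  by (cases x; cases y) (auto simp: fun_eq_iff)

text \<open>The second factor is read at the end vertex of the first: \<open>i + 1\<close> after an
  arrow \<open>a\<close>, \<open>i - 1\<close> after \<open>b\<close>, \<open>i\<close> after a
  loop. The products \<open>aa\<close> and \<open>bb\<close> and everything of length three or more
  are zero and so do not appear.\<close>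

fun lam_times :: "(bas => int => 'k) => (bas => int => 'k) => bas => int => 'k::comm_ring_1" where
  "lam_times x y bE i = x bE i * y bE i"
| "lam_times x y bA i = x bE i * y bA i + x bA i * y bE (i + 1)"
| "lam_times x y bB i = x bE i * y bB i + x bB i * y bE (i - 1)"
| "lam_times x y bS i = x bE i * y bS i + x bS i * y bE i + x bA i * y bB (i + 1) + x bB i * y bA (i - 1)"

text \<open>No \<open>m\<close> occurs here: families on all integers form a ring belonging to the
  infinite line that covers the cycle, and the algebra is recovered as the \<open>periodic\<close>
  elements. Ring computations can then rely on the type class.\<close>

instantiation lam :: (comm_ring_1) ring_1
begin
definition "0 = MkLam (\<lambda>_ _. 0)"
definition "1 = MkLam (\<lambda>t _. if t = bE then 1 else 0)"
definition "x + y = MkLam (\<lambda>t i. cf x t i + cf y t i)"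
definition "x - y = MkLam (\<lambda>t i. cf x t i - cf y t i)"
definition "- x = MkLam (\<lambda>t i. - cf x t i)"
definition "x * y = MkLam (lam_times (cf x) (cf y))"
instance
proof
  fix a b c :: "'a lam"
  show "a * b * c = a * (b * c)"
  proof (rule lam_eqI)
    fix t i show "cf (a * b * c) t i = cf (a * (b * c)) t i"
      by (cases t) (simp_all add: times_lam_def algebra_simps)
  qed
  show "(a + b) * c = a * c + b * c"
  proof (rule lam_eqI)
    fix t i show "cf ((a + b) * c) t i = cf (a * c + b * c) t i"
      by (cases t) (simp_all add: times_lam_def plus_lam_def algebra_simps)
  qed
  show "a * (b + c) = a * b + a * c"
  proof (rule lam_eqI)
    fix t i show "cf (a * (b + c)) t i = cf (a * b + a * c) t i"
      by (cases t) (simp_all add: times_lam_def plus_lam_def algebra_simps)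
  qed
  show "1 * a = a"
  proof (rule lam_eqI)
    fix t i show "cf (1 * a) t i = cf a t i"
      by (cases t) (simp_all add: times_lam_def one_lam_def)
  qed
  show "a * 1 = a"
  proof (rule lam_eqI)
    fix t i show "cf (a * 1) t i = cf a t i"
      by (cases t) (simp_all add: times_lam_def one_lam_def)
  qed
  show "(0 :: 'a lam) \<noteq> 1"
    by (auto simp: zero_lam_def one_lam_def fun_eq_iff)
qed (auto simp: zero_lam_def one_lam_def plus_lam_def minus_lam_def uminus_lam_def add_ac intro!: lam_eqI)
end

lemma cf_simps [simp]:
  "cf 0 t i = 0" "cf 1 t i = (if t = bE then 1 else 0)" "cf (x + y) t i = cf x t i + cf y t i"
  "cf (x - y) t i = cf x t i - cf y t i" "cf (- x) t i = - cf x t i"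
  "cf (x * y) t i = lam_times (cf x) (cf y) t i"
  by (simp_all add: zero_lam_def one_lam_def plus_lam_def minus_lam_def uminus_lam_def times_lam_def)

lemma cf_sum [simp]: "cf (sum f I) t i = (\<Sum>j\<in>I. cf (f j) t i)"
  by (induct I rule: infinite_finite_induct) auto

definition lscale :: "'k => 'k lam => 'k::comm_ring_1 lam" where
  "lscale c x = MkLam (\<lambda>t i. c * cf x t i)"

lemma cf_lscale [simp]: "cf (lscale c x) t i = c * cf x t i"
  by (simp add: lscale_def)

definition lbas :: "bas => 'k::comm_ring_1 lam" where
  "lbas t = MkLam (\<lambda>s i. if s = t then 1 else 0)"

text \<open>The image of \<open>e_j\<close> on the cover: the sum of the idempotents at all vertices
  above \<open>j\<close>.\<close>

definition lidem :: "nat => int => 'k::comm_ring_1 lam" where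
  "lidem m j = MkLam (\<lambda>s i. if s = bE \<and> i mod int m = j mod int m then 1 else 0)"

lemma cf_lbas [simp]: "cf (lbas t) s i = (if s = t then 1 else 0)"
  by (simp add: lbas_def)

lemma cf_lidem [simp]: "cf (lidem m j) s i = (if s = bE \<and> i mod int m = j mod int m then 1 else 0)"
  by (simp add: lidem_def)

definition periodic :: "nat => 'k lam => bool" where
  "periodic m x \<longleftrightarrow> (\<forall>t i. cf x t (i mod int m) = cf x t i)"

lemma lam_eq_iff: "x = y \<longleftrightarrow> (\<forall>t i. cf x t i = cf y t i)"
  by (auto intro: lam_eqI)

section \<open>Path algebras\<close>

lemma (in pre_digraph) awlast_conv: "awlast u p = (if p = [] then u else head G (last p))"
  by (simp add: awalk_verts_conv)

text \<open>One term of the product in \<open>path_algebra\<close>, with the coefficient as an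
  argument so that additivity in it can be used.\<close>

definition path_mult ::
    "('v, 'e) pre_digraph => ('v, 'e) path => ('v, 'e) path => 'k::field => ('v, 'e) path \<Rightarrow>\<^sub>0 'k" where
  "path_mult G p q c = (if pre_digraph.awlast G (fst p) (snd p) = fst q
     then psingle (fst p, snd p @ snd q) c else 0)"

lemma path_mult_add: "path_mult G p q (c + d) = path_mult G p q c + path_mult G p q d"
  by (simp add: path_mult_def single_add)

lemma path_mult_zero [simp]: "path_mult G p q 0 = 0"
  by (simp add: path_mult_def)

lemma path_algebra_simps:
  "carrier (path_algebra G) = {f. pkeys f \<subseteq> paths G}"
  "zero (path_algebra G) = 0" "add (path_algebra G) = (+)"
  "smult (path_algebra G) = (\<lambda>c. Poly_Mapping.map ((*) c))"
  "one (path_algebra G) = (\<Sum>v\<in>verts G. psingle (v, []) 1)"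
  "mult (path_algebra G) f g = (\<Sum>p\<in>pkeys f. \<Sum>q\<in>pkeys g.
     path_mult G p q (plookup f p * plookup g q))"
  by (simp_all add: path_algebra_def free_space_def path_mult_def)

lemma path_algebra_mult_superset:
  assumes "finite S" "pkeys f \<subseteq> S" "finite T" "pkeys g \<subseteq> T"
  shows "f \<otimes>\<^bsub>path_algebra G\<^esub> g =
    (\<Sum>p\<in>S. \<Sum>q\<in>T. path_mult G p q (plookup f p * plookup g q))"
proof -
  have "(\<Sum>q\<in>pkeys g. path_mult G p q (plookup f p * plookup g q)) =
      (\<Sum>q\<in>T. path_mult G p q (plookup f p * plookup g q))" for p
    by (rule sum.mono_neutral_left[OF assms(3,4)]) (simp add: in_keys_iff)
  then show ?thesis unfolding path_algebra_simps
    by (simp only:) (rule sum.mono_neutral_left[OF assms(1,2)], simp add: in_keys_iff)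
qed

lemma path_algebra_mult_add:
  "(f + f') \<otimes>\<^bsub>path_algebra G\<^esub> g = f \<otimes>\<^bsub>path_algebra G\<^esub> g + f' \<otimes>\<^bsub>path_algebra G\<^esub> g"
  "g \<otimes>\<^bsub>path_algebra G\<^esub> (f + f') = g \<otimes>\<^bsub>path_algebra G\<^esub> f + g \<otimes>\<^bsub>path_algebra G\<^esub> f'"
proof -
  let ?S = "pkeys f \<union> pkeys f'" and ?T = "pkeys g"
  have S: "finite ?S" "finite ?T" "pkeys f \<subseteq> ?S" "pkeys f' \<subseteq> ?S" "?T \<subseteq> ?T"
    by auto
  note k = Poly_Mapping.keys_add[of f f']
  show "(f + f') \<otimes>\<^bsub>path_algebra G\<^esub> g = f \<otimes>\<^bsub>path_algebra G\<^esub> g + f' \<otimes>\<^bsub>path_algebra G\<^esub> g"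
    unfolding path_algebra_mult_superset[OF S(1) k S(2,5)] path_algebra_mult_superset[OF S(1,3,2,5)]
      path_algebra_mult_superset[OF S(1,4,2,5)]
    by (simp add: lookup_add distrib_right path_mult_add sum.distrib)
  show "g \<otimes>\<^bsub>path_algebra G\<^esub> (f + f') = g \<otimes>\<^bsub>path_algebra G\<^esub> f + g \<otimes>\<^bsub>path_algebra G\<^esub> f'"
    unfolding path_algebra_mult_superset[OF S(2,5,1) k] path_algebra_mult_superset[OF S(2,5,1,3)]
      path_algebra_mult_superset[OF S(2,5,1,4)]
    by (simp add: lookup_add distrib_left path_mult_add sum.distrib)
qed

lemma path_algebra_mult_zero [simp]:
  "0 \<otimes>\<^bsub>path_algebra G\<^esub> g = 0" "g \<otimes>\<^bsub>path_algebra G\<^esub> 0 = 0"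
  by (simp_all add: path_algebra_simps)

lemma path_algebra_mult_sum:
  "(\<Sum>i\<in>I. f i) \<otimes>\<^bsub>path_algebra G\<^esub> g = (\<Sum>i\<in>I. f i \<otimes>\<^bsub>path_algebra G\<^esub> g)"
  "g \<otimes>\<^bsub>path_algebra G\<^esub> (\<Sum>i\<in>I. f i) = (\<Sum>i\<in>I. g \<otimes>\<^bsub>path_algebra G\<^esub> f i)"
  by (induct I rule: infinite_finite_induct) (simp_all add: path_algebra_mult_add)

lemma path_algebra_mult_single:
  "psingle p c \<otimes>\<^bsub>path_algebra G\<^esub> psingle q d = path_mult G p q (c * d)"
  by (subst path_algebra_mult_superset[of "{p}" _ "{q}"]) auto

lemma path_mult_scale: "path_mult G p q (c * d) = Poly_Mapping.map ((*) c) (path_mult G p q d)"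
  by (auto simp: path_mult_def intro!: poly_mapping_eqI simp: lookup_single when_def)

lemma path_algebra_induct [case_names zero single add]:
  fixes f :: "'s \<Rightarrow>\<^sub>0 'k::field"
  assumes "P 0" "\<And>p c. p \<in> pkeys f ==> P (psingle p c)"
    "\<And>g h. P g ==> P h ==> P (g + h)"
  shows "P f"
proof -
  have "P (\<Sum>p\<in>K. psingle p (plookup f p))" if "K \<subseteq> pkeys f" for K
    using finite_subset[OF that finite_keys] that by (induct K rule: finite_induct) (auto intro: assms)
  from this[of "pkeys f"] show ?thesis using poly_mapping_sum_single[of f] by simp
qed

lemma path_algebra_assoc:
  "(f \<otimes>\<^bsub>path_algebra G\<^esub> g) \<otimes>\<^bsub>path_algebra G\<^esub> h = f \<otimes>\<^bsub>path_algebra G\<^esub> (g \<otimes>\<^bsub>path_algebra G\<^esub> h)"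
proof (induct f rule: path_algebra_induct)
  case (single p c)
  show ?case
  proof (induct g rule: path_algebra_induct)
    case (single q d)
    show ?case
    proof (induct h rule: path_algebra_induct)
      case (single r e)
      have "path_mult G p q (c * d) \<otimes>\<^bsub>path_algebra G\<^esub> psingle r e =
          psingle p c \<otimes>\<^bsub>path_algebra G\<^esub> path_mult G q r (d * e)"
        by (auto simp: path_mult_def path_algebra_mult_single pre_digraph.awlast_conv mult.assoc)
      then show ?case by (simp add: path_algebra_mult_single)
    qed (simp_all add: path_algebra_mult_add)
  qed (simp_all add: path_algebra_mult_add)
qed (simp_all add: path_algebra_mult_add)

lemma path_algebra_scale:
  "Poly_Mapping.map ((*) c) f \<otimes>\<^bsub>path_algebra G\<^esub> g = Poly_Mapping.map ((*) c) (f \<otimes>\<^bsub>path_algebra G\<^esub> g)"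
  "f \<otimes>\<^bsub>path_algebra G\<^esub> Poly_Mapping.map ((*) c) g = Poly_Mapping.map ((*) c) (f \<otimes>\<^bsub>path_algebra G\<^esub> g)"
proof -
  have add: "Poly_Mapping.map ((*) c) (x + y) = Poly_Mapping.map ((*) c) x + Poly_Mapping.map ((*) c) y"
    for x y :: "('a, 'b) path \<Rightarrow>\<^sub>0 'c" by (rule poly_mapping_eqI) (simp add: lookup_add distrib_left)
  have z: "Poly_Mapping.map ((*) c) 0 = (0 :: ('a, 'b) path \<Rightarrow>\<^sub>0 'c)" by (rule poly_mapping_eqI) simp
  have s: "Poly_Mapping.map ((*) c) (psingle p d) = psingle p (c * d)"
    for p :: "('a, 'b) path" and d by (rule poly_mapping_eqI) (simp add: lookup_single when_def)
  have "Poly_Mapping.map ((*) c) f \<otimes>\<^bsub>path_algebra G\<^esub> g = Poly_Mapping.map ((*) c) (f \<otimes>\<^bsub>path_algebra G\<^esub> g) \<and>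
      f \<otimes>\<^bsub>path_algebra G\<^esub> Poly_Mapping.map ((*) c) g = Poly_Mapping.map ((*) c) (f \<otimes>\<^bsub>path_algebra G\<^esub> g)"
  proof (induct f rule: path_algebra_induct)
    case (single p d)
    show ?case
    proof (induct g rule: path_algebra_induct)
      case (single q e)
      show ?case
        unfolding s path_algebra_mult_single mult.assoc mult.left_commute[of d c] path_mult_scale[of G p q c] by simp
    qed (simp_all add: path_algebra_mult_add add z)
  qed (simp_all add: path_algebra_mult_add add z)
  then show "Poly_Mapping.map ((*) c) f \<otimes>\<^bsub>path_algebra G\<^esub> g = Poly_Mapping.map ((*) c) (f \<otimes>\<^bsub>path_algebra G\<^esub> g)"
    "f \<otimes>\<^bsub>path_algebra G\<^esub> Poly_Mapping.map ((*) c) g = Poly_Mapping.map ((*) c) (f \<otimes>\<^bsub>path_algebra G\<^esub> g)"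
    by auto
qed

lemma paths_iff: "(u, p) \<in> paths G \<longleftrightarrow> (\<exists>v. pre_digraph.awalk G u p v)"
  by (simp add: paths_def)

lemma kalg_path_algebra:
  assumes "wf_digraph G" "finite (verts G)"
  shows "kalg (path_algebra G :: ('k::field, ('v, 'e) path \<Rightarrow>\<^sub>0 'k) module)"
proof -
  interpret G: wf_digraph G by fact
  let ?A = "path_algebra G :: ('k, ('v, 'e) path \<Rightarrow>\<^sub>0 'k) module"
  interpret F: vec "free_space (paths G) :: ('k, ('v, 'e) path \<Rightarrow>\<^sub>0 'k) module" by (rule vec_free_space)
  interpret vec ?A
    by (rule vec_image[OF vec_free_space[of "paths G"], where p = "\<lambda>x. x"]) (simp_all add: path_algebra_simps)
  have pm: "path_mult G p q c \<in> carrier ?A" if pq: "p \<in> paths G" "q \<in> paths G" for p q c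
  proof (cases "G.awlast (fst p) (snd p) = fst q")
    case True
    obtain u w where u: "G.awalk (fst p) (snd p) u" and w: "G.awalk (fst q) (snd q) w"
      using pq paths_iff[of "fst p" "snd p" G] paths_iff[of "fst q" "snd q" G] by auto
    have "u = fst q" using u True by (auto elim: G.awalkE)
    then have "G.awalk (fst p) (snd p @ snd q) w" using G.awalk_appendI[OF u, of "snd q" w] w by simp
    then show ?thesis using True by (auto simp: path_mult_def path_algebra_simps paths_iff)
  qed (simp add: path_mult_def path_algebra_simps)
  have sum_closed: "(\<Sum>i\<in>I. f i) \<in> carrier ?A" if "\<And>i. i \<in> I ==> f i \<in> carrier ?A" for f :: "_ => _" and I
    using that
  proof (induct I rule: infinite_finite_induct)
    case (insert x I)
    then show ?case using a_closed[of "f x" "sum f I"] by (simp add: path_algebra_simps(3))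
  qed (use zero_closed in \<open>simp_all add: path_algebra_simps(2)\<close>)
  have mult_closed: "f \<otimes>\<^bsub>?A\<^esub> g \<in> carrier ?A" if "f \<in> carrier ?A" "g \<in> carrier ?A" for f g
    unfolding path_algebra_simps(6) by (intro sum_closed pm) (use that in \<open>auto simp: path_algebra_simps\<close>)
  have v: "(v, []) \<in> paths G" if "v \<in> verts G" for v
    using that by (auto simp: paths_iff G.awalk_Nil_iff)
  have one_closed: "\<one>\<^bsub>?A\<^esub> \<in> carrier ?A"
    unfolding path_algebra_simps(5) by (rule sum_closed) (use v in \<open>auto simp: path_algebra_simps\<close>)
  have l_one: "\<one>\<^bsub>?A\<^esub> \<otimes>\<^bsub>?A\<^esub> f = f" and r_one: "f \<otimes>\<^bsub>?A\<^esub> \<one>\<^bsub>?A\<^esub> = f" if f: "f \<in> carrier ?A" for f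
  proof -
    have 1: "\<one>\<^bsub>?A\<^esub> \<otimes>\<^bsub>?A\<^esub> psingle p c = psingle p c \<and>
        psingle p c \<otimes>\<^bsub>?A\<^esub> \<one>\<^bsub>?A\<^esub> = psingle p c" if p: "p \<in> paths G" for p c
    proof -
      obtain w where w: "G.awalk (fst p) (snd p) w" using p paths_iff[of "fst p" "snd p" G] by auto
      then have fp: "fst p \<in> verts G" by (simp add: G.awalk_def)
      have lp: "G.awlast (fst p) (snd p) \<in> verts G" using w G.awlast_in_verts by (auto simp: G.awalk_def)
      have "\<one>\<^bsub>?A\<^esub> \<otimes>\<^bsub>?A\<^esub> psingle p c = (\<Sum>v\<in>verts G. if v = fst p then psingle p c else 0)"
        unfolding path_algebra_simps(5) path_algebra_mult_sum path_algebra_mult_single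
        by (rule sum.cong) (auto simp: path_mult_def G.awlast_conv)
      moreover have "psingle p c \<otimes>\<^bsub>?A\<^esub> \<one>\<^bsub>?A\<^esub> =
          (\<Sum>v\<in>verts G. if v = G.awlast (fst p) (snd p) then psingle p c else 0)"
        unfolding path_algebra_simps(5) path_algebra_mult_sum path_algebra_mult_single
        by (rule sum.cong) (auto simp: path_mult_def)
      ultimately show ?thesis using fp lp assms(2) by simp
    qed
    have fk: "pkeys f \<subseteq> paths G" using f by (simp add: path_algebra_simps)
    have "\<one>\<^bsub>?A\<^esub> \<otimes>\<^bsub>?A\<^esub> f = f \<and> f \<otimes>\<^bsub>?A\<^esub> \<one>\<^bsub>?A\<^esub> = f"
    proof (induct f rule: path_algebra_induct)
      case (single p c) then show ?case using fk by (intro 1) auto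
    next
      case (add g h) then show ?case by (simp only: path_algebra_mult_add)
    qed simp
    then show "\<one>\<^bsub>?A\<^esub> \<otimes>\<^bsub>?A\<^esub> f = f" "f \<otimes>\<^bsub>?A\<^esub> \<one>\<^bsub>?A\<^esub> = f" by auto
  qed
  interpret ring ?A
  proof (rule ringI)
    show "Group.monoid ?A"
      by (rule monoidI) (simp_all add: mult_closed one_closed l_one r_one path_algebra_assoc)
  qed (simp_all add: abelian_group_axioms path_algebra_mult_add path_algebra_simps(3))
  show ?thesis
    by unfold_locales (simp_all add: path_algebra_simps(4) path_algebra_scale)
qed

section \<open>The quiver and the representation of its path algebra in coordinates\<close>

lemma quiver_simps [simp]:
  "verts (quiver m) = {0..<int m}" "arcs (quiver m) = Arr ` {0..<int m} \<union> Bar ` {0..<int m}"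
  "tail (quiver m) (Arr i) = i" "tail (quiver m) (Bar i) = (i + 1) mod int m"
  "head (quiver m) (Arr i) = (i + 1) mod int m" "head (quiver m) (Bar i) = i"
  by (simp_all add: quiver_def)

lemma wf_quiver: "m > 0 ==> wf_digraph (quiver m)"
  by unfold_locales auto

lemma mod_add_cancel: "(x + c) mod n = (y + c) mod n \<longleftrightarrow> x mod n = y mod (n::int)"
  by (simp add: mod_eq_dvd_iff)

lemma mod_diff_cancel: "(x - c) mod n = (y - c) mod n \<longleftrightarrow> x mod n = y mod (n::int)"
  by (simp add: mod_eq_dvd_iff)

text \<open>\<open>Bar i\<close> runs from \<open>i + 1\<close> to \<open>i\<close>; hence the
  idempotent at \<open>i + 1\<close>.\<close>

definition larr :: "nat => arrow => 'k::field lam" where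
  "larr m x = (case x of Arr i => lidem m i * lbas bA | Bar i => lidem m (i + 1) * lbas bB)"

definition lpath :: "nat => (int, arrow) path => 'k::field lam" where
  "lpath m p = lidem m (fst p) * prod_list (map (larr m) (snd p))"

text \<open>The homomorphism from the path algebra to coordinates. Its kernel on the path algebra
  turns out to be exactly the ideal of relations (\<open>I_ker\<close>,
  \<open>ker_I\<close>).\<close>

definition lrep :: "nat => 'k::field KQ => 'k lam" where
  "lrep m f = (\<Sum>p\<in>pkeys f. lscale (plookup f p) (lpath m p))"

lemma lscale_simps:
  "lscale (c + d) x = lscale c x + lscale d x" "lscale c (x + y) = lscale c x + lscale c y"
  "lscale 0 x = 0" "lscale c 0 = 0" "lscale 1 x = x" "lscale c (lscale d x) = lscale (c * d) x"
  by (auto intro!: lam_eqI simp: algebra_simps)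

lemma lscale_mult: "lscale c x * y = lscale c (x * y)" "x * lscale c y = lscale c (x * y)"
proof -
  show "lscale c x * y = lscale c (x * y)"
  proof (rule lam_eqI)
    fix t i show "cf (lscale c x * y) t i = cf (lscale c (x * y)) t i" by (cases t) (auto simp: algebra_simps)
  qed
  show "x * lscale c y = lscale c (x * y)"
  proof (rule lam_eqI)
    fix t i show "cf (x * lscale c y) t i = cf (lscale c (x * y)) t i" by (cases t) (auto simp: algebra_simps)
  qed
qed

lemma lscale_sum: "lscale c (\<Sum>i\<in>I. f i) = (\<Sum>i\<in>I. lscale c (f i))"
  by (induct I rule: infinite_finite_induct) (simp_all add: lscale_simps)

lemma lrep_superset:
  assumes "finite T" "pkeys f \<subseteq> T"
  shows "lrep m f = (\<Sum>p\<in>T. lscale (plookup f p) (lpath m p))"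
  unfolding lrep_def by (rule sum.mono_neutral_left[OF assms]) (simp add: in_keys_iff lscale_simps)

lemma lrep_add: "lrep m (f + g) = lrep m f + lrep m g"
proof -
  let ?T = "pkeys f \<union> pkeys g"
  have T: "finite ?T" "pkeys f \<subseteq> ?T" "pkeys g \<subseteq> ?T" by auto
  show ?thesis
    unfolding lrep_superset[OF T(1,2)] lrep_superset[OF T(1,3)]
      lrep_superset[OF T(1) Poly_Mapping.keys_add[of f g]]
    by (simp add: lookup_add lscale_simps sum.distrib)
qed

lemma lrep_scale: "lrep m (Poly_Mapping.map ((*) c) f) = lscale c (lrep m f)"
  unfolding lrep_superset[OF finite_keys keys_scale_subset[of c f]]
  by (simp add: lrep_def lscale_sum lscale_simps)

lemma lrep_zero [simp]: "lrep m 0 = 0" by (simp add: lrep_def)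

lemma lrep_single: "lrep m (psingle p c) = lscale c (lpath m p)"
  by (subst lrep_superset[of "{p}"]) auto

lemma lrep_sum: "lrep m (\<Sum>i\<in>I. f i) = (\<Sum>i\<in>I. lrep m (f i))"
  by (induct I rule: infinite_finite_induct) (simp_all add: lrep_add)

lemma lrep_uminus: "lrep m (- f) = - lrep m f"
  using lrep_add[of m f "- f"] by (simp add: eq_neg_iff_add_eq_0 add.commute)

lemma lrep_diff: "lrep m (f - g) = lrep m f - lrep m g"
  using lrep_add[of m f "- g"] by (simp add: lrep_uminus)

lemma lidem_mult: "lidem m u * lidem m w = (if u mod int m = w mod int m then lidem m u else 0)"
proof (rule lam_eqI)
  fix t i
  show "cf (lidem m u * lidem m w) t i = cf (if u mod int m = w mod int m then lidem m u else 0) t i"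
    by (cases t) auto
qed

lemma lbas_mult:
  "lbas bA * lbas bA = 0" "lbas bB * lbas bB = 0" "lbas bA * lbas bB = lbas bS" "lbas bB * lbas bA = lbas bS"
proof -
  show "lbas bA * lbas bA = 0" "lbas bB * lbas bB = 0" "lbas bA * lbas bB = lbas bS" "lbas bB * lbas bA = lbas bS"
    by (rule lam_eqI; rename_tac t i; case_tac t; simp)+
qed

lemma lbas_E: "lbas bE = 1"
  by (rule lam_eqI) simp

lemma lbas_lidem:
  "lbas bA * lidem m w = lidem m (w - 1) * lbas bA"
  "lbas bB * lidem m w = lidem m (w + 1) * lbas bB"
  "lbas bS * lidem m w = lidem m w * lbas bS"
proof -
  have 1: "(i + 1) mod int m = w mod int m \<longleftrightarrow> i mod int m = (w - 1) mod int m" for i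
    using mod_add_cancel[of i 1 "int m" "w - 1"] by simp
  have 2: "(i - 1) mod int m = w mod int m \<longleftrightarrow> i mod int m = (w + 1) mod int m" for i
    using mod_diff_cancel[of i 1 "int m" "w + 1"] by simp
  show "lbas bA * lidem m w = lidem m (w - 1) * lbas bA"
    "lbas bB * lidem m w = lidem m (w + 1) * lbas bB"
    "lbas bS * lidem m w = lidem m w * lbas bS"
    by (rule lam_eqI; rename_tac t i; case_tac t; simp add: 1 2)+
qed

lemma lidem_cong: "u mod int m = w mod int m ==> lidem m u = lidem m w"
  by (rule lam_eqI) simp

lemma larr_lidem:
  assumes "w \<in> {0..<int m}"
  shows "larr m x * lidem m w = (if head (quiver m) x mod int m = w then larr m x else 0)"
proof (cases x)
  case (Arr i)
  have "larr m x * lidem m w = (lidem m i * lidem m (w - 1)) * lbas bA"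
    by (simp add: larr_def Arr mult.assoc lbas_lidem)
  moreover have "i mod int m = (w - 1) mod int m \<longleftrightarrow> (i + 1) mod int m = w"
    using mod_add_cancel[of i 1 "int m" "w - 1"] assms by simp
  ultimately show ?thesis by (auto simp: lidem_mult larr_def Arr)
next
  case (Bar i)
  have "larr m x * lidem m w = (lidem m (i + 1) * lidem m (w + 1)) * lbas bB"
    by (simp add: larr_def Bar mult.assoc lbas_lidem)
  moreover have "(i + 1) mod int m = (w + 1) mod int m \<longleftrightarrow> i mod int m = w"
    using mod_add_cancel[of i 1 "int m" w] assms by simp
  ultimately show ?thesis by (auto simp: lidem_mult larr_def Bar)
qed

text \<open>The argument \<open>K\<close> carries the type of the ground field, which
  \<open>m\<close> does not mention.\<close>

locale Lam_alg =
  fixes m :: nat and K :: "'k::field itself"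
  assumes m3: "m \<ge> 3"
begin

abbreviation "KA \<equiv> KQ m :: ('k, 'k KQ) module"

lemma m_pos: "int m > 0" using m3 by simp

lemma kalg_KQ: "kalg KA"
  by (rule kalg_path_algebra) (use m3 in \<open>simp_all add: wf_quiver\<close>)

sublocale KQ: kalg KA by (rule kalg_KQ)
sublocale Qv: wf_digraph "quiver m" by (rule wf_quiver) (use m3 in simp)

lemmas KQ_simps = path_algebra_simps[of "quiver m"]

lemma path_snoc:
  assumes "(u, p @ [x]) \<in> paths (quiver m)"
  shows "(u, p) \<in> paths (quiver m)" "x \<in> arcs (quiver m)" "Qv.awlast u p = tail (quiver m) x"
proof -
  obtain w where "Qv.awalk u (p @ [x]) w" using assms by (auto simp: paths_iff)
  then have *: "Qv.awalk u p (Qv.awlast u p)" "Qv.awalk (Qv.awlast u p) [x] w"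
    using Qv.awalk_append_iff by blast+
  then show "(u, p) \<in> paths (quiver m)" "x \<in> arcs (quiver m)" "Qv.awlast u p = tail (quiver m) x"
    by (auto simp: paths_iff Qv.awalk_def)
qed

lemma path_source: "(u, p) \<in> paths (quiver m) ==> u \<in> {0..<int m}"
  by (auto simp: paths_iff Qv.awalk_def)

text \<open>In coordinates the end vertex of a path is visible only through the idempotent that
  fixes it on the right. This is what sends products of non-composable paths to zero in
  \<open>lpath_mult\<close>.\<close>

lemma lpath_lidem:
  assumes "(u, p) \<in> paths (quiver m)" "w \<in> {0..<int m}"
  shows "lpath m (u, p) * lidem m w = (if Qv.awlast u p = w then lpath m (u, p) else 0)"
proof (cases p rule: rev_cases)
  case Nil
  then show ?thesis using path_source[OF assms(1)] assms(2) by (simp add: lpath_def lidem_mult)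
next
  case (snoc q x)
  have x: "x \<in> arcs (quiver m)" using path_snoc[of u q x] assms(1) snoc by simp
  then have h: "head (quiver m) x mod int m = head (quiver m) x" by (cases x) auto
  have "lpath m (u, p) * lidem m w = lidem m u * prod_list (map (larr m) q) * (larr m x * lidem m w)"
    by (simp add: lpath_def snoc mult.assoc)
  also have "\<dots> = (if Qv.awlast u p = w then lpath m (u, p) else 0)"
    unfolding larr_lidem[OF assms(2)] h by (simp add: lpath_def snoc mult.assoc Qv.awlast_conv)
  finally show ?thesis .
qed

lemma lpath_mult:
  assumes "p \<in> paths (quiver m)" "q \<in> paths (quiver m)"
  shows "lscale c (lpath m p * lpath m q) = lrep m (path_mult (quiver m) p q c)"
proof -
  have "lpath m p * lpath m q = (lpath m (fst p, snd p) * lidem m (fst q)) * prod_list (map (larr m) (snd q))"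
    by (simp add: lpath_def mult.assoc)
  also have "\<dots> = (if Qv.awlast (fst p) (snd p) = fst q then lpath m (fst p, snd p @ snd q) else 0)"
    using assms path_source[of "fst q" "snd q"] by (subst lpath_lidem) (auto simp: lpath_def mult.assoc)
  finally have e: "lpath m p * lpath m q =
      (if Qv.awlast (fst p) (snd p) = fst q then lpath m (fst p, snd p @ snd q) else 0)" .
  show ?thesis unfolding e by (simp add: path_mult_def lrep_single lscale_simps)
qed

lemma lrep_mult:
  assumes "f \<in> carrier KA" "g \<in> carrier KA"
  shows "lrep m (f \<otimes>\<^bsub>KA\<^esub> g) = lrep m f * lrep m g"
proof -
  have f: "pkeys f \<subseteq> paths (quiver m)" and g: "pkeys g \<subseteq> paths (quiver m)"
    using assms by (simp_all add: KQ_simps)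
  have "lrep m (f \<otimes>\<^bsub>KA\<^esub> g) = (\<Sum>p\<in>pkeys f. \<Sum>q\<in>pkeys g.
      lscale (plookup f p * plookup g q) (lpath m p * lpath m q))"
    unfolding KQ_simps(6) lrep_sum
    by (intro sum.cong refl lpath_mult[symmetric]) (use f g in auto)
  also have "\<dots> = lrep m f * lrep m g"
    unfolding lrep_def sum_product by (simp add: lscale_mult lscale_simps mult.commute)
  finally show ?thesis .
qed

lemma gens_closed:
  "vertex m i \<in> carrier KA" "arr m i \<in> carrier KA" "bar m i \<in> carrier KA"
  using m_pos by (auto simp: vertex_def arr_def bar_def KQ_simps paths_iff Qv.awalk_def mod_add_left_eq split: if_splits)

lemma lrep_gens:
  "lrep m (vertex m i) = lidem m i" "lrep m (arr m i) = lidem m i * lbas bA"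
  "lrep m (bar m i) = lidem m (i + 1) * lbas bB"
proof -
  have c: "lidem m (i mod int m) = lidem m i" "lidem m ((i + 1) mod int m) = lidem m (i + 1)" for i
    by (rule lidem_cong, simp)+
  have c2: "lidem m (i mod int m + 1) = lidem m (i + 1)" for i by (rule lidem_cong) (simp add: mod_add_left_eq)
  show "lrep m (vertex m i) = lidem m i" "lrep m (arr m i) = lidem m i * lbas bA"
    "lrep m (bar m i) = lidem m (i + 1) * lbas bB"
    by (simp_all add: vertex_def arr_def bar_def lrep_single lpath_def larr_def lscale_simps c c2 lidem_mult
        flip: mult.assoc)
qed

lemma gens_cong:
  assumes "i mod int m = j mod int m"
  shows "vertex m i = (vertex m j :: 'k KQ)" "arr m i = (arr m j :: 'k KQ)" "bar m i = (bar m j :: 'k KQ)"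
proof -
  have "(i + 1) mod int m = (j + 1) mod int m" using assms by (simp add: mod_add_cancel)
  with assms show "vertex m i = (vertex m j :: 'k KQ)" "arr m i = (arr m j :: 'k KQ)" "bar m i = (bar m j :: 'k KQ)"
    by (simp_all add: vertex_def arr_def bar_def)
qed

lemma gens_mult_zero:
  "i mod int m \<noteq> j mod int m ==> vertex m i \<otimes>\<^bsub>KA\<^esub> arr m j = 0"
  "i mod int m \<noteq> (j + 1) mod int m ==> vertex m i \<otimes>\<^bsub>KA\<^esub> bar m j = 0"
  "(i + 1) mod int m \<noteq> j mod int m ==> arr m i \<otimes>\<^bsub>KA\<^esub> arr m j = 0"
  "i mod int m \<noteq> j mod int m ==> arr m i \<otimes>\<^bsub>KA\<^esub> bar m j = 0"
  "i mod int m \<noteq> j mod int m ==> bar m i \<otimes>\<^bsub>KA\<^esub> arr m j = 0"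
  "i mod int m \<noteq> (j + 1) mod int m ==> bar m i \<otimes>\<^bsub>KA\<^esub> bar m j = 0"
  by (simp_all add: vertex_def arr_def bar_def path_algebra_mult_single path_mult_def Qv.awlast_conv
      mod_add_left_eq mod_add_cancel)

lemma vertex_mult:
  "vertex m j \<otimes>\<^bsub>KA\<^esub> arr m j = arr m j" "vertex m (j + 1) \<otimes>\<^bsub>KA\<^esub> bar m j = bar m j"
  by (simp_all add: vertex_def arr_def bar_def path_algebra_mult_single path_mult_def Qv.awlast_conv)

section \<open>The ideal of relations and normal forms of paths\<close>

abbreviation "I \<equiv> I_Lam m 1 :: 'k KQ set"

definition "rels = (\<Union>i.
     {arr m i \<otimes>\<^bsub>KA\<^esub> arr m (i + 1), bar m (i - 1) \<otimes>\<^bsub>KA\<^esub> bar m (i - 2),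
      (arr m i \<otimes>\<^bsub>KA\<^esub> bar m i) \<ominus>\<^bsub>KA\<^esub> (bar m (i - 1) \<otimes>\<^bsub>KA\<^esub> arr m (i - 1))})"

lemma KQ_minus:
  assumes "x \<in> carrier KA" "y \<in> carrier KA" shows "x \<ominus>\<^bsub>KA\<^esub> y = x - y"
proof -
  have "\<ominus>\<^bsub>KA\<^esub> y = - y"
    by (rule KQ.minus_equality) (use assms in \<open>auto simp: KQ_simps in_keys_iff\<close>)
  then show ?thesis by (simp add: KQ.minus_eq KQ_simps)
qed

lemma I_def: "I = Idl\<^bsub>KA\<^esub> rels"
proof -
  have p: "x [^]\<^bsub>KA\<^esub> (1::nat) = x" if "x \<in> carrier KA" for x using that by simp
  show ?thesis unfolding I_Lam_def rels_def
    by (simp add: gens_closed)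
qed

lemma rels_closed: "rels \<subseteq> carrier KA"
  unfolding rels_def by (auto intro!: KQ.minus_closed KQ.m_closed gens_closed)

lemma ideal_I: "ideal I KA"
  unfolding I_def by (rule KQ.genideal_ideal[OF rels_closed])

sublocale I: ideal I KA by (rule ideal_I)
sublocale IV: vec_sub KA I by (rule KQ.ideal_vec_sub[OF ideal_I])

lemma rels_I: "r \<in> rels ==> r \<in> I"
  unfolding I_def using KQ.genideal_self[OF rels_closed] by blast

lemma rel_I:
  "arr m i \<otimes>\<^bsub>KA\<^esub> arr m (i + 1) \<in> I" "bar m (i + 1) \<otimes>\<^bsub>KA\<^esub> bar m i \<in> I"
  "arr m i \<otimes>\<^bsub>KA\<^esub> bar m i - bar m (i - 1) \<otimes>\<^bsub>KA\<^esub> arr m (i - 1) \<in> I"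
proof -
  show "arr m i \<otimes>\<^bsub>KA\<^esub> arr m (i + 1) \<in> I" by (rule rels_I) (auto simp: rels_def)
  have "bar m ((i + 2) - 1) \<otimes>\<^bsub>KA\<^esub> bar m ((i + 2) - 2) \<in> rels" unfolding rels_def by blast
  then show "bar m (i + 1) \<otimes>\<^bsub>KA\<^esub> bar m i \<in> I" by (intro rels_I) (simp add: add.commute)
  have "(arr m i \<otimes>\<^bsub>KA\<^esub> bar m i) \<ominus>\<^bsub>KA\<^esub> (bar m (i - 1) \<otimes>\<^bsub>KA\<^esub> arr m (i - 1)) \<in> rels" unfolding rels_def by blast
  then show "arr m i \<otimes>\<^bsub>KA\<^esub> bar m i - bar m (i - 1) \<otimes>\<^bsub>KA\<^esub> arr m (i - 1) \<in> I"
    by (intro rels_I) (simp add: KQ_minus gens_closed)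
qed

lemma I_plus: "x \<in> I ==> y \<in> I ==> x + y \<in> I"
  using I.a_closed[of x y] by (simp add: KQ_simps)

lemma I_minus: "x \<in> I ==> y \<in> I ==> x - y \<in> I"
  using KQ.subspaceD(6)[OF IV.sub, of x y] I.Icarr KQ_minus[of x y] by simp

lemma I_scale: "x \<in> I ==> Poly_Mapping.map ((*) c) x \<in> I"
  using KQ.subspaceD(4)[OF IV.sub, of x c] by (simp add: KQ_simps)

lemma I_zero: "0 \<in> I" using I.zero_closed by (simp add: KQ_simps)

text \<open>The kernel of \<open>lrep\<close> is an ideal, so it is enough to look at the relations:
  \<open>aa\<close> and \<open>bb\<close> vanish in coordinates, and \<open>ab\<close> and
  \<open>ba\<close> are both \<open>s\<close>.\<close>

lemma I_ker: "f \<in> I ==> lrep m f = 0"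
proof -
  let ?J = "{f \<in> carrier KA. lrep m f = 0}"
  have "subspace ?J KA"
    by (rule KQ.subspaceI) (use KQ.a_closed KQ.smult_closed KQ.zero_closed in \<open>auto simp: KQ_simps lrep_add lrep_scale lscale_simps\<close>)
  then have "ideal ?J KA"
    by (intro idealI KQ.ring_axioms) (auto simp: submodule_def lrep_mult)
  moreover have "rels \<subseteq> ?J"
  proof -
    have z: "lidem m i * lbas bA * (lidem m (i + 1) * lbas bA) = (0 :: 'k lam)" for i
    proof -
      have "lidem m i * lbas bA * (lidem m (i + 1) * lbas bA) = lidem m i * (lbas bA * lidem m (i + 1)) * (lbas bA :: 'k lam)"
        by (simp only: mult.assoc)
      also have "\<dots> = (lidem m i * lidem m (i + 1 - 1)) * (lbas bA * lbas bA)" unfolding lbas_lidem by (simp only: mult.assoc)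
      finally show ?thesis by (simp add: lbas_mult)
    qed
    have z2: "lidem m (i - 1 + 1) * lbas bB * (lidem m (i - 2 + 1) * lbas bB) = (0 :: 'k lam)" for i
    proof -
      have "lidem m (i - 1 + 1) * lbas bB * (lidem m (i - 2 + 1) * lbas bB) =
          lidem m (i - 1 + 1) * (lbas bB * lidem m (i - 2 + 1)) * (lbas bB :: 'k lam)"
        by (simp only: mult.assoc)
      also have "\<dots> = (lidem m (i - 1 + 1) * lidem m (i - 2 + 1 + 1)) * (lbas bB * lbas bB)" unfolding lbas_lidem by (simp only: mult.assoc)
      finally show ?thesis by (simp add: lbas_mult)
    qed
    have z3: "lidem m i * lbas bA * (lidem m (i + 1) * lbas bB) = lidem m i * (lbas bS :: 'k lam)" for i
    proof -
      have "lidem m i * lbas bA * (lidem m (i + 1) * lbas bB) = lidem m i * (lbas bA * lidem m (i + 1)) * (lbas bB :: 'k lam)"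
        by (simp add: mult.assoc)
      also have "\<dots> = (lidem m i * lidem m i) * (lbas bA * lbas bB)" unfolding lbas_lidem by (simp add: mult.assoc)
      finally show ?thesis by (simp add: lidem_mult lbas_mult)
    qed
    have z4: "lidem m i * lbas bB * (lidem m (i - 1) * lbas bA) = lidem m i * (lbas bS :: 'k lam)" for i
    proof -
      have "lidem m i * lbas bB * (lidem m (i - 1) * lbas bA) = lidem m i * (lbas bB * lidem m (i - 1)) * (lbas bA :: 'k lam)"
        by (simp add: mult.assoc)
      also have "\<dots> = (lidem m i * lidem m i) * (lbas bB * lbas bA)" unfolding lbas_lidem by (simp add: mult.assoc)
      finally show ?thesis by (simp add: lidem_mult lbas_mult)
    qed
    have "lrep m r = 0" if r: "r \<in> rels" for r
    proof -
      have cl: "lrep m (arr m i \<otimes>\<^bsub>KA\<^esub> bar m i \<ominus>\<^bsub>KA\<^esub> bar m (i - 1) \<otimes>\<^bsub>KA\<^esub> arr m (i - 1)) = 0" for i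
        using z4[of i] by (simp add: KQ_minus gens_closed lrep_diff lrep_mult lrep_gens z3)
      obtain i where "r = arr m i \<otimes>\<^bsub>KA\<^esub> arr m (i + 1) \<or> r = bar m (i - 1) \<otimes>\<^bsub>KA\<^esub> bar m (i - 2) \<or>
         r = arr m i \<otimes>\<^bsub>KA\<^esub> bar m i \<ominus>\<^bsub>KA\<^esub> bar m (i - 1) \<otimes>\<^bsub>KA\<^esub> arr m (i - 1)"
        using r unfolding rels_def by blast
      then show ?thesis
        using z[of i] z2[of i] cl[of i] by (elim disjE) (simp_all add: lrep_mult gens_closed lrep_gens)
    qed
    then show ?thesis using rels_closed by blast
  qed
  ultimately have "I \<subseteq> ?J" unfolding I_def by (rule KQ.genideal_minimal)
  then show "f \<in> I ==> lrep m f = 0" by blast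
qed

text \<open>Representatives of the basis elements with source \<open>u\<close>. The bar arrow
  starting at \<open>u\<close> is \<open>bar m (u - 1)\<close>; of the paths \<open>ab\<close> and
  \<open>ba\<close>, identified by the relations, the first is chosen.\<close>

fun bel :: "bas => int => 'k KQ" where
  "bel bE u = vertex m u" | "bel bA u = arr m u" | "bel bB u = bar m (u - 1)" | "bel bS u = arr m u \<otimes>\<^bsub>KA\<^esub> bar m u"

lemma bel_closed: "bel t u \<in> carrier KA"
  by (cases t) (auto intro!: gens_closed KQ.m_closed)

lemma lrep_bel: "lrep m (bel t u) = lidem m u * lbas t"
proof (cases t)
  case bS
  have "lrep m (bel t u) = lidem m u * (lbas bA * lidem m (u + 1)) * lbas bB"
    by (simp add: bS lrep_mult gens_closed lrep_gens mult.assoc)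
  also have "\<dots> = (lidem m u * lidem m u) * (lbas bA * lbas bB)" unfolding lbas_lidem by (simp add: mult.assoc)
  finally show ?thesis by (simp add: bS lidem_mult lbas_mult)
qed (simp_all add: lrep_gens lbas_E)

text \<open>The relations are paths and differences of two paths, so modulo the ideal a path is
  either zero or a single basis element with coefficient 1; no linear combinations arise.\<close>

definition reducible :: "int => 'k KQ => bool" where
  "reducible u f \<longleftrightarrow> f \<in> I \<or> (\<exists>t. f - bel t u \<in> I)"

lemma reducible_I: "f \<in> I ==> reducible u f" by (simp add: reducible_def)
lemma reducible_bel: "reducible u (bel t u)" unfolding reducible_def using I_zero by (metis diff_self)

lemma reducible_diff:
  assumes "f - g \<in> I" "reducible u g" shows "reducible u f"
proof -
  have "f \<in> I" if "g \<in> I" using I_plus[OF assms(1) that] by simp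
  moreover have "f - bel t u \<in> I" if "g - bel t u \<in> I" for t using I_plus[OF assms(1) that] by simp
  ultimately show ?thesis using assms(2) unfolding reducible_def by blast
qed

text \<open>Modulo the ideal: \<open>e a = a\<close>, \<open>a a = 0\<close>,
  \<open>b a = a b\<close>, and \<open>(a b) a = (b a) a = b (a a) = 0\<close>, where the loop has
  to be exchanged before the monomial relation applies.\<close>

lemma reducible_bel_arr: "reducible u (bel t u \<otimes>\<^bsub>KA\<^esub> arr m j)"
proof (cases t)
  case bE
  show ?thesis
  proof (cases "u mod int m = j mod int m")
    case True
    have "bel t u \<otimes>\<^bsub>KA\<^esub> arr m j = bel bA u" using gens_cong[OF True] vertex_mult(1)[of j] by (simp add: bE)
    then show ?thesis using reducible_bel by metis
  next
    case False then show ?thesis using gens_mult_zero(1) I_zero by (simp add: bE reducible_I)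
  qed
next
  case bA
  show ?thesis
  proof (cases "(u + 1) mod int m = j mod int m")
    case True then show ?thesis using gens_cong(2)[OF True] rel_I(1)[of u] by (simp add: bA reducible_I)
  next
    case False then show ?thesis using gens_mult_zero(3) I_zero by (simp add: bA reducible_I)
  qed
next
  case bB
  show ?thesis
  proof (cases "(u - 1) mod int m = j mod int m")
    case True
    have "bel t u \<otimes>\<^bsub>KA\<^esub> arr m j = bar m (u - 1) \<otimes>\<^bsub>KA\<^esub> arr m (u - 1)" using gens_cong(2)[OF True] by (simp add: bB)
    moreover have "bar m (u - 1) \<otimes>\<^bsub>KA\<^esub> arr m (u - 1) - bel bS u \<in> I"
      using I_minus[OF I_zero rel_I(3)[of u]] by simp
    ultimately show ?thesis using reducible_diff reducible_bel by metis
  next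
    case False then show ?thesis using gens_mult_zero(5) I_zero by (simp add: bB reducible_I)
  qed
next
  case bS
  let ?x = "bar m (u - 1) \<otimes>\<^bsub>KA\<^esub> (arr m (u - 1) \<otimes>\<^bsub>KA\<^esub> arr m j)"
  have "(arr m u \<otimes>\<^bsub>KA\<^esub> bar m u - bar m (u - 1) \<otimes>\<^bsub>KA\<^esub> arr m (u - 1)) \<otimes>\<^bsub>KA\<^esub> arr m j \<in> I"
    by (rule I.I_r_closed[OF rel_I(3) gens_closed(2)])
  moreover have "(x - y) \<otimes>\<^bsub>KA\<^esub> z = x \<otimes>\<^bsub>KA\<^esub> z - y \<otimes>\<^bsub>KA\<^esub> z" for x y z :: "'k KQ"
    using path_algebra_mult_add(1)[where f = "x - y" and f' = y and g = z and G = "quiver m"] by simp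
  ultimately have d: "bel t u \<otimes>\<^bsub>KA\<^esub> arr m j - ?x \<in> I" by (simp add: bS path_algebra_assoc)
  have "arr m (u - 1) \<otimes>\<^bsub>KA\<^esub> arr m j \<in> I"
  proof (cases "u mod int m = j mod int m")
    case True then show ?thesis using gens_cong(2)[OF True] rel_I(1)[of "u - 1"] by simp
  next
    case False then show ?thesis using gens_mult_zero(3)[of "u - 1" j] I_zero by simp
  qed
  then have "?x \<in> I" by (rule I.I_l_closed[OF _ gens_closed(3)])
  then show ?thesis using reducible_diff[OF d] reducible_I by blast
qed

text \<open>Modulo the ideal: \<open>e b = b\<close>, \<open>a b = s\<close>,
  \<open>b b = 0\<close>, and \<open>(a b) b = a (b b) = 0\<close> directly, \<open>s\<close> being
  represented by \<open>ab\<close>.\<close>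

lemma reducible_bel_bar: "reducible u (bel t u \<otimes>\<^bsub>KA\<^esub> bar m j)"
proof (cases t)
  case bE
  show ?thesis
  proof (cases "u mod int m = (j + 1) mod int m")
    case True
    have c: "(u - 1) mod int m = j mod int m" using mod_add_cancel[of "u - 1" 1 "int m" j] True by simp
    have "bel t u \<otimes>\<^bsub>KA\<^esub> bar m j = bel bB u"
      using gens_cong(1)[OF True] gens_cong(3)[OF c] vertex_mult(2)[of j] by (simp add: bE)
    then show ?thesis using reducible_bel by metis
  next
    case False then show ?thesis using gens_mult_zero(2) I_zero by (simp add: bE reducible_I)
  qed
next
  case bA
  show ?thesis
  proof (cases "u mod int m = j mod int m")
    case True
    have "bel t u \<otimes>\<^bsub>KA\<^esub> bar m j = bel bS u" using gens_cong(3)[OF True] by (simp add: bA)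
    then show ?thesis using reducible_bel by metis
  next
    case False then show ?thesis using gens_mult_zero(4) I_zero by (simp add: bA reducible_I)
  qed
next
  case bB
  show ?thesis
  proof (cases "(u - 1) mod int m = (j + 1) mod int m")
    case True
    then show ?thesis using gens_cong(3)[OF True] rel_I(2)[of j] by (simp add: bB reducible_I)
  next
    case False then show ?thesis using gens_mult_zero(6) I_zero by (simp add: bB reducible_I)
  qed
next
  case bS
  have "bar m u \<otimes>\<^bsub>KA\<^esub> bar m j \<in> I"
  proof (cases "u mod int m = (j + 1) mod int m")
    case True then show ?thesis using gens_cong(3)[OF True] rel_I(2)[of j] by simp
  next
    case False then show ?thesis using gens_mult_zero(6) I_zero by simp
  qed
  then have "arr m u \<otimes>\<^bsub>KA\<^esub> (bar m u \<otimes>\<^bsub>KA\<^esub> bar m j) \<in> I" by (rule I.I_l_closed[OF _ gens_closed(2)])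
  then show ?thesis by (simp add: bS path_algebra_assoc reducible_I)
qed

lemma reducible_path: "(u, p) \<in> paths (quiver m) ==> reducible u (psingle (u, p) 1)"
proof (induct p rule: rev_induct)
  case Nil
  have "psingle (u, []) 1 = bel bE u" using path_source[OF Nil] by (simp add: vertex_def)
  then show ?case using reducible_bel by metis
next
  case (snoc x p)
  note s = path_snoc[OF snoc(2)]
  let ?y = "psingle (tail (quiver m) x, [x]) 1 :: 'k KQ"
  have e: "psingle (u, p @ [x]) 1 = psingle (u, p) 1 \<otimes>\<^bsub>KA\<^esub> ?y"
    by (simp add: path_algebra_mult_single path_mult_def s(3))
  have y: "?y = arr m (case x of Arr j => j | Bar j => j) \<or> ?y = bar m (case x of Arr j => j | Bar j => j)"
    using s(2) by (cases x) (auto simp: arr_def bar_def)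
  have yc: "?y \<in> carrier KA" using y gens_closed by metis
  have ry: "reducible u (bel t u \<otimes>\<^bsub>KA\<^esub> ?y)" for t
    using y reducible_bel_arr reducible_bel_bar by metis
  have d: "(f - g) \<otimes>\<^bsub>KA\<^esub> z = f \<otimes>\<^bsub>KA\<^esub> z - g \<otimes>\<^bsub>KA\<^esub> z" for f g z :: "'k KQ"
    using path_algebra_mult_add(1)[where f = "f - g" and f' = g and g = z and G = "quiver m"] by simp
  from snoc(1)[OF s(1)] consider "psingle (u, p) 1 \<in> I" | t where "psingle (u, p) 1 - bel t u \<in> I"
    unfolding reducible_def by blast
  then show ?case
  proof cases
    case 1 then show ?thesis unfolding e using I.I_r_closed[OF 1 yc] by (rule_tac reducible_I)
  next
    case 2
    from I.I_r_closed[OF 2 yc] show ?thesis unfolding e d by (rule reducible_diff[OF _ ry])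
  qed
qed

definition lincomb :: "(bas => int => 'k) => 'k KQ" where
  "lincomb c = (\<Sum>u\<in>{0..<int m}. \<Sum>t\<in>{bE, bA, bB, bS}. Poly_Mapping.map ((*) (c t u)) (bel t u))"

lemma sum_bas: "(\<Sum>t\<in>{bE, bA, bB, bS}. f t) = f bE + f bA + f bB + f bS" for f :: "bas => 'z::comm_monoid_add"
  by (simp add: add.assoc)

lemma scale_closed: "x \<in> carrier KA ==> Poly_Mapping.map ((*) c) x \<in> carrier KA"
  using KQ.smult_closed[of x c] by (simp add: KQ_simps(4))

lemma plus_closed: "x \<in> carrier KA ==> y \<in> carrier KA ==> x + y \<in> carrier KA"
  using KQ.a_closed[of x y] by (simp add: KQ_simps(3))

lemma sum_closed: "(\<And>i. i \<in> J ==> f i \<in> carrier KA) ==> sum f J \<in> carrier KA"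
  using KQ.zero_closed by (induct J rule: infinite_finite_induct) (auto simp: plus_closed KQ_simps(2))

lemma lincomb_closed: "lincomb c \<in> carrier KA"
  unfolding lincomb_def by (intro sum_closed scale_closed bel_closed)

text \<open>The coefficients of a normal form can be read off after \<open>lrep\<close>; this gives
  linear independence of the basis modulo the ideal.\<close>

lemma cf_lrep_lincomb: "cf (lrep m (lincomb c)) t k = c t (k mod int m)"
proof -
  have b: "cf (lidem m u * lbas s) t k = (if s = t \<and> k mod int m = u mod int m then 1 else 0 :: 'k)" for s u
    by (cases t; cases s) auto
  have "cf (lrep m (lincomb c)) t k = (\<Sum>u\<in>{0..<int m}. \<Sum>s\<in>{bE, bA, bB, bS}. c s u * cf (lidem m u * lbas s) t k)"
    unfolding lincomb_def by (simp only: lrep_sum lrep_scale lrep_bel cf_sum cf_lscale)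
  also have "\<dots> = (\<Sum>u\<in>{0..<int m}. if k mod int m = u then c t u else 0)"
  proof (rule sum.cong[OF refl])
    fix u assume u: "u \<in> {0..<int m}"
    then show "(\<Sum>s\<in>{bE, bA, bB, bS}. c s u * cf (lidem m u * lbas s) t k) = (if k mod int m = u then c t u else 0)"
      unfolding b sum_bas by (cases t) auto
  qed
  also have "\<dots> = c t (k mod int m)" using m_pos by simp
  finally show ?thesis .
qed

lemma decompose: 
  assumes "f \<in> carrier KA" shows "\<exists>c. f - lincomb c \<in> I"
proof -
  have lc_add: "lincomb (\<lambda>t u. c t u + c' t u) = lincomb c + lincomb c'" for c c'
    unfolding lincomb_def sum.distrib[symmetric]
    by (intro sum.cong refl poly_mapping_eqI) (simp add: lookup_add distrib_right)
  have scale: "lincomb (\<lambda>t u. a * c t u) = Poly_Mapping.map ((*) a) (lincomb c)" for c a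
    unfolding lincomb_def
    by (rule poly_mapping_eqI) (simp add: lookup_sum lookup_add sum_distrib_left distrib_left mult.assoc)
  have unit: "lincomb (\<lambda>t' u'. if t' = t \<and> u' = u then 1 else 0) = bel t u" if "u \<in> {0..<int m}" for t u
  proof -
    have "lincomb (\<lambda>t' u'. if t' = t \<and> u' = u then 1 else 0) = (\<Sum>u'\<in>{0..<int m}. if u' = u then bel t u else 0)"
      unfolding lincomb_def
    proof (rule sum.cong[OF refl])
      fix u'
      have o: "Poly_Mapping.map ((*) 1) x = x" "Poly_Mapping.map ((*) 0) x = 0" for x :: "'k KQ"
        by (rule poly_mapping_eqI, simp)+
      show "(\<Sum>t'\<in>{bE, bA, bB, bS}. Poly_Mapping.map ((*) (if t' = t \<and> u' = u then 1 else 0)) (bel t' u')) =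
          (if u' = u then bel t u else 0)"
        unfolding sum_bas by (cases t; cases "u' = u") (simp_all add: o)
    qed
    then show ?thesis using that by simp
  qed
  have k: "pkeys f \<subseteq> paths (quiver m)" using assms by (simp add: KQ_simps)
  show ?thesis
  proof (induct f rule: path_algebra_induct)
    case zero
    have "lincomb (\<lambda>_ _. 0) = 0" unfolding lincomb_def by (rule poly_mapping_eqI) (simp add: lookup_sum lookup_add)
    then show ?case using I_zero by (intro exI[of _ "\<lambda>_ _. 0"]) simp
  next
    case (single p a)
    obtain u q where p: "p = (u, q)" by (cases p)
    have pq: "(u, q) \<in> paths (quiver m)" using single k p by auto
    have "\<exists>c. psingle p 1 - lincomb c \<in> I"
    proof -
      consider "psingle (u, q) 1 \<in> I" | t where "psingle (u, q) 1 - bel t u \<in> I"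
        using reducible_path[OF pq] unfolding reducible_def by blast
      then show ?thesis
      proof cases
        case 1
        have "lincomb (\<lambda>_ _. 0) = 0" unfolding lincomb_def by (rule poly_mapping_eqI) (simp add: lookup_sum lookup_add)
        then show ?thesis using 1 p by (intro exI[of _ "\<lambda>_ _. 0"]) simp
      next
        case 2 then show ?thesis using unit[OF path_source[OF pq]] p by metis
      qed
    qed
    then obtain c where c: "psingle p 1 - lincomb c \<in> I" by blast
    have "Poly_Mapping.map ((*) a) (psingle p 1 - lincomb c) = psingle p a - lincomb (\<lambda>t u. a * c t u)"
      unfolding scale by (rule poly_mapping_eqI) (simp add: lookup_minus lookup_single when_def right_diff_distrib)
    then show ?case using I_scale[OF c, of a] by metis
  next
    case (add g h)
    then obtain c c' where "g - lincomb c \<in> I" "h - lincomb c' \<in> I" by blast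
    from I_plus[OF this] have "(g + h) - lincomb (\<lambda>t u. c t u + c' t u) \<in> I" unfolding lc_add by (simp add: algebra_simps)
    then show ?case by blast
  qed
qed

text \<open>Modulo the ideal \<open>f\<close> is a normal form, and \<open>lrep\<close> recovers its
  coefficients, which are therefore all zero.\<close>

lemma ker_I:
  assumes "f \<in> carrier KA" "lrep m f = 0" shows "f \<in> I"
proof -
  obtain c where c: "f - lincomb c \<in> I" using decompose[OF assms(1)] by blast
  have "lrep m (lincomb c) = 0" using I_ker[OF c] assms(2) by (simp add: lrep_diff)
  then have z: "c t u = 0" if "u \<in> {0..<int m}" for t u
    using cf_lrep_lincomb[of c t u] that by simp
  have "lincomb c = 0" unfolding lincomb_def
    by (rule poly_mapping_eqI) (simp add: lookup_sum lookup_add z)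
  then show ?thesis using c by simp
qed

end

section \<open>A contracting homotopy\<close>

text \<open>An element of \<open>P\<^sup>n\<close> is encoded by its coefficients: \<open>X u v r i\<close> is that of \<open>u g v\<close>,
  where \<open>g\<close> is the generator of the \<open>(i, r)\<close>-summand. The homotopy \<open>hmu\<close> is right linear.\<close>

type_synonym 'k mfun = "bas => bas => int => int => 'k"

text \<open>The coefficient of the left factor \<open>u\<close> in a product with \<open>c\<close>
  on the left. Here \<open>i\<close> is the vertex where \<open>u\<close> ends, while
  \<open>c\<close> is indexed by sources, so the arrow \<open>a\<close> into \<open>i\<close> is
  found at \<open>i - 1\<close> and \<open>b\<close> at \<open>i + 1\<close>.\<close>

fun lpart :: "(bas => int => 'k) => bas => int => (bas => 'k) => 'k::comm_ring_1" where
  "lpart c bE i f = c bE i * f bE"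
| "lpart c bA i f = c bE (i - 1) * f bA + c bA (i - 1) * f bE"
| "lpart c bB i f = c bE (i + 1) * f bB + c bB (i + 1) * f bE"
| "lpart c bS i f = c bE i * f bS + c bS i * f bE + c bA i * f bB + c bB i * f bA"

text \<open>On the right the factor \<open>v\<close> starts at \<open>j\<close>, the second vertex
  of the generator, so the argument of \<open>c\<close> moves forward along
  \<open>v\<close>.\<close>

fun rpart :: "(bas => int => 'k) => bas => int => (bas => 'k) => 'k::comm_ring_1" where
  "rpart c bE j f = f bE * c bE j"
| "rpart c bA j f = f bE * c bA j + f bA * c bE (j + 1)"
| "rpart c bB j f = f bE * c bB j + f bB * c bE (j - 1)"
| "rpart c bS j f = f bE * c bS j + f bS * c bE j + f bA * c bB (j + 1) + f bB * c bA (j - 1)"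

definition mlact :: "'k lam => 'k mfun => 'k::comm_ring_1 mfun" where
  "mlact c X = (\<lambda>u v r i. lpart (cf c) u i (\<lambda>u. X u v r i))"

definition mract :: "int => 'k mfun => 'k lam => 'k::comm_ring_1 mfun" where
  "mract n X c = (\<lambda>u v r i. rpart (cf c) v (i + n - 2 * r) (\<lambda>v. X u v r i))"

text \<open>A sign with integer exponent, because the index \<open>r\<close> is an integer and may
  be negative.\<close>

definition sg :: "int => 'k::comm_ring_1" where "sg k = (if even k then 1 else - 1)"

text \<open>The coefficients of \<open>x a\<close>, and equally of \<open>a x\<close>: since
  \<open>ab\<close> and \<open>ba\<close> are both \<open>s\<close>, one function serves left and
  right multiplication. \<open>preB\<close> does the same for \<open>b\<close>.\<close>

fun preA :: "(bas => 'k) => bas => 'k::comm_ring_1" where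
  "preA f bE = 0" | "preA f bA = f bE" | "preA f bB = 0" | "preA f bS = f bB"

fun preB :: "(bas => 'k) => bas => 'k::comm_ring_1" where
  "preB f bE = 0" | "preB f bA = 0" | "preB f bB = f bE" | "preB f bS = f bA"

text \<open>The differential as a transpose: the entry at \<open>(i, r)\<close> collects the
  contributions of the generators \<open>(i, r)\<close> and \<open>(i - 1, r)\<close> through
  \<open>a\<close>, and of \<open>(i + 1, r + 1)\<close> and \<open>(i, r + 1)\<close> through
  \<open>b\<close>. For N = 1 all three cases of the resolution are this one formula.\<close>

definition dm :: "int => 'k mfun => 'k::comm_ring_1 mfun" where
  "dm n X = (\<lambda>u v r i. if 0 \<le> r \<and> r \<le> n - 1 then
      preA (\<lambda>v. X u v r i) v + sg (n + r) * preA (\<lambda>u. X u v r (i - 1)) u +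
      sg (n + r + 1) * preB (\<lambda>u. X u v (r + 1) (i + 1)) u + sg n * preB (\<lambda>v. X u v (r + 1) i) v
    else 0)"

text \<open>A term \<open>a g v\<close> with \<open>g\<close> the generator
  \<open>(i + 1, r)\<close> occurs, up to sign, in the boundary of the generator
  \<open>(i, r)\<close> one degree higher, multiplied by \<open>v\<close>. The homotopy strips this
  leftmost \<open>a\<close>, and likewise turns \<open>s = ba\<close> into \<open>b\<close>. A
  leftmost \<open>b\<close> is stripped only in the last summand \<open>r = n\<close>, using the
  generator \<open>(i, n + 1)\<close>, whose boundary has no terms with \<open>a\<close>; the
  summand with \<open>preA\<close> is the correction for \<open>s\<close> there.\<close>

fun hmu :: "int => 'k mfun => 'k::comm_ring_1 mfun" where
  "hmu n X bE v r i = sg (n - r + 1) * X bA v r (i + 1) +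
     (if r = n + 1 then preA (\<lambda>v. X bS v n i) v + X bB v n (i - 1) else 0)"
| "hmu n X bB v r i = sg (n - r + 1) * X bS v r (i + 1)"
| "hmu n X bA v r i = 0"
| "hmu n X bS v r i = 0"

text \<open>The finite set of generators appears as bounded support in \<open>r\<close> and
  periodicity in \<open>i\<close>.\<close>

definition mcarrier :: "nat => int => 'k::comm_ring_1 mfun set" where
  "mcarrier m n = {X. (\<forall>u v r i. (r < 0 \<or> r > n \<longrightarrow> X u v r i = 0) \<and> X u v r (i mod int m) = X u v r i)}"

text \<open>Values are indexed by the source \<open>k\<close> of the product, so a left factor
  \<open>a\<close> belongs to the generator at \<open>k + 1\<close> and a left factor
  \<open>b\<close> to the one at \<open>k - 1\<close>.\<close>

fun meps_fun :: "'k mfun => bas => int => 'k::comm_ring_1" where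
  "meps_fun X bE k = X bE bE 0 k"
| "meps_fun X bA k = X bE bA 0 k + X bA bE 0 (k + 1)"
| "meps_fun X bB k = X bE bB 0 k + X bB bE 0 (k - 1)"
| "meps_fun X bS k = X bE bS 0 k + X bS bE 0 k + X bA bB 0 (k + 1) + X bB bA 0 (k - 1)"

definition meps :: "'k mfun => 'k::comm_ring_1 lam" where "meps X = MkLam (meps_fun X)"

definition mgen :: "nat => int => int => 'k::comm_ring_1 mfun" where
  "mgen m i r = (\<lambda>u v r' i'. if u = bE \<and> v = bE \<and> r' = r \<and> i' mod int m = i mod int m then 1 else 0)"

lemma mfun_eqI: "(\<And>u v r i. X u v r i = Y u v r i) ==> X = Y" for X Y :: "'k mfun"
  by (simp add: fun_eq_iff)

lemma supp_zero: "X \<in> mcarrier m n ==> r < 0 \<or> r > n ==> X u v r i = 0"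
  unfolding mcarrier_def by blast

lemma sg_simps [simp]:
  "sg (x + y) = sg x * sg y" "sg (x - y) = sg x * sg y" "sg 1 = - 1" "sg 2 = 1" "sg 3 = - 1" "sg (2 * x) = 1" "sg 0 = 1"
  "sg x * sg x = 1" "sg x * (sg x * z) = z"
  by (auto simp: sg_def)

text \<open>A finite check over the types of \<open>u\<close> and \<open>v\<close>. The summand
  \<open>r = n\<close> is separate because the second half of \<open>hmu\<close> is active there: in
  degree \<open>n - 1\<close> on the boundary of \<open>X\<close>, and in degree \<open>n\<close> at
  the neighbouring index \<open>n + 1\<close>.\<close>

lemma dm_hmu:
  assumes X: "X \<in> mcarrier m n" and n: "n \<ge> 1"
  shows "dm (n + 1) (hmu n X) u v r i + hmu (n - 1) (dm n X) u v r i = X u v r i"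
proof -
  consider "r < 0" | "r > n" | "0 \<le> r \<and> r < n" | "r = n" by linarith
  then show ?thesis
  proof cases
    case 1
    then have d: "dm k Y u v r i = 0" for k u v i and Y :: "'a mfun" by (simp add: dm_def)
    show ?thesis using 1 n supp_zero[OF X, of r] by (cases u) (simp_all add: d)
  next
    case 2
    then have d: "dm (n + 1) Y u v r i = 0" "dm n Y u v r i = 0" for u v i and Y :: "'a mfun" by (simp_all add: dm_def)
    show ?thesis using 2 n supp_zero[OF X, of r] by (cases u) (simp_all add: d)
  next
    case 3
    then have c: "r \<noteq> n + 1" "r \<noteq> 1 + n" "r + 1 \<noteq> n + 1" "r \<noteq> n" "0 \<le> r" "r \<le> n" "r \<le> n - 1" by auto
    have d: "dm n X u v r i = preA (\<lambda>v. X u v r i) v + sg (n + r) * preA (\<lambda>u. X u v r (i - 1)) u +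
      sg (n + r + 1) * preB (\<lambda>u. X u v (r + 1) (i + 1)) u + sg n * preB (\<lambda>v. X u v (r + 1) i) v" for u v i
      using c by (simp add: dm_def)
    let ?H = "hmu n X"
    have d': "dm (n + 1) ?H u v r i = preA (\<lambda>v. ?H u v r i) v + sg (n + 1 + r) * preA (\<lambda>u. ?H u v r (i - 1)) u +
      sg (n + 1 + r + 1) * preB (\<lambda>u. ?H u v (r + 1) (i + 1)) u + sg (n + 1) * preB (\<lambda>v. ?H u v (r + 1) i) v"
      using c by (simp add: dm_def)
    show ?thesis unfolding d'
      by (cases u; cases v) (simp_all add: d c algebra_simps)
  next
    case 4
    have d: "dm n X u v (n - 1) i = preA (\<lambda>v. X u v (n - 1) i) v - preA (\<lambda>u. X u v (n - 1) (i - 1)) u +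
      preB (\<lambda>u. X u v n (i + 1)) u + sg n * preB (\<lambda>v. X u v n i) v" for u v i
      using n by (simp add: dm_def)
    have d0: "dm n X u v n i = 0" for u v i by (simp add: dm_def)
    let ?H = "hmu n X"
    have d': "dm (n + 1) ?H u v n i = preA (\<lambda>v. ?H u v n i) v - preA (\<lambda>u. ?H u v n (i - 1)) u +
      preB (\<lambda>u. ?H u v (n + 1) (i + 1)) u - sg n * preB (\<lambda>v. ?H u v (n + 1) i) v"
      using n by (simp add: dm_def)
    have z: "X u v (n + 1) i = 0" "X u v (1 + n) i = 0" for u v i by (rule supp_zero[OF X], simp)+
    show ?thesis unfolding 4 d'
      by (cases u; cases v) (simp_all add: d d0 z algebra_simps)
  qed
qed

text \<open>In degree 0 the identity holds on the kernel of the augmentation: the vanishing of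
  \<open>meps\<close> ties the coefficients with left factor \<open>e\<close>, which
  \<open>hmu\<close> ignores, to the remaining ones.\<close>

lemma dm_hmu_0:
  assumes X: "X \<in> mcarrier m 0" and eps: "meps X = 0"
  shows "dm 1 (hmu 0 X) u v r i = X u v r i"
proof (cases "r = 0")
  case True
  have e: "meps_fun X t k = 0" for t k using eps by (simp add: meps_def zero_lam_def fun_eq_iff)
  have z: "X u v 1 i = 0" for u v i using supp_zero[OF X, of 1] by simp
  have eE: "X bE bE 0 i = 0" using e[of bE i] by simp
  have eA: "X bA bE 0 (i + 1) = - X bE bA 0 i"
    by (subst eq_iff_diff_eq_0) (use e[of bA i] in \<open>simp add: algebra_simps\<close>)
  have eB: "X bB bE 0 (i - 1) = - X bE bB 0 i"
    by (subst eq_iff_diff_eq_0) (use e[of bB i] in \<open>simp add: algebra_simps\<close>)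
  have eS: "X bA bB 0 (i + 1) = - X bE bS 0 i - X bS bE 0 i - X bB bA 0 (i - 1)"
    by (subst eq_iff_diff_eq_0) (use e[of bS i] in \<open>simp add: algebra_simps\<close>)
  show ?thesis unfolding True
    by (cases u; cases v) (simp_all add: dm_def z eE eA eB eS)
next
  case False
  then have "r < 0 \<or> r > 0" by linarith
  from supp_zero[OF X this] show ?thesis using False by (auto simp: dm_def)
qed

lemma dm_dm:  "dm n (dm (n + 1) X) u v r i = 0"
proof -
  consider "0 \<le> r \<and> r \<le> n - 1" | "\<not> (0 \<le> r \<and> r \<le> n - 1)" by blast
  then show ?thesis
  proof cases
    case 1
    then have c: "0 \<le> r" "r \<le> n - 1" "r \<le> n" "0 \<le> r + 1" "r + 1 \<le> n" by auto
    show ?thesis by (cases u; cases v) (simp_all add: dm_def c algebra_simps)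
  next
    case 2 then show ?thesis by (simp only: dm_def if_False)
  qed
qed

lemma meps_dm: "meps (dm 1 X) = 0"
proof (rule lam_eqI)
  fix t k show "cf (meps (dm 1 X)) t k = cf 0 t k"
    by (cases t) (simp_all add: meps_def dm_def)
qed

lemma periodic_cong:
  assumes "periodic m c" "i mod int m = j mod int m" shows "cf c t i = cf c t j"
  using assms unfolding periodic_def by metis

lemma mcarrier_cong:
  assumes "X \<in> mcarrier m n" "i mod int m = j mod int m" shows "X u v r i = X u v r j"
proof -
  have "X u v r (i mod int m) = X u v r i" "X u v r (j mod int m) = X u v r j" using assms(1) by (auto simp: mcarrier_def)
  then show ?thesis using assms(2) by simp
qed

lemma mcarrierI:
  assumes "\<And>u v r i. r < 0 \<or> r > n ==> X u v r i = 0"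
    "\<And>u v r i j. i mod int m = j mod int m ==> X u v r i = X u v r j"
  shows "X \<in> mcarrier m n"
  unfolding mcarrier_def using assms(1) assms(2)[of "_ mod int m" "_"] by simp

lemma mod_shifts:
  assumes "i mod int m = j mod int m"
  shows "(i + 1) mod int m = (j + 1) mod int m" "(i - 1) mod int m = (j - 1) mod int m"
    "(i + n - 2 * r) mod int m = (j + n - 2 * r) mod int m"
    "(i + n - 2 * r + 1) mod int m = (j + n - 2 * r + 1) mod int m"
    "(i + n - 2 * r - 1) mod int m = (j + n - 2 * r - 1) mod int m"
  using assms by (simp_all add: mod_eq_dvd_iff)

lemma mlact_closed:
  assumes c: "periodic m c" and X: "X \<in> mcarrier m n" shows "mlact c X \<in> mcarrier m n"
proof (rule mcarrierI)
  fix u v r i assume "r < 0 \<or> r > n"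
  then show "mlact c X u v r i = 0" unfolding mlact_def by (cases u) (simp_all add: supp_zero[OF X])
next
  fix u v r i j assume ij: "i mod int m = j mod int m"
  note p = periodic_cong[OF c ij] periodic_cong[OF c mod_shifts(1)[OF ij]] periodic_cong[OF c mod_shifts(2)[OF ij]]
    mcarrier_cong[OF X ij]
  show "mlact c X u v r i = mlact c X u v r j" unfolding mlact_def by (cases u) (simp_all add: p)
qed

lemma mract_closed:
  assumes c: "periodic m c" and X: "X \<in> mcarrier m n" shows "mract k X c \<in> mcarrier m n"
proof (rule mcarrierI)
  fix u v r i assume "r < 0 \<or> r > n"
  then show "mract k X c u v r i = 0" unfolding mract_def by (cases v) (simp_all add: supp_zero[OF X])
next
  fix u v r i j assume ij: "i mod int m = j mod int m"
  note p = periodic_cong[OF c mod_shifts(3)[OF ij]] periodic_cong[OF c mod_shifts(4)[OF ij]]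
    periodic_cong[OF c mod_shifts(5)[OF ij]] mcarrier_cong[OF X ij]
  show "mract k X c u v r i = mract k X c u v r j" unfolding mract_def by (cases v) (simp_all add: p)
qed

lemma dm_closed:
  assumes X: "X \<in> mcarrier m (n + 1)" shows "dm (n + 1) X \<in> mcarrier m n"
proof (rule mcarrierI)
  fix u v r i assume "r < 0 \<or> r > n"
  then show "dm (n + 1) X u v r i = 0" unfolding dm_def by auto
next
  fix u v r i j assume ij: "i mod int m = j mod int m"
  note p = mcarrier_cong[OF X ij] mcarrier_cong[OF X mod_shifts(1)[OF ij]] mcarrier_cong[OF X mod_shifts(2)[OF ij]]
  show "dm (n + 1) X u v r i = dm (n + 1) X u v r j"
    unfolding dm_def by (cases u; cases v) (simp_all add: p)
qed

lemma hmu_closed: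
  assumes X: "X \<in> mcarrier m n" and n: "n \<ge> 0" shows "hmu n X \<in> mcarrier m (n + 1)"
proof (rule mcarrierI)
  fix u v r i assume "r < 0 \<or> r > n + 1"
  then show "hmu n X u v r i = 0" using n by (cases u) (auto simp: supp_zero[OF X])
next
  fix u v r i j assume ij: "i mod int m = j mod int m"
  note p = mcarrier_cong[OF X ij] mcarrier_cong[OF X mod_shifts(1)[OF ij]] mcarrier_cong[OF X mod_shifts(2)[OF ij]]
  show "hmu n X u v r i = hmu n X u v r j" by (cases u; cases v) (simp_all add: p)
qed

lemma mgen_closed: "0 \<le> r ==> r \<le> n ==> mgen m i r \<in> mcarrier m n"
  by (rule mcarrierI) (auto simp: mgen_def)

lemma dm_mlact: "dm n (mlact c X) = mlact c (dm n X)"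
proof (rule mfun_eqI)
  fix u v r i show "dm n (mlact c X) u v r i = mlact c (dm n X) u v r i"
    by (cases u; cases v) (simp_all add: dm_def mlact_def algebra_simps)
qed

lemma dm_mract: "dm n (mract n X c) = mract (n - 1) (dm n X) c"
proof (rule mfun_eqI)
  fix u v r i
  have e: "i + (n - 1) - 2 * r = i + n - 2 * r - 1" "i - 1 + n - 2 * r = i + n - 2 * r - 1"
    "i + 1 + n - 2 * (r + 1) = i + n - 2 * r - 1" "i + n - 2 * (r + 1) = i + n - 2 * r - 2" by auto
  show "dm n (mract n X c) u v r i = mract (n - 1) (dm n X) c u v r i"
    unfolding dm_def mract_def e by (cases u; cases v) (simp_all add: algebra_simps)
qed

lemma meps_mlact: "meps (mlact c X) = c * meps X"
proof (rule lam_eqI)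
  fix t k show "cf (meps (mlact c X)) t k = cf (c * meps X) t k"
    by (cases t) (simp_all add: meps_def mlact_def algebra_simps)
qed

lemma meps_mract: "meps (mract 0 X c) = meps X * c"
proof (rule lam_eqI)
  fix t k show "cf (meps (mract 0 X c)) t k = cf (meps X * c) t k"
    by (cases t) (simp_all add: meps_def mract_def algebra_simps)
qed

lemma meps_mgen: "meps (mgen m i 0) = lidem m i"
proof (rule lam_eqI)
  fix t k show "cf (meps (mgen m i 0)) t k = cf (lidem m i) t k"
    by (cases t) (simp_all add: meps_def mgen_def)
qed

lemma act_assoc:
  "mlact (c * d) X = mlact c (mlact d X)" "mract n X (c * d) = mract n (mract n X c) d"
  "mract n (mlact c X) d = mlact c (mract n X d)"
proof -
  show "mlact (c * d) X = mlact c (mlact d X)"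
  proof (rule mfun_eqI)
    fix u v r i show "mlact (c * d) X u v r i = mlact c (mlact d X) u v r i"
      by (cases u) (simp_all add: mlact_def algebra_simps)
  qed
  show "mract n X (c * d) = mract n (mract n X c) d"
  proof (rule mfun_eqI)
    fix u v r i show "mract n X (c * d) u v r i = mract n (mract n X c) d u v r i"
      by (cases v) (simp_all add: mract_def algebra_simps)
  qed
  show "mract n (mlact c X) d = mlact c (mract n X d)"
  proof (rule mfun_eqI)
    fix u v r i show "mract n (mlact c X) d u v r i = mlact c (mract n X d) u v r i"
      by (cases u; cases v) (simp_all add: mract_def mlact_def algebra_simps)
  qed
qed

text \<open>Matches the transposed form with the formula on generators; the two conditions on
  \<open>r\<close> drop the generators with index \<open>n\<close> and \<open>-1\<close> in degree
  \<open>n - 1\<close>.\<close>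

lemma dm_mgen:
  assumes "0 \<le> r" "r \<le> n" "n \<ge> 1"
  shows "dm n (mgen m i r) u v r' i' =
    (if r \<le> n - 1 then mract (n - 1) (mgen m i r) (lbas bA) u v r' i' + sg (n + r) * mlact (lbas bA) (mgen m (i + 1) r) u v r' i' else 0)
  + (if 1 \<le> r then sg (n + r) * mlact (lbas bB) (mgen m (i - 1) (r - 1)) u v r' i' + sg n * mract (n - 1) (mgen m i (r - 1)) (lbas bB) u v r' i' else 0)"
proof -
  have 1: "(i' - 1) mod int m = i mod int m \<longleftrightarrow> i' mod int m = (i + 1) mod int m"
    by (simp add: mod_eq_dvd_iff algebra_simps)
  have 2: "(i' + 1) mod int m = i mod int m \<longleftrightarrow> i' mod int m = (i - 1) mod int m"
    by (simp add: mod_eq_dvd_iff algebra_simps)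
  have 3: "r' + 1 = r \<longleftrightarrow> r' = r - 1" by auto
  have 4: "sg (n + (r - 1) + 1) = (sg (n + r) :: 'a)" by simp
  show ?thesis using assms
    by (cases u; cases v; cases "r' = r"; cases "r' = r - 1")
      (simp_all add: dm_def mract_def mlact_def mgen_def 1 2 3)
qed

section \<open>Bivariate polynomials\<close>

text \<open>The monomial c x^p y^q, with x the outer and y the inner variable.\<close>

definition bimon :: "'k::field => nat => nat => 'k poly poly" where
  "bimon c p q = monom (monom c q) p"

lemma coeff_bimon [simp]: "coeff (coeff (bimon c p q) i) j = (if i = p \<and> j = q then c else 0)"
  by (simp add: bimon_def)

lemma bimon_mult: "bimon c p q * bimon d p' q' = bimon (c * d) (p + p') (q + q')"
  by (simp add: bimon_def mult_monom)

lemma bimon_add: "bimon (c + d) p q = bimon c p q + bimon d p q"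
  by (simp add: bimon_def add_monom)

lemma bimon_zero [simp]: "bimon 0 p q = 0" by (simp add: bimon_def)

lemma bimon_one: "bimon 1 0 0 = 1" by (simp add: bimon_def monom_0 one_pCons)

lemma bipoly_eqI: "(\<And>p q. coeff (coeff F p) q = coeff (coeff G p) q) ==> F = G"
  by (intro poly_eqI) auto

lemma bipoly_expand:
  assumes "degree F \<le> d" "\<And>p. degree (coeff F p) \<le> e"
  shows "F = (\<Sum>p\<le>d. \<Sum>q\<le>e. bimon (coeff (coeff F p) q) p q)"
proof (rule bipoly_eqI)
  fix p q
  have c: "coeff (coeff (\<Sum>i\<le>d. \<Sum>j\<le>e. bimon (coeff (coeff F i) j) i j) p) q =
      (\<Sum>i\<le>d. \<Sum>j\<le>e. if p = i \<and> q = j then coeff (coeff F i) j else 0)"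
    by (simp add: coeff_sum)
  have i: "(\<Sum>j\<le>e. if p = i \<and> q = j then coeff (coeff F i) j else 0) =
      (if p = i then if q \<le> e then coeff (coeff F p) q else 0 else 0)" for i
    by (cases "p = i") auto
  have z: "coeff (coeff F p) q = 0" if "p > d \<or> q > e"
    using that assms(1) assms(2)[of p] by (auto intro: coeff_eq_0 simp: coeff_eq_0[of F p])
  show "coeff (coeff F p) q = coeff (coeff (\<Sum>i\<le>d. \<Sum>j\<le>e. bimon (coeff (coeff F i) j) i j) p) q"
    unfolding c i using z by (auto simp: not_le)
qed

lemma bipoly_bound: "\<exists>e. \<forall>p. degree (coeff F p) \<le> (e::nat)"
proof -
  have "degree (coeff F p) \<le> Max ((\<lambda>p. degree (coeff F p)) ` {..degree F})" for p
  proof (cases "p \<le> degree F")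
    case False then show ?thesis by (simp add: coeff_eq_0)
  qed (auto intro: Max_ge)
  then show ?thesis by blast
qed

text \<open>Gaussian elimination, one equation at a time: an equation with a nonzero coefficient is
  solved for that unknown, one whose coefficients all vanish is dropped.\<close>

lemma homogeneous_solution:
  fixes a :: "'j => 'i => 'k::field"
  assumes "finite J" "finite I" "card J < card I"
  shows "\<exists>c. (\<exists>i\<in>I. c i \<noteq> 0) \<and> (\<forall>j\<in>J. (\<Sum>i\<in>I. c i * a j i) = 0)"
  using assms
proof (induct J arbitrary: I a rule: finite_induct)
  case empty
  then obtain i where "i \<in> I" by fastforce
  then show ?case by (intro exI[of _ "\<lambda>_. 1"]) auto
next
  case (insert j J)
  show ?case
  proof (cases "\<forall>i\<in>I. a j i = 0")
    case True
    obtain c where "\<exists>i\<in>I. c i \<noteq> 0" "\<forall>j\<in>J. (\<Sum>i\<in>I. c i * a j i) = 0"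
      using insert(3)[OF insert(4), of a] insert(1,2,5) by auto
    with True show ?thesis by (intro exI[of _ c]) auto
  next
    case False
    then obtain k where k: "k \<in> I" "a j k \<noteq> 0" by blast
    let ?I = "I - {k}"
    \<comment> \<open>Equation \<open>l\<close> minus the multiple of equation \<open>j\<close> that
      removes the unknown \<open>k\<close>.\<close>
    define b where "b = (\<lambda>l i. a l i - a l k * a j i / a j k)"
    have "card J < card ?I" using insert(1,2,4,5) k by simp
    then obtain c where c: "\<exists>i\<in>?I. c i \<noteq> 0" "\<forall>l\<in>J. (\<Sum>i\<in>?I. c i * b l i) = 0"
      using insert(3)[of ?I b] insert(4) by auto
    define s where "s = (\<Sum>i\<in>?I. c i * a j i)"
    \<comment> \<open>The value of the unknown \<open>k\<close> is the one forced by equation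
      \<open>j\<close>.\<close>
    define c' where "c' = (\<lambda>i. if i = k then - s / a j k else c i)"
    have sum: "(\<Sum>i\<in>I. c' i * a l i) = - s / a j k * a l k + (\<Sum>i\<in>?I. c i * a l i)" for l
    proof -
      have "(\<Sum>i\<in>I. c' i * a l i) = c' k * a l k + (\<Sum>i\<in>?I. c' i * a l i)"
        using insert(4) k(1) by (rule sum.remove)
      also have "(\<Sum>i\<in>?I. c' i * a l i) = (\<Sum>i\<in>?I. c i * a l i)"
        by (rule sum.cong) (auto simp: c'_def)
      finally show ?thesis by (simp add: c'_def)
    qed
    have "(\<Sum>i\<in>I. c' i * a l i) = 0" if "l \<in> J" for l
    proof -
      have "0 = (\<Sum>i\<in>?I. c i * b l i)" using c(2) that by simp
      also have "\<dots> = (\<Sum>i\<in>?I. c i * a l i - (a l k / a j k) * (c i * a j i))"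
        by (rule sum.cong) (auto simp: b_def field_simps)
      also have "\<dots> = (\<Sum>i\<in>?I. c i * a l i) - (a l k / a j k) * s"
        by (simp add: sum_subtractf s_def sum_distrib_left)
      finally show ?thesis unfolding sum by (simp add: field_simps)
    qed
    moreover have "(\<Sum>i\<in>I. c' i * a j i) = 0"
      unfolding sum using k(2) by (simp add: s_def)
    moreover have "\<exists>i\<in>I. c' i \<noteq> 0" using c(1) by (auto simp: c'_def)
    ultimately show ?thesis by (intro exI[of _ c']) auto
  qed
qed

text \<open>Bounding each variable separately leaves (d + 1)^2 coefficients, a number that is easily
  compared with a count of monomials.\<close>

definition bidegree_le :: "'k::field poly poly => nat => bool" where
  "bidegree_le F d \<longleftrightarrow> degree F \<le> d \<and> (\<forall>p. degree (coeff F p) \<le> d)"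

lemma bidegree_le_mono: "bidegree_le F d ==> d \<le> e ==> bidegree_le F e"
  unfolding bidegree_le_def by (meson order_trans)

lemma bidegree_le_mult:
  assumes "bidegree_le F d" "bidegree_le G e" shows "bidegree_le (F * G) (d + e)"
proof -
  have "degree (F * G) \<le> d + e"
    using degree_mult_le[of F G] assms by (simp add: bidegree_le_def)
  moreover have "degree (coeff (F * G) p) \<le> d + e" for p
    unfolding coeff_mult
  proof (rule degree_sum_le)
    fix i assume "i \<in> {..p}"
    show "degree (coeff F i * coeff G (p - i)) \<le> d + e"
      using degree_mult_le[of "coeff F i" "coeff G (p - i)"] assms
      unfolding bidegree_le_def by (meson add_mono order_trans)
  qed simp
  ultimately show ?thesis by (simp add: bidegree_le_def)
qed

lemma bidegree_le_power: "bidegree_le F d ==> bidegree_le (F ^ n) (n * d)"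
proof (induct n)
  case 0 show ?case by (simp add: bidegree_le_def one_pCons coeff_pCons split: nat.split)
next
  case (Suc n)
  then show ?case using bidegree_le_mult[of F d "F ^ n" "n * d"] by simp
qed

lemma bidegree_le_exists: "\<exists>d. bidegree_le F d"
proof -
  obtain e where "\<forall>p. degree (coeff F p) \<le> e" using bipoly_bound by blast
  then have "bidegree_le F (max (degree F) e)" by (auto simp: bidegree_le_def le_max_iff_disj)
  then show ?thesis ..
qed

section \<open>Chains of primes in subrings of K[x,y]\<close>

abbreviation const2 :: "'k::field => 'k poly poly" where "const2 c \<equiv> [:[:c:]:]"

text \<open>There are t^3 monomials in \<open>u\<close>, \<open>v\<close>, \<open>w\<close> with
  exponents below \<open>t\<close>, but their bidegrees are bounded linearly in \<open>t\<close>, so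
  only quadratically many coefficients have to cancel.\<close>

lemma three_dependent:
  fixes u v w :: "'k::field poly poly"
  shows "\<exists>t c. (\<exists>i<t. \<exists>j<t. \<exists>k<t. c i j k \<noteq> 0) \<and>
    (\<Sum>i<t. \<Sum>j<t. \<Sum>k<t. const2 (c i j k) * (u ^ i * v ^ j * w ^ k)) = 0"
proof -
  obtain d1 d2 d3 where "bidegree_le u d1" "bidegree_le v d2" "bidegree_le w d3"
    using bidegree_le_exists by metis
  then obtain D where D: "bidegree_le u D" "bidegree_le v D" "bidegree_le w D"
    using bidegree_le_mono[of u d1 "d1 + d2 + d3"] bidegree_le_mono[of v d2 "d1 + d2 + d3"]
      bidegree_le_mono[of w d3 "d1 + d2 + d3"] by auto
  \<comment> \<open>Since \<open>L + 1 \<le> t (3 D + 1)\<close>, there are at most t^2 (3 D + 1)^2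
    equations, which is less than t^3 as soon as \<open>t\<close> exceeds (3 D + 1)^2.\<close>
  define t where "t = (3 * D + 1) ^ 2 + 1"
  define L where "L = t * (3 * D)"
  define M where "M = (\<lambda>(i, j, k). u ^ i * v ^ j * w ^ k)"
  have bd: "bidegree_le (M (i, j, k)) L" if "i < t" "j < t" "k < t" for i j k
  proof -
    have "bidegree_le (M (i, j, k)) (i * D + j * D + k * D)"
      unfolding M_def prod.case using D by (intro bidegree_le_mult bidegree_le_power)
    moreover have "i * D + j * D + k * D \<le> L"
    proof -
      have "i * D \<le> t * D" "j * D \<le> t * D" "k * D \<le> t * D" using that by simp_all
      moreover have "L = t * D + t * D + t * D" by (simp add: L_def)
      ultimately show ?thesis by linarith
    qed
    ultimately show ?thesis by (rule bidegree_le_mono)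
  qed
  let ?I = "{..<t} \<times> {..<t} \<times> {..<t}" and ?J = "{..L} \<times> {..L}"
  have t1: "1 \<le> t" by (simp add: t_def)
  have LL: "L + 1 \<le> t * (3 * D + 1)" 
  proof -
    have "t * (3 * D + 1) = L + t" unfolding L_def by simp
    then show ?thesis using t1 by linarith
  qed
  have "(L + 1) * (L + 1) \<le> (t * (3 * D + 1)) * (t * (3 * D + 1))" by (rule mult_mono[OF LL LL]) auto
  also have "\<dots> = t * t * (3 * D + 1) ^ 2" by (simp only: power2_eq_square mult_ac)
  also have "\<dots> < t * t * t" using t1 by (simp add: t_def)
  finally have card: "card ?J < card ?I" by (simp add: card_cartesian_product)
  obtain c where c: "\<exists>i\<in>?I. c i \<noteq> 0"
      "\<forall>j\<in>?J. (\<Sum>i\<in>?I. c i * coeff (coeff (M i) (fst j)) (snd j)) = 0"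
    using homogeneous_solution[of ?J ?I "\<lambda>j i. coeff (coeff (M i) (fst j)) (snd j)"] card by auto
  have "(\<Sum>i\<in>?I. const2 (c i) * M i) = 0"
  proof (rule bipoly_eqI)
    fix p q
    have e: "coeff (coeff (\<Sum>i\<in>?I. const2 (c i) * M i) p) q = (\<Sum>i\<in>?I. c i * coeff (coeff (M i) p) q)"
      by (simp add: coeff_sum)
    show "coeff (coeff (\<Sum>i\<in>?I. const2 (c i) * M i) p) q = coeff (coeff 0 p) q"
    proof (cases "p \<le> L \<and> q \<le> L")
      case True then show ?thesis unfolding e using c(2)[rule_format, of "(p, q)"] by simp
    next
      case False
      have "coeff (coeff (M i) p) q = 0" if "i \<in> ?I" for i
      proof -
        have "bidegree_le (M i) L" using bd that by (cases i) auto
        then have d: "degree (M i) \<le> L" "degree (coeff (M i) p) \<le> L" by (auto simp: bidegree_le_def)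
        show ?thesis
        proof (cases "p \<le> L")
          case True
          with False d(2) show ?thesis by (intro coeff_eq_0) auto
        next
          case False
          then have "coeff (M i) p = 0" using d(1) by (intro coeff_eq_0) auto
          then show ?thesis by simp
        qed
      qed
      then show ?thesis unfolding e by (simp add: sum.neutral)
    qed
  qed
  then have "(\<Sum>i<t. \<Sum>j<t. \<Sum>k<t. const2 (c (i, j, k)) * (u ^ i * v ^ j * w ^ k)) = 0"
    by (simp add: sum.cartesian_product case_prod_unfold M_def)
  moreover have "\<exists>i<t. \<exists>j<t. \<exists>k<t. c (i, j, k) \<noteq> 0" using c(1) by auto
  ultimately show ?thesis by (intro exI[of _ t] exI[of _ "\<lambda>i j k. c (i, j, k)"]) auto
qed

text \<open>Prime ideals of a subring that is given as a subset of a type, so that powers and finite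
  sums of the type class are available.\<close>

definition prime_in :: "'a::comm_ring_1 set => 'a set => bool" where
  "prime_in R P \<longleftrightarrow> P \<subseteq> R \<and> 0 \<in> P \<and> 1 \<notin> P \<and> (\<forall>x\<in>P. \<forall>y\<in>P. x + y \<in> P) \<and>
     (\<forall>r\<in>R. \<forall>x\<in>P. r * x \<in> P) \<and> (\<forall>x\<in>R. \<forall>y\<in>R. x * y \<in> P \<longrightarrow> x \<in> P \<or> y \<in> P)"

lemma prime_in_power:
  assumes "prime_in R P" "x \<in> R" "\<And>n. x ^ n \<in> R" "x ^ n \<in> P" shows "x \<in> P"
  using assms(4)
proof (induct n)
  case 0 then show ?case using assms(1) by (simp add: prime_in_def)
next
  case (Suc n) then show ?case using assms(1-3) unfolding prime_in_def by (metis power_Suc)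
qed

text \<open>From a relation \<open>\<Sum>\<^sub>i x\<^sup>i f i \<in> P\<close> with \<open>x \<notin> P\<close>, divide by the lowest power of \<open>x\<close> and reduce
  modulo a prime containing \<open>P\<close> and \<open>x\<close>.\<close>

lemma leading_coefficient_in_prime:
  fixes x :: "'a::comm_ring_1"
  assumes P: "prime_in R P" and P': "prime_in R P'" and sub: "P \<subseteq> P'"
    and R: "\<And>a b. a \<in> R ==> b \<in> R ==> a + b \<in> R" "\<And>a b. a \<in> R ==> b \<in> R ==> a * b \<in> R" "1 \<in> R" "- 1 \<in> R"
    and x: "x \<in> P'" "x \<notin> P" and f: "\<And>i. f i \<in> R"
    and s: "(\<Sum>i<t. x ^ i * f i) \<in> P" and i0: "i0 < t" "\<And>i. i < i0 ==> f i = 0"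
  shows "f i0 \<in> P'"
proof -
  have xR: "x \<in> R" using x(1) P' by (auto simp: prime_in_def)
  have pw: "x ^ n \<in> R" for n by (induct n) (auto intro: R xR)
  have 0: "0 \<in> R" using R(1)[OF R(3,4)] by simp
  have sR: "sum g I \<in> R" if "\<And>i. i \<in> I ==> g i \<in> R" for g :: "nat => 'a" and I
    using that by (induct I rule: infinite_finite_induct) (auto intro: R 0)
  define g where "g = (\<Sum>i\<in>{Suc i0..<t}. x ^ (i - Suc i0) * f i)"
  have gR: "g \<in> R" unfolding g_def by (rule sR) (auto intro: R pw f)
  have split: "{..<t} = {..<i0} \<union> ({i0} \<union> {Suc i0..<t})" using i0(1) by auto
  have "(\<Sum>i<t. x ^ i * f i) = (\<Sum>i<i0. x ^ i * f i) + (\<Sum>i\<in>{i0} \<union> {Suc i0..<t}. x ^ i * f i)"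
    unfolding split by (rule sum.union_disjoint) auto
  also have "(\<Sum>i<i0. x ^ i * f i) = 0" using i0(2) by simp
  also have "(\<Sum>i\<in>{i0} \<union> {Suc i0..<t}. x ^ i * f i) = x ^ i0 * f i0 + (\<Sum>i\<in>{Suc i0..<t}. x ^ i * f i)"
    by simp
  also have "(\<Sum>i\<in>{Suc i0..<t}. x ^ i * f i) = x ^ i0 * (x * g)"
    unfolding g_def sum_distrib_left
  proof (rule sum.cong[OF refl])
    fix i assume "i \<in> {Suc i0..<t}"
    then have "i = i0 + (1 + (i - Suc i0))" by simp
    then have "x ^ i = x ^ i0 * (x * x ^ (i - Suc i0))" by (metis power_add power_one_right)
    then show "x ^ i * f i = x ^ i0 * (x * (x ^ (i - Suc i0) * f i))" by (simp add: mult.assoc)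
  qed
  finally have "x ^ i0 * (f i0 + x * g) \<in> P" using s by (simp add: distrib_left)
  moreover have h: "f i0 + x * g \<in> R" by (intro R f xR gR)
  moreover have "x ^ i0 \<notin> P" using prime_in_power[OF P xR pw] x(2) by blast
  ultimately have "f i0 + x * g \<in> P'" using P pw sub unfolding prime_in_def by blast
  moreover have "(- 1 * g) * x \<in> P'" using P' x(1) R(2)[OF R(4) gR] unfolding prime_in_def by blast
  ultimately have "(f i0 + x * g) + (- 1 * g) * x \<in> P'" using P' unfolding prime_in_def by blast
  then show ?thesis by (simp add: mult.commute)
qed

text \<open>Choose \<open>u\<close>, \<open>v\<close>, \<open>w\<close> in the three gaps of the
  chain and nest a polynomial relation between them in powers of \<open>u\<close>, then
  \<open>v\<close>, then \<open>w\<close>. Each use of \<open>leading_coefficient_in_prime\<close>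
  passes to an inner coefficient and one prime further up, until a nonzero constant lies in
  \<open>P 3\<close>.\<close>

lemma no_prime_chain:
  fixes R :: "'k::field poly poly set"
  assumes R: "\<And>a b. a \<in> R ==> b \<in> R ==> a + b \<in> R" "\<And>a b. a \<in> R ==> b \<in> R ==> a * b \<in> R"
      "\<And>c. const2 c \<in> R"
    and P: "\<And>i. i \<le> 3 ==> prime_in R (P i)" and chain: "\<And>i. i < 3 ==> P i \<subset> P (Suc i)"
  shows False
proof -
  have one: "1 \<in> R" "- 1 \<in> R" using R(3)[of 1] R(3)[of "- 1"] by (auto simp: one_pCons)
  note L = leading_coefficient_in_prime[OF P P _ R(1,2) one]
  have sub: "P 0 \<subset> P 1" "P 1 \<subset> P 2" "P 2 \<subset> P 3" using chain[of 0] chain[of 1] chain[of 2] by (auto simp: eval_nat_numeral)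
  obtain u where u: "u \<in> P 1" "u \<notin> P 0" using sub by blast
  obtain v where v: "v \<in> P 2" "v \<notin> P 1" using sub by blast
  obtain w where w: "w \<in> P 3" "w \<notin> P 2" using sub by blast
  have mR: "u \<in> R" "v \<in> R" "w \<in> R" using u v w P[of 1] P[of 2] P[of 3] by (auto simp: prime_in_def)
  have pw: "z ^ n \<in> R" if "z \<in> R" for z n by (induct n) (auto intro: R one that)
  have 0: "0 \<in> R" using R(3)[of 0] by simp
  have sR: "sum g I \<in> R" if "\<And>i. i \<in> I ==> g i \<in> R" for g :: "nat => 'k poly poly" and I
    using that by (induct I rule: infinite_finite_induct) (auto intro: R 0)
  obtain t c where c: "\<exists>i<t. \<exists>j<t. \<exists>k<t. c i j k \<noteq> 0"
    and z: "(\<Sum>i<t. \<Sum>j<t. \<Sum>k<t. const2 (c i j k) * (u ^ i * v ^ j * w ^ k)) = 0"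
    using three_dependent[of u v w] by blast
  \<comment> \<open>Coefficients are extended by zero outside the box, so that the least
    \<open>j\<close> and \<open>k\<close> with a nonzero coefficient lie below \<open>t\<close>
    automatically.\<close>
  define d where "d = (\<lambda>i j k. if j < t \<and> k < t then c i j k else 0)"
  define f where "f = (\<lambda>i. \<Sum>j<t. v ^ j * (\<Sum>k<t. w ^ k * const2 (d i j k)))"
  define g where "g = (\<lambda>i j. \<Sum>k<t. w ^ k * const2 (d i j k))"
  have "(\<Sum>i<t. u ^ i * f i) = (\<Sum>i<t. \<Sum>j<t. \<Sum>k<t. const2 (c i j k) * (u ^ i * v ^ j * w ^ k))"
    unfolding f_def sum_distrib_left by (intro sum.cong refl) (simp add: d_def mult_ac)
  then have "(\<Sum>i<t. u ^ i * f i) = 0" using z by simp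
  moreover have "0 \<in> P 0" using P[of 0] by (simp add: prime_in_def)
  ultimately have s: "(\<Sum>i<t. u ^ i * f i) \<in> P 0" by simp
  define i0 where "i0 = (LEAST i. i < t \<and> (\<exists>j k. d i j k \<noteq> 0))"
  have i0: "i0 < t \<and> (\<exists>j k. d i0 j k \<noteq> 0)"
    unfolding i0_def by (rule LeastI_ex) (use c in \<open>auto simp: d_def\<close>)
  have d0: "d i j k = 0" if "i < i0" for i j k
    using not_less_Least[of i "\<lambda>i. i < t \<and> (\<exists>j k. d i j k \<noteq> 0)"] that i0 unfolding i0_def[symmetric] by auto
  have gR: "g i j \<in> R" for i j unfolding g_def by (intro sR R pw mR)
  have fR: "f i \<in> R" for i unfolding f_def g_def[symmetric] by (intro sR R pw mR gR)
  have f0: "f i = 0" if "i < i0" for i unfolding f_def by (simp add: d0[OF that])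
  have f1: "f i0 \<in> P 1"
    by (rule L[of 0 1 u f t i0]) (use sub u fR s i0 f0 in auto)
  define j0 where "j0 = (LEAST j. \<exists>k. d i0 j k \<noteq> 0)"
  have j0: "\<exists>k. d i0 j0 k \<noteq> 0" unfolding j0_def by (rule LeastI_ex) (use i0 in blast)
  have jt: "j0 < t" using j0 by (auto simp: d_def split: if_splits)
  have e0: "d i0 j k = 0" if "j < j0" for j k
    using not_less_Least[of j "\<lambda>j. \<exists>k. d i0 j k \<noteq> 0"] that unfolding j0_def[symmetric] by auto
  have g0: "g i0 j = 0" if "j < j0" for j unfolding g_def by (simp add: e0[OF that])
  have g1: "g i0 j0 \<in> P 2"
    by (rule L[of 1 2 v "g i0" t j0]) (use sub v gR f1 jt g0 in \<open>auto simp: f_def g_def\<close>)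
  define k0 where "k0 = (LEAST k. d i0 j0 k \<noteq> 0)"
  have k0: "d i0 j0 k0 \<noteq> 0" unfolding k0_def by (rule LeastI_ex) (use j0 in blast)
  have kt: "k0 < t" using k0 by (auto simp: d_def split: if_splits)
  have h0: "const2 (d i0 j0 k) = 0" if "k < k0" for k
    using not_less_Least[of k "\<lambda>k. d i0 j0 k \<noteq> 0"] that unfolding k0_def[symmetric] by auto
  have "const2 (d i0 j0 k0) \<in> P 3"
    by (rule L[of 2 3 w "\<lambda>k. const2 (d i0 j0 k)" t k0]) (use sub w R(3) g1 kt h0 in \<open>auto simp: g_def\<close>)
  then have "const2 (inverse (d i0 j0 k0)) * const2 (d i0 j0 k0) \<in> P 3"
    using P[of 3] R(3) unfolding prime_in_def by blast
  then show False using P[of 3] k0 by (auto simp: prime_in_def one_pCons)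
qed

section \<open>Quotients and the presented algebra\<close>



text \<open>The codomain is a ring of a type class and \<open>sc\<close> provides its scalars.
  Properties of the quotient by the kernel are then read off in the codomain through the injection
  \<open>hq\<close>.\<close>

locale alg_map = kalg A for A :: "('k::field, 'a, 'c) module_scheme" (structure) +
  fixes h :: "'a => 's::comm_ring_1" and sc :: "'k => 's"
  assumes h_add: "x \<in> carrier A ==> y \<in> carrier A ==> h (x \<oplus> y) = h x + h y"
    and h_mult: "x \<in> carrier A ==> y \<in> carrier A ==> h (x \<otimes> y) = h x * h y"
    and h_one: "h \<one> = 1"
    and h_smult: "x \<in> carrier A ==> h (c \<odot> x) = sc c * h x"
begin

definition ker :: "'a set" where "ker = {x \<in> carrier A. h x = 0}"

lemma h_zero: "h \<zero> = 0" using h_add[of \<zero> \<zero>] by simp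

lemma h_neg: "x \<in> carrier A ==> h (\<ominus> x) = - h x"
  using h_add[of "\<ominus> x" x] by (simp add: l_neg h_zero eq_neg_iff_add_eq_0)

lemma h_minus: "x \<in> carrier A ==> y \<in> carrier A ==> h (x \<ominus> y) = h x - h y"
  by (simp add: minus_eq h_add h_neg)

lemma h_power: "x \<in> carrier A ==> h (x [^] (n::nat)) = h x ^ n"
  by (induct n) (simp_all add: h_one h_mult mult.commute)

lemma ideal_ker: "ideal ker A"
proof (rule idealI[OF ring_axioms])
  show "subgroup ker (add_monoid A)"
  proof
    fix x assume "x \<in> ker"
    then show "inv\<^bsub>add_monoid A\<^esub> x \<in> ker"
      using h_neg[of x] a_inv_closed[of x] by (simp add: ker_def a_inv_def[symmetric])
  qed (auto simp: ker_def h_add h_zero)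
qed (auto simp: ker_def h_mult)

abbreviation "Q \<equiv> A //\<^sub>k ker"

sublocale Q: kalg Q by (rule kalg_quot[OF kalg ideal_ker])
sublocale K: vec_sub A ker by (rule ideal_vec_sub[OF ideal_ker])
sublocale KI: ideal ker A by (rule ideal_ker)

text \<open>An arbitrary representative is evaluated; \<open>hq_coset\<close> shows that the choice
  does not matter.\<close>

definition hq :: "'a set => 's" where "hq X = h (SOME x. x \<in> X)"

lemma hq_coset: assumes x: "x \<in> carrier A" shows "hq (ker +> x) = h x"
proof -
  define y where "y = (SOME y. y \<in> ker +> x)"
  have "y \<in> ker +> x" unfolding y_def by (rule someI[of _ x]) (simp add: K.mem_coset_iff x)
  then have y: "y \<in> carrier A" "y \<ominus> x \<in> ker" using K.mem_coset_iff[OF x] K.coset_eq_iff[OF _ x] by auto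
  have "h (y \<ominus> x) = 0" using y(2) unfolding ker_def by blast
  then show ?thesis unfolding hq_def y_def[symmetric] using h_minus[OF y(1) x] by simp
qed

lemma Q_cases: assumes "X \<in> carrier Q" obtains x where "x \<in> carrier A" "X = ker +> x"
  using assms unfolding carrier_quot by (elim imageE)

lemma Q_mult: "x \<in> carrier A ==> y \<in> carrier A ==> (ker +> x) \<otimes>\<^bsub>Q\<^esub> (ker +> y) = ker +> (x \<otimes> y)"
  using KI.rcoset_mult_add[of x y] by (simp add: quot_simps)

lemma hq_add: assumes "X \<in> carrier Q" "Y \<in> carrier Q" shows "hq (X \<oplus>\<^bsub>Q\<^esub> Y) = hq X + hq Y"
proof -
  obtain x where x: "x \<in> carrier A" "X = ker +> x" using assms(1) by (rule Q_cases)
  obtain y where y: "y \<in> carrier A" "Y = ker +> y" using assms(2) by (rule Q_cases)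
  show ?thesis unfolding x(2) y(2) K.quot_add[OF x(1) y(1)] using x y by (simp add: hq_coset h_add)
qed

lemma hq_mult: assumes "X \<in> carrier Q" "Y \<in> carrier Q" shows "hq (X \<otimes>\<^bsub>Q\<^esub> Y) = hq X * hq Y"
proof -
  obtain x where x: "x \<in> carrier A" "X = ker +> x" using assms(1) by (rule Q_cases)
  obtain y where y: "y \<in> carrier A" "Y = ker +> y" using assms(2) by (rule Q_cases)
  show ?thesis unfolding x(2) y(2) Q_mult[OF x(1) y(1)] using x y by (simp add: hq_coset h_mult)
qed

lemma hq_smult: assumes "X \<in> carrier Q" shows "hq (c \<odot>\<^bsub>Q\<^esub> X) = sc c * hq X"
proof -
  obtain x where x: "x \<in> carrier A" "X = ker +> x" using assms(1) by (rule Q_cases)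
  show ?thesis unfolding x(2) K.quot_smult[OF x(1)] using x by (simp add: hq_coset h_smult)
qed

lemma hq_one: "hq \<one>\<^bsub>Q\<^esub> = 1" unfolding quot_simps by (simp add: hq_coset h_one)

lemma hq_zero: "hq \<zero>\<^bsub>Q\<^esub> = 0" using hq_coset[OF zero_closed] K.quot_zero by (simp add: h_zero)

lemma hq_inj: "inj_on hq (carrier Q)"
proof (rule inj_onI)
  fix X Y assume X: "X \<in> carrier Q" and Y: "Y \<in> carrier Q" and e: "hq X = hq Y"
  obtain x where x: "x \<in> carrier A" "X = ker +> x" using X by (rule Q_cases)
  obtain y where y: "y \<in> carrier A" "Y = ker +> y" using Y by (rule Q_cases)
  have "h x = h y" using e unfolding x(2) y(2) hq_coset[OF x(1)] hq_coset[OF y(1)] .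
  then have "x \<ominus> y \<in> ker"
    unfolding ker_def using h_minus[OF x(1) y(1)] minus_closed[OF x(1) y(1)] by simp
  then show "X = Y" using K.coset_eq_iff[OF x(1) y(1)] unfolding x(2) y(2) by blast
qed

lemma hq_subset_iff:
  assumes "S \<subseteq> carrier Q" "T \<subseteq> carrier Q" shows "hq ` S \<subseteq> hq ` T \<longleftrightarrow> S \<subseteq> T"
proof
  assume le: "hq ` S \<subseteq> hq ` T"
  show "S \<subseteq> T"
  proof
    fix X assume X: "X \<in> S"
    then have "hq X \<in> hq ` T" using le by blast
    moreover have "X \<in> carrier Q" using X assms(1) by blast
    ultimately show "X \<in> T" using inj_on_image_mem_iff[OF hq_inj _ assms(2)] by blast
  qed
qed (rule image_mono)

lemma hq_image: "hq ` carrier Q = h ` carrier A"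
  unfolding carrier_quot image_image by (rule image_cong[OF refl]) (rule hq_coset)

text \<open>Commutativity is inherited from the codomain through the injective \<open>hq\<close>;
  \<open>A\<close> itself may be noncommutative.\<close>

lemma cring_Q: "cring Q"
proof (intro cring.intro comm_monoid.intro comm_monoid_axioms.intro Q.ring_axioms Q.monoid_axioms)
  fix X Y assume XY: "X \<in> carrier Q" "Y \<in> carrier Q"
  show "X \<otimes>\<^bsub>Q\<^esub> Y = Y \<otimes>\<^bsub>Q\<^esub> X"
    by (rule inj_onD[OF hq_inj]) (use XY hq_mult in \<open>simp_all add: mult.commute\<close>)
qed

text \<open>The generators are the elements of the quotient lying over \<open>T\<close>, finitely
  many by injectivity of \<open>hq\<close>. The hypothesis \<open>gen\<close> speaks of subsets of
  the codomain, so only the closure properties of a subalgebra have to be carried over.\<close>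

lemma fin_gen_Q:
  assumes T: "finite T" "T \<subseteq> h ` carrier A"
    and gen: "\<And>C. (\<And>x y. x \<in> C ==> y \<in> C ==> x + y \<in> C) ==> (\<And>x y. x \<in> C ==> y \<in> C ==> x * y \<in> C) ==>
      1 \<in> C ==> (\<And>c x. x \<in> C ==> sc c * x \<in> C) ==> T \<subseteq> C ==> h ` carrier A \<subseteq> C"
  shows "fin_gen_algebra Q"
proof -
  let ?S = "{X \<in> carrier Q. hq X \<in> T}"
  have fin: "finite ?S"
    by (rule finite_imageD[of hq]) (auto intro: finite_subset[OF _ T(1)] inj_on_subset[OF hq_inj])
  have "B = carrier Q" if B: "subring B Q" "subspace B Q" "?S \<subseteq> B" for B
  proof
    note s = subringE[OF B(1)] and v = Q.subspaceD[OF B(2)]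
    have in_Q: "X \<in> B ==> X \<in> carrier Q" for X using s(1) by blast
    show "B \<subseteq> carrier Q" by (rule s(1))
    have "h ` carrier A \<subseteq> hq ` B"
    proof (rule gen)
      fix x y assume x: "x \<in> hq ` B" and y: "y \<in> hq ` B"
      obtain X where X: "x = hq X" "X \<in> B" using x by (rule imageE)
      obtain Y where Y: "y = hq Y" "Y \<in> B" using y by (rule imageE)
      show "x + y \<in> hq ` B" "x * y \<in> hq ` B"
        using imageI[OF v(3)[OF X(2) Y(2)], of hq] imageI[OF s(6)[OF X(2) Y(2)], of hq]
        by (simp_all add: hq_add hq_mult in_Q X Y)
    next
      show "1 \<in> hq ` B" using imageI[OF s(3), of hq] by (simp add: hq_one)
    next
      fix c x assume "x \<in> hq ` B"
      then obtain X where X: "x = hq X" "X \<in> B" by (rule imageE)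
      show "sc c * x \<in> hq ` B" using imageI[OF v(4)[OF X(2)], of hq c] by (simp add: hq_smult in_Q X)
    next
      show "T \<subseteq> hq ` B"
      proof
        fix t assume t: "t \<in> T"
        then have "t \<in> hq ` carrier Q" using T(2) unfolding hq_image by blast
        then obtain X where "t = hq X" "X \<in> carrier Q" by (rule imageE)
        then show "t \<in> hq ` B" using B(3) t by blast
      qed
    qed
    then have "hq ` carrier Q \<subseteq> hq ` B" unfolding hq_image .
    then show "carrier Q \<subseteq> B" using hq_subset_iff[OF subset_refl s(1)] by blast
  qed
  then show ?thesis unfolding fin_gen_algebra_def using fin by (intro exI[of _ ?S]) auto
qed

text \<open>\<open>hq\<close> identifies the quotient with the image of \<open>h\<close>, which is
  why primality is asserted inside that image and not in the whole codomain.\<close>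

lemma prime_image:
  assumes "primeideal P Q" shows "prime_in (h ` carrier A) (hq ` P)"
proof -
  interpret P: primeideal P Q by fact
  have Pc: "X \<in> P ==> X \<in> carrier Q" for X by (rule P.Icarr)
  have mem: "X \<in> carrier Q ==> hq X \<in> hq ` P \<longleftrightarrow> X \<in> P" for X
    by (rule inj_on_image_mem_iff[OF hq_inj]) (use Pc in auto)
  show ?thesis unfolding prime_in_def hq_image[symmetric]
  proof (intro conjI ballI impI)
    show "hq ` P \<subseteq> hq ` carrier Q" using Pc by blast
    show "0 \<in> hq ` P" using imageI[OF P.zero_closed, of hq] by (simp add: hq_zero)
    show "1 \<notin> hq ` P"
      using mem[OF Q.one_closed] P.I_notcarr P.one_imp_carrier by (auto simp: hq_one)
  next
    fix x y assume x: "x \<in> hq ` P" and y: "y \<in> hq ` P"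
    obtain X where X: "x = hq X" "X \<in> P" using x by (rule imageE)
    obtain Y where Y: "y = hq Y" "Y \<in> P" using y by (rule imageE)
    show "x + y \<in> hq ` P" using imageI[OF P.a_closed[OF X(2) Y(2)], of hq] by (simp add: hq_add Pc X Y)
  next
    fix r x assume r: "r \<in> hq ` carrier Q" and x: "x \<in> hq ` P"
    obtain Y where Y: "r = hq Y" "Y \<in> carrier Q" using r by (rule imageE)
    obtain X where X: "x = hq X" "X \<in> P" using x by (rule imageE)
    show "r * x \<in> hq ` P" using imageI[OF P.I_l_closed[OF X(2) Y(2)], of hq] by (simp add: hq_mult Pc X Y)
  next
    fix x y assume x: "x \<in> hq ` carrier Q" and y: "y \<in> hq ` carrier Q" and xy: "x * y \<in> hq ` P"
    obtain X where X: "x = hq X" "X \<in> carrier Q" using x by (rule imageE)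
    obtain Y where Y: "y = hq Y" "Y \<in> carrier Q" using y by (rule imageE)
    have "X \<otimes>\<^bsub>Q\<^esub> Y \<in> P" using xy mem[OF Q.m_closed[OF X(2) Y(2)]] by (simp add: hq_mult X Y)
    from P.I_prime[OF X(2) Y(2) this] show "x \<in> hq ` P \<or> y \<in> hq ` P" using X Y by blast
  qed
qed

text \<open>The pullback of the zero ideal of a domain. It will serve for the identity and for
  setting first one and then both variables to zero.\<close>

lemma prime_kernel:
  fixes w :: "'s => 't::idom"
  assumes add: "\<And>x y. w (x + y) = w x + w y" and mult: "\<And>x y. w (x * y) = w x * w y" and one: "w 1 = 1"
  shows "primeideal {X \<in> carrier Q. w (hq X) = 0} Q"
proof -
  have "w 0 + 0 = w 0 + w 0" using add[of 0 0] by (simp only: add_0_right)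
  then have zero: "w 0 = 0" by (simp only: add_left_cancel)
  have neg: "w (- x) = - w x" for x using add[of "- x" x] by (simp add: zero eq_neg_iff_add_eq_0)
  have hn: "hq (\<ominus>\<^bsub>Q\<^esub> X) = - hq X" if "X \<in> carrier Q" for X
    using hq_add[of "\<ominus>\<^bsub>Q\<^esub> X" X] that by (simp add: Q.l_neg hq_zero eq_neg_iff_add_eq_0)
  show ?thesis
  proof (rule primeidealI[OF _ cring_Q])
    show "ideal {X \<in> carrier Q. w (hq X) = 0} Q"
    proof (rule idealI[OF Q.ring_axioms])
      show "subgroup {X \<in> carrier Q. w (hq X) = 0} (add_monoid Q)"
      proof
        fix x assume "x \<in> {X \<in> carrier Q. w (hq X) = 0}"
        then show "inv\<^bsub>add_monoid Q\<^esub> x \<in> {X \<in> carrier Q. w (hq X) = 0}"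
          using Q.a_inv_closed[of x] hn[of x] by (simp add: a_inv_def[symmetric] neg)
      qed (auto simp: hq_add hq_zero add zero)
    qed (auto simp: hq_mult mult)
    show "carrier Q \<noteq> {X \<in> carrier Q. w (hq X) = 0}"
      using Q.one_closed hq_one one by force
  qed (auto simp: hq_mult mult)
qed

end

text \<open>Four primes in a chain contradict \<open>no_prime_chain\<close>. A chain of three
  consists of the elements that are zero, those that vanish at x = 0 and those that vanish at x = y
  = 0; \<open>F1\<close> and \<open>F2\<close> make the inclusions strict.\<close>

lemma krull_dim_quot_eq_2:
  fixes h :: "'a => 'k::field poly poly"
  assumes "alg_map A h const2"
    and X: "F1 \<in> h ` carrier A" "F1 \<noteq> 0" "coeff F1 0 = 0"
    and Y: "F2 \<in> h ` carrier A" "coeff F2 0 \<noteq> 0" "coeff (coeff F2 0) 0 = 0"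
  shows "krull_dim (A //\<^sub>k alg_map.ker A h) = 2"
proof -
  interpret alg_map A h const2 by fact
  have up: "n \<le> 2" if p: "\<And>i. i \<le> n ==> primeideal (p i) Q" "\<And>i. i < n ==> p i \<subset> p (Suc i)" for n p
  proof (rule ccontr)
    assume "\<not> n \<le> 2"
    then have n: "3 \<le> n" by simp
    have pc: "p i \<subseteq> carrier Q" if "i \<le> n" for i
      by (rule subsetI) (rule ideal.Icarr[OF primeideal.axioms(1)[OF p(1)[OF that]]])
    show False
    proof (rule no_prime_chain[of "h ` carrier A" "\<lambda>i. hq ` p i"])
      fix a b assume a: "a \<in> h ` carrier A" and b: "b \<in> h ` carrier A"
      obtain x where x: "a = h x" "x \<in> carrier A" using a by (rule imageE)
      obtain y where y: "b = h y" "y \<in> carrier A" using b by (rule imageE)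
      show "a + b \<in> h ` carrier A" "a * b \<in> h ` carrier A"
        using imageI[OF a_closed[OF x(2) y(2)], of h] imageI[OF m_closed[OF x(2) y(2)], of h]
        by (simp_all add: h_add h_mult x y)
    next
      fix c show "const2 c \<in> h ` carrier A"
        using imageI[OF smult_closed[OF one_closed], of h c] by (simp add: h_smult h_one)
    next
      fix i :: nat assume "i \<le> 3"
      then show "prime_in (h ` carrier A) (hq ` p i)" using prime_image[OF p(1)] n by simp
    next
      fix i :: nat assume i: "i < 3"
      then have "p i \<subset> p (Suc i)" "p i \<subseteq> carrier Q" "p (Suc i) \<subseteq> carrier Q" using p(2) pc n by auto
      then show "hq ` p i \<subset> hq ` p (Suc i)"
        unfolding less_le_not_le by (simp only: hq_subset_iff simp_thms)
    qed
  qed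
  define p where "p = (\<lambda>i::nat. {X \<in> carrier Q. if i = 0 then hq X = 0 else if i = 1 then coeff (hq X) 0 = 0
     else coeff (coeff (hq X) 0) 0 = 0})"
  have c0: "coeff (a * b) 0 = coeff a 0 * coeff b 0" for a b :: "'z::comm_ring_1 poly" by (simp add: coeff_mult)
  have "primeideal {X \<in> carrier Q. id (hq X) = 0} Q" by (rule prime_kernel) simp_all
  moreover have "primeideal {X \<in> carrier Q. coeff (hq X) 0 = 0} Q" by (rule prime_kernel) (simp_all add: c0)
  moreover have "primeideal {X \<in> carrier Q. coeff (coeff (hq X) 0) 0 = 0} Q" by (rule prime_kernel) (simp_all add: c0)
  ultimately have pr: "primeideal (p i) Q" for i
    unfolding p_def by (cases "i = 0"; cases "i = 1"; simp)
  obtain X1 where X1: "F1 = hq X1" "X1 \<in> carrier Q" using X(1) unfolding hq_image[symmetric] by (rule imageE)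
  obtain X2 where X2: "F2 = hq X2" "X2 \<in> carrier Q" using Y(1) unfolding hq_image[symmetric] by (rule imageE)
  have ch0: "p 0 \<subset> p 1"
  proof
    show "p 0 \<subseteq> p 1" by (auto simp: p_def)
    have "X1 \<in> p 1" "X1 \<notin> p 0" using X1 X by (auto simp: p_def)
    then show "p 0 \<noteq> p 1" by blast
  qed
  have ch1: "p 1 \<subset> p 2"
  proof
    show "p 1 \<subseteq> p 2" by (auto simp: p_def)
    have "X2 \<in> p 2" "X2 \<notin> p 1" using X2 Y by (auto simp: p_def)
    then show "p 1 \<noteq> p 2" by blast
  qed
  have ch: "p i \<subset> p (Suc i)" if "i < 2" for i
  proof -
    have "i = 0 \<or> i = 1" using that by auto
    then show ?thesis using ch0 ch1 by (auto simp: numeral_2_eq_2 One_nat_def)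
  qed
  show ?thesis
  proof (rule antisym)
    show "krull_dim Q \<le> 2" unfolding krull_dim_def
    proof (rule Sup_least)
      fix e assume "e \<in> {enat n | n. \<exists>p. (\<forall>i\<le>n. primeideal (p i) Q) \<and> (\<forall>i<n. p i \<subset> p (Suc i))}"
      then obtain n p where n: "e = enat n" "\<forall>i\<le>n. primeideal (p i) Q" "\<forall>i<n. p i \<subset> p (Suc i)" by blast
      have "n \<le> 2" by (rule up[of n p]) (use n in auto)
      then show "e \<le> 2" unfolding n(1) by (metis enat_ord_simps(1) numeral_eq_enat)
    qed
    have "enat 2 \<le> krull_dim Q" unfolding krull_dim_def
      by (rule Sup_upper) (use pr ch in blast)
    then show "2 \<le> krull_dim Q" by (simp add: numeral_eq_enat)
  qed
qed

text \<open>Both quotients are identified with the common image; the isomorphism is the first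
  identification followed by the inverse of the second. Hence it matches elements with equal
  images.\<close>

lemma alg_iso_quot:
  assumes "alg_map A h sc" "alg_map B g sc" and im: "h ` carrier A = g ` carrier B"
  shows "\<exists>\<phi>\<in>alg_iso (A //\<^sub>k alg_map.ker A h) (B //\<^sub>k alg_map.ker B g).
    \<forall>x\<in>carrier A. \<forall>y\<in>carrier B. h x = g y \<longrightarrow>
      \<phi> (alg_map.ker A h +>\<^bsub>A\<^esub> x) = alg_map.ker B g +>\<^bsub>B\<^esub> y"
proof -
  interpret A: alg_map A h sc by fact
  interpret B: alg_map B g sc by fact
  define \<phi> where "\<phi> = (\<lambda>X. inv_into (carrier B.Q) B.hq (A.hq X))"
  have bA: "bij_betw A.hq (carrier A.Q) (h ` carrier A)" unfolding bij_betw_def using A.hq_inj A.hq_image by blast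
  have bB: "bij_betw B.hq (carrier B.Q) (h ` carrier A)" unfolding bij_betw_def im using B.hq_inj B.hq_image by blast
  have bij: "bij_betw \<phi> (carrier A.Q) (carrier B.Q)"
    using bij_betw_trans[OF bA bij_betw_inv_into[OF bB]] by (simp add: \<phi>_def comp_def)
  have closed: "\<phi> X \<in> carrier B.Q" if "X \<in> carrier A.Q" for X using bij that by (rule bij_betw_apply)
  have h: "B.hq (\<phi> X) = A.hq X" if "X \<in> carrier A.Q" for X
    unfolding \<phi>_def using bij_betw_inv_into_right[OF bB] bij_betw_apply[OF bA that] .
  have eq: "\<phi> X = Y" if "X \<in> carrier A.Q" "Y \<in> carrier B.Q" "A.hq X = B.hq Y" for X Y
    by (rule inj_onD[OF B.hq_inj]) (use that closed h in auto)
  have "\<phi> \<in> ring_hom A.Q B.Q"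
  proof (rule ring_hom_memI)
    fix X Y assume X: "X \<in> carrier A.Q" and Y: "Y \<in> carrier A.Q"
    show "\<phi> X \<in> carrier B.Q" by (rule closed[OF X])
    show "\<phi> (X \<otimes>\<^bsub>A.Q\<^esub> Y) = \<phi> X \<otimes>\<^bsub>B.Q\<^esub> \<phi> Y"
      by (rule eq) (simp_all add: X Y closed h A.hq_mult B.hq_mult)
    show "\<phi> (X \<oplus>\<^bsub>A.Q\<^esub> Y) = \<phi> X \<oplus>\<^bsub>B.Q\<^esub> \<phi> Y"
      by (rule eq) (simp_all add: X Y closed h A.hq_add B.hq_add)
  next
    show "\<phi> \<one>\<^bsub>A.Q\<^esub> = \<one>\<^bsub>B.Q\<^esub>" by (rule eq) (simp_all add: A.hq_one B.hq_one)
  qed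
  moreover have "\<phi> (c \<odot>\<^bsub>A.Q\<^esub> X) = c \<odot>\<^bsub>B.Q\<^esub> \<phi> X" if "X \<in> carrier A.Q" for c X
    by (rule eq) (simp_all add: that closed h A.hq_smult B.hq_smult)
  ultimately have "\<phi> \<in> alg_iso A.Q B.Q" using bij by (simp add: alg_iso_def ring_iso_def)
  moreover have "\<phi> (A.ker +>\<^bsub>A\<^esub> x) = B.ker +>\<^bsub>B\<^esub> y" if "x \<in> carrier A" "y \<in> carrier B" "h x = g y" for x y
    by (rule eq) (simp_all add: that A.K.quot_closed B.K.quot_closed A.hq_coset B.hq_coset)
  ultimately show ?thesis by (intro bexI[of _ \<phi>]) auto
qed

subsection \<open>The presented algebra\<close>

lemma poly_alg_simps [simp]:
  "carrier poly_alg = UNIV" "mult poly_alg = (*)" "one poly_alg = 1" "zero poly_alg = 0" "add poly_alg = (+)"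
  "smult poly_alg c x = Poly_Mapping.map ((*) c) x"
  by (simp_all add: poly_alg_def)

lemma cring_poly_alg: "cring (poly_alg :: ('k::field, ('v \<Rightarrow>\<^sub>0 nat) \<Rightarrow>\<^sub>0 'k) module)"
proof (rule cringI)
  show "abelian_group (poly_alg :: ('k, ('v \<Rightarrow>\<^sub>0 nat) \<Rightarrow>\<^sub>0 'k) module)"
    by (rule abelian_groupI) (auto simp: ac_simps intro: exI[of _ "- _"] left_minus)
  show "comm_monoid (poly_alg :: ('k, ('v \<Rightarrow>\<^sub>0 nat) \<Rightarrow>\<^sub>0 'k) module)"
    by (rule comm_monoidI) (auto simp: ac_simps)
qed (auto simp: distrib_right)

lemma scale_eq_mult: "Poly_Mapping.map ((*) c) f = psingle 0 c * (f :: ('v \<Rightarrow>\<^sub>0 nat) \<Rightarrow>\<^sub>0 'k::field)"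
proof -
  have "psingle 0 c * f = (\<Sum>p\<in>pkeys f. psingle p (c * plookup f p))"
    by (subst poly_mapping_sum_single[of f]) (simp add: sum_distrib_left mult_single)
  also have "\<dots> = Poly_Mapping.map ((*) c) f"
    by (rule poly_mapping_eqI) (auto simp: lookup_sum lookup_single when_def in_keys_iff)
  finally show ?thesis by simp
qed

lemma kalg_poly_alg: "kalg (poly_alg :: ('k::field, ('v \<Rightarrow>\<^sub>0 nat) \<Rightarrow>\<^sub>0 'k) module)"
proof -
  interpret cring "poly_alg :: ('k, ('v \<Rightarrow>\<^sub>0 nat) \<Rightarrow>\<^sub>0 'k) module" by (rule cring_poly_alg)
  show ?thesis
    by unfold_locales
      (simp_all add: scale_eq_mult single_add mult_single[symmetric] algebra_simps single_one,
        simp_all add: mult_single flip: mult.assoc)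
qed

text \<open>\<open>xexp\<close> and \<open>yexp\<close> are the exponents of x and y in the image of
  the monomial \<open>a\<close>; they are additive in \<open>a\<close>.\<close>

definition xexp :: "nat => (chi_var \<Rightarrow>\<^sub>0 nat) => nat" where
  "xexp m a = 2 * (plookup a X40 + m * plookup a X2)"

definition yexp :: "nat => (chi_var \<Rightarrow>\<^sub>0 nat) => nat" where
  "yexp m a = 2 * (plookup a X40 + m * plookup a Xm2)"

definition ev :: "nat => ((chi_var \<Rightarrow>\<^sub>0 nat) \<Rightarrow>\<^sub>0 'k::field) => 'k poly poly" where
  "ev m f = (\<Sum>a\<in>pkeys f. bimon (plookup f a) (xexp m a) (yexp m a))"

lemma ev_superset:
  assumes "finite S" "pkeys f \<subseteq> S"
  shows "ev m f = (\<Sum>a\<in>S. bimon (plookup f a) (xexp m a) (yexp m a))"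
  unfolding ev_def by (rule sum.mono_neutral_left) (use assms in \<open>auto simp: in_keys_iff\<close>)

lemma ev_add: "ev m (f + g) = ev m f + ev m g"
proof -
  let ?S = "pkeys f \<union> pkeys g"
  have "pkeys (f + g) \<subseteq> ?S" by (rule Poly_Mapping.keys_add)
  then show ?thesis by (simp add: ev_superset[of ?S] lookup_add bimon_add sum.distrib)
qed

lemma ev_single: "ev m (psingle a c) = bimon c (xexp m a) (yexp m a)"
  by (subst ev_superset[of "{a}"]) auto

lemma ev_sum: "ev m (sum f J) = (\<Sum>j\<in>J. ev m (f j))"
proof (induct J rule: infinite_finite_induct)
  case (insert j J) then show ?case by (simp add: ev_add)
qed (simp_all add: ev_def)

lemma ev_mult: "ev m (f * g) = ev m f * ev m (g :: (chi_var \<Rightarrow>\<^sub>0 nat) \<Rightarrow>\<^sub>0 'k::field)"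
proof -
  have ex: "xexp m (a + b) = xexp m a + xexp m b" "yexp m (a + b) = yexp m a + yexp m b" for a b
    by (simp_all add: xexp_def yexp_def lookup_add algebra_simps)
  let ?t = "\<lambda>f p. psingle p (plookup f p) :: (chi_var \<Rightarrow>\<^sub>0 nat) \<Rightarrow>\<^sub>0 'k"
  have "ev m (sum (?t f) (pkeys f) * sum (?t g) (pkeys g)) =
      ev m (sum (?t f) (pkeys f)) * ev m (sum (?t g) (pkeys g))"
    by (simp add: sum_product ev_sum ev_single mult_single bimon_mult ex)
  then show ?thesis unfolding poly_mapping_sum_single[symmetric] .
qed

lemma alg_map_ev: "alg_map (poly_alg :: ('k::field, _) module) (ev m) const2"
proof (intro alg_map.intro alg_map_axioms.intro kalg_poly_alg)
  have s: "ev m (psingle 0 c) = const2 c" for c :: 'k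
    by (simp add: ev_single xexp_def yexp_def bimon_def monom_0)
  show "ev m \<one>\<^bsub>poly_alg\<^esub> = (1 :: 'k poly poly)" using s[of 1] by (simp add: one_pCons)
  show "ev m (c \<odot>\<^bsub>poly_alg\<^esub> x) = const2 c * ev m x" for c :: 'k and x
    unfolding poly_alg_simps scale_eq_mult ev_mult s ..
qed (simp_all add: ev_add ev_mult)

lemma lookup_pvar: "plookup (psingle v k) w = (if v = w then k else 0 :: nat)"
  by (simp add: lookup_single when_def)

lemma ev_pvar:
  "ev m (pvar X40) = bimon 1 2 2" "ev m (pvar X2) = bimon 1 (2 * m) 0" "ev m (pvar Xm2) = bimon 1 0 (2 * m)"
  by (simp_all add: pvar_def ev_single xexp_def yexp_def lookup_pvar)

definition mon3 :: "nat => nat => nat => chi_var \<Rightarrow>\<^sub>0 nat" where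
  "mon3 i j k = psingle X40 i + psingle X2 j + psingle Xm2 k"

lemma lookup_mon3:
  "plookup (mon3 i j k) X40 = i" "plookup (mon3 i j k) X2 = j"
  "plookup (mon3 i j k) Xm2 = k"
  by (simp_all add: mon3_def lookup_add lookup_pvar)

lemma mon3_lookup:
  "mon3 (plookup a X40) (plookup a X2) (plookup a Xm2) = a"
proof (rule poly_mapping_eqI)
  fix v show "plookup (mon3 (plookup a X40) (plookup a X2)
      (plookup a Xm2)) v = plookup a v"
    by (cases v) (simp_all add: lookup_mon3)
qed

text \<open>The result of replacing X40^m by X2 Xm2 until the exponent of X40 is below
  \<open>m\<close>.\<close>

definition nform :: "nat => (chi_var \<Rightarrow>\<^sub>0 nat) => chi_var \<Rightarrow>\<^sub>0 nat" where
  "nform m a = (let i = plookup a X40 in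
     mon3 (i mod m) (i div m + plookup a X2) (i div m + plookup a Xm2))"

text \<open>Half the exponents are \<open>i + m j\<close> and \<open>i + m k\<close>, with
  \<open>i\<close>, \<open>j\<close>, \<open>k\<close> the exponents of X40, X2 and Xm2; division by
  \<open>m\<close> with remainder recovers exactly the data of the normal form.\<close>

lemma nform_eq_iff:
  assumes "m > 0" shows "nform m a = nform m b \<longleftrightarrow> xexp m a = xexp m b \<and> yexp m a = yexp m b"
proof
  assume e: "nform m a = nform m b"
  have x: "xexp m (nform m a) = xexp m a" "yexp m (nform m a) = yexp m a" for a
    by (simp_all add: xexp_def yexp_def nform_def Let_def lookup_mon3 add_mult_distrib2 flip: add.assoc)
  show "xexp m a = xexp m b \<and> yexp m a = yexp m b" using e x[of a] x[of b] by metis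
next
  assume e: "xexp m a = xexp m b \<and> yexp m a = yexp m b"
  let ?l = plookup
  have 1: "?l a X40 + m * ?l a X2 = ?l b X40 + m * ?l b X2" "?l a X40 + m * ?l a Xm2 = ?l b X40 + m * ?l b Xm2"
    using e by (simp_all add: xexp_def yexp_def)
  have "?l a X40 mod m = ?l b X40 mod m" using arg_cong[OF 1(1), of "\<lambda>z. z mod m"] by simp
  moreover have "?l a X40 div m + ?l a X2 = ?l b X40 div m + ?l b X2"
    using arg_cong[OF 1(1), of "\<lambda>z. z div m"] assms by simp
  moreover have "?l a X40 div m + ?l a Xm2 = ?l b X40 div m + ?l b Xm2"
    using arg_cong[OF 1(2), of "\<lambda>z. z div m"] assms by simp
  ultimately show "nform m a = nform m b" by (simp add: nform_def Let_def)
qed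

definition chi_gen :: "nat => (chi_var \<Rightarrow>\<^sub>0 nat) \<Rightarrow>\<^sub>0 'k::field" where
  "chi_gen m = pvar X40 ^ m - pvar X2 * pvar Xm2"

lemma pvar_power: "pvar v ^ n = psingle (psingle v n) (1 :: 'k::field)"
  by (induct n) (simp_all add: pvar_def mult_single single_add[symmetric] single_one)

text \<open>The difference contains the factor u^q - v^q with u = X40^m and v = X2 Xm2, and this is
  divisible by u - v.\<close>

lemma nform_congruent:
  "chi_gen m dvd psingle a c - psingle (nform m a) (c :: 'k::field)"
proof -
  let ?l = "plookup a" and ?X = "pvar X40 :: (chi_var \<Rightarrow>\<^sub>0 nat) \<Rightarrow>\<^sub>0 'k"
    and ?Y = "pvar X2 :: (chi_var \<Rightarrow>\<^sub>0 nat) \<Rightarrow>\<^sub>0 'k" and ?Z = "pvar Xm2 :: (chi_var \<Rightarrow>\<^sub>0 nat) \<Rightarrow>\<^sub>0 'k"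
  let ?q = "?l X40 div m" and ?r = "?l X40 mod m"
  have mon: "psingle (mon3 i j k) c = psingle 0 c * (?X ^ i * ?Y ^ j * ?Z ^ k)" for i j k
    by (simp add: pvar_power mult_single mon3_def)
  have gen: "psingle (mon3 (m * q + r) j k) c - psingle (mon3 r (q + j) (q + k)) c =
      psingle 0 c * ?X ^ r * ?Y ^ j * ?Z ^ k * ((?X ^ m) ^ q - (?Y * ?Z) ^ q)" for q r j k
    unfolding mon by (simp add: power_add power_mult power_mult_distrib algebra_simps)
  have "psingle a c - psingle (nform m a) c =
      psingle 0 c * ?X ^ ?r * ?Y ^ ?l X2 * ?Z ^ ?l Xm2 * ((?X ^ m) ^ ?q - (?Y * ?Z) ^ ?q)"
    using gen[of ?q ?r "?l X2" "?l Xm2"] unfolding nform_def Let_def mult_div_mod_eq mon3_lookup .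
  moreover have "chi_gen m dvd (?X ^ m) ^ ?q - (?Y * ?Z) ^ ?q"
    unfolding chi_gen_def power_diff_sumr2[of "?X ^ m" ?q "?Y * ?Z"] by (rule dvd_triv_left)
  ultimately show ?thesis by simp
qed

text \<open>Monomials with the same normal form have the same image and those with different normal
  forms have different images. So if \<open>f\<close> evaluates to zero, its coefficients sum to
  zero over each class, and replacing all monomials by their normal forms turns \<open>f\<close>
  into 0.\<close>

lemma ker_ev:
  assumes m: "m > 0" shows "alg_map.ker poly_alg (ev m) = (chi_rel m :: ((chi_var \<Rightarrow>\<^sub>0 nat) \<Rightarrow>\<^sub>0 'k::field) set)"
proof -
  interpret E: alg_map "poly_alg :: ('k, (chi_var \<Rightarrow>\<^sub>0 nat) \<Rightarrow>\<^sub>0 'k) module" "ev m" const2 by (rule alg_map_ev)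
  interpret C: cring "poly_alg :: ('k, (chi_var \<Rightarrow>\<^sub>0 nat) \<Rightarrow>\<^sub>0 'k) module" by (rule cring_poly_alg)
  have rel: "(chi_rel m :: ((chi_var \<Rightarrow>\<^sub>0 nat) \<Rightarrow>\<^sub>0 'k) set) = {f. chi_gen m dvd f}"
    unfolding chi_rel_def using C.cgenideal_eq_genideal[of "chi_gen m"]
    by (auto simp: cgenideal_def chi_gen_def dvd_def mult.commute)
  have "ev m (chi_gen m) = (0 :: 'k poly poly)"
  proof -
    have p: "ev m (pvar X40 ^ n) = (bimon 1 (2 * n) (2 * n) :: 'k poly poly)" for n
      by (simp add: pvar_power ev_single xexp_def yexp_def lookup_pvar)
    have "ev m (pvar X40 ^ m) = ev m (chi_gen m + pvar X2 * pvar Xm2 :: (chi_var \<Rightarrow>\<^sub>0 nat) \<Rightarrow>\<^sub>0 'k)"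
      by (simp add: chi_gen_def)
    then show ?thesis by (simp add: ev_add ev_mult ev_pvar p bimon_mult)
  qed
  moreover have kerE: "f \<in> E.ker \<longleftrightarrow> ev m f = 0" for f unfolding E.ker_def by simp
  ultimately have 1: "f \<in> E.ker" if "chi_gen m dvd f" for f
    using that unfolding kerE by (auto simp: ev_mult elim!: dvdE)
  have 2: "chi_gen m dvd f" if "f \<in> E.ker" for f :: "(chi_var \<Rightarrow>\<^sub>0 nat) \<Rightarrow>\<^sub>0 'k"
  proof -
    let ?K = "pkeys f" and ?l = "plookup f"
    let ?g = "\<Sum>a\<in>?K. psingle (nform m a) (?l a)"
    have "?g = 0"
    proof (rule poly_mapping_eqI)
      fix b
      show "plookup ?g b = plookup 0 b"
      proof (cases "b \<in> range (nform m)")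
        case True
        then obtain a0 where b: "b = nform m a0" by blast
        have "0 = coeff (coeff (ev m f) (xexp m a0)) (yexp m a0)" using that unfolding kerE by simp
        also have "\<dots> = (\<Sum>a\<in>?K. if nform m a = b then ?l a else 0)"
          unfolding ev_def b nform_eq_iff[OF m] coeff_sum coeff_bimon by (rule sum.cong) auto
        also have "\<dots> = plookup ?g b"
          by (simp add: lookup_sum lookup_single when_def)
        finally show ?thesis by simp
      next
        case False
        then have "nform m a \<noteq> b" for a by blast
        then show ?thesis by (simp add: lookup_sum lookup_single)
      qed
    qed
    then have e: "(\<Sum>a\<in>?K. psingle a (?l a) - psingle (nform m a) (?l a)) = f"
      unfolding sum_subtractf poly_mapping_sum_single[of f, symmetric] by simp
    have "chi_gen m dvd (\<Sum>a\<in>?K. psingle a (?l a) - psingle (nform m a) (?l a))"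
      by (rule dvd_sum) (rule nform_congruent)
    then show ?thesis unfolding e .
  qed
  show ?thesis unfolding rel
    by (intro equalityI subsetI CollectI) (erule 2, elim CollectE, erule 1)
qed

text \<open>Given by a condition on supports, so that membership of an image is a test on single
  coefficients.\<close>

definition RR :: "nat => 'k::field poly poly set" where
  "RR m = {F. \<forall>p q. coeff (coeff F p) q \<noteq> 0 \<longrightarrow> even p \<and> even q \<and> int m dvd int p - int q}"

text \<open>Stated for any set \<open>C\<close> closed under the operations, so that it yields both
  the images of the two algebra maps and finite generation. If p = q + 2mj, then x^p y^q is the
  product of (x^2 y^2)^(q/2) and (x^(2m))^j, and symmetrically.\<close>

lemma RR_generated:
  assumes "odd m"
    and add: "\<And>x y. x \<in> C ==> y \<in> C ==> x + y \<in> C" and mult: "\<And>x y. x \<in> C ==> y \<in> C ==> x * y \<in> C"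
    and one: "1 \<in> C" and sc: "\<And>c x. x \<in> C ==> const2 c * x \<in> C"
    and gens: "{bimon 1 2 2, bimon 1 (2 * m) 0, bimon 1 0 (2 * m)} \<subseteq> C"
  shows "RR m \<subseteq> (C :: 'k::field poly poly set)"
proof
  fix F :: "'k poly poly" assume F: "F \<in> RR m"
  have pow: "x ^ n \<in> C" if "x \<in> C" for x n using that by (induct n) (auto intro: one mult)
  have zero: "0 \<in> C" using sc[OF one, of 0] by simp
  have bp: "bimon 1 p q ^ n = (bimon 1 (p * n) (q * n) :: 'k poly poly)" for p q n
    by (induct n) (simp_all add: bimon_one bimon_mult)
  have bs: "const2 c * bimon 1 p q = bimon c p q" for c :: 'k and p q by (simp add: bimon_def smult_monom)
  have good: "bimon c p q \<in> C" if "c \<noteq> 0 ==> even p \<and> even q \<and> int m dvd int p - int q" for c :: 'k and p q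
  proof (cases "c = 0")
    case False
    then have pq: "even p" "even q" "int m dvd int p - int q" using that by auto
    \<comment> \<open>Oddness of \<open>m\<close> combines the conditions modulo 2 and modulo
      \<open>m\<close> into one modulo \<open>2 m\<close>.\<close>
    have "coprime (int 2) (int m)" using assms(1) by simp
    moreover have "int 2 dvd int p - int q" using pq(1,2) by simp
    ultimately have "int 2 * int m dvd int p - int q" using pq(3) by (intro divides_mult)
    then obtain k where k: "int p - int q = int (2 * m) * k" by (auto simp: dvd_def)
    have "bimon 1 p q \<in> C"
    proof (cases "k \<ge> 0")
      case True
      then obtain j where j: "k = int j" using nonneg_int_cases by blast
      have "int p = int (q + 2 * m * j)" using k unfolding j by (simp add: algebra_simps)
      then have "p = q + 2 * m * j" by (simp only: of_nat_eq_iff)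
      then have "bimon 1 p q = (bimon 1 2 2 :: 'k poly poly) ^ (q div 2) * bimon 1 (2 * m) 0 ^ j"
        using pq(2) by (simp add: bp bimon_mult)
      then show ?thesis using mult pow gens by simp
    next
      case False
      then obtain j where j: "- k = int j" using nonneg_int_cases[of "- k"] by auto
      have "int q = int (p + 2 * m * j)" using k unfolding of_nat_add of_nat_mult j[symmetric] by (simp add: algebra_simps)
      then have "q = p + 2 * m * j" by (simp only: of_nat_eq_iff)
      then have "bimon 1 p q = (bimon 1 2 2 :: 'k poly poly) ^ (p div 2) * bimon 1 0 (2 * m) ^ j"
        using pq(1) by (simp add: bp bimon_mult)
      then show ?thesis using mult pow gens by simp
    qed
    then have "const2 c * bimon 1 p q \<in> C" by (rule sc)
    then show ?thesis unfolding bs .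
  qed (simp add: zero)
  have sumC: "(\<And>j. j \<in> J ==> f j \<in> C) ==> sum f J \<in> C" for f and J :: "nat set"
    by (induct J rule: infinite_finite_induct) (auto intro: zero add)
  obtain e where e: "\<And>p. degree (coeff F p) \<le> e" using bipoly_bound[of F] by blast
  have "(\<Sum>p\<le>degree F. \<Sum>q\<le>e. bimon (coeff (coeff F p) q) p q) \<in> C"
    by (intro sumC good) (use F in \<open>auto simp: RR_def\<close>)
  then show "F \<in> C" using bipoly_expand[of F "degree F" e] e by simp
qed

lemma ev_image: assumes "odd m" shows "range (ev m) = (RR m :: 'k::field poly poly set)"
proof
  show "range (ev m) \<subseteq> (RR m :: 'k poly poly set)"
  proof
    fix F :: "'k poly poly" assume "F \<in> range (ev m)"
    then obtain f where f: "F = ev m f" by (rule rangeE)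
    show "F \<in> RR m" unfolding RR_def
    proof (intro CollectI allI impI)
      fix p q assume "coeff (coeff F p) q \<noteq> 0"
      then have "(\<Sum>a\<in>pkeys f. if p = xexp m a \<and> q = yexp m a then plookup f a else 0) \<noteq> 0"
        by (simp add: f ev_def coeff_sum)
      then obtain a where "(if p = xexp m a \<and> q = yexp m a then plookup f a else 0) \<noteq> 0"
        by (rule sum.not_neutral_contains_not_neutral)
      then have "p = xexp m a" "q = yexp m a" by (auto split: if_splits)
      moreover have "int (xexp m a) - int (yexp m a) = int m * (2 * (int (plookup a X2) - int (plookup a Xm2)))"
        by (simp add: xexp_def yexp_def algebra_simps)
      ultimately show "even p \<and> even q \<and> int m dvd int p - int q" by (simp add: xexp_def yexp_def)
    qed
  qed
  interpret E: alg_map "poly_alg :: ('k, (chi_var \<Rightarrow>\<^sub>0 nat) \<Rightarrow>\<^sub>0 'k) module" "ev m" const2 by (rule alg_map_ev)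
  show "RR m \<subseteq> (range (ev m) :: 'k poly poly set)"
  proof (rule RR_generated[OF assms])
    fix x y :: "'k poly poly" assume x: "x \<in> range (ev m)" and y: "y \<in> range (ev m)"
    obtain f where f: "x = ev m f" using x by (rule rangeE)
    obtain g where g: "y = ev m g" using y by (rule rangeE)
    show "x + y \<in> range (ev m)" "x * y \<in> range (ev m)"
      unfolding f g ev_add[symmetric] ev_mult[symmetric] by (rule rangeI)+
  next
    fix c :: 'k and x :: "'k poly poly" assume "x \<in> range (ev m)"
    then obtain f where f: "x = ev m f" by (rule rangeE)
    have "const2 c * x = ev m (c \<odot>\<^bsub>poly_alg\<^esub> f)" unfolding f by (rule E.h_smult[symmetric]) simp
    then show "const2 c * x \<in> range (ev m)" by simp
  next
    have e: "ev m 1 = (1 :: 'k poly poly)" using E.h_one by simp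
    show "1 \<in> (range (ev m) :: 'k poly poly set)" unfolding e[symmetric] by (rule rangeI)
    show "{bimon 1 2 2, bimon 1 (2 * m) 0, bimon 1 0 (2 * m)} \<subseteq> (range (ev m) :: 'k poly poly set)"
      unfolding ev_pvar[of m, symmetric] by auto
  qed
qed

section \<open>The resolution\<close>

text \<open>The statement writes \<open>Lam m 1\<close>; rewriting \<open>1\<close> to \<open>Suc 0\<close> would block the simplification rules about it.\<close>

declare One_nat_def [simp del]


lemma finite_UNIV_bas: "finite (UNIV :: bas set)"
proof -
  have "(UNIV :: bas set) = {bE, bA, bB, bS}" using bas.exhaust by blast
  moreover have "finite {bE, bA, bB, bS}" by simp
  ultimately show ?thesis by (simp only:)
qed

section \<open>Coordinates on the algebra\<close>

context Lam_alg begin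

abbreviation "LA \<equiv> Lam m 1 :: ('k, 'k KQ set) module"

lemma LA_quot: "LA = KA //\<^sub>k I" by (simp add: Lam_def)

lemma kalg_LA: "kalg LA"
  unfolding LA_quot by (rule kalg_quot[OF kalg_KQ ideal_I])

sublocale LA: kalg LA by (rule kalg_LA)

text \<open>The coordinate map of the quotient algebra, induced by \<open>lrep\<close> and injective
  by \<open>ker_I\<close>; equations in \<open>LA\<close> are checked after applying it.\<close>

definition gam :: "'k KQ set => 'k lam" where "gam X = lrep m (SOME f. f \<in> X)"

lemma gam_coset:
  assumes "f \<in> carrier KA" shows "gam (I +>\<^bsub>KA\<^esub> f) = lrep m f"
proof -
  have "(SOME g. g \<in> I +>\<^bsub>KA\<^esub> f) \<in> I +>\<^bsub>KA\<^esub> f" (is "?g \<in> _")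
    by (rule someI[of _ f]) (simp add: IV.mem_coset_iff[OF assms] assms)
  then have g: "?g \<in> carrier KA" "?g \<ominus>\<^bsub>KA\<^esub> f \<in> I"
    using IV.mem_coset_iff[OF assms] IV.coset_eq_iff[OF _ assms] by auto
  then have "lrep m (?g - f) = 0" using I_ker by (simp add: KQ_minus assms)
  then show ?thesis by (simp add: gam_def lrep_diff)
qed

lemma LA_cases:
  assumes "X \<in> carrier LA" obtains f where "f \<in> carrier KA" "X = I +>\<^bsub>KA\<^esub> f"
  using assms unfolding LA_quot carrier_quot by (elim imageE)

lemma coset_LA: "f \<in> carrier KA ==> I +>\<^bsub>KA\<^esub> f \<in> carrier LA"
  unfolding LA_quot by (rule IV.quot_closed)

lemma coset_ops:
  assumes "f \<in> carrier KA" "g \<in> carrier KA"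
  shows "(I +>\<^bsub>KA\<^esub> f) \<oplus>\<^bsub>LA\<^esub> (I +>\<^bsub>KA\<^esub> g) = I +>\<^bsub>KA\<^esub> (f \<oplus>\<^bsub>KA\<^esub> g)"
    "(I +>\<^bsub>KA\<^esub> f) \<otimes>\<^bsub>LA\<^esub> (I +>\<^bsub>KA\<^esub> g) = I +>\<^bsub>KA\<^esub> (f \<otimes>\<^bsub>KA\<^esub> g)"
    "c \<odot>\<^bsub>LA\<^esub> (I +>\<^bsub>KA\<^esub> f) = I +>\<^bsub>KA\<^esub> (c \<odot>\<^bsub>KA\<^esub> f)"
  unfolding LA_quot using IV.quot_add[OF assms] I.rcoset_mult_add[OF assms] IV.quot_smult[OF assms(1)]
  by (simp_all add: quot_simps(2))

lemma gam_add [simp]: "X \<in> carrier LA ==> Y \<in> carrier LA ==> gam (X \<oplus>\<^bsub>LA\<^esub> Y) = gam X + gam Y"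
proof -
  assume X: "X \<in> carrier LA" and Y: "Y \<in> carrier LA"
  obtain f where f: "f \<in> carrier KA" "X = I +>\<^bsub>KA\<^esub> f" using X by (rule LA_cases)
  obtain g where g: "g \<in> carrier KA" "Y = I +>\<^bsub>KA\<^esub> g" using Y by (rule LA_cases)
  show ?thesis unfolding f(2) g(2) coset_ops[OF f(1) g(1)] gam_coset[OF f(1)] gam_coset[OF g(1)]
      gam_coset[OF KQ.a_closed[OF f(1) g(1)]] by (simp add: KQ_simps lrep_add)
qed

lemma gam_mult [simp]: "X \<in> carrier LA ==> Y \<in> carrier LA ==> gam (X \<otimes>\<^bsub>LA\<^esub> Y) = gam X * gam Y"
proof -
  assume X: "X \<in> carrier LA" and Y: "Y \<in> carrier LA"
  obtain f where f: "f \<in> carrier KA" "X = I +>\<^bsub>KA\<^esub> f" using X by (rule LA_cases)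
  obtain g where g: "g \<in> carrier KA" "Y = I +>\<^bsub>KA\<^esub> g" using Y by (rule LA_cases)
  show ?thesis unfolding f(2) g(2) coset_ops[OF f(1) g(1)] gam_coset[OF f(1)] gam_coset[OF g(1)]
      gam_coset[OF KQ.m_closed[OF f(1) g(1)]] by (rule lrep_mult[OF f(1) g(1)])
qed

lemma gam_smult [simp]: "X \<in> carrier LA ==> gam (c \<odot>\<^bsub>LA\<^esub> X) = lscale c (gam X)"
proof -
  assume X: "X \<in> carrier LA"
  obtain f where f: "f \<in> carrier KA" "X = I +>\<^bsub>KA\<^esub> f" using X by (rule LA_cases)
  show ?thesis unfolding f(2) coset_ops(3)[OF f(1) f(1)] gam_coset[OF f(1)] gam_coset[OF KQ.smult_closed[OF f(1)]]
    by (simp add: KQ_simps lrep_scale)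
qed

lemma gam_zero [simp]: "gam \<zero>\<^bsub>LA\<^esub> = 0"
  using gam_smult[of "\<zero>\<^bsub>LA\<^esub>" 0] by (simp add: lscale_simps)

lemma gam_neg [simp]: "X \<in> carrier LA ==> gam (\<ominus>\<^bsub>LA\<^esub> X) = - gam X"
  using gam_smult[of X "- 1"] by (simp add: LA.smult_minus_one lam_eq_iff)

lemma gam_minus [simp]: "X \<in> carrier LA ==> Y \<in> carrier LA ==> gam (X \<ominus>\<^bsub>LA\<^esub> Y) = gam X - gam Y"
  by (simp add: LA.minus_eq)

lemma gam_inj:
  assumes "X \<in> carrier LA" "Y \<in> carrier LA" "gam X = gam Y" shows "X = Y"
proof -
  obtain f where f: "f \<in> carrier KA" "X = I +>\<^bsub>KA\<^esub> f" using assms(1) by (rule LA_cases)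
  obtain g where g: "g \<in> carrier KA" "Y = I +>\<^bsub>KA\<^esub> g" using assms(2) by (rule LA_cases)
  have "lrep m (f \<ominus>\<^bsub>KA\<^esub> g) = 0"
    using assms(3) f g by (simp add: KQ_minus gam_coset lrep_diff)
  then have "f \<ominus>\<^bsub>KA\<^esub> g \<in> I" by (rule ker_I[OF KQ.minus_closed[OF f(1) g(1)]])
  then show ?thesis using f g by (simp add: IV.coset_eq_iff)
qed

lemma gam_periodic: "X \<in> carrier LA ==> periodic m (gam X)"
proof -
  assume "X \<in> carrier LA"
  then obtain f where f: "f \<in> carrier KA" "X = I +>\<^bsub>KA\<^esub> f" by (rule LA_cases)
  obtain c where "f - lincomb c \<in> I" using decompose[OF f(1)] by blast
  from I_ker[OF this] have "lrep m f = lrep m (lincomb c)" by (simp add: lrep_diff)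
  then show ?thesis using f by (simp add: gam_coset periodic_def cf_lrep_lincomb)
qed

text \<open>The inverse of \<open>gam\<close> on periodic elements.\<close>

definition el :: "'k lam => 'k KQ set" where
  "el x = I +>\<^bsub>KA\<^esub> lincomb (\<lambda>t u. cf x t u)"

lemma el_closed [simp]: "el x \<in> carrier LA" unfolding el_def by (rule coset_LA[OF lincomb_closed])

lemma gam_el [simp]: "periodic m x ==> gam (el x) = x"
  unfolding el_def gam_coset[OF lincomb_closed] by (rule lam_eqI) (simp add: cf_lrep_lincomb periodic_def)

lemma periodic_lbas [simp]: "periodic m (lbas t)" by (simp add: periodic_def)

lemma gam_el_one [simp]: "gam (el 1) = 1"
  using gam_el[OF periodic_lbas[of bE]] by (simp add: lbas_E)

abbreviation "ei i \<equiv> idem m 1 i :: 'k KQ set"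
abbreviation "as \<equiv> a_sum m 1 :: 'k KQ set"
abbreviation "bs \<equiv> b_sum m 1 :: 'k KQ set"
abbreviation "us t \<equiv> el (lbas t)"

lemma ei_closed [simp]: "ei i \<in> carrier LA" unfolding idem_def by (rule coset_LA[OF gens_closed(1)])
lemma as_closed [simp]: "as \<in> carrier LA" unfolding a_sum_def by (intro coset_LA sum_closed gens_closed)
lemma bs_closed [simp]: "bs \<in> carrier LA" unfolding b_sum_def by (intro coset_LA sum_closed gens_closed)

lemma gam_ei [simp]: "gam (ei i) = lidem m i"
  unfolding idem_def gam_coset[OF gens_closed(1)] by (rule lrep_gens)

lemma gam_as [simp]: "gam as = lbas bA"
proof -
  have c: "(\<Sum>i\<in>{0..<int m}. arr m i) \<in> carrier KA" by (intro sum_closed gens_closed)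
  have b: "cf (lidem m u * lbas bA) t k = (if t = bA \<and> k mod int m = u mod int m then 1 else 0 :: 'k)" for u t k
    by (cases t) auto
  have "cf (\<Sum>u\<in>{0..<int m}. lidem m u * lbas bA) t k = (if t = bA then 1 else 0 :: 'k)" for t k
  proof -
    have "cf (\<Sum>u\<in>{0..<int m}. lidem m u * lbas bA) t k =
        (\<Sum>u\<in>{0..<int m}. if k mod int m = u then if t = bA then 1 else 0 else (0 :: 'k))"
      unfolding cf_sum b by (rule sum.cong) auto
    then show ?thesis using m_pos by simp
  qed
  then show ?thesis unfolding a_sum_def gam_coset[OF c] lrep_sum lrep_gens by (intro lam_eqI) simp
qed

lemma gam_bs [simp]: "gam bs = lbas bB"
proof -
  have c: "(\<Sum>i\<in>{0..<int m}. bar m i) \<in> carrier KA" by (intro sum_closed gens_closed)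
  have b: "cf (lidem m (u + 1) * lbas bB) t k = (if t = bB \<and> (k - 1) mod int m = u mod int m then 1 else 0 :: 'k)" for u t k
    using mod_add_cancel[of "k - 1" 1 "int m" u] by (cases t) auto
  have "cf (\<Sum>u\<in>{0..<int m}. lidem m (u + 1) * lbas bB) t k = (if t = bB then 1 else 0 :: 'k)" for t k
  proof -
    have "cf (\<Sum>u\<in>{0..<int m}. lidem m (u + 1) * lbas bB) t k =
        (\<Sum>u\<in>{0..<int m}. if (k - 1) mod int m = u then if t = bB then 1 else 0 else (0 :: 'k))"
      unfolding cf_sum b by (rule sum.cong) auto
    then show ?thesis using m_pos by simp
  qed
  then show ?thesis unfolding b_sum_def gam_coset[OF c] lrep_sum lrep_gens by (intro lam_eqI) simp
qed

lemma gam_one [simp]: "gam \<one>\<^bsub>LA\<^esub> = 1"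
proof -
  have "gam (\<one>\<^bsub>LA\<^esub> \<otimes>\<^bsub>LA\<^esub> us bE) = gam \<one>\<^bsub>LA\<^esub> * 1"
    by (subst gam_mult) (simp_all add: lbas_E)
  then show ?thesis by (simp add: lbas_E)
qed

lemma ei_idem [simp]: "ei i \<otimes>\<^bsub>LA\<^esub> ei i = ei i"
  by (rule gam_inj) (simp_all add: lidem_mult)

lemma ei_mod: "ei (i mod int m) = ei i"
  by (rule gam_inj) (simp_all add: lidem_cong[of "i mod int m" m i])

lemma ei_cong: "i mod int m = j mod int m ==> ei i = ei j"
  using ei_mod by metis

text \<open>The coefficients of \<open>x e\<^sub>i\<close> and of \<open>e\<^sub>j x\<close> with respect to the basis elements.\<close>

fun lco :: "'k lam => int => bas => 'k" where
  "lco c i bE = cf c bE i" | "lco c i bA = cf c bA (i - 1)" | "lco c i bB = cf c bB (i + 1)" | "lco c i bS = cf c bS i"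

text \<open>A sum over \<open>bas\<close> written out, so that additivity alone moves linear maps
  through it.\<close>

definition four :: "('k, 'z, 'w) module_scheme => (bas => 'z) => 'z" where
  "four M f = f bE \<oplus>\<^bsub>M\<^esub> f bA \<oplus>\<^bsub>M\<^esub> f bB \<oplus>\<^bsub>M\<^esub> f bS"

lemma mult_ei_expand:
  assumes "x \<in> carrier LA"
  shows "x \<otimes>\<^bsub>LA\<^esub> ei i = four LA (\<lambda>t. lco (gam x) i t \<odot>\<^bsub>LA\<^esub> (us t \<otimes>\<^bsub>LA\<^esub> ei i))"
proof (rule gam_inj)
  note p = periodic_cong[OF gam_periodic[OF assms]]
  show "gam (x \<otimes>\<^bsub>LA\<^esub> ei i) = gam (four LA (\<lambda>t. lco (gam x) i t \<odot>\<^bsub>LA\<^esub> (us t \<otimes>\<^bsub>LA\<^esub> ei i)))"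
  proof (rule lam_eqI)
    fix t k
    have s: "(k + 1) mod int m = i mod int m \<longleftrightarrow> k mod int m = (i - 1) mod int m"
      "(k - 1) mod int m = i mod int m \<longleftrightarrow> k mod int m = (i + 1) mod int m"
      by (simp_all add: mod_eq_dvd_iff algebra_simps)
    show "cf (gam (x \<otimes>\<^bsub>LA\<^esub> ei i)) t k = cf (gam (four LA (\<lambda>t. lco (gam x) i t \<odot>\<^bsub>LA\<^esub> (us t \<otimes>\<^bsub>LA\<^esub> ei i)))) t k"
      using assms by (cases t) (auto simp: four_def s intro: p)
  qed
qed (use assms in \<open>auto simp: four_def\<close>)

lemma ei_mult_expand:
  assumes "x \<in> carrier LA"
  shows "ei j \<otimes>\<^bsub>LA\<^esub> x = four LA (\<lambda>t. cf (gam x) t j \<odot>\<^bsub>LA\<^esub> (ei j \<otimes>\<^bsub>LA\<^esub> us t))"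
proof (rule gam_inj)
  note p = periodic_cong[OF gam_periodic[OF assms]]
  show "gam (ei j \<otimes>\<^bsub>LA\<^esub> x) = gam (four LA (\<lambda>t. cf (gam x) t j \<odot>\<^bsub>LA\<^esub> (ei j \<otimes>\<^bsub>LA\<^esub> us t)))"
  proof (rule lam_eqI)
    fix t k
    show "cf (gam (ei j \<otimes>\<^bsub>LA\<^esub> x)) t k = cf (gam (four LA (\<lambda>t. cf (gam x) t j \<odot>\<^bsub>LA\<^esub> (ei j \<otimes>\<^bsub>LA\<^esub> us t)))) t k"
      using assms by (cases t) (auto simp: four_def intro: p)
  qed
qed (use assms in \<open>auto simp: four_def\<close>)

end

lemma (in idem_family) gen_ei:
  assumes "i \<in> I" shows "lact D (e i) (gen i) = gen i" "ract D (gen i) (e' i) = gen i"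
proof -
  interpret ip: idem_pair A "e i" "e' i" by (rule idem_pair[OF assms])
  show "lact D (e i) (gen i) = gen i" "ract D (gen i) (e' i) = gen i"
    unfolding gen_def using inj_at_act[OF assms ip.proj_gen_closed] ip.gen_e by simp_all
qed

section \<open>The modules of the resolution, their universal property and their bases\<close>

context Lam_alg begin

abbreviation "PN n \<equiv> res_obj m 1 n :: ('k, 'k KQ set, 'k Lam_res) bimod"
abbreviation "G n i r \<equiv> res_gen m 1 n i r :: 'k Lam_res"

definition "src s = ei (fst s)"
definition "trg n s = ei (fst s + int n - 2 * snd s)"

lemma idem_fam: "idem_family LA (res_idx m n) src (trg n)"
proof (intro idem_family.intro idem_family_axioms.intro kalg_LA)
  show "finite (res_idx m n)" by (simp add: res_idx_def)
  fix s show "idem_pair LA (src s) (trg n s)"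
    by (intro idem_pair.intro idem_pair_axioms.intro kalg_LA) (simp_all add: src_def trg_def)
qed

sublocale F: idem_family LA "res_idx m n" src "trg n" for n by (rule idem_fam)

lemma PN_D: "F.D n = PN n"
  unfolding res_obj_def src_def trg_def by (simp add: case_prod_unfold)

lemma bim_PN: "bim LA (PN n)" using F.bim_D[of n] unfolding PN_D .

sublocale PN: bim LA "PN n" for n by (rule bim_PN)

lemma idx_iff: "(i, r) \<in> res_idx m n \<longleftrightarrow> 0 \<le> i \<and> i < int m \<and> 0 \<le> r \<and> r \<le> int n"
  by (auto simp: res_idx_def)

lemma zero_PN: "\<zero>\<^bsub>PN n\<^esub> = (\<lambda>s\<in>res_idx m n. \<zero>\<^bsub>PN n\<^esub> s)"
  by (rule ext) (simp add: PN_D[symmetric] direct_sum_simps restrict_def)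

lemma G_gen:
  assumes "0 \<le> r" "r \<le> int n" shows "G n i r = F.gen n (i mod int m, r)"
proof -
  have "ei i = src (i mod int m, r)" "ei (i + int n - 2 * r) = trg n (i mod int m, r)"
    unfolding src_def trg_def fst_conv snd_conv by (intro ei_cong; simp add: mod_eq_dvd_iff)+
  then show ?thesis
    unfolding res_gen_def F.gen_def F.inj_at_def
    by (intro restrict_ext) (auto simp: PN_D[symmetric] direct_sum_simps)
qed

lemma G_zero:
  assumes "\<not> (0 \<le> r \<and> r \<le> int n)" shows "G n i r = \<zero>\<^bsub>PN n\<^esub>"
proof -
  have "G n i r = (\<lambda>s\<in>res_idx m n. \<zero>\<^bsub>PN n\<^esub> s)"
    unfolding res_gen_def by (rule restrict_ext) (use assms in \<open>auto simp: idx_iff\<close>)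
  then show ?thesis using zero_PN[of n] by simp
qed

lemma G_mod: "G n (i mod int m) r = G n i r"
  by (cases "0 \<le> r \<and> r \<le> int n") (simp_all add: G_gen G_zero)

lemma G_cong: "i mod int m = j mod int m ==> G n i r = G n j r"
  using G_mod by metis

lemma idx_mod: "0 \<le> r ==> r \<le> int n ==> (i mod int m, r) \<in> res_idx m n"
  using m_pos by (simp add: idx_iff)

lemma G_closed [simp]: "G n i r \<in> carrier (PN n)"
proof (cases "0 \<le> r \<and> r \<le> int n")
  case True
  then show ?thesis using F.gen_closed[OF idx_mod, of r n i] by (simp add: G_gen PN_D)
qed (simp add: G_zero)

lemma G_ei: "lact (PN n) (ei i) (G n i r) = G n i r" "ract (PN n) (G n i r) (ei (i + int n - 2 * r)) = G n i r"
proof -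
  have "lact (PN n) (ei i) (G n i r) = G n i r \<and> ract (PN n) (G n i r) (ei (i + int n - 2 * r)) = G n i r"
  proof (cases "0 \<le> r \<and> r \<le> int n")
    case True
    then have "ei i = src (i mod int m, r)" "ei (i + int n - 2 * r) = trg n (i mod int m, r)"
      unfolding src_def trg_def fst_conv snd_conv by (intro ei_cong; simp add: mod_eq_dvd_iff)+
    then show ?thesis using F.gen_ei[OF idx_mod, of r n i] True by (simp add: G_gen PN_D)
  qed (simp add: G_zero)
  then show "lact (PN n) (ei i) (G n i r) = G n i r" "ract (PN n) (G n i r) (ei (i + int n - 2 * r)) = G n i r"
    by auto
qed

lemma PN_induct_gen [consumes 1, case_names zero gen add]:
  assumes "x \<in> carrier (PN n)" "Q \<zero>\<^bsub>PN n\<^esub>"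
    "\<And>i r a b. 0 \<le> i ==> i < int m ==> 0 \<le> r ==> r \<le> int n ==> a \<in> carrier LA ==> b \<in> carrier LA ==>
      Q (ract (PN n) (lact (PN n) a (G n i r)) b)"
    "\<And>x y. x \<in> carrier (PN n) ==> y \<in> carrier (PN n) ==> Q x ==> Q y ==> Q (x \<oplus>\<^bsub>PN n\<^esub> y)"
  shows "Q x"
proof -
  have "x \<in> carrier (F.D n)" using assms(1) by (simp add: PN_D)
  then show ?thesis
  proof (induct rule: F.D_induct)
    case zero then show ?case using assms(2) by (simp add: PN_D)
  next
    case (gen s a b)
    obtain i r where s: "s = (i, r)" by (cases s)
    have ir: "0 \<le> i" "i < int m" "0 \<le> r" "r \<le> int n" using gen(1) by (auto simp: s idx_iff)
    then show ?case using assms(3)[OF ir gen(2,3)] by (simp add: PN_D s G_gen)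
  next
    case (add x y) then show ?case using assms(4)[of x y] by (simp add: PN_D)
  qed
qed

text \<open>The value at \<open>(i, r)\<close> has to lie in \<open>e_i M e_j\<close> with
  \<open>j = i + n - 2 r\<close>, as the generator does; this is the exact condition for values on
  generators to extend.\<close>

definition compat :: "nat => ('k, 'k KQ set, 'z) bimod => (int => int => 'z) => bool" where
  "compat n M v \<longleftrightarrow> (\<forall>i r. 0 \<le> i \<and> i < int m \<and> 0 \<le> r \<and> r \<le> int n \<longrightarrow> v i r \<in> carrier M \<and>
     lact M (ei i) (v i r) = v i r \<and> ract M (v i r) (ei (i + int n - 2 * r)) = v i r)"

lemma hom_unique_G:
  assumes "bim LA M" "f \<in> bimod_hom LA (PN n) M" "g \<in> bimod_hom LA (PN n) M"
    "\<And>i r. 0 \<le> i ==> i < int m ==> 0 \<le> r ==> r \<le> int n ==> f (G n i r) = g (G n i r)"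
  shows "f = g"
proof (rule F.hom_unique[OF assms(1), of f n g])
  show "f \<in> bimod_hom LA (F.D n) M" "g \<in> bimod_hom LA (F.D n) M" using assms(2,3) by (simp_all add: PN_D)
  fix s assume s: "s \<in> res_idx m n"
  obtain i r where sr: "s = (i, r)" by (cases s)
  have ir: "0 \<le> i" "i < int m" "0 \<le> r" "r \<le> int n" using s by (auto simp: sr idx_iff)
  then show "f (F.gen n s) = g (F.gen n s)" using assms(4)[OF ir] by (simp add: G_gen sr)
qed

text \<open>Existence and uniqueness of the homomorphism justify the definite description in
  \<open>hom_by_gens\<close>. The reduction of \<open>i\<close> accounts for values that are
  prescribed only for \<open>0 \<le> i < m\<close>.\<close>

lemma hom_by_gens_hom:
  assumes "bim LA M" "compat n M v"
  shows "hom_by_gens m 1 n M v \<in> bimod_hom LA (PN n) M"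
    "0 \<le> r ==> r \<le> int n ==> hom_by_gens m 1 n M v (G n i r) = v (i mod int m) r"
proof -
  let ?Q = "\<lambda>f. f \<in> bimod_hom LA (PN n) M \<and> (\<forall>(i, r)\<in>res_idx m n. f (G n i r) = v i r)"
  have "\<exists>f\<in>bimod_hom LA (F.D n) M. \<forall>s\<in>res_idx m n. f (F.gen n s) = v (fst s) (snd s)"
    by (rule F.hom_exists[OF assms(1)]) (use assms(2) in \<open>auto simp: compat_def res_idx_def src_def trg_def\<close>)
  then obtain f where f: "f \<in> bimod_hom LA (PN n) M" "\<And>s. s \<in> res_idx m n ==> f (F.gen n s) = v (fst s) (snd s)"
    by (auto simp: PN_D)
  have fQ: "?Q f"
  proof (intro conjI f(1) ballI)
    fix s assume s: "s \<in> res_idx m n"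
    obtain i r where sr: "s = (i, r)" by (cases s)
    have ir: "0 \<le> i" "i < int m" "0 \<le> r" "r \<le> int n" using s by (auto simp: sr idx_iff)
    then show "case s of (i, r) => f (G n i r) = v i r" using f(2)[OF s] by (simp add: G_gen sr)
  qed
  have "hom_by_gens m 1 n M v = f"
    unfolding hom_by_gens_def
  proof (rule the_equality[of ?Q, OF fQ])
    fix g assume g: "?Q g"
    show "g = f"
    proof (rule hom_unique_G[OF assms(1)])
      fix i r assume "0 \<le> i" "i < int m" "0 \<le> r" "r \<le> int n"
      then have "(i, r) \<in> res_idx m n" by (simp add: idx_iff)
      then show "g (G n i r) = f (G n i r)" using g fQ by fastforce
    qed (use g f in auto)
  qed
  then show "hom_by_gens m 1 n M v \<in> bimod_hom LA (PN n) M"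
    "0 \<le> r ==> r \<le> int n ==> hom_by_gens m 1 n M v (G n i r) = v (i mod int m) r"
    using f(1) f(2)[OF idx_mod, of r i] by (simp_all add: G_gen)
qed

text \<open>For \<open>0 \<le> i < m\<close> and \<open>0 \<le> r \<le> n\<close> these are the
  basis elements of P^n over the field: the generator with a basis element on each side.\<close>

definition "TT n t t' i r = ract (PN n) (lact (PN n) (us t) (G n i r)) (us t')"

lemma TT_closed [simp]: "TT n t t' i r \<in> carrier (PN n)" by (simp add: TT_def)

lemma four_closed: "vec M ==> (\<And>t. f t \<in> carrier M) ==> four M f \<in> carrier M"
  by (simp add: four_def vec_def abelian_groupE(1))

lemma vlin_four:
  assumes "vec M" "vec N" "vlin M N \<phi>" "\<And>t. f t \<in> carrier M" shows "\<phi> (four M f) = four N (\<lambda>t. \<phi> (f t))"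
proof -
  interpret M: vec M by fact
  show ?thesis by (simp add: four_def vlinD(2)[OF assms(3)] assms(4))
qed

text \<open>The idempotents of the generator cut \<open>a\<close> down to the four coefficients of
  basis elements ending at its first vertex, and \<open>b\<close> to the four starting at its
  second.\<close>

lemma G_act_expand:
  assumes "a \<in> carrier LA" "b \<in> carrier LA"
  shows "ract (PN n) (lact (PN n) a (G n i r)) b = four (PN n) (\<lambda>t. four (PN n) (\<lambda>t'.
    (lco (gam a) i t * cf (gam b) t' (i + int n - 2 * r)) \<odot>\<^bsub>PN n\<^esub> TT n t t' i r))"
proof -
  let ?P = "PN n" and ?g = "G n i r" and ?j = "i + int n - 2 * r"
  have 1: "lact ?P a ?g = four ?P (\<lambda>t. lco (gam a) i t \<odot>\<^bsub>?P\<^esub> lact ?P (us t) ?g)"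
  proof -
    have "lact ?P a ?g = lact ?P (a \<otimes>\<^bsub>LA\<^esub> ei i) ?g" using assms G_ei(1)[of n i r] by (simp add: PN.lact_mult)
    also have "\<dots> = four ?P (\<lambda>t. lact ?P (lco (gam a) i t \<odot>\<^bsub>LA\<^esub> (us t \<otimes>\<^bsub>LA\<^esub> ei i)) ?g)"
      unfolding mult_ei_expand[OF assms(1)] by (rule vlin_four[OF LA.vec PN.M.vec PN.vlin_lact_scalar]) simp_all
    also have "\<dots> = four ?P (\<lambda>t. lco (gam a) i t \<odot>\<^bsub>?P\<^esub> lact ?P (us t) ?g)"
      using G_ei(1)[of n i r] by (simp add: PN.lact_smult_scalar PN.lact_mult)
    finally show ?thesis .
  qed
  have 2: "ract ?P (lact ?P (us t) ?g) b = four ?P (\<lambda>t'. cf (gam b) t' ?j \<odot>\<^bsub>?P\<^esub> TT n t t' i r)" for t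
  proof -
    have g: "ract ?P (lact ?P (us t) ?g) (ei ?j) = lact ?P (us t) ?g"
      using G_ei(2)[of n i r] by (simp add: PN.ract_lact)
    have "ract ?P (lact ?P (us t) ?g) b = ract ?P (lact ?P (us t) ?g) (ei ?j \<otimes>\<^bsub>LA\<^esub> b)"
      using assms g by (simp add: PN.ract_mult)
    also have "\<dots> = four ?P (\<lambda>t'. ract ?P (lact ?P (us t) ?g) (cf (gam b) t' ?j \<odot>\<^bsub>LA\<^esub> (ei ?j \<otimes>\<^bsub>LA\<^esub> us t')))"
      unfolding ei_mult_expand[OF assms(2)] by (rule vlin_four[OF LA.vec PN.M.vec PN.vlin_ract_scalar]) simp_all
    also have "\<dots> = four ?P (\<lambda>t'. cf (gam b) t' ?j \<odot>\<^bsub>?P\<^esub> TT n t t' i r)"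
      using g by (simp add: PN.ract_smult_scalar PN.ract_mult TT_def)
    finally show ?thesis .
  qed
  have "ract ?P (lact ?P a ?g) b = four ?P (\<lambda>t. ract ?P (lco (gam a) i t \<odot>\<^bsub>?P\<^esub> lact ?P (us t) ?g) b)"
    unfolding 1 by (rule vlin_four[OF PN.M.vec PN.M.vec PN.vlin_ract[OF assms(2)]]) simp
  also have "\<dots> = four ?P (\<lambda>t. lco (gam a) i t \<odot>\<^bsub>?P\<^esub> four ?P (\<lambda>t'. cf (gam b) t' ?j \<odot>\<^bsub>?P\<^esub> TT n t t' i r))"
    using assms(2) by (simp add: PN.ract_smult 2)
  also have "\<dots> = four ?P (\<lambda>t. four ?P (\<lambda>t'. (lco (gam a) i t * cf (gam b) t' ?j) \<odot>\<^bsub>?P\<^esub> TT n t t' i r))"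
    by (simp add: four_def PN.M.smult_r_distr PN.M.smult_assoc)
  finally show ?thesis .
qed

lemma PN_induct [consumes 1, case_names zero gen add]:
  assumes "x \<in> carrier (PN n)" and zero: "Q \<zero>\<^bsub>PN n\<^esub>"
    and gen: "\<And>i r t t' c. 0 \<le> i ==> i < int m ==> 0 \<le> r ==> r \<le> int n ==> Q (c \<odot>\<^bsub>PN n\<^esub> TT n t t' i r)"
    and add: "\<And>x y. x \<in> carrier (PN n) ==> y \<in> carrier (PN n) ==> Q x ==> Q y ==> Q (x \<oplus>\<^bsub>PN n\<^esub> y)"
  shows "Q x"
  using assms(1)
proof (induct rule: PN_induct_gen)
  case (gen i r a b)
  have four: "Q (four (PN n) f)" if "\<And>t. f t \<in> carrier (PN n)" "\<And>t. Q (f t)" for f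
    unfolding four_def by (intro add PN.M.a_closed that)
  show ?case
    unfolding G_act_expand[OF gen(5,6)]
    by (intro four four_closed PN.M.vec PN.M.smult_closed TT_closed assms(3) gen)
qed (use assms in auto)

subsection \<open>Coordinates\<close>

text \<open>The target of coordinates on P^n. \<open>LA\<close> acts on it through
  \<open>gam\<close>, so the coordinate map \<open>Phi\<close> can be obtained as a bimodule
  homomorphism from its values on generators.\<close>

definition MP :: "nat => ('k, 'k KQ set, 'k mfun) bimod" where
  "MP n = \<lparr>carrier = mcarrier m (int n), mult = undefined, one = undefined, zero = (\<lambda>_ _ _ _. 0),
     add = (\<lambda>X Y u v r i. X u v r i + Y u v r i), smult = (\<lambda>c X u v r i. c * X u v r i),
     lact = (\<lambda>a X. mlact (gam a) X), ract = (\<lambda>X a. mract (int n) X (gam a))\<rparr>"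

lemma MP_simps [simp]:
  "carrier (MP n) = mcarrier m (int n)" "zero (MP n) = (\<lambda>_ _ _ _. 0)"
  "add (MP n) = (\<lambda>X Y u v r i. X u v r i + Y u v r i)" "smult (MP n) = (\<lambda>c X u v r i. c * X u v r i)"
  "lact (MP n) a X = mlact (gam a) X" "ract (MP n) X a = mract (int n) X (gam a)"
  by (simp_all add: MP_def)

lemma vec_MP: "vec (MP n)"
proof -
  interpret abelian_group "MP n"
  proof (rule abelian_groupI)
    fix X Y :: "'k mfun" assume X: "X \<in> carrier (MP n)"
    show "\<exists>Y\<in>carrier (MP n). Y \<oplus>\<^bsub>MP n\<^esub> X = \<zero>\<^bsub>MP n\<^esub>"
      using X by (intro bexI[of _ "\<lambda>u v r i. - X u v r i"]) (auto simp: mcarrier_def)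
    assume Y: "Y \<in> carrier (MP n)"
    show "X \<oplus>\<^bsub>MP n\<^esub> Y \<in> carrier (MP n)" using X Y by (auto simp: mcarrier_def)
  qed (auto simp: mcarrier_def add_ac)
  show ?thesis by unfold_locales (auto simp: mcarrier_def algebra_simps)
qed

lemma bim_MP: "bim LA (MP n)"
proof (intro bim.intro bim_axioms.intro kalg_LA vec_MP)
  have l: "cf (gam (c \<odot>\<^bsub>LA\<^esub> \<one>\<^bsub>LA\<^esub>)) t i = (if t = bE then c else 0)" for c t i by simp
  fix a b X Y and c :: 'k
  show "lact (MP n) (c \<odot>\<^bsub>LA\<^esub> \<one>\<^bsub>LA\<^esub>) X = c \<odot>\<^bsub>MP n\<^esub> X"
  proof (rule mfun_eqI)
    fix u v r i show "lact (MP n) (c \<odot>\<^bsub>LA\<^esub> \<one>\<^bsub>LA\<^esub>) X u v r i = (c \<odot>\<^bsub>MP n\<^esub> X) u v r i"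
      by (cases u) (simp_all add: mlact_def)
  qed
  show "ract (MP n) X (c \<odot>\<^bsub>LA\<^esub> \<one>\<^bsub>LA\<^esub>) = c \<odot>\<^bsub>MP n\<^esub> X"
  proof (rule mfun_eqI)
    fix u v r i show "ract (MP n) X (c \<odot>\<^bsub>LA\<^esub> \<one>\<^bsub>LA\<^esub>) u v r i = (c \<odot>\<^bsub>MP n\<^esub> X) u v r i"
      by (cases v) (simp_all add: mract_def)
  qed
  assume a: "a \<in> carrier LA" and X: "X \<in> carrier (MP n)"
  show "lact (MP n) a X \<in> carrier (MP n)" "ract (MP n) X a \<in> carrier (MP n)"
    using mlact_closed[OF gam_periodic[OF a]] mract_closed[OF gam_periodic[OF a]] X by simp_all
  show "lact (MP n) a (X \<oplus>\<^bsub>MP n\<^esub> Y) = lact (MP n) a X \<oplus>\<^bsub>MP n\<^esub> lact (MP n) a Y"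
  proof (rule mfun_eqI)
    fix u v r i show "lact (MP n) a (X \<oplus>\<^bsub>MP n\<^esub> Y) u v r i = (lact (MP n) a X \<oplus>\<^bsub>MP n\<^esub> lact (MP n) a Y) u v r i"
      by (cases u) (simp_all add: mlact_def algebra_simps)
  qed
  show "ract (MP n) (X \<oplus>\<^bsub>MP n\<^esub> Y) a = ract (MP n) X a \<oplus>\<^bsub>MP n\<^esub> ract (MP n) Y a"
  proof (rule mfun_eqI)
    fix u v r i show "ract (MP n) (X \<oplus>\<^bsub>MP n\<^esub> Y) a u v r i = (ract (MP n) X a \<oplus>\<^bsub>MP n\<^esub> ract (MP n) Y a) u v r i"
      by (cases v) (simp_all add: mract_def algebra_simps)
  qed
  assume b: "b \<in> carrier LA"
  show "lact (MP n) (a \<oplus>\<^bsub>LA\<^esub> b) X = lact (MP n) a X \<oplus>\<^bsub>MP n\<^esub> lact (MP n) b X"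
  proof (rule mfun_eqI)
    fix u v r i show "lact (MP n) (a \<oplus>\<^bsub>LA\<^esub> b) X u v r i = (lact (MP n) a X \<oplus>\<^bsub>MP n\<^esub> lact (MP n) b X) u v r i"
      using a b by (cases u) (simp_all add: mlact_def algebra_simps)
  qed
  show "ract (MP n) X (a \<oplus>\<^bsub>LA\<^esub> b) = ract (MP n) X a \<oplus>\<^bsub>MP n\<^esub> ract (MP n) X b"
  proof (rule mfun_eqI)
    fix u v r i show "ract (MP n) X (a \<oplus>\<^bsub>LA\<^esub> b) u v r i = (ract (MP n) X a \<oplus>\<^bsub>MP n\<^esub> ract (MP n) X b) u v r i"
      using a b by (cases v) (simp_all add: mract_def algebra_simps)
  qed
  show "lact (MP n) (a \<otimes>\<^bsub>LA\<^esub> b) X = lact (MP n) a (lact (MP n) b X)"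
    "ract (MP n) X (a \<otimes>\<^bsub>LA\<^esub> b) = ract (MP n) (ract (MP n) X a) b"
    "ract (MP n) (lact (MP n) a X) b = lact (MP n) a (ract (MP n) X b)"
    using a b by (simp_all only: MP_simps gam_mult act_assoc)
qed

sublocale MP: bim LA "MP n" for n by (rule bim_MP)

lemma mlact_lidem_mgen: "mlact (lidem m i) (mgen m i r) = mgen m i r"
proof (rule mfun_eqI)
  fix u v r' i' show "mlact (lidem m i) (mgen m i r) u v r' i' = mgen m i r u v r' i'"
    by (cases u) (auto simp: mlact_def mgen_def)
qed

lemma mract_lidem_mgen: "mract n (mgen m i r) (lidem m (i + n - 2 * r)) = mgen m i r"
proof (rule mfun_eqI)
  fix u v r' i'
  have "i' mod int m = i mod int m ==> (i' + n - 2 * r) mod int m = (i + n - 2 * r) mod int m"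
    by (rule mod_shifts(3))
  then show "mract n (mgen m i r) (lidem m (i + n - 2 * r)) u v r' i' = mgen m i r u v r' i'"
    by (cases v) (auto simp: mract_def mgen_def)
qed

lemma compat_mgen: "compat n (MP n) (mgen m)"
  unfolding compat_def by (simp add: mgen_closed mlact_lidem_mgen mract_lidem_mgen)

definition Phi :: "nat => 'k Lam_res => 'k mfun" where
  "Phi n = hom_by_gens m 1 n (MP n) (mgen m)"

lemma Phi_hom: "Phi n \<in> bimod_hom LA (PN n) (MP n)"
  unfolding Phi_def by (rule hom_by_gens_hom(1)[OF bim_MP compat_mgen])

lemma mgen_mod: "mgen m (i mod int m) r = (mgen m i r :: 'k mfun)" by (simp add: mgen_def)

lemma Phi_G: "0 \<le> r ==> r \<le> int n ==> Phi n (G n i r) = mgen m i r"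
  unfolding Phi_def by (simp add: hom_by_gens_hom(2)[OF bim_MP compat_mgen] mgen_mod)

lemma Phi_TT:
  assumes "0 \<le> r" "r \<le> int n"
  shows "Phi n (TT n t t' i r) u v r' i' = (if u = t \<and> v = t' \<and> r' = r \<and> i' mod int m =
    i mod int m then 1 else 0)"
proof -
  have P: "Phi n (TT n t t' i r) = mract (int n) (mlact (lbas t) (mgen m i r)) (lbas t')"
    unfolding TT_def using bimod_homD(3,4)[OF Phi_hom] by (simp add: Phi_G assms)
    have 1: "mlact (lbas t) (mgen m i r) u v r' i' =
        (if u = t \<and> v = bE \<and> r' = r \<and> i' mod int m = i mod int m then 1 else 0 :: 'k)" for u v r' i'
      by (cases u; cases t) (simp_all add: mlact_def mgen_def)
    show ?thesis unfolding P mract_def 1 by (cases v; cases t') simp_all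
qed

definition "KI n = res_idx m n \<times> (UNIV :: bas set) \<times> (UNIV :: bas set)"

text \<open>The inverse of \<open>Phi\<close>: the sum over the basis, with one representative
  vertex from each residue class.\<close>

definition Psi :: "nat => 'k mfun => 'k Lam_res" where
  "Psi n X = (\<Oplus>\<^bsub>PN n\<^esub>\<kappa>\<in>KI n.
    (\<lambda>(s, t, t'). X t t' (snd s) (fst s) \<odot>\<^bsub>PN n\<^esub> TT n t t' (fst s) (snd s)) \<kappa>)"

lemma finite_KI: "finite (KI n)"
  unfolding KI_def res_idx_def by (intro finite_cartesian_product finite_UNIV_bas finite_atLeastLessThan_int finite_atLeastAtMost_int)

lemma Psi_closed: "Psi n X \<in> carrier (PN n)"
  unfolding Psi_def by (rule PN.M.finsum_closed) auto

text \<open>It is enough to treat multiples of basis elements, each of which has a single nonzero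
  coordinate. This makes \<open>Phi\<close> injective, so that equations in P^n can be tested in
  coordinates.\<close>

lemma Psi_Phi:
  assumes "x \<in> carrier (PN n)" shows "Psi n (Phi n x) = x"
  using assms
proof (induct rule: PN_induct)
  case zero
  have z: "Phi n \<zero>\<^bsub>PN n\<^esub> = (\<lambda>_ _ _ _. 0)"
    using vlin_zero[OF PN.M.vec MP.M.vec bimod_homD(2)[OF Phi_hom]] by simp
  show ?case unfolding Psi_def z by (rule PN.M.add.finprod_one_eqI) auto
next
  case (gen i r t t' c)
  let ?T = "TT n t t' i r"
  have ir: "((i, r), t, t') \<in> KI n" using gen by (simp add: KI_def idx_iff)
  have P: "Phi n (c \<odot>\<^bsub>PN n\<^esub> ?T) u v r' i' = (if u = t \<and> v = t' \<and> r' = r \<and> i' mod int m = i mod int m then c else 0)" for u v r' i'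
    using vlinD(3)[OF bimod_homD(2)[OF Phi_hom], of ?T n c] Phi_TT[OF gen(3,4), of t t' i u v r' i'] by simp
  have "Psi n (Phi n (c \<odot>\<^bsub>PN n\<^esub> ?T)) = (\<Oplus>\<^bsub>PN n\<^esub>\<kappa>\<in>KI n. if ((i, r), t, t') = \<kappa> then c \<odot>\<^bsub>PN n\<^esub> ?T else \<zero>\<^bsub>PN n\<^esub>)"
    unfolding Psi_def
  proof (rule PN.M.add.finprod_cong'[OF refl])
    fix \<kappa> assume k: "\<kappa> \<in> KI n"
    obtain i' r' u v where kk: "\<kappa> = ((i', r'), u, v)" by (metis prod.exhaust)
    have "i' mod int m = i mod int m \<longleftrightarrow> i' = i" using k gen by (auto simp: kk KI_def idx_iff)
    then show "(case \<kappa> of (s, u, v) => Phi n (c \<odot>\<^bsub>PN n\<^esub> ?T) u v (snd s) (fst s) \<odot>\<^bsub>PN n\<^esub> TT n u v (fst s) (snd s)) =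
        (if ((i, r), t, t') = \<kappa> then c \<odot>\<^bsub>PN n\<^esub> ?T else \<zero>\<^bsub>PN n\<^esub>)"
      by (auto simp: kk P)
  qed auto
  also have "\<dots> = c \<odot>\<^bsub>PN n\<^esub> ?T"
    by (rule PN.M.add.finprod_singleton[OF ir finite_KI, of "\<lambda>_. c \<odot>\<^bsub>PN n\<^esub> ?T"]) auto
  finally show ?case .
next
  case (add x y)
  have "Psi n (Phi n (x \<oplus>\<^bsub>PN n\<^esub> y)) = Psi n (Phi n x) \<oplus>\<^bsub>PN n\<^esub> Psi n (Phi n y)"
    unfolding vlinD(2)[OF bimod_homD(2)[OF Phi_hom] add(1,2)] Psi_def
    by (subst PN.M.finsum_addf[symmetric]) (auto intro!: PN.M.add.finprod_cong' simp: PN.M.smult_l_distr)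
  then show ?case using add by simp
qed

lemma Phi_inj: "x \<in> carrier (PN n) ==> y \<in> carrier (PN n) ==> Phi n x = Phi n y ==> x = y"
  using Psi_Phi by metis

lemma finsum_MP:
  assumes "finite J" "\<And>j. j \<in> J ==> f j \<in> mcarrier m (int n)"
  shows "finsum (MP n) f J u v r i = (\<Sum>j\<in>J. f j u v r i)"
  using assms
proof (induct J rule: finite_induct)
  case (insert x J)
  then show ?case by (subst MP.M.finsum_insert) auto
qed simp

lemma Phi_Psi:
  assumes X: "X \<in> mcarrier m (int n)" shows "Phi n (Psi n X) = X"
proof (rule mfun_eqI)
  fix u v r i
  let ?f = "\<lambda>(s, t, t'). X t t' (snd s) (fst s) \<odot>\<^bsub>PN n\<^esub> TT n t t' (fst s) (snd s)"
  have f: "?f \<kappa> \<in> carrier (PN n)" for \<kappa> by (cases \<kappa>) auto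
  have pc: "Phi n (?f \<kappa>) \<in> mcarrier m (int n)" for \<kappa> using bimod_hom_closed[OF Phi_hom f] by simp
  have "Phi n (Psi n X) u v r i = (\<Sum>\<kappa>\<in>KI n. Phi n (?f \<kappa>) u v r i)"
    unfolding Psi_def using vlin_finsum[OF PN.M.vec MP.M.vec bimod_homD(2)[OF Phi_hom], of ?f "KI n" n] f
      finsum_MP[OF finite_KI, of n "\<lambda>\<kappa>. Phi n (?f \<kappa>)" n u v r i] pc by auto
  also have "\<dots> = (\<Sum>\<kappa>\<in>KI n. if \<kappa> = ((i mod int m, r), u, v) then X u v r i else 0)"
  proof (rule sum.cong[OF refl])
    fix \<kappa> assume k: "\<kappa> \<in> KI n"
    obtain i' r' t t' where kk: "\<kappa> = ((i', r'), t, t')" by (metis prod.exhaust)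
    have ir: "0 \<le> i'" "i' < int m" "0 \<le> r'" "r' \<le> int n" using k by (auto simp: kk KI_def idx_iff)
    have "Phi n (?f \<kappa>) u v r i = X t t' r' i' * Phi n (TT n t t' i' r') u v r i"
      using vlinD(3)[OF bimod_homD(2)[OF Phi_hom], of "TT n t t' i' r'" n "X t t' r' i'"] by (simp add: kk)
    also have "\<dots> = (if u = t \<and> v = t' \<and> r = r' \<and> i mod int m = i' then X u v r i' else 0)"
      using Phi_TT[OF ir(3,4), of t t' i' u v r i] ir by auto
    also have "\<dots> = (if \<kappa> = ((i mod int m, r), u, v) then X u v r i else 0)"
      using mcarrier_cong[OF X, of "i mod int m" i u v r] by (auto simp: kk)
    finally show "Phi n (?f \<kappa>) u v r i = (if \<kappa> = ((i mod int m, r), u, v) then X u v r i else 0)" .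
  qed
  also have "\<dots> = X u v r i"
  proof (cases "0 \<le> r \<and> r \<le> int n")
    case True
    then have "((i mod int m, r), u, v) \<in> KI n" using idx_mod by (simp add: KI_def)
    then show ?thesis using finite_KI by simp
  next
    case False
    then have x0: "X u v r i = 0" using supp_zero[OF X, of r u v i] by linarith
    show ?thesis unfolding x0 by simp
  qed
  finally show "Phi n (Psi n X) u v r i = X u v r i" .
qed

end

section \<open>The differential, exactness and projectivity\<close>

context Lam_alg begin

abbreviation "RQ \<equiv> Lam_resolution m 1 :: ('k, 'k KQ set, 'k Lam_res) aug_complex"

text \<open>The boundary of a generator of degree \<open>n + 1\<close>, which lies in degree
  \<open>n\<close>, in the form common to all three cases when N = 1.\<close>

definition Bd :: "nat => int => int => 'k Lam_res" where
  "Bd n i r = ract (PN n) (G n i r) as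
     \<oplus>\<^bsub>PN n\<^esub> sg (int (Suc n) + r) \<odot>\<^bsub>PN n\<^esub> lact (PN n) as (G n (i + 1) r)
     \<oplus>\<^bsub>PN n\<^esub> sg (int (Suc n) + r) \<odot>\<^bsub>PN n\<^esub> lact (PN n) bs (G n (i - 1) (r - 1))
     \<oplus>\<^bsub>PN n\<^esub> sg (int (Suc n)) \<odot>\<^bsub>PN n\<^esub> ract (PN n) (G n i (r - 1)) bs"

lemma RQ_simps:
  "obj RQ = res_obj m 1" "bdry RQ n = hom_by_gens m 1 n (res_obj m 1 (n - 1)) (res_bdry_gen m 1 n)"
  "aug RQ = hom_by_gens m 1 0 (regular_bimod LA) (\<lambda>i r. ei i)"
  by (simp_all add: Lam_resolution_def)

lemma sg_power: "0 \<le> r ==> (- 1) ^ (n + nat r) = (sg (int n + r) :: 'k)"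
proof -
  assume "0 \<le> r"
  then obtain q where q: "r = int q" using nonneg_int_cases by blast
  have "(- 1) ^ k = (sg (int k) :: 'k)" for k by (induct k) (simp_all add: sg_def)
  from this[of "n + q"] show ?thesis by (simp add: q)
qed

lemma sg_power': "(- 1) ^ n = (sg (int n) :: 'k)"
  using sg_power[of 0 n] by simp

text \<open>The exponents \<open>N - 1\<close> are zero and the sum over \<open>k\<close> has a
  single term. In the middle case the degree is \<open>2 r\<close>, hence even, so the signs written
  there agree with those of the other two cases.\<close>

lemma res_bdry_gen_1:
  assumes r: "0 \<le> r" "r \<le> int (Suc n)"
  shows "res_bdry_gen m 1 (Suc n) i r = Bd n i r"
proof -
  have p: "x \<otimes>\<^bsub>LA\<^esub> y [^]\<^bsub>LA\<^esub> (1 - 1 :: nat) = x" if "x \<in> carrier LA" for x y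
    using that by simp
  show ?thesis
  proof (cases "int (Suc n) - 2 * r = 0")
    case False
    then show ?thesis
      using sg_power[OF r(1), of "Suc n"] sg_power'[of "Suc n"]
      by (simp add: res_bdry_gen_def Let_def Bd_def p del: of_nat_Suc power_Suc)
  next
    case True
    then have e: "sg (int (Suc n)) = (1 :: 'k)" "sg (int (Suc n) + r) = (sg r :: 'k)" "(- 1) ^ nat r = (sg r :: 'k)"
      using sg_power[OF r(1), of 0] by (simp_all add: sg_def)
    have s: "(\<Oplus>\<^bsub>PN n\<^esub>k\<in>{..<1::nat}. f k) = f 0" if "f 0 \<in> carrier (PN n)" for f
    proof -
      have l: "{..<1::nat} = {0}" by auto
      show ?thesis unfolding l using that PN.M.finsum_insert[of "{}" 0 f n] by simp
    qed
    let ?P = "PN n" and ?g = "G n"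
    have "res_bdry_gen m 1 (Suc n) i r =
      (ract ?P (?g i r) as \<oplus>\<^bsub>?P\<^esub> sg r \<odot>\<^bsub>?P\<^esub> lact ?P bs (?g (i - 1) (r - 1))) \<oplus>\<^bsub>?P\<^esub>
      (sg r \<odot>\<^bsub>?P\<^esub> lact ?P as (?g (i + 1) r) \<oplus>\<^bsub>?P\<^esub> ract ?P (?g i (r - 1)) bs)"
      using True unfolding res_bdry_gen_def Let_def
      by (simp add: s e(3) del: of_nat_Suc power_Suc)
    also have "\<dots> = Bd n i r"
      unfolding Bd_def e by (simp add: PN.M.a_ac)
    finally show ?thesis .
  qed
qed

lemma ei_commute:
  "ei i \<otimes>\<^bsub>LA\<^esub> as = as \<otimes>\<^bsub>LA\<^esub> ei (i + 1)" "ei i \<otimes>\<^bsub>LA\<^esub> bs = bs \<otimes>\<^bsub>LA\<^esub> ei (i - 1)"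
  by (rule gam_inj; simp add: lbas_lidem)+

lemma lact_G_ei:
  "lact (PN n) (ei i) (lact (PN n) as (G n (i + 1) r)) = lact (PN n) as (G n (i + 1) r)"
  "lact (PN n) (ei i) (lact (PN n) bs (G n (i - 1) r)) = lact (PN n) bs (G n (i - 1) r)"
  using G_ei(1)[of n "i + 1" r] G_ei(1)[of n "i - 1" r]
  by (simp_all add: ei_commute flip: PN.lact_mult) (simp_all add: PN.lact_mult)

lemma ract_G_ei:
  "j = i + int n - 2 * r + 1 ==> ract (PN n) (ract (PN n) (G n i r) as) (ei j) = ract (PN n) (G n i r) as"
  "j = i + int n - 2 * r - 1 ==> ract (PN n) (ract (PN n) (G n i r) bs) (ei j) = ract (PN n) (G n i r) bs"
proof -
  have 1: "as \<otimes>\<^bsub>LA\<^esub> ei (k + 1) = ei k \<otimes>\<^bsub>LA\<^esub> as" "bs \<otimes>\<^bsub>LA\<^esub> ei (k - 1) = ei k \<otimes>\<^bsub>LA\<^esub> bs" for k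
    by (simp_all add: ei_commute)
  show "j = i + int n - 2 * r + 1 ==> ract (PN n) (ract (PN n) (G n i r) as) (ei j) = ract (PN n) (G n i r) as"
    using G_ei(2)[of n i r] by (simp add: 1 flip: PN.ract_mult) (simp add: PN.ract_mult)
  show "j = i + int n - 2 * r - 1 ==> ract (PN n) (ract (PN n) (G n i r) bs) (ei j) = ract (PN n) (G n i r) bs"
    using G_ei(2)[of n i r] by (simp add: 1 flip: PN.ract_mult) (simp add: PN.ract_mult)
qed

lemma compat_Bd: "compat (Suc n) (PN n) (Bd n)"
  unfolding compat_def
proof (intro allI impI conjI)
  fix i r
  show "Bd n i r \<in> carrier (PN n)" by (simp add: Bd_def)
  show "lact (PN n) (ei i) (Bd n i r) = Bd n i r"
    using G_ei(1)[of n i]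
    by (simp add: Bd_def PN.lact_add PN.lact_smult lact_G_ei flip: PN.ract_lact)
  have j: "i + int (Suc n) - 2 * r = (i + 1) + int n - 2 * r" "i + int (Suc n) - 2 * r = (i - 1) + int n - 2 * (r - 1)"
    by auto
  show "ract (PN n) (Bd n i r) (ei (i + int (Suc n) - 2 * r)) = Bd n i r"
    using G_ei(2)[of n "i + 1" r] G_ei(2)[of n "i - 1" "r - 1"]
    by (simp add: Bd_def PN.ract_add PN.ract_smult ract_G_ei PN.ract_lact j(1)[simplified] j(2)[simplified] algebra_simps)
qed

lemma compat_cong:
  assumes "\<And>i r. 0 \<le> r ==> r \<le> int n ==> v i r = v' i r" shows "compat n M v = compat n M v'"
  unfolding compat_def using assms by simp

lemma compat_bdry: "compat (Suc n) (PN n) (res_bdry_gen m 1 (Suc n))"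
  using compat_Bd compat_cong[of "Suc n" "res_bdry_gen m 1 (Suc n)" "Bd n"] res_bdry_gen_1 by blast

lemma bd_hom: "bdry RQ (Suc n) \<in> bimod_hom LA (PN (Suc n)) (PN n)"
  unfolding RQ_simps using hom_by_gens_hom(1)[OF bim_PN compat_bdry] by simp

lemma Bd_mod: "Bd n (i mod int m) r = Bd n i r"
proof -
  have "(i mod int m + 1) mod int m = (i + 1) mod int m" "(i mod int m - 1) mod int m = (i - 1) mod int m"
    by (simp_all add: mod_add_left_eq mod_diff_left_eq)
  then have "G n (i mod int m + 1) r = G n (i + 1) r" "G n (i mod int m - 1) (r - 1) = G n (i - 1) (r - 1)"
    by (auto intro: G_cong)
  then show ?thesis unfolding Bd_def G_mod by simp
qed

lemma bd_G: "0 \<le> r ==> r \<le> int (Suc n) ==> bdry RQ (Suc n) (G (Suc n) i r) = Bd n i r"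
proof -
  assume r: "0 \<le> r" "r \<le> int (Suc n)"
  have "bdry RQ (Suc n) (G (Suc n) i r) = res_bdry_gen m 1 (Suc n) (i mod int m) r"
    unfolding RQ_simps using hom_by_gens_hom(2)[OF bim_PN compat_bdry r] by simp
  then show ?thesis using res_bdry_gen_1[OF r] Bd_mod by simp
qed

lemma Phi_G': "Phi n (G n i r) = (if 0 \<le> r \<and> r \<le> int n then mgen m i r else (\<lambda>_ _ _ _. 0))"
proof (cases "0 \<le> r \<and> r \<le> int n")
  case False
  have z: "Phi n \<zero>\<^bsub>PN n\<^esub> = (\<lambda>_ _ _ _. 0)"
    using vlin_zero[OF PN.M.vec MP.M.vec bimod_homD(2)[OF Phi_hom]] by simp
  show ?thesis unfolding if_not_P[OF False] G_zero[OF False] by (rule z)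
qed (simp add: Phi_G)

text \<open>Both composites are bimodule homomorphisms, so they are compared on generators, where
  \<open>dm_mgen\<close> applies.\<close>

lemma Phi_bd:
  assumes "x \<in> carrier (PN (Suc n))"
  shows "Phi n (bdry RQ (Suc n) x) = dm (int (Suc n)) (Phi (Suc n) x)"
proof -
  let ?D = "\<lambda>X\<in>carrier (MP (Suc n)). dm (int (Suc n)) X"
  have D: "?D \<in> bimod_hom LA (MP (Suc n)) (MP n)"
  proof (rule bimod_hom_restrictI[OF bim_MP])
    have lin: "dm k (\<lambda>u v r i. X u v r i + Y u v r i) = (\<lambda>u v r i. dm k X u v r i + dm k Y u v r i)"
      "dm k (\<lambda>u v r i. c * X u v r i) = (\<lambda>u v r i. c * dm k X u v r i)" for k X Y and c :: 'k
    proof -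
      show "dm k (\<lambda>u v r i. X u v r i + Y u v r i) = (\<lambda>u v r i. dm k X u v r i + dm k Y u v r i)"
      proof (rule mfun_eqI)
        fix u v r i show "dm k (\<lambda>u v r i. X u v r i + Y u v r i) u v r i = dm k X u v r i + dm k Y u v r i"
          by (cases u; cases v) (simp_all add: dm_def algebra_simps)
      qed
      show "dm k (\<lambda>u v r i. c * X u v r i) = (\<lambda>u v r i. c * dm k X u v r i)"
      proof (rule mfun_eqI)
        fix u v r i show "dm k (\<lambda>u v r i. c * X u v r i) u v r i = c * dm k X u v r i"
          by (cases u; cases v) (simp_all add: dm_def algebra_simps)
      qed
    qed
    show "vlin (MP (Suc n)) (MP n) (dm (int (Suc n)))"
      by (rule vlinI) (use dm_closed[of _ m "int n"] lin in \<open>simp_all add: add.commute\<close>)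
    show "dm (int (Suc n)) (lact (MP (Suc n)) a X) = lact (MP n) a (dm (int (Suc n)) X)" for a X
      by (simp add: dm_mlact)
    show "dm (int (Suc n)) (ract (MP (Suc n)) X a) = ract (MP n) (dm (int (Suc n)) X) a" for a X
      using dm_mract[of "int (Suc n)" X "gam a"] by simp
  qed
  have 1: "compose (carrier (PN (Suc n))) (Phi n) (bdry RQ (Suc n)) \<in> bimod_hom LA (PN (Suc n)) (MP n)"
    by (rule bimod_hom_comp[OF bim_PN bd_hom Phi_hom])
  have 2: "compose (carrier (PN (Suc n))) ?D (Phi (Suc n)) \<in> bimod_hom LA (PN (Suc n)) (MP n)"
    by (rule bimod_hom_comp[OF bim_PN Phi_hom D])
  have "compose (carrier (PN (Suc n))) (Phi n) (bdry RQ (Suc n)) = compose (carrier (PN (Suc n))) ?D (Phi (Suc n))"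
  proof (rule hom_unique_G[OF bim_MP 1 2])
    fix i r assume ir: "0 \<le> i" "i < int m" "0 \<le> r" "r \<le> int (Suc n)"
    have mc: "(mgen m i r :: 'k mfun) \<in> mcarrier m (int (Suc n))" by (rule mgen_closed[OF ir(3,4)])
    note pv = vlinD[OF bimod_homD(2)[OF Phi_hom[of n]]] and pa = bimod_homD(3,4)[OF Phi_hom[of n]]
    have "Phi n (Bd n i r) = (\<lambda>u v r' i'. mract (int n) (Phi n (G n i r)) (lbas bA) u v r' i'
       + sg (int (Suc n) + r) * mlact (lbas bA) (Phi n (G n (i + 1) r)) u v r' i'
       + sg (int (Suc n) + r) * mlact (lbas bB) (Phi n (G n (i - 1) (r - 1))) u v r' i'
       + sg (int (Suc n)) * mract (int n) (Phi n (G n i (r - 1))) (lbas bB) u v r' i')"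
      by (simp add: Bd_def pv pa)
    also have "\<dots> = dm (int (Suc n)) (mgen m i r)"
    proof (rule mfun_eqI)
      fix u v r' i'
      have z1: "mlact c (\<lambda>_ _ _ _. 0) u v r' i' = 0" for c :: "'k lam" and u v r' i'
        by (cases u) (simp_all add: mlact_def)
      have z2: "mract k (\<lambda>_ _ _ _. 0) c u v r' i' = 0" for c :: "'k lam" and k u v r' i'
        by (cases v) (simp_all add: mract_def)
      note z = z1 z2
      have e: "int (Suc n) - 1 = int n" by simp
      have d: "dm (int (Suc n)) (mgen m i r) u v r' i' = (if r \<le> int n then mract (int n) (mgen m i r) (lbas bA) u v r' i' + sg (int (Suc n) + r) * mlact (lbas bA) (mgen m (i + 1) r) u v r' i' else 0)
        + (if 1 \<le> r then sg (int (Suc n) + r) * mlact (lbas bB) (mgen m (i - 1) (r - 1)) u v r' i' + sg (int (Suc n)) * mract (int n) (mgen m i (r - 1)) (lbas bB) u v r' i' else (0 :: 'k))"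
        using dm_mgen[OF ir(3,4), of m i u v r' i'] unfolding e by simp
      show "mract (int n) (Phi n (G n i r)) (lbas bA) u v r' i'
       + sg (int (Suc n) + r) * mlact (lbas bA) (Phi n (G n (i + 1) r)) u v r' i'
       + sg (int (Suc n) + r) * mlact (lbas bB) (Phi n (G n (i - 1) (r - 1))) u v r' i'
       + sg (int (Suc n)) * mract (int n) (Phi n (G n i (r - 1))) (lbas bB) u v r' i' = dm (int (Suc n)) (mgen m i r) u v r' i'"
        unfolding d Phi_G' using ir(3,4) by (cases "r \<le> int n"; cases "1 \<le> r") (simp_all add: z del: sg_simps)
    qed
    finally show "compose (carrier (PN (Suc n))) (Phi n) (bdry RQ (Suc n)) (G (Suc n) i r) =
        compose (carrier (PN (Suc n))) ?D (Phi (Suc n)) (G (Suc n) i r)"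
      using mc by (simp add: compose_eq bd_G[OF ir(3,4)] Phi_G[OF ir(3,4)] del: of_nat_Suc)
  qed
  from fun_cong[OF this, of x] show ?thesis
    using assms bimod_hom_closed[OF Phi_hom assms] by (simp add: compose_eq)
qed

lemma compat_aug: "compat 0 (regular_bimod LA) (\<lambda>i r. ei i)"
proof -
  have "r = 0" if "0 \<le> r" "r \<le> int 0" for r :: int using that by simp
  then show ?thesis unfolding compat_def by fastforce
qed

lemma aug_hom: "aug RQ \<in> bimod_hom LA (PN 0) (regular_bimod LA)"
  unfolding RQ_simps by (rule hom_by_gens_hom(1)[OF bim_regular[OF kalg_LA] compat_aug])

lemma aug_G: "aug RQ (G 0 i 0) = ei i"
  unfolding RQ_simps by (simp add: hom_by_gens_hom(2)[OF bim_regular[OF kalg_LA] compat_aug] ei_mod)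

lemma gam_aug:
  assumes "x \<in> carrier (PN 0)" shows "gam (aug RQ x) = meps (Phi 0 x)"
  using assms
proof (induct rule: PN_induct_gen)
  case zero
  have "aug RQ \<zero>\<^bsub>PN 0\<^esub> = \<zero>\<^bsub>LA\<^esub>"
    using vlin_zero[OF PN.M.vec _ bimod_homD(2)[OF aug_hom]] bim_regular[OF kalg_LA] by (simp add: bim_def)
  moreover have "Phi 0 \<zero>\<^bsub>PN 0\<^esub> = (\<lambda>_ _ _ _. 0)"
    using vlin_zero[OF PN.M.vec MP.M.vec bimod_homD(2)[OF Phi_hom]] by simp
  moreover have "meps (\<lambda>_ _ _ _. 0) = (0 :: 'k lam)"
  proof (rule lam_eqI)
    fix t k show "cf (meps (\<lambda>_ _ _ _. 0)) t k = cf (0 :: 'k lam) t k" by (cases t) (simp_all add: meps_def)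
  qed
  ultimately show ?case by simp
next
  case (gen i r a b)
  then have r: "r = 0" by simp
  have "aug RQ (ract (PN 0) (lact (PN 0) a (G 0 i r)) b) = a \<otimes>\<^bsub>LA\<^esub> ei i \<otimes>\<^bsub>LA\<^esub> b"
    using bimod_homD(3,4)[OF aug_hom] gen(5,6) by (simp add: r aug_G)
  moreover have "Phi 0 (ract (PN 0) (lact (PN 0) a (G 0 i r)) b) = mract 0 (mlact (gam a) (mgen m i 0)) (gam b)"
    using bimod_homD(3,4)[OF Phi_hom[of 0]] gen(5,6) by (simp add: r Phi_G)
  ultimately show ?case using gen(5,6) by (simp add: meps_mract meps_mlact meps_mgen)
next
  case (add x y)
  have "aug RQ (x \<oplus>\<^bsub>PN 0\<^esub> y) = aug RQ x \<oplus>\<^bsub>LA\<^esub> aug RQ y"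
    using vlinD(2)[OF bimod_homD(2)[OF aug_hom] add(1,2)] by simp
  moreover have "Phi 0 (x \<oplus>\<^bsub>PN 0\<^esub> y) = (\<lambda>u v r i. Phi 0 x u v r i + Phi 0 y u v r i)"
    using vlinD(2)[OF bimod_homD(2)[OF Phi_hom] add(1,2)] by simp
  moreover have "aug RQ x \<in> carrier LA" "aug RQ y \<in> carrier LA"
    using bimod_hom_closed[OF aug_hom add(1)] bimod_hom_closed[OF aug_hom add(2)] by simp_all
  moreover have "meps (\<lambda>u v r i. X u v r i + Y u v r i) = meps X + meps Y" for X Y :: "'k mfun"
  proof (rule lam_eqI)
    fix t k show "cf (meps (\<lambda>u v r i. X u v r i + Y u v r i)) t k = cf (meps X + meps Y) t k"
      by (cases t) (simp_all add: meps_def)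
  qed
  ultimately show ?case using add by simp
qed

lemma Phi_closed: "x \<in> carrier (PN n) ==> Phi n x \<in> mcarrier m (int n)"
  using bimod_hom_closed[OF Phi_hom] by simp

lemma Phi_zero_iff: "x \<in> carrier (PN n) ==> x = \<zero>\<^bsub>PN n\<^esub> \<longleftrightarrow> Phi n x = (\<lambda>_ _ _ _. 0)"
  using Phi_inj[of x n "\<zero>\<^bsub>PN n\<^esub>"] vlin_zero[OF PN.M.vec MP.M.vec bimod_homD(2)[OF Phi_hom]] by auto

lemma bd_closed: "x \<in> carrier (PN (Suc n)) ==> bdry RQ (Suc n) x \<in> carrier (PN n)"
  by (rule bimod_hom_closed[OF bd_hom])

lemma hmu_zero: "hmu n (\<lambda>_ _ _ _. 0) u v r i = (0 :: 'k)"
proof -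
  have p: "preA (\<lambda>_. 0) v = (0 :: 'k)" for v by (cases v) auto
  show ?thesis by (cases u) (simp_all add: p)
qed

text \<open>The witness \<open>Psi (hmu (Phi x))\<close> is also needed for its length.\<close>

lemma exact_bd_witness:
  assumes x: "x \<in> carrier (PN (Suc n))" "bdry RQ (Suc n) x = \<zero>\<^bsub>PN n\<^esub>"
  shows "bdry RQ (Suc (Suc n)) (Psi (Suc (Suc n)) (hmu (int (Suc n)) (Phi (Suc n) x))) = x"
proof -
  let ?X = "Phi (Suc n) x" and ?y = "Psi (Suc (Suc n)) (hmu (int (Suc n)) (Phi (Suc n) x))"
  have h: "hmu (int (Suc n)) ?X \<in> mcarrier m (int (Suc (Suc n)))"
    using hmu_closed[OF Phi_closed[OF x(1)]] by (simp add: add.commute)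
  have "dm (int (Suc n)) ?X = (\<lambda>_ _ _ _. 0)"
    using Phi_bd[OF x(1)] x(2) Phi_zero_iff[of "\<zero>\<^bsub>PN n\<^esub>" n] by simp
  then have "dm (int (Suc n) + 1) (hmu (int (Suc n)) ?X) u v r i = ?X u v r i" for u v r i
    using dm_hmu[OF Phi_closed[OF x(1)], of u v r i] by (simp add: hmu_zero del: hmu.simps)
  then have "Phi (Suc n) (bdry RQ (Suc (Suc n)) ?y) = ?X"
    unfolding Phi_bd[OF Psi_closed] Phi_Psi[OF h] by (intro mfun_eqI) (simp add: add.commute del: hmu.simps)
  then show ?thesis by (intro Phi_inj[OF bd_closed[OF Psi_closed] x(1)])
qed

lemma exact_aug_witness:
  assumes x: "x \<in> carrier (PN 0)" "aug RQ x = \<zero>\<^bsub>LA\<^esub>"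
  shows "bdry RQ (Suc 0) (Psi (Suc 0) (hmu 0 (Phi 0 x))) = x"
proof -
  let ?X = "Phi 0 x" and ?y = "Psi (Suc 0) (hmu 0 (Phi 0 x))"
  have X: "?X \<in> mcarrier m 0" using Phi_closed[OF x(1)] by simp
  have h: "hmu 0 ?X \<in> mcarrier m (int (Suc 0))" using hmu_closed[OF X] by simp
  have "meps ?X = 0" using gam_aug[OF x(1)] x(2) by simp
  then have "dm 1 (hmu 0 ?X) u v r i = ?X u v r i" for u v r i by (rule dm_hmu_0[OF X])
  then have "Phi 0 (bdry RQ (Suc 0) ?y) = ?X"
    unfolding Phi_bd[OF Psi_closed] Phi_Psi[OF h] by (intro mfun_eqI) (simp del: hmu.simps)
  then show ?thesis by (intro Phi_inj[OF bd_closed[OF Psi_closed] x(1)])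
qed

lemma bd_bd: "x \<in> carrier (PN (Suc (Suc n))) ==> bdry RQ (Suc n) (bdry RQ (Suc (Suc n)) x) = \<zero>\<^bsub>PN n\<^esub>"
proof -
  assume x: "x \<in> carrier (PN (Suc (Suc n)))"
  have "Phi n (bdry RQ (Suc n) (bdry RQ (Suc (Suc n)) x)) = (\<lambda>_ _ _ _. 0)"
    unfolding Phi_bd[OF bd_closed[OF x]] Phi_bd[OF x]
    using dm_dm[of "int (Suc n)"] by (intro mfun_eqI) (simp add: add.commute)
  then show ?thesis using Phi_zero_iff[OF bd_closed[OF bd_closed[OF x]]] by simp
qed

lemma aug_bd: "x \<in> carrier (PN (Suc 0)) ==> aug RQ (bdry RQ (Suc 0) x) = \<zero>\<^bsub>LA\<^esub>"
proof -
  assume x: "x \<in> carrier (PN (Suc 0))"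
  have "gam (aug RQ (bdry RQ (Suc 0) x)) = 0"
    unfolding gam_aug[OF bd_closed[OF x]] Phi_bd[OF x] using meps_dm by simp
  then show ?thesis using bimod_hom_closed[OF aug_hom bd_closed[OF x]] by (intro gam_inj) simp_all
qed

text \<open>The right linear section of the augmentation that sends x to the sum of all
  \<open>e_i \<otimes> e_i x\<close>; it preserves lengths.\<close>

definition asec :: "'k KQ set => 'k mfun" where
  "asec X = (\<lambda>u v r i. if u = bE \<and> r = 0 then cf (gam X) v i else 0)"

lemma asec_closed: "X \<in> carrier LA ==> asec X \<in> mcarrier m (int 0)"
  by (rule mcarrierI) (auto simp: asec_def intro: periodic_cong[OF gam_periodic])

lemma aug_asec: assumes X: "X \<in> carrier LA" shows "aug RQ (Psi 0 (asec X)) = X"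
proof -
  have "meps (asec X) = gam X"
  proof (rule lam_eqI)
    fix t k show "cf (meps (asec X)) t k = cf (gam X) t k" by (cases t) (simp_all add: meps_def asec_def)
  qed
  then have "gam (aug RQ (Psi 0 (asec X))) = gam X" unfolding gam_aug[OF Psi_closed] Phi_Psi[OF asec_closed[OF X]] .
  then show ?thesis using bimod_hom_closed[OF aug_hom Psi_closed] X by (intro gam_inj) simp_all
qed

lemma aug_surj: "aug RQ ` carrier (PN 0) = carrier LA"
proof
  show "aug RQ ` carrier (PN 0) \<subseteq> carrier LA" using bimod_hom_closed[OF aug_hom] by auto
  show "carrier LA \<subseteq> aug RQ ` carrier (PN 0)"
  proof
    fix X assume "X \<in> carrier LA"
    from imageI[OF Psi_closed, of "aug RQ" 0 "asec X", unfolded aug_asec[OF this]]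
    show "X \<in> aug RQ ` carrier (PN 0)" .
  qed
qed

text \<open>An arbitrary preimage \<open>y i r\<close> is cut down to \<open>e_i y e_j\<close>. It
  remains a preimage because \<open>p\<close> respects the actions and the image of the generator is
  fixed by these idempotents. The values on generators are part of the conclusion since the length
  estimates refer to them.\<close>

lemma lift_gens:
  assumes M: "bim LA M" and M': "bim LA M'" and p: "p \<in> bimod_hom LA M M'" and f: "f \<in> bimod_hom LA (PN n) M'"
    and y: "\<And>i r. 0 \<le> i ==> i < int m ==> 0 \<le> r ==> r \<le> int n ==> y i r \<in> carrier M \<and> p (y i r) = f (G n i r)"
  shows "\<exists>h\<in>bimod_hom LA (PN n) M. (\<forall>x\<in>carrier (PN n). p (h x) = f x) \<and>
    (\<forall>i r. 0 \<le> i \<and> i < int m \<and> 0 \<le> r \<and> r \<le> int n \<longrightarrow>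
      h (G n i r) = ract M (lact M (ei i) (y i r)) (ei (i + int n - 2 * r)))"
proof -
  interpret M: bim LA M by fact
  interpret M': bim LA M' by fact
  define v where "v = (\<lambda>i r. ract M (lact M (ei i) (y i r)) (ei (i + int n - 2 * r)))"
  have c: "compat n M v"
    unfolding compat_def v_def
    using y by (auto simp: M.ract_lact simp flip: M.lact_mult M.ract_mult)
  let ?h = "hom_by_gens m 1 n M v"
  note h = hom_by_gens_hom[OF M c]
  have hG: "?h (G n i r) = v i r" if "0 \<le> i" "i < int m" "0 \<le> r" "r \<le> int n" for i r
    using h(2)[OF that(3,4), of i] that by simp
  have "compose (carrier (PN n)) p ?h = f"
  proof (rule hom_unique_G[OF M' bimod_hom_comp[OF bim_PN h(1) p] f])
    fix i r assume ir: "0 \<le> i" "i < int m" "0 \<le> r" "r \<le> int n"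
    have "p (v i r) = ract M' (lact M' (ei i) (f (G n i r))) (ei (i + int n - 2 * r))"
      unfolding v_def using y[OF ir] bimod_homD(3,4)[OF p] by simp
    also have "\<dots> = f (ract (PN n) (lact (PN n) (ei i) (G n i r)) (ei (i + int n - 2 * r)))"
      using bimod_homD(3,4)[OF f] by simp
    finally show "compose (carrier (PN n)) p ?h (G n i r) = f (G n i r)"
      using G_ei hG[OF ir] by (simp add: compose_eq)
  qed
  note eq = fun_cong[OF this]
  have ph: "\<forall>x\<in>carrier (PN n). p (?h x) = f x"
  proof
    fix x assume "x \<in> carrier (PN n)"
    then show "p (?h x) = f x" using eq[of x] by (simp only: compose_eq)
  qed
  show ?thesis
    by (intro bexI[OF _ h(1)] conjI ph allI impI) (elim conjE, unfold hG, simp only: v_def)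
qed

lemma lift_hom:
  assumes M: "bim LA M" and M': "bim LA M'" and p: "p \<in> bimod_hom LA M M'" and f: "f \<in> bimod_hom LA (PN n) M'"
    and im: "\<And>x. x \<in> carrier (PN n) ==> f x \<in> p ` carrier M"
  shows "\<exists>h\<in>bimod_hom LA (PN n) M. \<forall>x\<in>carrier (PN n). p (h x) = f x"
proof -
  define y where "y = (\<lambda>i r. SOME y. y \<in> carrier M \<and> p y = f (G n i r))"
  have "y i r \<in> carrier M \<and> p (y i r) = f (G n i r)" for i r
  proof -
    from im[OF G_closed, of i r] obtain z where "f (G n i r) = p z" "z \<in> carrier M" by (rule imageE)
    then have "z \<in> carrier M \<and> p z = f (G n i r)" by simp
    then show ?thesis unfolding y_def by (rule someI)
  qed
  from lift_gens[OF M M' p f this]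
  obtain h where h: "h \<in> bimod_hom LA (PN n) M" "\<forall>x\<in>carrier (PN n). p (h x) = f x" by (elim bexE conjE)
  show ?thesis by (intro bexI[OF _ h(1)]) (rule h(2))
qed

lemma lifting_complex_RQ: "lifting_complex LA RQ"
proof (rule lifting_complex.intro)
  show "bim LA (obj RQ n)" for n by (simp add: RQ_simps bim_PN)
  show "bdry RQ (Suc n) \<in> bimod_hom LA (obj RQ (Suc n)) (obj RQ n)" for n using bd_hom by (simp add: RQ_simps(1))
  show "aug RQ \<in> bimod_hom LA (obj RQ 0) (regular_bimod LA)" using aug_hom by (simp add: RQ_simps(1))
  show "aug RQ x = \<zero>\<^bsub>LA\<^esub> \<longleftrightarrow> x \<in> bdry RQ (Suc 0) ` carrier (obj RQ (Suc 0))" if "x \<in> carrier (obj RQ 0)" for x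
  proof
    assume "aug RQ x = \<zero>\<^bsub>LA\<^esub>"
    then have "bdry RQ (Suc 0) (Psi (Suc 0) (hmu 0 (Phi 0 x))) = x"
      using that exact_aug_witness[of x] unfolding RQ_simps(1) by blast
    then show "x \<in> bdry RQ (Suc 0) ` carrier (obj RQ (Suc 0))"
      using Psi_closed unfolding RQ_simps(1) by (metis image_eqI)
  next
    assume "x \<in> bdry RQ (Suc 0) ` carrier (obj RQ (Suc 0))"
    then show "aug RQ x = \<zero>\<^bsub>LA\<^esub>" using aug_bd unfolding RQ_simps(1) by blast
  qed
  show "bdry RQ (Suc n) x = \<zero>\<^bsub>obj RQ n\<^esub> \<longleftrightarrow> x \<in> bdry RQ (Suc (Suc n)) ` carrier (obj RQ (Suc (Suc n)))"
    if "x \<in> carrier (obj RQ (Suc n))" for n x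
  proof
    assume "bdry RQ (Suc n) x = \<zero>\<^bsub>obj RQ n\<^esub>"
    then have "bdry RQ (Suc (Suc n)) (Psi (Suc (Suc n)) (hmu (int (Suc n)) (Phi (Suc n) x))) = x"
      using that exact_bd_witness[of x n] unfolding RQ_simps(1) by blast
    then show "x \<in> bdry RQ (Suc (Suc n)) ` carrier (obj RQ (Suc (Suc n)))"
      using Psi_closed unfolding RQ_simps(1) by (metis image_eqI)
  next
    assume "x \<in> bdry RQ (Suc (Suc n)) ` carrier (obj RQ (Suc (Suc n)))"
    then show "bdry RQ (Suc n) x = \<zero>\<^bsub>obj RQ n\<^esub>" using bd_bd unfolding RQ_simps(1) by blast
  qed
  show "\<exists>h\<in>bimod_hom LA (obj RQ n) (obj RQ 0). \<forall>x\<in>carrier (obj RQ n). aug RQ (h x) = f x"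
    if "f \<in> bimod_hom LA (obj RQ n) (regular_bimod LA)" for n f
  proof -
    have f: "f \<in> bimod_hom LA (PN n) (regular_bimod LA)" using that unfolding RQ_simps(1) .
    have "f x \<in> aug RQ ` carrier (PN 0)" if "x \<in> carrier (PN n)" for x
      using bimod_hom_closed[OF f that] unfolding aug_surj by simp
    from lift_hom[OF bim_PN bim_regular[OF kalg_LA] aug_hom f this] show ?thesis unfolding RQ_simps(1) .
  qed
  show "\<exists>h\<in>bimod_hom LA (obj RQ n) (obj RQ (Suc k)). \<forall>x\<in>carrier (obj RQ n). bdry RQ (Suc k) (h x) = f x"
    if "f \<in> bimod_hom LA (obj RQ n) (obj RQ k)"
      "\<And>x. x \<in> carrier (obj RQ n) ==> f x \<in> bdry RQ (Suc k) ` carrier (obj RQ (Suc k))" for n k f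
    using that unfolding RQ_simps(1) by (rule lift_hom[OF bim_PN bim_PN bd_hom])
qed

text \<open>Map the free bimodule on the generators onto P^n and split it by sending each generator
  to \<open>e_i \<otimes> e_j\<close> in its own summand. The generators themselves serve as
  indices, since index sets have to live in the type of the elements of P^n.\<close>

lemma projective_PN: "projective_bimod LA (PN n)"
proof -
  let ?I = "F.gen n ` res_idx m n"
  let ?F = "free_bimod LA ?I"
  interpret FF: idem_family LA ?I "\<lambda>_. \<one>\<^bsub>LA\<^esub>" "\<lambda>_. \<one>\<^bsub>LA\<^esub>"
    by (intro idem_family.intro idem_family_axioms.intro idem_pair.intro idem_pair_axioms.intro kalg_LA)
      (simp_all add: res_idx_def)
  have Fd: "FF.D = ?F" by (simp add: free_bimod_def)
  have bimF: "bim LA ?F" using FF.bim_D unfolding Fd .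
  interpret B: bim LA ?F by (rule bimF)
  have "\<exists>f\<in>bimod_hom LA FF.D (PN n). \<forall>g\<in>?I. f (FF.gen g) = g"
  proof (rule FF.hom_exists[OF bim_PN])
    fix g assume "g \<in> ?I"
    then have g: "g \<in> carrier (PN n)" using F.gen_closed unfolding PN_D by (elim imageE) simp
    then show "g \<in> carrier (PN n)" "lact (PN n) \<one>\<^bsub>LA\<^esub> g = g" "ract (PN n) g \<one>\<^bsub>LA\<^esub> = g" by simp_all
  qed
  then obtain f where f: "f \<in> bimod_hom LA ?F (PN n)" "\<And>g. g \<in> ?I ==> f (FF.gen g) = g" unfolding Fd by blast
  have Gi: "G n i r \<in> ?I" if "0 \<le> r" "r \<le> int n" for i r using idx_mod[OF that] by (simp add: G_gen that)
  have id: "(\<lambda>x\<in>carrier (PN n). x) \<in> bimod_hom LA (PN n) (PN n)" by (rule bimod_hom_id[OF bim_PN])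
  have "\<exists>h\<in>bimod_hom LA (PN n) ?F. (\<forall>x\<in>carrier (PN n). f (h x) = (\<lambda>x\<in>carrier (PN n). x) x) \<and>
    (\<forall>i r. 0 \<le> i \<and> i < int m \<and> 0 \<le> r \<and> r \<le> int n \<longrightarrow>
      h (G n i r) = ract ?F (lact ?F (ei i) (FF.gen (G n i r))) (ei (i + int n - 2 * r)))"
  proof (rule lift_gens[OF bimF bim_PN f(1) id])
    fix i r assume "0 \<le> r" "r \<le> int n"
    note gi = Gi[OF this, of i]
    show "FF.gen (G n i r) \<in> carrier ?F \<and> f (FF.gen (G n i r)) = (\<lambda>x\<in>carrier (PN n). x) (G n i r)"
      using FF.gen_closed[OF gi] f(2)[OF gi] unfolding Fd by simp
  qed
  then obtain h where h: "h \<in> bimod_hom LA (PN n) ?F" "\<forall>x\<in>carrier (PN n). f (h x) = (\<lambda>x\<in>carrier (PN n). x) x" by blast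
  have "\<forall>x\<in>carrier (PN n). f (h x) = x" using h(2) by simp
  then have "\<exists>r\<in>bimod_hom LA ?F (PN n). \<forall>x\<in>carrier (PN n). r (h x) = x" by (rule bexI[OF _ f(1)])
  then have "\<exists>s\<in>bimod_hom LA (PN n) ?F. \<exists>r\<in>bimod_hom LA ?F (PN n). \<forall>x\<in>carrier (PN n). r (s x) = x"
    by (rule bexI[OF _ h(1)])
  moreover have "bimodule LA (PN n)" by (rule iffD2[OF bimodule_iff_bim[OF kalg_LA] bim_PN])
  ultimately show ?thesis unfolding projective_bimod_def by (intro conjI exI[of _ ?I])
qed

lemma projective_resolution_RQ: "projective_resolution LA RQ"
proof -
  interpret L: lifting_complex LA RQ by (rule lifting_complex_RQ)
  have 1: "{x \<in> carrier (obj RQ 0). aug RQ x = \<zero>\<^bsub>LA\<^esub>} = bdry RQ (Suc 0) ` carrier (obj RQ (Suc 0))"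
  proof (intro equalityI subsetI)
    fix x assume "x \<in> {x \<in> carrier (obj RQ 0). aug RQ x = \<zero>\<^bsub>LA\<^esub>}"
    then show "x \<in> bdry RQ (Suc 0) ` carrier (obj RQ (Suc 0))" using L.exact_aug[of x] by simp
  next
    fix x assume x: "x \<in> bdry RQ (Suc 0) ` carrier (obj RQ (Suc 0))"
    then have "x \<in> carrier (obj RQ 0)" by (elim imageE) (simp only: L.d_closed)
    then show "x \<in> {x \<in> carrier (obj RQ 0). aug RQ x = \<zero>\<^bsub>LA\<^esub>}" using L.exact_aug[of x] x by simp
  qed
  have 2: "{x \<in> carrier (obj RQ (Suc n)). bdry RQ (Suc n) x = \<zero>\<^bsub>obj RQ n\<^esub>} =
         bdry RQ (Suc (Suc n)) ` carrier (obj RQ (Suc (Suc n)))" for n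
  proof (intro equalityI subsetI)
    fix x assume "x \<in> {x \<in> carrier (obj RQ (Suc n)). bdry RQ (Suc n) x = \<zero>\<^bsub>obj RQ n\<^esub>}"
    then show "x \<in> bdry RQ (Suc (Suc n)) ` carrier (obj RQ (Suc (Suc n)))" using L.exact[of x n] by simp
  next
    fix x assume x: "x \<in> bdry RQ (Suc (Suc n)) ` carrier (obj RQ (Suc (Suc n)))"
    then have "x \<in> carrier (obj RQ (Suc n))" by (elim imageE) (simp only: L.d_closed)
    then show "x \<in> {x \<in> carrier (obj RQ (Suc n)). bdry RQ (Suc n) x = \<zero>\<^bsub>obj RQ n\<^esub>}" using L.exact[of x n] x by simp
  qed
  show ?thesis
    unfolding projective_resolution_def
  proof (intro conjI allI)
    show "aug RQ ` carrier (obj RQ 0) = carrier LA" unfolding RQ_simps(1) by (rule aug_surj)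
  qed (rule L.bdry L.aug 1[folded One_nat_def] 2 projective_PN[folded RQ_simps(1)])+
qed

end

section \<open>Leading coefficients of cocycles\<close>

locale Lam_odd = Lam_alg m K for m and K :: "'k::field itself" +
  assumes odd_m: "odd m" and char2: "CHAR('k) \<noteq> 2"
begin

sublocale L: lifting_complex LA RQ by (rule lifting_complex_RQ)

text \<open>This is where the characteristic enters.\<close>

lemma two_cancel: "(x :: 'k) = - x ==> x = 0"
proof -
  assume "x = - x"
  then have "2 * x = 0" by (metis add.right_inverse mult_2)
  moreover have "(2 :: 'k) \<noteq> 0"
  proof
    assume "(2 :: 'k) = 0"
    then have "of_nat 2 = (0 :: 'k)" by simp
    then have "CHAR('k) dvd 2" by (simp only: of_nat_eq_0_iff_char_dvd)
    then have "CHAR('k) \<le> 2" "CHAR('k) \<noteq> 0" by (auto dest: dvd_imp_le) (metis dvd_0_left_iff gr0I zero_neq_numeral)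
    moreover have "CHAR('k) \<noteq> Suc 0" using CHAR_not_1' by auto
    ultimately show False using char2 by linarith
  qed
  ultimately show "x = 0" by simp
qed

abbreviation "HAL n \<equiv> bimod_hom LA (PN n) (regular_bimod LA)"
abbreviation "ZL n \<equiv> carrier (cocycles LA RQ n)"

lemma Z_HAL: "f \<in> ZL n ==> f \<in> HAL n" using L.Z_HA[of f n] unfolding RQ_simps(1) .

definition val :: "nat => ('k Lam_res => 'k KQ set) => int => int => 'k lam" where
  "val n f i r = gam (f (G n i r))"

lemma HAL_closed: "f \<in> HAL n ==> x \<in> carrier (PN n) ==> f x \<in> carrier LA"
  using bimod_hom_closed[of f LA "PN n" "regular_bimod LA" x] by simp

lemma HAL_simps:
  assumes f: "f \<in> HAL n" and x: "x \<in> carrier (PN n)"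
  shows "y \<in> carrier (PN n) ==> gam (f (x \<oplus>\<^bsub>PN n\<^esub> y)) = gam (f x) + gam (f y)"
    "gam (f (c \<odot>\<^bsub>PN n\<^esub> x)) = lscale c (gam (f x))"
    "a \<in> carrier LA ==> gam (f (lact (PN n) a x)) = gam a * gam (f x)"
    "a \<in> carrier LA ==> gam (f (ract (PN n) x a)) = gam (f x) * gam a"
proof -
  note c = HAL_closed[OF f x]
  show "y \<in> carrier (PN n) ==> gam (f (x \<oplus>\<^bsub>PN n\<^esub> y)) = gam (f x) + gam (f y)"
    using vlinD(2)[OF bimod_homD(2)[OF f] x, of y] HAL_closed[OF f, of y] c by simp
  show "gam (f (c \<odot>\<^bsub>PN n\<^esub> x)) = lscale c (gam (f x))"
    using vlinD(3)[OF bimod_homD(2)[OF f] x, of c] c by simp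
  show "a \<in> carrier LA ==> gam (f (lact (PN n) a x)) = gam a * gam (f x)"
    using bimod_homD(3)[OF f _ x, of a] c by simp
  show "a \<in> carrier LA ==> gam (f (ract (PN n) x a)) = gam (f x) * gam a"
    using bimod_homD(4)[OF f _ x, of a] c by simp
qed

lemma HAL_zero: "f \<in> HAL n ==> gam (f \<zero>\<^bsub>PN n\<^esub>) = 0"
  using L.HA_zero[of f n] unfolding RQ_simps(1) by simp

lemma val_Bd:
  assumes "f \<in> HAL n"
  shows "gam (f (Bd n i r)) = val n f i r * lbas bA + lscale (sg (int (Suc n) + r)) (lbas bA * val n f (i + 1) r)
     + lscale (sg (int (Suc n) + r)) (lbas bB * val n f (i - 1) (r - 1)) + lscale (sg (int (Suc n))) (val n f i (r - 1) * lbas bB)"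
  unfolding Bd_def val_def by (simp add: HAL_simps[OF assms] del: of_nat_Suc sg_simps)

lemma val_out: "f \<in> HAL n ==> \<not> (0 \<le> r \<and> r \<le> int n) ==> val n f i r = 0"
  unfolding val_def by (simp add: G_zero HAL_zero)

lemma val_ei:
  assumes "f \<in> HAL n"
  shows "lidem m i * val n f i r = val n f i r" "val n f i r * lidem m (i + int n - 2 * r) = val n f i r"
  unfolding val_def
  by (rule HAL_simps(3)[OF assms G_closed ei_closed, of i i r, unfolded G_ei gam_ei, symmetric])
    (rule HAL_simps(4)[OF assms G_closed ei_closed, of i r "i + int n - 2 * r", unfolded G_ei gam_ei, symmetric])

lemma val_mod: "i mod int m = j mod int m ==> val n f i r = val n f j r"
  unfolding val_def using G_cong[of i j n r] by simp

text \<open>The value on a generator lies between the idempotents of the two vertices of the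
  generator, and an idempotent survives there only if it belongs to both.\<close>

lemma val_E:
  assumes f: "f \<in> HAL n" and k: "cf (val n f i r) bE k \<noteq> 0"
  shows "k mod int m = i mod int m" "k mod int m = (i + int n - 2 * r) mod int m"
proof -
  have "cf (lidem m i * val n f i r) bE k \<noteq> 0" unfolding val_ei[OF f] by (rule k)
  then show "k mod int m = i mod int m" by (auto split: if_splits)
  have "cf (val n f i r * lidem m (i + int n - 2 * r)) bE k \<noteq> 0" unfolding val_ei[OF f] by (rule k)
  then show "k mod int m = (i + int n - 2 * r) mod int m" by (auto split: if_splits)
qed

text \<open>The coefficient c(n,r), taken at vertex 0; that the vertex does not matter for cocycles
  is \<open>val_top\<close>.\<close>

definition top :: "nat => ('k Lam_res => 'k KQ set) => int => 'k" where
  "top n f r = cf (val n f 0 r) bE 0"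

lemma top_out: "f \<in> HAL n ==> \<not> (0 \<le> r \<and> r \<le> int n) ==> top n f r = 0"
  unfolding top_def by (simp add: val_out)

text \<open>The first recursion is the coefficient of the arrow \<open>a\<close> from
  \<open>i\<close> in the cocycle equation for the generator \<open>(i, r)\<close>, the second that
  of the arrow \<open>b\<close> from \<open>i + 1\<close> in the equation for
  \<open>(i + 1, r + 1)\<close>.\<close>

lemma cocycle_val:
  assumes f: "f \<in> ZL n"
  shows "cf (val n f (i + 1) r) bE (i + 1) = sg (int n + r) * cf (val n f i r) bE i"
    "cf (val n f (i + 1) r) bE (i + 1) = sg r * cf (val n f i r) bE i"
proof -
  note fH = Z_HAL[OF f]
  have z: "gam (f (Bd n i r)) = 0" if "0 \<le> r" "r \<le> int (Suc n)" for i r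
    using L.Z_d[OF f, of "G (Suc n) i r"] bd_G[OF that, of i] unfolding RQ_simps(1) by simp
  have s: "sg x = 1 \<or> sg x = (- 1 :: 'k)" for x by (simp add: sg_def)
  have "cf (val n f (i + 1) r) bE (i + 1) = sg (int n + r) * cf (val n f i r) bE i \<and>
    cf (val n f (i + 1) r) bE (i + 1) = sg r * cf (val n f i r) bE i"
  proof (cases "0 \<le> r \<and> r \<le> int n")
    case True
    then have r: "0 \<le> r" "r \<le> int (Suc n)" "0 \<le> r + 1" "r + 1 \<le> int (Suc n)" by auto
    have "cf (gam (f (Bd n i r))) bA i = 0" "cf (gam (f (Bd n (i + 1) (r + 1)))) bB (i + 1) = 0"
      using z[OF r(1,2), of i] z[OF r(3,4), of "i + 1"] by simp_all
    then have "cf (val n f i r) bE i + sg (int (Suc n) + r) * cf (val n f (i + 1) r) bE (i + 1) = 0"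
      "sg (int (Suc n) + (r + 1)) * cf (val n f i r) bE i + sg (int (Suc n)) * cf (val n f (i + 1) r) bE (i + 1) = 0"
      unfolding val_Bd[OF fH] by (simp_all del: of_nat_Suc sg_simps)
    moreover have "sg (int (Suc n) + r) = (- sg (int n) * sg r :: 'k)" "sg (int (Suc n)) = (- sg (int n) :: 'k)"
      "sg (int (Suc n) + (r + 1)) = (sg (int n) * sg r :: 'k)" by simp_all
    ultimately show ?thesis using s[of "int n"] s[of r]
      by (auto simp: eq_neg_iff_add_eq_0 add.commute)
  qed (simp add: val_out[OF fH])
  then show "cf (val n f (i + 1) r) bE (i + 1) = sg (int n + r) * cf (val n f i r) bE i"
    "cf (val n f (i + 1) r) bE (i + 1) = sg r * cf (val n f i r) bE i" by blast+
qed

lemma cocycle_val_step: "f \<in> ZL n ==> cf (val n f (int k) r) bE (int k) = sg (int k * r) * top n f r"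
proof (induct k)
  case 0 show ?case by (simp add: top_def)
next
  case (Suc k)
  then show ?case using cocycle_val(2)[OF Suc(2), of "int k" r] by (simp add: algebra_simps)
qed

text \<open>Once round the cycle the coefficient picks up (-1)^(m r), so \<open>r\<close> is even
  because \<open>m\<close> is odd; comparing the two recursions then makes \<open>n\<close> even. A
  value with an idempotent component also requires the generator to end where it starts, which is
  the divisibility.\<close>

lemma top_nonzero:
  assumes f: "f \<in> ZL n" and t: "top n f r \<noteq> 0"
  shows "even n" "even r" "0 \<le> r" "r \<le> int n" "int m dvd int n - 2 * r"
proof -
  note fH = Z_HAL[OF f]
  have r: "0 \<le> r \<and> r \<le> int n" using t top_out[OF fH] by blast
  then show "0 \<le> r" "r \<le> int n" by auto
  have p: "cf (val n f (int m) r) bE (int m) = top n f r"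
  proof -
    have "periodic m (val n f 0 r)" unfolding val_def by (rule gam_periodic[OF HAL_closed[OF fH G_closed]])
    from periodic_cong[OF this, of "int m" 0 bE] show ?thesis
      unfolding top_def using val_mod[of "int m" 0 n f r] by simp
  qed
  show er: "even r"
  proof (rule ccontr)
    assume "odd r"
    then have "sg (int m * r) = (- 1 :: 'k)" using odd_m by (simp add: sg_def)
    then have "top n f r = - top n f r" using cocycle_val_step[OF f, of m r] p by simp
    then show False using two_cancel t by blast
  qed
  show "even n"
  proof (rule ccontr)
    assume "odd n"
    then have "sg (int n + r) = (- 1 :: 'k)" "sg r = (1 :: 'k)" using er by (simp_all add: sg_def)
    then have "cf (val n f (0 + 1) r) bE (0 + 1) = - top n f r" "cf (val n f (0 + 1) r) bE (0 + 1) = top n f r"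
      using cocycle_val[OF f, of 0 r] by (simp_all add: top_def del: sg_simps)
    then show False using two_cancel[of "top n f r"] t by metis
  qed
  show "int m dvd int n - 2 * r"
    using val_E(2)[OF fH, of 0 r 0] t by (simp add: top_def mod_eq_0_iff_dvd)
qed

lemma val_top:
  assumes f: "f \<in> ZL n"
  shows "cf (val n f i r) bE k = (if k mod int m = i mod int m then top n f r else 0)"
proof (cases "k mod int m = i mod int m")
  case True
  let ?j = "nat (i mod int m)"
  have j: "int ?j = i mod int m" by (rule nat_0_le[OF pos_mod_sign[OF m_pos]])
  have "periodic m (val n f i r)" unfolding val_def by (rule gam_periodic[OF HAL_closed[OF Z_HAL[OF f] G_closed]])
  then have "cf (val n f i r) bE k = cf (val n f i r) bE (int ?j)"
    by (rule periodic_cong) (unfold j, simp add: True)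
  also have "\<dots> = cf (val n f (int ?j) r) bE (int ?j)"
    unfolding j using val_mod[of i "i mod int m" n f r] by simp
  also have "\<dots> = sg (int ?j * r) * top n f r" by (rule cocycle_val_step[OF f])
  also have "\<dots> = top n f r"
    using top_nonzero(2)[OF f, of r] by (cases "top n f r = 0") (auto simp: sg_def)
  finally show ?thesis using True by simp
next
  case False then show ?thesis using val_E(1)[OF Z_HAL[OF f], of i r k] by auto
qed

text \<open>Minimality of the resolution: each term in the boundary of a generator carries an arrow,
  so a coboundary has no component along the idempotents.\<close>

lemma B_top: assumes "f \<in> coboundaries LA RQ n" shows "top n f r = 0"
proof (cases n)
  case 0
  then have "f = (\<lambda>x\<in>carrier (PN 0). \<zero>\<^bsub>LA\<^esub>)" using assms L.B_0[of f] by (simp add: RQ_simps(1))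
  then show ?thesis using G_closed[of 0 0 r] by (simp add: top_def val_def 0)
next
  case (Suc k)
  then obtain g where g: "g \<in> HAL k" "f = compose (carrier (PN (Suc k))) g (bdry RQ (Suc k))"
    using assms L.B_Suc[of f k] by (auto simp: RQ_simps(1))
  have f: "f \<in> HAL n" using L.Z_HA[OF L.B_sub_Z[OF assms]] by (simp add: RQ_simps(1))
  show ?thesis
  proof (cases "0 \<le> r \<and> r \<le> int (Suc k)")
    case True
    then have "val n f 0 r = gam (g (Bd k 0 r))"
      using bd_G[of r k 0] G_closed[of "Suc k" 0 r] by (simp add: val_def g(2) Suc compose_eq)
    then show ?thesis unfolding top_def val_Bd[OF g(1)] by (simp del: of_nat_Suc sg_simps)
  next
    case False then show ?thesis using top_out[OF f, of r] Suc by simp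
  qed
qed

subsection \<open>Leading coefficients of products\<close>

text \<open>The radical is an ideal, so terms with an arrow on either side of the generator do not
  affect the coefficient of an idempotent.\<close>

lemma HAL_E:
  assumes f: "f \<in> HAL n" and x: "x \<in> carrier (PN n)"
  shows "cf (gam (f x)) bE k = (\<Sum>s\<in>{0..int n}. Phi n x bE bE s k * cf (val n f k s) bE k)"
  using x
proof (induct rule: PN_induct)
  case zero
  have "Phi n \<zero>\<^bsub>PN n\<^esub> = (\<lambda>_ _ _ _. 0)" using Phi_zero_iff[of "\<zero>\<^bsub>PN n\<^esub>" n] by simp
  then show ?case by (simp add: HAL_zero[OF f])
next
  case (gen i r t t' c)
  have 1: "gam (f (c \<odot>\<^bsub>PN n\<^esub> TT n t t' i r)) = lscale c (lbas t * val n f i r * lbas t')"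
    unfolding TT_def val_def by (simp add: HAL_simps[OF f])
  have 2: "Phi n (c \<odot>\<^bsub>PN n\<^esub> TT n t t' i r) bE bE s k =
      (if s = r then if bE = t \<and> bE = t' \<and> k mod int m = i mod int m then c else 0 else 0)" for s
    using vlinD(3)[OF bimod_homD(2)[OF Phi_hom], of "TT n t t' i r" n c] Phi_TT[OF gen(3,4), of t t' i bE bE s k] by simp
  have 3: "cf (val n f i r) bE k = (if k mod int m = i mod int m then cf (val n f k r) bE k else 0)"
    using val_E(1)[OF f, of i r k] val_mod[of i k n f r] by auto
  have 4: "(\<Sum>s\<in>{0..int n}. Phi n (c \<odot>\<^bsub>PN n\<^esub> TT n t t' i r) bE bE s k * cf (val n f k s) bE k) =
      (if bE = t \<and> bE = t' \<and> k mod int m = i mod int m then c else 0) * cf (val n f k r) bE k"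
    unfolding 2 using gen by (simp add: if_distrib[of "\<lambda>z. z * _"] sum.delta cong: if_cong)
  show ?case unfolding 1 4 by (cases t; cases t') (simp_all add: 3)
next
  case (add x y)
  have "Phi n (x \<oplus>\<^bsub>PN n\<^esub> y) = (\<lambda>u v r i. Phi n x u v r i + Phi n y u v r i)"
    using vlinD(2)[OF bimod_homD(2)[OF Phi_hom] add(1,2)] by simp
  then show ?case using add by (simp add: HAL_simps(1)[OF f add(1,2)] distrib_right sum.distrib)
qed

lemma Phi_hom_Bd:
  assumes h: "h \<in> bimod_hom LA (PN n) (PN k)"
  shows "Phi k (h (Bd n i r)) = (\<lambda>u v r' i'. mract (int k) (Phi k (h (G n i r))) (lbas bA) u v r' i'
       + sg (int (Suc n) + r) * mlact (lbas bA) (Phi k (h (G n (i + 1) r))) u v r' i'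
       + sg (int (Suc n) + r) * mlact (lbas bB) (Phi k (h (G n (i - 1) (r - 1)))) u v r' i'
       + sg (int (Suc n)) * mract (int k) (Phi k (h (G n i (r - 1)))) (lbas bB) u v r' i')"
proof -
  note c = bimod_hom_closed[OF h G_closed]
  note hv = vlinD[OF bimod_homD(2)[OF h]] and ha = bimod_homD(3,4)[OF h]
  note pv = vlinD[OF bimod_homD(2)[OF Phi_hom[of k]]] and pa = bimod_homD(3,4)[OF Phi_hom[of k]]
  show ?thesis unfolding Bd_def by (simp add: hv ha pv pa c del: of_nat_Suc sg_simps)
qed

lemma chain_lifts_RQ:
  assumes "l \<in> chain_lifts LA RQ p g"
  shows "l k \<in> bimod_hom LA (PN (p + k)) (PN k)" "x \<in> carrier (PN p) ==> aug RQ (l 0 x) = g x"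
    "x \<in> carrier (PN (Suc (p + k))) ==> bdry RQ (Suc k) (l (Suc k) x) = l k (bdry RQ (Suc (p + k)) x)"
  using assms unfolding chain_lifts_def RQ_simps(1) by auto

text \<open>Induction on \<open>k\<close>, comparing coefficients of single arrows in the chain map
  equation: both differentials copy idempotent coefficients into these positions.\<close>

lemma lift_top:
  assumes g: "g \<in> ZL p" and l: "l \<in> chain_lifts LA RQ p g"
  shows "0 \<le> s ==> s \<le> int k ==> Phi k (l k (G (p + k) i r)) bE bE s i = top p g (r - s)"
proof (induct k arbitrary: s r)
  case 0
  note gH = Z_HAL[OF g]
  have c: "l 0 (G p i r) \<in> carrier (PN 0)"
    using bimod_hom_closed[OF chain_lifts_RQ(1)[OF l, of 0], of "G p i r"] by simp
  have "Phi 0 (l 0 (G p i r)) bE bE 0 i = cf (val p g i r) bE i"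
    using gam_aug[OF c] chain_lifts_RQ(2)[OF l G_closed, of i r] by (simp add: val_def meps_def)
  then show ?case using 0 by (simp add: val_top[OF g])
next
  case (Suc k)
  note gH = Z_HAL[OF g] and lk = chain_lifts_RQ(1)[OF l]
  have zero: "Phi j (l j (G (p + j) i r)) = (\<lambda>_ _ _ _. 0)" if "\<not> (0 \<le> r \<and> r \<le> int (p + j))" for j
  proof -
    have "l j \<zero>\<^bsub>PN (p + j)\<^esub> = \<zero>\<^bsub>PN j\<^esub>" by (rule vlin_zero[OF PN.M.vec PN.M.vec bimod_homD(2)[OF lk]])
    then show ?thesis using Phi_zero_iff[of "\<zero>\<^bsub>PN j\<^esub>" j] G_zero[OF that] by simp
  qed
  show ?case
  proof (cases "0 \<le> r \<and> r \<le> int (Suc (p + k))")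
    case False
    have "\<not> (0 \<le> r - s \<and> r - s \<le> int p)" using False Suc(2,3) by auto
    then have "top p g (r - s) = 0" by (rule top_out[OF gH])
    then show ?thesis using zero[of "Suc k"] False by simp
  next
    case True
    then have r: "0 \<le> r" "r \<le> int (Suc (p + k))" by auto
    let ?X = "Phi (Suc k) (l (Suc k) (G (p + Suc k) i r))"
    have Gc: "G (Suc (p + k)) i r \<in> carrier (PN (Suc (p + k)))" by simp
    have lc: "l (Suc k) (G (p + Suc k) i r) \<in> carrier (PN (Suc k))" by (rule bimod_hom_closed[OF lk G_closed])
    have e: "dm (int (Suc k)) ?X = Phi k (l k (Bd (p + k) i r))"
      using Phi_bd[OF lc] chain_lifts_RQ(3)[OF l Gc] bd_G[OF r, of i] by simp
    have e': "dm (int (Suc k)) ?X u v s' i = mract (int k) (Phi k (l k (G (p + k) i r))) (lbas bA) u v s' i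
       + sg (int (Suc (p + k)) + r) * mlact (lbas bA) (Phi k (l k (G (p + k) (i + 1) r))) u v s' i
       + sg (int (Suc (p + k)) + r) * mlact (lbas bB) (Phi k (l k (G (p + k) (i - 1) (r - 1)))) u v s' i
       + sg (int (Suc (p + k))) * mract (int k) (Phi k (l k (G (p + k) i (r - 1)))) (lbas bB) u v s' i" for u v s'
      unfolding e Phi_hom_Bd[OF lk] by (rule refl)
    show ?thesis
    proof (cases "s = 0")
      case True
      \<comment> \<open>The coefficient of a generator followed by \<open>a\<close>, in the summand
        0: on either side it comes from exactly one term, the one with \<open>a\<close> on the
        right.\<close>
      have "?X bE bE 0 i = Phi k (l k (G (p + k) i r)) bE bE 0 i"
        using e'[of bE bA 0] by (simp add: dm_def mract_def mlact_def)
      then show ?thesis using Suc(1)[of 0 r] True by simp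
    next
      case False
      then have s: "0 \<le> s - 1" "s - 1 \<le> int k" using Suc(2,3) by auto
      \<comment> \<open>For s > 0 the coefficient of a generator followed by \<open>b\<close>, in
        the summand \<open>s - 1\<close>, is used; this lowers \<open>r\<close> and \<open>s\<close>
        together and keeps \<open>r - s\<close>.\<close>
      have "sg (int (Suc k)) * ?X bE bE s i = sg (int (Suc (p + k))) * Phi k (l k (G (p + k) i (r - 1))) bE bE (s - 1) i"
        using e'[of bE bB "s - 1"] s by (simp add: dm_def mract_def mlact_def del: sg_simps)
      also have "\<dots> = sg (int (Suc (p + k))) * top p g (r - s)"
        using Suc(1)[OF s, of "r - 1"] by (simp add: algebra_simps del: sg_simps)
      \<comment> \<open>The two signs differ by (-1)^p, and \<open>p\<close> is even whenever the
        coefficient is nonzero.\<close>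
      also have "\<dots> = sg (int (Suc k)) * top p g (r - s)"
        using top_nonzero(1)[OF g, of "r - s"] by (cases "top p g (r - s) = 0") (simp_all add: sg_def)
      finally show ?thesis by (simp add: sg_def split: if_splits)
    qed
  qed
qed


lemma top_product:
  assumes f: "f \<in> ZL n" and g: "g \<in> ZL p" and l: "l \<in> chain_lifts LA RQ p g"
  shows "top (p + n) (compose (carrier (PN (p + n))) f (l n)) r = (\<Sum>s\<in>{0..int n}. top n f s * top p g (r - s))"
proof -
  note fH = Z_HAL[OF f]
  have c: "l n (G (p + n) 0 r) \<in> carrier (PN n)" by (rule bimod_hom_closed[OF chain_lifts_RQ(1)[OF l] G_closed])
  have "top (p + n) (compose (carrier (PN (p + n))) f (l n)) r = cf (gam (f (l n (G (p + n) 0 r)))) bE 0"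
    by (simp add: top_def val_def compose_eq)
  also have "\<dots> = (\<Sum>s\<in>{0..int n}. top n f s * top p g (r - s))"
    unfolding HAL_E[OF fH c] using lift_top[OF g l, of _ n 0 r]
    by (intro sum.cong) (simp_all add: val_top[OF f] mult.commute)
  finally show ?thesis .
qed

subsection \<open>Filtration by length\<close>

fun len :: "bas => nat" where "len bE = 0" | "len bA = 1" | "len bB = 1" | "len bS = 2"

text \<open>Membership in the e-th power of the radical. \<open>Fil e\<close> is the corresponding
  filtration of P^n by the total length on both sides of a generator.\<close>

definition Rd :: "nat => 'k lam => bool" where
  "Rd e x \<longleftrightarrow> (\<forall>t i. len t < e \<longrightarrow> cf x t i = 0)"

definition Fil :: "nat => 'k mfun => bool" where
  "Fil e X \<longleftrightarrow> (\<forall>u v r i. len u + len v < e \<longrightarrow> X u v r i = 0)"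

lemma Rd_simps [simp]: "Rd e 0" "Rd e x ==> Rd e y ==> Rd e (x + y)" "Rd e x ==> Rd e (lscale c x)"
  by (auto simp: Rd_def)

lemma Rd_sandwich:
  assumes "Rd e x" shows "Rd (len t + len t' + e) (lbas t * x * lbas t')"
proof -
  have z: "len s < e ==> cf x s k = 0" for s k using assms by (simp add: Rd_def)
  show ?thesis unfolding Rd_def
  proof (intro allI impI)
    fix s i assume "len s < len t + len t' + e"
    then show "cf (lbas t * x * lbas t') s i = 0"
      by (cases t; cases t'; cases s) (simp_all add: z)
  qed
qed

lemma Rd_3: assumes "Rd 3 x" shows "x = 0"
proof (rule lam_eqI)
  fix t i have "len t < 3" by (cases t) auto
  then show "cf x t i = cf 0 t i" using assms by (simp add: Rd_def)
qed

lemma Rd_mono: "Rd e x ==> d \<le> e ==> Rd d x" by (auto simp: Rd_def)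

text \<open>A basis term \<open>u g v\<close> goes to \<open>u f(g) v\<close>, and lengths add under
  multiplication.\<close>

lemma Rd_HAL:
  assumes f: "f \<in> HAL n" and d: "\<And>i r. Rd d (val n f i r)" and x: "x \<in> carrier (PN n)" and e: "Fil e (Phi n x)"
  shows "Rd (d + e) (gam (f x))"
proof -
  define T where "T = (\<lambda>\<kappa>. (\<lambda>(s, t, t'). Phi n x t t' (snd s) (fst s) \<odot>\<^bsub>PN n\<^esub> TT n t t' (fst s) (snd s)) \<kappa>)"
  have T: "T \<kappa> \<in> carrier (PN n)" for \<kappa> by (cases \<kappa>) (auto simp: T_def)
  have R: "Rd (d + e) (gam (f (T \<kappa>)))" for \<kappa>
  proof -
    obtain i r t t' where k: "\<kappa> = ((i, r), t, t')" by (metis prod.exhaust)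
    have g: "gam (f (T \<kappa>)) = lscale (Phi n x t t' r i) (lbas t * val n f i r * lbas t')"
      unfolding T_def TT_def val_def k by (simp add: HAL_simps[OF f])
    show ?thesis
    proof (cases "len t + len t' < e")
      case True
      then have "Phi n x t t' r i = 0" using e by (simp add: Fil_def)
      then have "gam (f (T \<kappa>)) = 0" unfolding g by (intro lam_eqI) simp
      then show ?thesis by simp
    next
      case False
      then show ?thesis unfolding g by (intro Rd_simps(3) Rd_mono[OF Rd_sandwich[OF d]]) simp
    qed
  qed
  have "Rd (d + e) (gam (f (finsum (PN n) T J)))" for J
  proof (induct J rule: infinite_finite_induct)
    case (insert \<kappa> J)
    have "finsum (PN n) T (insert \<kappa> J) = T \<kappa> \<oplus>\<^bsub>PN n\<^esub> finsum (PN n) T J"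
      by (rule PN.M.finsum_insert[OF insert(1,2) funcsetI[OF T] T])
    moreover have "finsum (PN n) T J \<in> carrier (PN n)" by (rule PN.M.finsum_closed[OF funcsetI[OF T]])
    ultimately show ?case using HAL_simps(1)[OF f T] Rd_simps(2)[OF R insert(3)] by simp
  qed (simp_all add: HAL_zero[OF f])
  then show ?thesis using arg_cong[OF Psi_Phi[OF x], of f, symmetric] unfolding Psi_def T_def[symmetric] by simp
qed

text \<open>Each part of \<open>hmu\<close> strips one arrow on the left; the part with
  \<open>preA\<close> removes \<open>s\<close>, of length two, and puts one arrow back on the
  right.\<close>

lemma Fil_hmu:
  assumes "Fil (Suc e) X" shows "Fil e (hmu n X)"
proof -
  have z: "len u + len v < Suc e ==> X u v r i = 0" for u v r i using assms by (simp add: Fil_def)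
  have p: "preA (\<lambda>v. X bS v r i) v = 0" if "len v < e" for v r i using that z[of bS _ r i] by (cases v) simp_all
  show ?thesis unfolding Fil_def
  proof (intro allI impI)
    fix u v r i assume "len u + len v < e"
    then show "hmu n X u v r i = 0" by (cases u) (simp_all add: z p)
  qed
qed

lemma Fil_lidem:
  assumes "Fil e X" shows "Fil e (mlact (lidem m i) X)" "Fil e (mract n X (lidem m j))"
proof -
  have z: "len u + len v < e ==> X u v r i = 0" for u v r i using assms by (simp add: Fil_def)
  show "Fil e (mlact (lidem m i) X)" unfolding Fil_def
  proof (intro allI impI)
    fix u v r k assume "len u + len v < e"
    then show "mlact (lidem m i) X u v r k = 0" by (cases u) (simp_all add: z mlact_def)
  qed
  show "Fil e (mract n X (lidem m j))" unfolding Fil_def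
  proof (intro allI impI)
    fix u v r k assume "len u + len v < e"
    then show "mract n X (lidem m j) u v r k = 0" by (cases v) (simp_all add: z mract_def)
  qed
qed

lemma Fil_arrow:
  assumes "Fil e X" "t = bA \<or> t = bB" shows "Fil (Suc e) (mlact (lbas t) X)" "Fil (Suc e) (mract n X (lbas t))"
proof -
  have z: "len u + len v < e ==> X u v r i = 0" for u v r i using assms by (simp add: Fil_def)
  show "Fil (Suc e) (mlact (lbas t) X)" unfolding Fil_def
  proof (intro allI impI)
    fix u v r k assume "len u + len v < Suc e"
    then show "mlact (lbas t) X u v r k = 0" using assms(2) by (cases u) (auto simp: z mlact_def)
  qed
  show "Fil (Suc e) (mract n X (lbas t))" unfolding Fil_def
  proof (intro allI impI)
    fix u v r k assume "len u + len v < Suc e"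
    then show "mract n X (lbas t) u v r k = 0" using assms(2) by (cases v) (auto simp: z mract_def)
  qed
qed

text \<open>Each term in the boundary of a generator carries one arrow. This gain pays for the loss
  in \<open>Fil_hmu\<close>.\<close>

lemma Fil_Bd:
  assumes h: "h \<in> bimod_hom LA (PN n) (PN k)" and e: "\<And>i r. Fil e (Phi k (h (G n i r)))"
  shows "Fil (Suc e) (Phi k (h (Bd n i r)))"
proof -
  have z: "mlact (lbas t) (Phi k (h (G n i r))) u v r' i' = 0" "mract (int k) (Phi k (h (G n i r))) (lbas t) u v r' i' = 0"
    if "t = bA \<or> t = bB" "len u + len v < Suc e" for t u v r' i' i r
    using Fil_arrow(1)[OF e that(1), of i r] Fil_arrow(2)[OF e that(1), of "int k" i r] that(2)
    unfolding Fil_def by blast+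
  show ?thesis unfolding Phi_hom_Bd[OF h] Fil_def
  proof (intro allI impI)
    fix u v r' i' assume l: "len u + len v < Suc e"
    note zA = z[OF _ l, of bA, simplified] and zB = z[OF _ l, of bB, simplified]
    show "mract (int k) (Phi k (h (G n i r))) (lbas bA) u v r' i'
       + sg (int (Suc n) + r) * mlact (lbas bA) (Phi k (h (G n (i + 1) r))) u v r' i'
       + sg (int (Suc n) + r) * mlact (lbas bB) (Phi k (h (G n (i - 1) (r - 1)))) u v r' i'
       + sg (int (Suc n)) * mract (int k) (Phi k (h (G n i (r - 1)))) (lbas bB) u v r' i' = 0"
      unfolding zA zB by simp
  qed
qed

lemma Fil_conj:
  assumes "y \<in> carrier (PN k)" "Fil e (Phi k y)"
  shows "Fil e (Phi k (ract (PN k) (lact (PN k) (ei i) y) (ei j)))"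
proof -
  have "Phi k (ract (PN k) (lact (PN k) (ei i) y) (ei j)) = mract (int k) (mlact (lidem m i) (Phi k y)) (lidem m j)"
    using assms(1) by (simp add: bimod_homD(3,4)[OF Phi_hom])
  then show ?thesis using Fil_lidem(2)[OF Fil_lidem(1)[OF assms(2)]] by simp
qed

end

section \<open>The leading coefficient homomorphism\<close>


text \<open>The substitution \<open>k = i + j\<close>, \<open>s = j\<close> turns the convolution
  over degree and over \<open>r\<close> into the coefficient of x^p y^q in a product of polynomials.
  Pairs with \<open>s > q\<close> or \<open>k - s > p\<close> lie outside the support of
  \<open>b\<close>.\<close>

lemma convolution_reindex:
  fixes a b :: "nat => int => 'a::comm_ring_1"
  assumes a: "\<And>n r. \<not> (0 \<le> r \<and> r \<le> int n) ==> a n r = 0" and b: "\<And>n r. \<not> (0 \<le> r \<and> r \<le> int n) ==> b n r = 0"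
  shows "(\<Sum>k\<le>p + q. \<Sum>s\<in>{0..int k}. a k s * b (p + q - k) (int q - s)) =
    (\<Sum>i\<le>p. \<Sum>j\<le>q. a (i + j) (int j) * b ((p - i) + (q - j)) (int (q - j)))"
proof -
  let ?S = "SIGMA k:{..p + q}. {0..int k}" and ?T = "{..p} \<times> {..q}"
  let ?S' = "{(k, s). (k, s) \<in> ?S \<and> (nat s > q \<or> k - nat s > p)}"
  let ?g = "\<lambda>(k, s). a k s * b (p + q - k) (int q - s)"
  let ?h = "\<lambda>(i, j). a (i + j) (int j) * b ((p - i) + (q - j)) (int (q - j))"
  have "(\<Sum>k\<le>p + q. \<Sum>s\<in>{0..int k}. a k s * b (p + q - k) (int q - s)) = sum ?g ?S"
    by (subst sum.Sigma) auto
  also have "\<dots> = sum ?g (?S - ?S')"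
  proof (rule sum.mono_neutral_right)
    show "\<forall>x\<in>?S - (?S - ?S'). ?g x = 0"
    proof
      fix x assume "x \<in> ?S - (?S - ?S')"
      then obtain k s where x: "x = (k, s)" "k \<le> p + q" "0 \<le> s" "s \<le> int k" "nat s > q \<or> k - nat s > p" by auto
      have "\<not> (0 \<le> int q - s \<and> int q - s \<le> int (p + q - k))" using x by linarith
      then show "?g x = 0" using b by (simp add: x)
    qed
  qed auto
  also have "\<dots> = sum ?h ?T"
    by (rule sum.reindex_bij_witness[of _ "\<lambda>(i, j). (i + j, int j)" "\<lambda>(k, s). (k - nat s, nat s)"])
      (auto simp: of_nat_diff nat_le_iff intro!: arg_cong2[of _ _ _ _ "(*)"] arg_cong2[of _ _ _ _ b])
  also have "\<dots> = (\<Sum>i\<le>p. \<Sum>j\<le>q. a (i + j) (int j) * b ((p - i) + (q - j)) (int (q - j)))"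
    by (subst sum.cartesian_product) auto
  finally show ?thesis .
qed

context Lam_odd begin

text \<open>Cycles of the augmented complex, so that degree 0 needs no separate treatment when a
  preimage is taken.\<close>

definition cyc :: "nat => 'k Lam_res => bool" where
  "cyc k y \<longleftrightarrow> y \<in> carrier (PN k) \<and> (if k = 0 then aug RQ y = \<zero>\<^bsub>LA\<^esub> else bdry RQ k y = \<zero>\<^bsub>PN (k - 1)\<^esub>)"

lemma cyc_witness: "cyc k y ==> bdry RQ (Suc k) (Psi (Suc k) (hmu (int k) (Phi k y))) = y"
  using exact_bd_witness[of y "k - 1"] exact_aug_witness[of y] unfolding cyc_def by (cases k) auto

lemma Fil_zero: "Fil e (\<lambda>_ _ _ _. 0)" by (simp add: Fil_def)

lemma Fil_all:
  assumes h: "h \<in> bimod_hom LA (PN n) (PN k)"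
    and F: "\<And>i r. 0 \<le> i ==> i < int m ==> 0 \<le> r ==> r \<le> int n ==> Fil e (Phi k (h (G n i r)))"
  shows "Fil e (Phi k (h (G n i r)))"
proof (cases "0 \<le> r \<and> r \<le> int n")
  case True
  have "Fil e (Phi k (h (G n (i mod int m) r)))" using F[of "i mod int m" r] True m_pos by simp
  then show ?thesis unfolding G_mod .
next
  case False
  have "h \<zero>\<^bsub>PN n\<^esub> = \<zero>\<^bsub>PN k\<^esub>" by (rule vlin_zero[OF PN.M.vec PN.M.vec bimod_homD(2)[OF h]])
  then show ?thesis using Phi_zero_iff[of "\<zero>\<^bsub>PN k\<^esub>" k] G_zero[OF False] Fil_zero by simp
qed

text \<open>The lift is built from explicit preimages, \<open>asec\<close> in degree 0 and the
  homotopy afterwards; an arbitrary preimage would give no control of the length.\<close>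

lemma filtered_lift:
  assumes g: "g \<in> ZL p" and e: "\<And>i r. Rd e (val p g i r)"
  shows "\<exists>l\<in>chain_lifts LA RQ p g. \<forall>k i r. Fil e (Phi k (l k (G (p + k) i r)))"
proof -
  note gH = Z_HAL[OF g]
  \<comment> \<open>Besides the chain map, each step records the length bound and that
    \<open>h\<close> sends boundaries to cycles, which makes the homotopy applicable.\<close>
  define R where "R = (\<lambda>k h. h \<in> bimod_hom LA (PN (p + k)) (PN k) \<and> (k = 0 \<longrightarrow> (\<forall>x\<in>carrier (PN p). aug RQ (h x) = g x)) \<and>
      (\<forall>x\<in>carrier (PN (Suc (p + k))). cyc k (h (bdry RQ (Suc (p + k)) x))) \<and> (\<forall>i r. Fil e (Phi k (h (G (p + k) i r)))))"
  define S where "S = (\<lambda>k h h'. \<forall>x\<in>carrier (PN (Suc (p + k))). bdry RQ (Suc k) (h' x) = h (bdry RQ (Suc (p + k)) x))"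
  have "\<exists>l. \<forall>k. R k (l k) \<and> S k (l k) (l (Suc k))"
  proof (rule dependent_nat_choice)
    have gG: "g (G p i r) \<in> carrier LA" for i r by (rule HAL_closed[OF gH G_closed])
    let ?y = "\<lambda>i r. Psi 0 (asec (g (G p i r)))"
    have y: "?y i r \<in> carrier (PN 0) \<and> aug RQ (?y i r) = g (G p i r)" for i r
      using aug_asec[OF gG] Psi_closed by blast
    have Fy: "Fil e (Phi 0 (?y i r))" for i r
      using e[of i r] Phi_Psi[OF asec_closed[OF gG, of i r]] by (auto simp: val_def Fil_def Rd_def asec_def)
    obtain h where h: "h \<in> bimod_hom LA (PN p) (PN 0)" "\<forall>x\<in>carrier (PN p). aug RQ (h x) = g x"
      "\<forall>i r. 0 \<le> i \<and> i < int m \<and> 0 \<le> r \<and> r \<le> int p \<longrightarrow>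
        h (G p i r) = ract (PN 0) (lact (PN 0) (ei i) (?y i r)) (ei (i + int p - 2 * r))"
      using lift_gens[OF bim_PN bim_regular[OF kalg_LA] aug_hom gH, of ?y] y by blast
    have "Fil e (Phi 0 (h (G p i r)))" for i r
      by (rule Fil_all[OF h(1)]) (use h(3) Fil_conj[OF Psi_closed Fy] in simp)
    moreover have "cyc 0 (h (bdry RQ (Suc p) x))" if "x \<in> carrier (PN (Suc p))" for x
      using h(2) bd_closed[OF that] bimod_hom_closed[OF h(1) bd_closed[OF that]] L.Z_d[OF g, of x] that
      by (simp add: cyc_def RQ_simps(1))
    ultimately have "R 0 h" unfolding R_def using h(1,2) by simp
    then show "\<exists>h. R 0 h" by (rule exI[of _ h])
  next
    fix h k assume "R k h"
    then have h: "h \<in> bimod_hom LA (PN (p + k)) (PN k)"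
      and cy: "\<And>x. x \<in> carrier (PN (Suc (p + k))) ==> cyc k (h (bdry RQ (Suc (p + k)) x))"
      and F: "\<And>i r. Fil e (Phi k (h (G (p + k) i r)))"
      unfolding R_def by blast+
    let ?n = "Suc (p + k)"
    let ?f = "compose (carrier (PN ?n)) h (bdry RQ ?n)"
    have f: "?f \<in> bimod_hom LA (PN ?n) (PN k)" by (rule bimod_hom_comp[OF bim_PN bd_hom h])
    \<comment> \<open>The homotopy is applied to \<open>h\<close> of a boundary, which has length at
      least \<open>e + 1\<close>, so the preimage has length at least \<open>e\<close>.\<close>
    let ?y = "\<lambda>i r. Psi (Suc k) (hmu (int k) (Phi k (h (bdry RQ ?n (G ?n i r)))))"
    have y: "?y i r \<in> carrier (PN (Suc k)) \<and> bdry RQ (Suc k) (?y i r) = ?f (G ?n i r)" for i r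
      using cyc_witness[OF cy[OF G_closed, of i r]] Psi_closed by (simp add: compose_eq)
    have Fy: "Fil e (Phi (Suc k) (?y i r))" if "0 \<le> r" "r \<le> int ?n" for i r
    proof -
      have c: "h (bdry RQ ?n (G ?n i r)) \<in> carrier (PN k)" using cy[OF G_closed, of i r] by (simp add: cyc_def)
      have "hmu (int k) (Phi k (h (bdry RQ ?n (G ?n i r)))) \<in> mcarrier m (int (Suc k))"
        using hmu_closed[OF Phi_closed[OF c]] by (simp add: add.commute)
      then show ?thesis
        using Fil_hmu[OF Fil_Bd[OF h F, of i r], of "int k"] bd_G[OF that, of i] by (simp add: Phi_Psi)
    qed
    obtain h' where h': "h' \<in> bimod_hom LA (PN ?n) (PN (Suc k))" "\<forall>x\<in>carrier (PN ?n). bdry RQ (Suc k) (h' x) = ?f x"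
      "\<forall>i r. 0 \<le> i \<and> i < int m \<and> 0 \<le> r \<and> r \<le> int ?n \<longrightarrow>
        h' (G ?n i r) = ract (PN (Suc k)) (lact (PN (Suc k)) (ei i) (?y i r)) (ei (i + int ?n - 2 * r))"
      using lift_gens[OF bim_PN bim_PN bd_hom f, of ?y] y by blast
    have s: "bdry RQ (Suc k) (h' x) = h (bdry RQ ?n x)" if "x \<in> carrier (PN ?n)" for x
      using h'(2) that by (simp add: compose_eq)
    have F': "Fil e (Phi (Suc k) (h' (G ?n i r)))" for i r
      by (rule Fil_all[OF h'(1)]) (use h'(3) Fil_conj[OF Psi_closed Fy] in \<open>simp del: of_nat_Suc\<close>)
    have cy': "cyc (Suc k) (h' (bdry RQ (Suc ?n) x))" if "x \<in> carrier (PN (Suc ?n))" for x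
    proof -
      have "h \<zero>\<^bsub>PN (p + k)\<^esub> = \<zero>\<^bsub>PN k\<^esub>" by (rule vlin_zero[OF PN.M.vec PN.M.vec bimod_homD(2)[OF h]])
      then show ?thesis
        using s[OF bd_closed[OF that]] bd_bd[OF that] bimod_hom_closed[OF h'(1) bd_closed[OF that]] by (simp add: cyc_def)
    qed
    have "R (Suc k) h'" unfolding R_def using h'(1) F' cy' by simp
    moreover have "S k h h'" unfolding S_def using s by blast
    ultimately show "\<exists>h'. R (Suc k) h' \<and> S k h h'" by blast
  qed
  then obtain l where l: "\<And>k. R k (l k)" "\<And>k. S k (l k) (l (Suc k))" by blast
  have "l \<in> chain_lifts LA RQ p g"
    unfolding chain_lifts_def RQ_simps(1) using l(1)[unfolded R_def] l(2)[unfolded S_def] by blast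
  moreover have "\<forall>k i r. Fil e (Phi k (l k (G (p + k) i r)))" using l(1) unfolding R_def by blast
  ultimately show ?thesis by blast
qed

section \<open>Classes with values in powers of the radical\<close>

abbreviation "HL \<equiv> HH LA RQ"
abbreviation "ExtL n \<equiv> Ext_grp LA RQ n"
abbreviation "clsL n \<equiv> Ext_class LA RQ n"
abbreviation "YL \<equiv> yoneda LA RQ"

text \<open>One good representative is enough; adding a coboundary may well spoil the bound.\<close>

definition XR :: "nat => nat => ('k Lam_res => 'k KQ set) set => bool" where
  "XR d n X \<longleftrightarrow> (\<exists>f\<in>ZL n. X = clsL n f \<and> (\<forall>i r. Rd d (val n f i r)))"

lemma val_ops:
  assumes "f \<in> HAL n" "g \<in> HAL n"
  shows "val n (\<lambda>x\<in>carrier (PN n). f x \<oplus>\<^bsub>LA\<^esub> g x) i r = val n f i r + val n g i r"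
    "val n (\<lambda>x\<in>carrier (PN n). f x \<ominus>\<^bsub>LA\<^esub> g x) i r = val n f i r - val n g i r"
    "val n (\<lambda>x\<in>carrier (PN n). c \<odot>\<^bsub>LA\<^esub> f x) i r = lscale c (val n f i r)"
    "val n (\<lambda>x\<in>carrier (PN n). \<zero>\<^bsub>LA\<^esub>) i r = 0"
  using HAL_closed[OF assms(1) G_closed] HAL_closed[OF assms(2) G_closed] by (simp_all add: val_def)

lemma val_zero: "val n (\<lambda>x\<in>carrier (PN n). \<zero>\<^bsub>LA\<^esub>) i r = 0"
  by (simp add: val_def)

lemma XR_zero: "XR d n \<zero>\<^bsub>ExtL n\<^esub>"
  unfolding XR_def using L.Z_zero[of n] L.Ext_zero[of n]
  by (intro bexI[of _ "\<lambda>x\<in>carrier (PN n). \<zero>\<^bsub>LA\<^esub>"]) (simp_all add: val_zero RQ_simps(1))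

lemma XR_add: assumes "XR d n X" "XR d n U" shows "XR d n (X \<oplus>\<^bsub>ExtL n\<^esub> U)"
proof -
  obtain f where f: "f \<in> ZL n" "X = clsL n f" "\<And>i r. Rd d (val n f i r)" using assms(1) unfolding XR_def by blast
  obtain g where g: "g \<in> ZL n" "U = clsL n g" "\<And>i r. Rd d (val n g i r)" using assms(2) unfolding XR_def by blast
  show ?thesis unfolding XR_def f(2) g(2) L.cls_add[OF f(1) g(1)]
    using L.Z_add[OF f(1) g(1)] f(3) g(3) by (intro bexI[OF _ L.Z_add[OF f(1) g(1)]]) (simp add: RQ_simps(1) val_ops(1) Z_HAL f(1) g(1))
qed

lemma XR_Ext: "XR d n X ==> X \<in> carrier (ExtL n)"
  unfolding XR_def using L.cls_closed by blast

lemma XR_finsum: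
  assumes "\<And>j. j \<in> J ==> XR d n (f j)" shows "XR d n (finsum (ExtL n) f J)"
  using assms
proof (induct J rule: infinite_finite_induct)
  case (insert j J)
  have "f \<in> J \<rightarrow> carrier (ExtL n)" "f j \<in> carrier (ExtL n)" using insert(4) XR_Ext by auto
  then have "finsum (ExtL n) f (insert j J) = f j \<oplus>\<^bsub>ExtL n\<^esub> finsum (ExtL n) f J"
    using L.E.finsum_insert[OF insert(1,2)] by blast
  then show ?case using XR_add[OF insert(4)[of j] insert(3)] insert(4) by simp
qed (simp_all add: XR_zero)

text \<open>A representative with values in rad^d is applied to a lift of length at least
  \<open>e\<close>, and the lengths add.\<close>

lemma XR_Y:
  assumes "XR d n X" "XR e p U" shows "XR (d + e) (p + n) (YL n p X U)"
proof -
  obtain f where f: "f \<in> ZL n" "X = clsL n f" "\<And>i r. Rd d (val n f i r)" using assms(1) unfolding XR_def by blast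
  obtain g where g: "g \<in> ZL p" "U = clsL p g" "\<And>i r. Rd e (val p g i r)" using assms(2) unfolding XR_def by blast
  obtain l where l: "l \<in> chain_lifts LA RQ p g" "\<And>k i r. Fil e (Phi k (l k (G (p + k) i r)))"
    using filtered_lift[OF g(1,3)] by blast
  let ?c = "compose (carrier (PN (p + n))) f (l n)"
  have "?c \<in> ZL (p + n)"
    using L.comp_Z[OF f(1)] l(1) L.chain_lifts_iff[of l p g] by (simp add: RQ_simps(1))
  moreover have "YL n p X U = clsL (p + n) ?c"
    using L.yoneda_cls[OF f(1) g(1) l(1)] f(2) g(2) by (simp add: RQ_simps(1))
  moreover have "Rd (d + e) (val (p + n) ?c i r)" for i r
    using Rd_HAL[OF Z_HAL[OF f(1)] f(3) bimod_hom_closed[OF chain_lifts_RQ(1)[OF l(1)] G_closed] l(2)]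
    by (simp add: val_def compose_eq)
  ultimately show ?thesis unfolding XR_def by blast
qed

text \<open>rad^3 = 0, so the representative vanishes on all generators.\<close>

lemma XR_3: assumes "XR 3 n X" shows "X = \<zero>\<^bsub>ExtL n\<^esub>"
proof -
  obtain f where f: "f \<in> ZL n" "X = clsL n f" "\<And>i r. Rd 3 (val n f i r)" using assms unfolding XR_def by blast
  note z = Z_HAL[OF L.Z_zero[of n, unfolded RQ_simps(1)]]
  have "f = (\<lambda>x\<in>carrier (PN n). \<zero>\<^bsub>LA\<^esub>)"
  proof (rule hom_unique_G[OF bim_regular[OF kalg_LA] Z_HAL[OF f(1)] z])
    fix i r
    have "gam (f (G n i r)) = 0" using Rd_3[OF f(3)] by (simp add: val_def)
    then show "f (G n i r) = (\<lambda>x\<in>carrier (PN n). \<zero>\<^bsub>LA\<^esub>) (G n i r)"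
      using HAL_closed[OF Z_HAL[OF f(1)] G_closed] by (intro gam_inj) simp_all
  qed
  then show ?thesis using f(2) L.Ext_zero[of n] by (simp add: RQ_simps(1))
qed

subsection \<open>The bigraded leading coefficient map\<close>

text \<open>Read off from an arbitrary representative; coboundaries have no leading coefficients
  (\<open>B_top\<close>), so the value depends on the class alone.\<close>

definition tpc :: "nat => ('k Lam_res => 'k KQ set) set => int => 'k" where
  "tpc n X r = top n (SOME f. f \<in> X) r"

lemma tpc_cls: assumes f: "f \<in> ZL n" shows "tpc n (clsL n f) r = top n f r"
proof -
  have "f \<in> clsL n f" using L.mem_cls_iff[OF f, of f] f by simp
  then have "(SOME f'. f' \<in> clsL n f) \<in> clsL n f" (is "?g \<in> _") by (rule someI[of "\<lambda>f'. f' \<in> clsL n f"])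
  then have g: "?g \<in> ZL n" "clsL n ?g = clsL n f" using L.mem_cls_iff[OF f, of ?g] by auto
  then have "(\<lambda>x\<in>carrier (PN n). ?g x \<ominus>\<^bsub>LA\<^esub> f x) \<in> coboundaries LA RQ n"
    using L.cls_eq_iff[OF g(1) f] by (simp add: RQ_simps(1))
  from B_top[OF this, of r] have "top n ?g r - top n f r = 0"
    unfolding top_def val_ops(2)[OF Z_HAL[OF g(1)] Z_HAL[OF f]] by simp
  then show ?thesis by (simp add: tpc_def)
qed

lemma tpc_ops:
  assumes "X \<in> carrier (ExtL n)" "U \<in> carrier (ExtL n)"
  shows "tpc n (X \<oplus>\<^bsub>ExtL n\<^esub> U) r = tpc n X r + tpc n U r" "tpc n (c \<odot>\<^bsub>ExtL n\<^esub> X) r = c * tpc n X r"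
proof -
  obtain f where f: "f \<in> ZL n" "X = clsL n f" using assms(1) by (rule L.Ext_cases)
  obtain g where g: "g \<in> ZL n" "U = clsL n g" using assms(2) by (rule L.Ext_cases)
  note H = Z_HAL[OF f(1)] Z_HAL[OF g(1)]
  show "tpc n (X \<oplus>\<^bsub>ExtL n\<^esub> U) r = tpc n X r + tpc n U r"
    unfolding f(2) g(2) L.cls_add[OF f(1) g(1)] tpc_cls[OF f(1)] tpc_cls[OF g(1)] tpc_cls[OF L.Z_add[OF f(1) g(1)]]
    unfolding top_def RQ_simps(1) val_ops(1)[OF H] by simp
  show "tpc n (c \<odot>\<^bsub>ExtL n\<^esub> X) r = c * tpc n X r"
    unfolding f(2) L.cls_smult[OF f(1)] tpc_cls[OF f(1)] tpc_cls[OF L.Z_smult[OF f(1)]]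
    unfolding top_def RQ_simps(1) val_ops(3)[OF H] by simp
qed

lemma tpc_zero: "tpc n \<zero>\<^bsub>ExtL n\<^esub> r = 0"
  using tpc_ops(2)[of "\<zero>\<^bsub>ExtL n\<^esub>" n "\<zero>\<^bsub>ExtL n\<^esub>" 0 r] L.E.smult_zero_right[of n 0] by simp

lemma tpc_finsum:
  assumes "f \<in> J \<rightarrow> carrier (ExtL n)" shows "tpc n (finsum (ExtL n) f J) r = (\<Sum>j\<in>J. tpc n (f j) r)"
  using assms
proof (induct J rule: infinite_finite_induct)
  case (insert j J)
  then have c: "f \<in> J \<rightarrow> carrier (ExtL n)" "f j \<in> carrier (ExtL n)" by auto
  have "finsum (ExtL n) f (insert j J) = f j \<oplus>\<^bsub>ExtL n\<^esub> finsum (ExtL n) f J"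
    by (rule L.E.finsum_insert[OF insert(1,2) c])
  then show ?case using tpc_ops(1)[OF c(2) L.E.finsum_closed[OF c(1)]] insert(1-3) c by simp
qed (simp_all add: tpc_zero)

lemma tpc_nonzero:
  assumes "X \<in> carrier (ExtL n)" "tpc n X r \<noteq> 0"
  shows "even n" "even r" "0 \<le> r" "r \<le> int n" "int m dvd int n - 2 * r"
proof -
  obtain f where f: "f \<in> ZL n" "X = clsL n f" using assms(1) by (rule L.Ext_cases)
  then have "top n f r \<noteq> 0" using assms(2) tpc_cls[OF f(1)] by simp
  from top_nonzero[OF f(1) this] show "even n" "even r" "0 \<le> r" "r \<le> int n" "int m dvd int n - 2 * r" by auto
qed

lemma tpc_Y:
  assumes "X \<in> carrier (ExtL n)" "U \<in> carrier (ExtL p)"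
  shows "tpc (p + n) (YL n p X U) r = (\<Sum>s\<in>{0..int n}. tpc n X s * tpc p U (r - s))"
proof -
  obtain f where f: "f \<in> ZL n" "X = clsL n f" using assms(1) by (rule L.Ext_cases)
  obtain g where g: "g \<in> ZL p" "U = clsL p g" using assms(2) by (rule L.Ext_cases)
  obtain l where l: "l \<in> chain_lifts LA RQ p g" using L.lifts_exist[OF g(1)] by blast
  let ?c = "compose (carrier (PN (p + n))) f (l n)"
  have c: "?c \<in> ZL (p + n)"
    using L.comp_Z[OF f(1)] l L.chain_lifts_iff[of l p g] by (simp add: RQ_simps(1))
  have "YL n p X U = clsL (p + n) ?c"
    using L.yoneda_cls[OF f(1) g(1) l] f(2) g(2) by (simp add: RQ_simps(1))
  then have "tpc (p + n) (YL n p X U) r = top (p + n) ?c r" using tpc_cls[OF c] by simp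
  then show ?thesis unfolding top_product[OF f(1) g(1) l] f(2) g(2) tpc_cls[OF f(1)] tpc_cls[OF g(1)] .
qed

text \<open>By \<open>val_top\<close> every idempotent coefficient of a cocycle is zero or one of
  the leading coefficients.\<close>

lemma XR_1_iff:
  assumes "X \<in> carrier (ExtL n)" shows "XR 1 n X \<longleftrightarrow> (\<forall>r. tpc n X r = 0)"
proof
  assume "XR 1 n X"
  then obtain f where f: "f \<in> ZL n" "X = clsL n f" "\<And>i r. Rd 1 (val n f i r)" unfolding XR_def by blast
  then show "\<forall>r. tpc n X r = 0" by (simp add: tpc_cls top_def Rd_def)
next
  assume z: "\<forall>r. tpc n X r = 0"
  obtain f where f: "f \<in> ZL n" "X = clsL n f" using assms(1) by (rule L.Ext_cases)
  then have t: "top n f r = 0" for r using z tpc_cls[OF f(1), of r] by simp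
  have "Rd 1 (val n f i r)" for i r unfolding Rd_def
  proof (intro allI impI)
    fix s k assume "len s < 1"
    then have "s = bE" by (cases s) auto
    then show "cf (val n f i r) s k = 0" using val_top[OF f(1), of i r k] t by simp
  qed
  then show "XR 1 n X" unfolding XR_def using f by blast
qed

definition pm :: "(nat => ('k Lam_res => 'k KQ set) set) => 'k poly poly" where
  "pm h = (\<Sum>n\<in>{n. h n \<noteq> \<zero>\<^bsub>ExtL n\<^esub>}. \<Sum>q\<le>n. bimon (tpc n (h n) (int q)) (n - q) q)"

text \<open>The monomial x^p y^q determines the degree \<open>p + q\<close>, so contributions of
  different degrees never meet.\<close>

lemma coeff_pm:
  assumes h: "h \<in> carrier HL" shows "coeff (coeff (pm h) p) q = tpc (p + q) (h (p + q)) (int q)"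
proof -
  have fin: "finite {n. h n \<noteq> \<zero>\<^bsub>ExtL n\<^esub>}" using h by (simp add: L.HH_simps)
  have "(\<Sum>j\<le>n. if p = n - j \<and> q = j then tpc n (h n) (int j) else 0) = (if n = p + q then tpc n (h n) (int q) else 0)" for n
  proof -
    have "(\<Sum>j\<le>n. if p = n - j \<and> q = j then tpc n (h n) (int j) else 0) =
        (\<Sum>j\<le>n. if j = q then (if n = p + q then tpc n (h n) (int q) else 0) else 0)"
      by (rule sum.cong) auto
    then show ?thesis by (simp add: sum.delta)
  qed
  then have "coeff (coeff (pm h) p) q = (\<Sum>n\<in>{n. h n \<noteq> \<zero>\<^bsub>ExtL n\<^esub>}. if n = p + q then tpc n (h n) (int q) else 0)"
    by (simp add: pm_def coeff_sum)
  also have "\<dots> = tpc (p + q) (h (p + q)) (int q)"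
    using fin by (auto simp: sum.delta tpc_zero)
  finally show ?thesis .
qed

sublocale HL: kalg HL by (rule L.HH_kalg)

lemma pm_add: "h \<in> carrier HL ==> h' \<in> carrier HL ==> pm (h \<oplus>\<^bsub>HL\<^esub> h') = pm h + pm h'"
  by (rule bipoly_eqI) (simp add: coeff_pm L.HH_simps(3)[symmetric] tpc_ops(1) L.HH_closed, simp add: L.HH_simps(3) tpc_ops(1) L.HH_closed)

lemma pm_smult: "h \<in> carrier HL ==> pm (c \<odot>\<^bsub>HL\<^esub> h) = const2 c * pm h"
  by (rule bipoly_eqI) (simp add: coeff_pm, simp add: L.HH_simps(4) tpc_ops(2)[OF _ L.HH_closed] L.HH_closed)

lemma pm_one: "pm \<one>\<^bsub>HL\<^esub> = 1"
proof (rule bipoly_eqI)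
  fix p q
  have a: "tpc 0 (clsL 0 (aug RQ)) 0 = 1"
    unfolding tpc_cls[OF L.aug_Z] by (simp add: top_def val_def aug_G)
  show "coeff (coeff (pm \<one>\<^bsub>HL\<^esub>) p) q = coeff (coeff 1 p) q"
    unfolding coeff_pm[OF HL.one_closed] unfolding L.HH_simps(5) in_degree_def
    using a by (cases "p + q = 0") (auto simp: tpc_zero one_pCons coeff_pCons split: nat.split)
qed

text \<open>The convolution over degrees in the product of \<open>HH\<close> and the convolution
  over \<open>r\<close> in \<open>tpc_Y\<close> together form the product of bivariate
  polynomials.\<close>

lemma pm_mult:
  assumes h: "h \<in> carrier HL" and h': "h' \<in> carrier HL"
  shows "pm (h \<otimes>\<^bsub>HL\<^esub> h') = pm h * pm h'"
proof (rule bipoly_eqI)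
  fix p q :: nat
  let ?n = "p + q" and ?a = "\<lambda>n r. tpc n (h n) r" and ?b = "\<lambda>n r. tpc n (h' n) r"
  note c = L.HH_closed[OF h] and c' = L.HH_closed[OF h']
  have out: "\<not> (0 \<le> r \<and> r \<le> int n) ==> ?a n r = 0" "\<not> (0 \<le> r \<and> r \<le> int n) ==> ?b n r = 0" for n r
    using tpc_nonzero(3,4)[OF c, of n r] tpc_nonzero(3,4)[OF c', of n r] by blast+
  have "coeff (coeff (pm (h \<otimes>\<^bsub>HL\<^esub> h')) p) q = (\<Sum>k\<le>?n. tpc ?n (YL k (?n - k) (h k) (h' (?n - k))) (int q))"
    unfolding coeff_pm[OF HL.m_closed[OF h h']] unfolding L.HH_simps(6) by (rule tpc_finsum[OF L.mult_term_closed[OF h h']])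
  also have "\<dots> = (\<Sum>k\<le>?n. \<Sum>s\<in>{0..int k}. ?a k s * ?b (?n - k) (int q - s))"
  proof (rule sum.cong[OF refl])
    fix k assume "k \<in> {..?n}"
    then have e: "?n - k + k = ?n" by simp
    show "tpc ?n (YL k (?n - k) (h k) (h' (?n - k))) (int q) = (\<Sum>s\<in>{0..int k}. ?a k s * ?b (?n - k) (int q - s))"
      using tpc_Y[OF c[of k] c'[of "?n - k"], of "int q"] unfolding e .
  qed
  also have "\<dots> = (\<Sum>i\<le>p. \<Sum>j\<le>q. ?a (i + j) (int j) * ?b ((p - i) + (q - j)) (int (q - j)))"
    by (rule convolution_reindex[of ?a ?b, OF out])
  also have "\<dots> = coeff (coeff (pm h * pm h') p) q"
    unfolding coeff_mult coeff_sum by (simp add: coeff_pm[OF h] coeff_pm[OF h'])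
  finally show "coeff (coeff (pm (h \<otimes>\<^bsub>HL\<^esub> h')) p) q = coeff (coeff (pm h * pm h') p) q" .
qed

lemma pm_zero_iff:
  assumes h: "h \<in> carrier HL" shows "pm h = 0 \<longleftrightarrow> (\<forall>n. XR 1 n (h n))"
proof
  assume z: "pm h = 0"
  show "\<forall>n. XR 1 n (h n)"
  proof
    fix n
    have "tpc n (h n) r = 0" for r
    proof (cases "0 \<le> r \<and> r \<le> int n")
      case True
      then have e: "n = (n - nat r) + nat r" "int (nat r) = r" by auto
      show ?thesis using coeff_pm[OF h, of "n - nat r" "nat r"] z e by simp
    next
      case False then show ?thesis using tpc_nonzero(3,4)[OF L.HH_closed[OF h], of n r] by blast
    qed
    then show "XR 1 n (h n)" using XR_1_iff[OF L.HH_closed[OF h]] by blast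
  qed
next
  assume "\<forall>n. XR 1 n (h n)"
  then have "tpc n (h n) r = 0" for n r using XR_1_iff[OF L.HH_closed[OF h]] by blast
  then show "pm h = 0" by (intro bipoly_eqI) (simp add: coeff_pm[OF h])
qed

lemma XR_mult:
  assumes h: "h \<in> carrier HL" and h': "h' \<in> carrier HL" and "\<And>n. XR d n (h n)" "\<And>n. XR e n (h' n)"
  shows "XR (d + e) n ((h \<otimes>\<^bsub>HL\<^esub> h') n)"
  unfolding L.HH_simps(6)
proof (rule XR_finsum)
  fix k assume "k \<in> {..n}"
  then show "XR (d + e) n (YL k (n - k) (h k) (h' (n - k)))"
    using XR_Y[OF assms(3)[of k] assms(4)[of "n - k"]] by simp
qed

text \<open>The bounds add under products, so the cube has values in rad^3. The estimate is uniform
  in the degree, hence \<open>h\<close> may be inhomogeneous.\<close>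

lemma pm_kernel_cube:
  assumes h: "h \<in> carrier HL" "pm h = 0" shows "h [^]\<^bsub>HL\<^esub> (3::nat) = \<zero>\<^bsub>HL\<^esub>"
proof -
  have 1: "XR 1 n (h n)" for n using pm_zero_iff[OF h(1)] h(2) by blast
  have "XR (1 + 1) n ((h \<otimes>\<^bsub>HL\<^esub> h) n)" for n by (rule XR_mult[OF h(1,1) 1 1])
  then have "XR (1 + 1 + 1) n ((h \<otimes>\<^bsub>HL\<^esub> h \<otimes>\<^bsub>HL\<^esub> h) n)" for n by (rule XR_mult[OF HL.m_closed[OF h(1,1)] h(1) _ 1])
  then have "(h \<otimes>\<^bsub>HL\<^esub> h \<otimes>\<^bsub>HL\<^esub> h) n = \<zero>\<^bsub>ExtL n\<^esub>" for n by (intro XR_3) simp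
  then have "h \<otimes>\<^bsub>HL\<^esub> h \<otimes>\<^bsub>HL\<^esub> h = \<zero>\<^bsub>HL\<^esub>" unfolding L.HH_simps(2) by (rule ext)
  then show ?thesis using h(1) by (simp add: numeral_3_eq_3)
qed

lemma alg_map_pm: "alg_map HL pm const2"
  by (intro alg_map.intro alg_map_axioms.intro L.HH_kalg pm_add pm_mult pm_one pm_smult)

abbreviation "kpm \<equiv> alg_map.ker HL pm"

lemmas kpm_def = alg_map.ker_def[OF alg_map_pm]

text \<open>The generators of the ideal are homogeneous, so an element of the kernel has to be
  decomposed: being in the kernel is a condition on each component separately, and each component is
  then nilpotent by \<open>pm_kernel_cube\<close>.\<close>

lemma nil_ideal_eq: "nil_ideal LA RQ = kpm"
proof
  let ?N = "{h \<in> carrier HL. (\<exists>n. \<forall>k. k \<noteq> n \<longrightarrow> h k = \<zero>\<^bsub>ExtL k\<^esub>) \<and> (\<exists>k::nat. h [^]\<^bsub>HL\<^esub> k = \<zero>\<^bsub>HL\<^esub>)}"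
  have Nc: "?N \<subseteq> carrier HL" by blast
  have "?N \<subseteq> kpm"
  proof
    fix h assume h: "h \<in> ?N"
    then obtain k :: nat where k: "h [^]\<^bsub>HL\<^esub> k = \<zero>\<^bsub>HL\<^esub>" by blast
    have hc: "h \<in> carrier HL" using h by simp
    have "pm h ^ k = 0"
      using alg_map.h_power[OF alg_map_pm hc, of k] alg_map.h_zero[OF alg_map_pm] unfolding k by simp
    then show "h \<in> kpm" using hc by (simp add: kpm_def)
  qed
  then show "nil_ideal LA RQ \<subseteq> kpm" unfolding nil_ideal_def by (rule HL.genideal_minimal[OF alg_map.ideal_ker[OF alg_map_pm]])
  interpret I: ideal "nil_ideal LA RQ" HL unfolding nil_ideal_def by (rule HL.genideal_ideal[OF Nc])
  have gen: "?N \<subseteq> nil_ideal LA RQ" unfolding nil_ideal_def by (rule HL.genideal_self[OF Nc])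
  \<comment> \<open>Induction on a bound for the degrees that occur; the component in degree
    \<open>N\<close> is split off as a homogeneous nilpotent.\<close>
  have key: "\<And>h. h \<in> kpm ==> (\<And>n. n \<ge> N ==> h n = \<zero>\<^bsub>ExtL n\<^esub>) ==> h \<in> nil_ideal LA RQ" for N
  proof (induct N)
    case 0
    then have "h = \<zero>\<^bsub>HL\<^esub>" unfolding L.HH_simps(2) by (intro ext) simp
    then show ?case by simp
  next
    case (Suc N)
    have h: "h \<in> carrier HL" and z: "pm h = 0" using Suc(2) by (auto simp: kpm_def)
    let ?a = "h(N := \<zero>\<^bsub>ExtL N\<^esub>)" and ?b = "in_degree LA RQ N (h N)"
    have a: "?a \<in> carrier HL" by (rule L.HH_I[of _ N]) (use L.HH_closed[OF h] Suc(3) in auto)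
    have b: "?b \<in> carrier HL" by (rule L.in_degree_closed[OF L.HH_closed[OF h]])
    have X: "XR 1 n (h n)" for n using pm_zero_iff[OF h] z by blast
    have za: "pm ?a = 0" unfolding pm_zero_iff[OF a] using X XR_zero by simp
    have "?a \<in> nil_ideal LA RQ"
    proof (rule Suc(1))
      show "?a \<in> kpm" unfolding kpm_def by (intro CollectI conjI a za)
      show "?a n = \<zero>\<^bsub>ExtL n\<^esub>" if "n \<ge> N" for n using Suc(3)[of n] that by (cases "n = N") simp_all
    qed
    moreover have zb: "pm ?b = 0" unfolding pm_zero_iff[OF b] unfolding in_degree_def using X XR_zero by simp
    have "?b \<in> ?N" using b pm_kernel_cube[OF b zb] by (auto simp: in_degree_def)
    then have "?b \<in> nil_ideal LA RQ" using gen by blast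
    moreover have "h = ?a \<oplus>\<^bsub>HL\<^esub> ?b"
      unfolding L.HH_simps(3) in_degree_def using L.HH_closed[OF h] by (intro ext) simp
    ultimately show ?case using I.a_closed by metis
  qed
  show "kpm \<subseteq> nil_ideal LA RQ"
  proof (intro subsetI)
    fix h assume h: "h \<in> kpm"
    obtain N where N: "\<And>n. n > N ==> h n = \<zero>\<^bsub>ExtL n\<^esub>" using L.HH_bound[of h] h by (auto simp: kpm_def)
    show "h \<in> nil_ideal LA RQ" by (rule key[OF h, of "Suc N"]) (simp add: N)
  qed
qed

end


section \<open>The classes chi and the image of the leading coefficient map\<close>

context Lam_odd begin

lemma ker_pm: "alg_map.ker HL pm = nil_ideal LA RQ"
  by (rule nil_ideal_eq[symmetric])

text \<open>An arrow moves past the idempotents, and since \<open>n\<close> and \<open>q\<close> are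
  even the two terms with \<open>a\<close> in a boundary carry opposite signs, as do the two with
  \<open>b\<close>.\<close>

lemma chi_cocycle:
  assumes n: "even n" and q: "even q" "q \<le> n" and k: "k = int n - 2 * int q" "int m dvd k"
  shows "chi m 1 n k \<in> ZL n" "top n (chi m 1 n k) r = (if r = int q then 1 else 0)"
proof -
  let ?v = "\<lambda>i r. if int n - 2 * r = k then ei i else \<zero>\<^bsub>LA\<^esub>" and ?f = "chi m 1 n k"
  have c: "compat n (regular_bimod LA) ?v"
    unfolding compat_def
  proof (intro allI impI conjI)
    fix i r
    show "?v i r \<in> carrier (regular_bimod LA)" "lact (regular_bimod LA) (ei i) (?v i r) = ?v i r" by simp_all
    \<comment> \<open>Since \<open>m\<close> divides \<open>k\<close>, the generator leads from
      \<open>i\<close> back to \<open>i\<close>, as the value \<open>e_i\<close> demands.\<close>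
    have "ei (i + int n - 2 * r) = ei i" if "int n - 2 * r = k"
    proof (rule ei_cong)
      have "i + int n - 2 * r = i + k" using that by simp
      then show "(i + int n - 2 * r) mod int m = i mod int m" using k(2) by (simp add: mod_eq_dvd_iff)
    qed
    then show "ract (regular_bimod LA) (?v i r) (ei (i + int n - 2 * r)) = ?v i r" by simp
  qed
  note h = hom_by_gens_hom[OF bim_regular[OF kalg_LA] c, folded chi_def]
  have f: "?f \<in> HAL n" by (rule h(1))
  have v: "val n ?f i r = (if r = int q then lidem m i else 0)" for i r
  proof (cases "0 \<le> r \<and> r \<le> int n")
    case True
    have "?f (G n i r) = (if int n - 2 * r = k then ei (i mod int m) else \<zero>\<^bsub>LA\<^esub>)" using h(2) True by simp
    then show ?thesis unfolding val_def ei_mod k(1) by simp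
  next
    case False
    then show ?thesis using val_out[OF f, of r i] q by auto
  qed
  show "top n ?f r = (if r = int q then 1 else 0)" by (simp add: top_def v)
  have z: "gam (?f (Bd n i r)) = 0" for i r
  proof -
    have a: "lidem m i * lbas bA = lbas bA * (lidem m (i + 1) :: 'k lam)"
      "lidem m i * lbas bB = lbas bB * (lidem m (i - 1) :: 'k lam)" by (simp_all add: lbas_lidem)
    have s: "sg (int (Suc n) + int q) = (- 1 :: 'k)" "sg (int (Suc n) + (int q + 1)) = (1 :: 'k)" "sg (int (Suc n)) = (- 1 :: 'k)"
      using n q by (simp_all add: sg_def)
    have l: "lscale (- 1) x = - x" "lscale 1 x = x" for x :: "'k lam" by (rule lam_eqI, simp)+
    have l0: "lscale c 0 = (0 :: 'k lam)" for c by (rule lam_eqI) simp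
    consider "r = int q" | "r = int q + 1" | "r \<noteq> int q" "r - 1 \<noteq> int q" by linarith
    then show ?thesis
    proof cases
      case 1
      then show ?thesis unfolding val_Bd[OF f] v by (simp add: s l l0 a del: of_nat_Suc sg_simps)
    next
      case 2
      then show ?thesis unfolding val_Bd[OF f] v by (simp add: s l l0 a del: of_nat_Suc sg_simps)
    next
      case 3
      then show ?thesis unfolding val_Bd[OF f] v by (simp add: l0 del: of_nat_Suc sg_simps)
    qed
  qed
  have cH: "compose (carrier (PN (Suc n))) ?f (bdry RQ (Suc n)) \<in> HAL (Suc n)" by (rule bimod_hom_comp[OF bim_PN bd_hom f])
  have "compose (carrier (PN (Suc n))) ?f (bdry RQ (Suc n)) = (\<lambda>x\<in>carrier (PN (Suc n)). \<zero>\<^bsub>LA\<^esub>)"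
  proof (rule hom_unique_G[OF bim_regular[OF kalg_LA] cH])
    show "(\<lambda>x\<in>carrier (PN (Suc n)). \<zero>\<^bsub>LA\<^esub>) \<in> HAL (Suc n)" using Z_HAL L.Z_zero[of "Suc n"] unfolding RQ_simps(1) .
    fix i r assume r: "0 \<le> r" "r \<le> int (Suc n)"
    have "?f (Bd n i r) = \<zero>\<^bsub>LA\<^esub>"
    proof (rule gam_inj)
      show "?f (Bd n i r) \<in> carrier LA"
        by (rule HAL_closed[OF f]) (use bd_closed[OF G_closed, of n i r] bd_G[OF r, of i] in simp)
    qed (simp_all add: z)
    then show "compose (carrier (PN (Suc n))) ?f (bdry RQ (Suc n)) (G (Suc n) i r) =
        (\<lambda>x\<in>carrier (PN (Suc n)). \<zero>\<^bsub>LA\<^esub>) (G (Suc n) i r)"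
      using bd_G[OF r, of i] G_closed[of "Suc n" i r] by (simp add: compose_eq)
  qed
  note eq = fun_cong[OF this]
  show "?f \<in> ZL n"
  proof (rule L.Z_I)
    show "?f \<in> bimod_hom LA (obj RQ n) (regular_bimod LA)" using f unfolding RQ_simps(1) .
    fix x assume x: "x \<in> carrier (obj RQ (Suc n))"
    then have x': "x \<in> carrier (PN (Suc n))" unfolding RQ_simps(1) .
    show "?f (bdry RQ (Suc n) x) = \<zero>\<^bsub>LA\<^esub>" using eq[of x] unfolding compose_eq[OF x'] restrict_apply'[OF x'] .
  qed
qed

definition "chi_elt n k = in_degree LA RQ n (clsL n (chi m 1 n k))"

lemma pm_chi:
  assumes n: "even n" and q: "even q" "q \<le> n" and k: "k = int n - 2 * int q" "int m dvd k"
  shows "chi_elt n k \<in> carrier HL" "pm (chi_elt n k) = bimon 1 (n - q) q"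
proof -
  note c = chi_cocycle[OF assms]
  show h: "chi_elt n k \<in> carrier HL" unfolding chi_elt_def by (rule L.in_degree_closed[OF L.cls_closed[OF c(1)]])
  show "pm (chi_elt n k) = bimon 1 (n - q) q"
  proof (rule bipoly_eqI)
    fix i j
    have "coeff (coeff (pm (chi_elt n k)) i) j = (if i + j = n then tpc n (clsL n (chi m 1 n k)) (int j) else 0)"
      unfolding coeff_pm[OF h] unfolding chi_elt_def in_degree_def by (simp add: tpc_zero)
    also have "\<dots> = coeff (coeff (bimon 1 (n - q) q) i) j"
      unfolding tpc_cls[OF c(1)] c(2) using q(2) by auto
    finally show "coeff (coeff (pm (chi_elt n k)) i) j = coeff (coeff (bimon 1 (n - q) q) i) j" .
  qed
qed

text \<open>The index q = (n - k) / 2 takes the even values 2, 0 and 2m.\<close>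

lemma pm_chis:
  "chi_elt 4 0 \<in> carrier HL" "pm (chi_elt 4 0) = bimon 1 2 2"
  "chi_elt (2 * m) (2 * int m) \<in> carrier HL" "pm (chi_elt (2 * m) (2 * int m)) = bimon 1 (2 * m) 0"
  "chi_elt (2 * m) (- 2 * int m) \<in> carrier HL" "pm (chi_elt (2 * m) (- 2 * int m)) = bimon 1 0 (2 * m)"
  using pm_chi[of 4 2 0] pm_chi[of "2 * m" 0 "2 * int m"] pm_chi[of "2 * m" "2 * m" "- 2 * int m"] by simp_all

text \<open>The constraints of \<open>tpc_nonzero\<close> are those defining \<open>RR m\<close>,
  and the three classes chi already reach its generators.\<close>

lemma pm_image: "pm ` carrier HL = RR m"
proof
  show "pm ` carrier HL \<subseteq> RR m"
  proof
    fix F assume "F \<in> pm ` carrier HL"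
    then obtain h where h: "F = pm h" "h \<in> carrier HL" by (rule imageE)
    show "F \<in> RR m" unfolding RR_def
    proof (intro CollectI allI impI)
      fix p q assume "coeff (coeff F p) q \<noteq> 0"
      then have "tpc (p + q) (h (p + q)) (int q) \<noteq> 0" unfolding h(1) coeff_pm[OF h(2)] .
      note t = tpc_nonzero[OF L.HH_closed[OF h(2)] this]
      have "int (p + q) - 2 * int q = int p - int q" by simp
      then show "even p \<and> even q \<and> int m dvd int p - int q" using t(1,2,5) by auto
    qed
  qed
  interpret alg_map HL pm const2 by (rule alg_map_pm)
  show "RR m \<subseteq> pm ` carrier HL"
  proof (rule RR_generated[OF odd_m])
    fix x y assume x: "x \<in> pm ` carrier HL" and y: "y \<in> pm ` carrier HL"
    obtain f where f: "x = pm f" "f \<in> carrier HL" using x by (rule imageE)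
    obtain g where g: "y = pm g" "g \<in> carrier HL" using y by (rule imageE)
    show "x + y \<in> pm ` carrier HL" "x * y \<in> pm ` carrier HL"
      unfolding f(1) g(1) pm_add[OF f(2) g(2), symmetric] pm_mult[OF f(2) g(2), symmetric]
      using f(2) g(2) by simp_all
  next
    fix c x assume "x \<in> pm ` carrier HL"
    then obtain f where f: "x = pm f" "f \<in> carrier HL" by (rule imageE)
    show "const2 c * x \<in> pm ` carrier HL"
      unfolding f(1) pm_smult[OF f(2), symmetric] using f(2) by simp
  next
    show "1 \<in> pm ` carrier HL" using imageI[OF HL.one_closed, of pm] unfolding pm_one .
    show "{bimon 1 2 2, bimon 1 (2 * m) 0, bimon 1 0 (2 * m)} \<subseteq> pm ` carrier HL"
      unfolding pm_chis(2,4,6)[symmetric] using pm_chis(1,3,5) by simp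
  qed
qed

lemma HH_Lam_red_quot: "(HH_Lam_red m 1 :: ('k, _) module) = HL //\<^sub>k alg_map.ker HL pm"
  unfolding HH_Lam_red_def HH_red_def ker_pm ..

lemma chi_red_coset: "(chi_red m 1 n k :: (nat => ('k Lam_res => 'k KQ set) set) set) =
    alg_map.ker HL pm +>\<^bsub>HL\<^esub> chi_elt n k"
  unfolding chi_red_def HH_red_class_def ker_pm chi_elt_def ..

text \<open>Both algebras map onto the same subring of K[x,y]; as a variable and its class chi have
  the same image there, \<open>alg_iso_quot\<close> sends one to the other.\<close>

lemma presentation:
  "\<exists>\<phi>\<in>alg_iso (chi_alg m :: ('k, _) module) (HH_Lam_red m 1).
      \<phi> (chi_var_class m X40) = chi_red m 1 4 0 \<and>
      \<phi> (chi_var_class m X2) = chi_red m 1 (2 * m) (2 * int m) \<and>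
      \<phi> (chi_var_class m Xm2) = chi_red m 1 (2 * m) (- 2 * int m)"
proof -
  have m0: "m > 0" using m3 by simp
  have im: "ev m ` carrier poly_alg = pm ` carrier HL" unfolding pm_image using ev_image[OF odd_m] by simp
  obtain \<phi> where iso: "\<phi> \<in> alg_iso (chi_alg m :: ('k, _) module) (HH_Lam_red m 1)"
    and \<phi>: "\<And>x y. y \<in> carrier HL ==> ev m x = pm y ==> \<phi> (chi_rel m +>\<^bsub>poly_alg\<^esub> x) = alg_map.ker HL pm +>\<^bsub>HL\<^esub> y"
    using alg_iso_quot[OF alg_map_ev alg_map_pm im] unfolding ker_ev[OF m0] HH_Lam_red_quot chi_alg_def by auto
  have "\<phi> (chi_var_class m X40) = chi_red m 1 4 0"
    unfolding chi_var_class_def chi_red_coset by (rule \<phi>) (simp_all only: pm_chis ev_pvar)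
  moreover have "\<phi> (chi_var_class m X2) = chi_red m 1 (2 * m) (2 * int m)"
    unfolding chi_var_class_def chi_red_coset by (rule \<phi>) (simp_all only: pm_chis ev_pvar)
  moreover have "\<phi> (chi_var_class m Xm2) = chi_red m 1 (2 * m) (- 2 * int m)"
    unfolding chi_var_class_def chi_red_coset by (rule \<phi>) (simp_all only: pm_chis ev_pvar)
  ultimately show ?thesis using iso by blast
qed

lemma fin_gen_HH_Lam_red: "fin_gen_algebra (HH_Lam_red m 1 :: ('k, _) module)"
  unfolding HH_Lam_red_quot
proof (rule alg_map.fin_gen_Q[OF alg_map_pm, of "{bimon 1 2 2, bimon 1 (2 * m) 0, bimon 1 0 (2 * m)}"])
  show "{bimon 1 2 2, bimon 1 (2 * m) 0, bimon 1 0 (2 * m)} \<subseteq> pm ` carrier HL"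
    unfolding pm_chis(2,4,6)[symmetric] using pm_chis(1,3,5) by simp
  fix C :: "'k poly poly set"
  assume "\<And>x y. x \<in> C ==> y \<in> C ==> x + y \<in> C" "\<And>x y. x \<in> C ==> y \<in> C ==> x * y \<in> C" "1 \<in> C"
    "\<And>c x. x \<in> C ==> const2 c * x \<in> C" "{bimon 1 2 2, bimon 1 (2 * m) 0, bimon 1 0 (2 * m)} \<subseteq> C"
  then show "pm ` carrier HL \<subseteq> C" unfolding pm_image by (rule RR_generated[OF odd_m])
qed simp

text \<open>The witnesses for strictness: x^(2m) vanishes at x = 0 without being zero, and y^(2m)
  vanishes at the origin but not along x = 0.\<close>

lemma krull_dim_HH_Lam_red: "krull_dim (HH_Lam_red m 1 :: ('k, _) module) = 2"
  unfolding HH_Lam_red_quot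
proof (rule krull_dim_quot_eq_2[OF alg_map_pm])
  show "bimon 1 (2 * m) 0 \<in> pm ` carrier HL" "bimon 1 0 (2 * m) \<in> pm ` carrier HL"
    unfolding pm_chis(4,6)[symmetric] using pm_chis(3,5) by simp_all
  have nz: "2 * m \<noteq> 0" using m3 by simp
  show "bimon 1 (2 * m) 0 \<noteq> (0 :: 'k poly poly)"
  proof
    assume "bimon 1 (2 * m) 0 = (0 :: 'k poly poly)"
    then have "coeff (coeff (bimon 1 (2 * m) 0) (2 * m)) 0 = (0 :: 'k)" by simp
    then show False by (simp del: coeff_0)
  qed
  show "coeff (bimon 1 (2 * m) 0) 0 = (0 :: 'k poly)" using nz by (simp add: bimon_def)
  show "coeff (bimon 1 0 (2 * m)) 0 \<noteq> (0 :: 'k poly)" by (simp add: bimon_def)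
  show "coeff (coeff (bimon 1 0 (2 * m)) 0) 0 = (0 :: 'k)" using nz by simp
qed

end

theorem corollary5p3:
  fixes m :: nat
  assumes "m \<ge> 3" and "odd m" and "CHAR('k::field) \<noteq> 2"
  shows "projective_resolution (Lam m 1 :: ('k, _) module) (Lam_resolution m 1) \<and>
    (\<exists>\<phi> \<in> alg_iso (chi_alg m :: ('k, _) module) (HH_Lam_red m 1).
      \<phi> (chi_var_class m X40) = chi_red m 1 4 0 \<and>
      \<phi> (chi_var_class m X2) = chi_red m 1 (2 * m) (2 * int m) \<and>
      \<phi> (chi_var_class m Xm2) = chi_red m 1 (2 * m) (- 2 * int m)) \<and>
    cring (HH_Lam_red m 1 :: ('k, _) module) \<and>
    fin_gen_algebra (HH_Lam_red m 1 :: ('k, _) module) \<and>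
    krull_dim (HH_Lam_red m 1 :: ('k, _) module) = 2"
proof -
  interpret Lam_odd m "TYPE('k)" by unfold_locales (rule assms)+
  have "cring (HH_Lam_red m 1 :: ('k, _) module)"
    unfolding HH_Lam_red_quot by (rule alg_map.cring_Q[OF alg_map_pm])
  with projective_resolution_RQ presentation fin_gen_HH_Lam_red krull_dim_HH_Lam_red
  show ?thesis by blast
qed

end
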